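(* Let $n\ge 1$ be an integer, let $p>q$ be odd primes with $q\mid p-1$. Let $G$ denote the nonabelian group of the form $\mathbb{Z}_{p^n}\rtimes\mathbb{Z}_q$ (unique up to isomorphism) and let $C$ denote the cyclic group of order $p^nq$. Then the following are true: (1) $e'(G,G)=e(G,G)=2+2p^n(q-2)$; (2) $e'(G,C)=q-1$ and $e(G,C)=p^n$; (3) $e'(C,G)=2p^{2n-1}$ and $e(C,G)=2p^{n-1}(q-1)$.
   Context: $\mathbb{Z}_m$ denotes the cyclic group of order $m$. The nonabelian group $\mathbb{Z}_{p^n}\rtimes\mathbb{Z}_q$ has presentation $\langle x,y\mid x^{p^n}=y^q=1,\ yxy^{-1}=x^k\rangle$, where $k$ is an element of multiplicative order $q$ in $\mathbb{Z}_{p^n}^{\times}$. For a finite group $N$, the holomorph is $\mathrm{Hol}(N)=N\rtimes\mathrm{Aut}(N)$ (with $\mathrm{Aut}(N)$ acting naturally on $N$), which acts on $N$ by $(a,\zeta)\cdot b=a\,\zeta(b)$. A subgroup $\Gamma\le\mathrm{Hol}(N)$ is regular if it acts simply transitively on $N$; for $|\Gamma|=|N|$ this is equivalent to requiring that the only element of $\Gamma$ of the form $(1_N,\zeta)$ is the one with $\zeta=\mathrm{id}$. A Hopf-Galois structure on a finite Galois field extension $L/K$ is a $K$-Hopf algebra $\mathcal{H}$ with an action on $L$ making $L$ an $\mathcal{H}$-module algebra and an $\mathcal{H}$-Galois extension of $K$; it has type $N$ if $L\otimes_K\mathcal{H}\cong L[N]$ as $L$-Hopf algebras. For finite groups $G,N$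 of the same order, $e(G,N)$ is the number of Hopf-Galois structures of type $N$ on a finite Galois extension with Galois group isomorphic to $G$; equivalently (Greither-Pareigis), the number of regular subgroups of $\mathrm{Perm}(G)$ that are isomorphic to $N$ and normalised by the left regular representation $\lambda(G)$. The number of regular subgroups of $\mathrm{Hol}(N)$ isomorphic to $G$ is denoted $e'(G,N)$. By Byott, $e(G,N)=\frac{|\mathrm{Aut}(G)|}{|\mathrm{Aut}(N)|}\,e'(G,N)$. *)

theory Defs
  imports "HOL-Algebra.Algebra"
begin

section \<open>Semidirect products, the holomorph and regular subgroups\<close>

definition semidirect_product ::
    "('a, 'x) monoid_scheme \<Rightarrow> ('b, 'y) monoid_scheme \<Rightarrow> ('b \<Rightarrow> 'a \<Rightarrow> 'a) \<Rightarrow> ('a \<times> 'b) monoid" where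
  "semidirect_product N Q \<theta> =
     \<lparr>carrier = carrier N \<times> carrier Q,
      monoid.mult = (\<lambda>(a, s) (b, t). (a \<otimes>\<^bsub>N\<^esub> \<theta> s b, s \<otimes>\<^bsub>Q\<^esub> t)),
      one = (\<one>\<^bsub>N\<^esub>, \<one>\<^bsub>Q\<^esub>)\<rparr>"

definition nonabelian_cyclic_semidirect :: "nat \<Rightarrow> nat \<Rightarrow> ('a, 'x) monoid_scheme \<Rightarrow> bool" where
  "nonabelian_cyclic_semidirect a b G \<longleftrightarrow>
     group G \<and> \<not> comm_group G \<and>
     (\<exists>\<theta> \<in> hom (integer_mod_group b) (AutoGroup (integer_mod_group a)).
        G \<cong> semidirect_product (integer_mod_group a) (integer_mod_group b) \<theta>)"

definition holomorph :: "('a, 'x) monoid_scheme \<Rightarrow> ('a \<times> ('a \<Rightarrow> 'a)) monoid" where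
  "holomorph N = semidirect_product N (AutoGroup N) (\<lambda>\<zeta>. \<zeta>)"

definition holomorph_act :: "('a, 'x) monoid_scheme \<Rightarrow> 'a \<times> ('a \<Rightarrow> 'a) \<Rightarrow> 'a \<Rightarrow> 'a" where
  "holomorph_act N = (\<lambda>(a, \<zeta>) b. a \<otimes>\<^bsub>N\<^esub> \<zeta> b)"

definition regular_subgroup :: "('a, 'x) monoid_scheme \<Rightarrow> ('a \<times> ('a \<Rightarrow> 'a)) set \<Rightarrow> bool" where
  "regular_subgroup N \<Gamma> \<longleftrightarrow> subgroup \<Gamma> (holomorph N) \<and>
     (\<forall>a \<in> carrier N. \<forall>b \<in> carrier N. \<exists>!g. g \<in> \<Gamma> \<and> holomorph_act N g a = b)"

text \<open>\<open>e_prime G N\<close> is \<open>e'(G,N)\<close>: the group counted is \<open>G\<close>, acting on \<open>N\<close>.\<close>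

definition e_prime :: "('g, 'x) monoid_scheme \<Rightarrow> ('a, 'y) monoid_scheme \<Rightarrow> nat" where
  "e_prime G N = card {\<Gamma>. regular_subgroup N \<Gamma> \<and> (holomorph N)\<lparr>carrier := \<Gamma>\<rparr> \<cong> G}"

section \<open>Finite Galois extensions\<close>

text \<open>The top field \<open>L\<close> of an extension is a type \<^typ>\<open>'l :: field\<close>; the base field \<open>K\<close> is a subset of it.\<close>

definition scalars :: "'l :: field set \<Rightarrow> 'l ring" where
  "scalars K = \<lparr>carrier = K, monoid.mult = (*), one = 1, ring.zero = 0, add = (+)\<rparr>"

definition gal_group :: "'l :: field set \<Rightarrow> ('l \<Rightarrow> 'l) monoid" where
  "gal_group K =
     \<lparr>carrier = {\<sigma>. bij \<sigma> \<and> (\<forall>x y. \<sigma> (x + y) = \<sigma> x + \<sigma> y) \<and> (\<forall>x y. \<sigma> (x * y) = \<sigma> x * \<sigma> y) \<and>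
                   (\<forall>a \<in> K. \<sigma> a = a)},
      monoid.mult = (\<circ>), one = id\<rparr>"

definition finite_galois :: "'l :: field set \<Rightarrow> bool" where
  "finite_galois K \<longleftrightarrow> subfield K (scalars UNIV) \<and>
     ring.finite_dimension (scalars UNIV) K UNIV \<and>
     {x. \<forall>\<sigma> \<in> carrier (gal_group K). \<sigma> x = x} = K"

section \<open>Tensor products of vector spaces\<close>

text \<open>
  Throughout, \<open>K\<close> is a subfield of \<^typ>\<open>'l\<close> and \<open>V\<close>, \<open>W\<close>, \<open>Z\<close> are \<open>K\<close>-vector spaces. A list
  \<open>[(v\<^sub>1, w\<^sub>1), \<dots>, (v\<^sub>r, w\<^sub>r)]\<close> stands for the element \<open>v\<^sub>1 \<otimes> w\<^sub>1 + \<dots> + v\<^sub>r \<otimes> w\<^sub>r\<close> of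
  \<open>V \<otimes>\<^sub>K W\<close>. Over a field the linear forms on \<open>V \<otimes>\<^sub>K W\<close>, that is the \<open>K\<close>-bilinear forms
  on \<open>V \<times> W\<close>, separate points, so two lists represent the same tensor iff all bilinear
  forms agree on them; likewise for threefold tensor products.
\<close>

definition linear_form :: "'l :: field set \<Rightarrow> ('l, 'v, 'm) module_scheme \<Rightarrow> ('v \<Rightarrow> 'l) \<Rightarrow> bool" where
  "linear_form K V f \<longleftrightarrow>
     (\<forall>v \<in> carrier V. f v \<in> K) \<and>
     (\<forall>v \<in> carrier V. \<forall>w \<in> carrier V. f (v \<oplus>\<^bsub>V\<^esub> w) = f v + f w) \<and>
     (\<forall>a \<in> K. \<forall>v \<in> carrier V. f (a \<odot>\<^bsub>V\<^esub> v) = a * f v)"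

definition tensor_eq ::
    "'l :: field set \<Rightarrow> ('l, 'v, 'm) module_scheme \<Rightarrow> ('l, 'w, 'n) module_scheme \<Rightarrow>
     ('v \<times> 'w) list \<Rightarrow> ('v \<times> 'w) list \<Rightarrow> bool" where
  "tensor_eq K V W s t \<longleftrightarrow>
     set s \<subseteq> carrier V \<times> carrier W \<and> set t \<subseteq> carrier V \<times> carrier W \<and>
     (\<forall>\<beta>. (\<forall>v \<in> carrier V. linear_form K W (\<lambda>w. \<beta> v w)) \<and>
          (\<forall>w \<in> carrier W. linear_form K V (\<lambda>v. \<beta> v w)) \<longrightarrow>
        (\<Sum>(v, w)\<leftarrow>s. \<beta> v w) = (\<Sum>(v, w)\<leftarrow>t. \<beta> v w))"

definition tensor3_eq ::
    "'l :: field set \<Rightarrow> ('l, 'v, 'm) module_scheme \<Rightarrow> ('l, 'w, 'n) module_scheme \<Rightarrow>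
     ('l, 'x, 'o) module_scheme \<Rightarrow> ('v \<times> 'w \<times> 'x) list \<Rightarrow> ('v \<times> 'w \<times> 'x) list \<Rightarrow> bool" where
  "tensor3_eq K V W Z s t \<longleftrightarrow>
     set s \<subseteq> carrier V \<times> carrier W \<times> carrier Z \<and> set t \<subseteq> carrier V \<times> carrier W \<times> carrier Z \<and>
     (\<forall>\<beta>. (\<forall>v \<in> carrier V. \<forall>w \<in> carrier W. linear_form K Z (\<lambda>x. \<beta> v w x)) \<and>
          (\<forall>v \<in> carrier V. \<forall>x \<in> carrier Z. linear_form K W (\<lambda>w. \<beta> v w x)) \<and>
          (\<forall>w \<in> carrier W. \<forall>x \<in> carrier Z. linear_form K V (\<lambda>v. \<beta> v w x)) \<longrightarrow>
        (\<Sum>(v, w, x)\<leftarrow>s. \<beta> v w x) = (\<Sum>(v, w, x)\<leftarrow>t. \<beta> v w x))"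

definition tensor_class ::
    "'l :: field set \<Rightarrow> ('l, 'v, 'm) module_scheme \<Rightarrow> ('l, 'w, 'n) module_scheme \<Rightarrow>
     ('v \<times> 'w) list \<Rightarrow> ('v \<times> 'w) list set" where
  "tensor_class K V W s = {t. tensor_eq K V W s t}"

definition tensor_rep :: "('v \<times> 'w) list set \<Rightarrow> ('v \<times> 'w) list" where
  "tensor_rep c = (SOME s. s \<in> c)"

definition tensor_space ::
    "'l :: field set \<Rightarrow> ('l, 'v, 'm) module_scheme \<Rightarrow> ('l, 'w, 'n) module_scheme \<Rightarrow>
     ('v \<times> 'w) list set set" where
  "tensor_space K V W = tensor_class K V W ` {s. set s \<subseteq> carrier V \<times> carrier W}"

definition list_add :: "('v, 'm) ring_scheme \<Rightarrow> 'v list \<Rightarrow> 'v" where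
  "list_add V vs = foldr (\<lambda>v w. v \<oplus>\<^bsub>V\<^esub> w) vs \<zero>\<^bsub>V\<^esub>"

section \<open>Hopf algebras\<close>

text \<open>
  The value \<open>comult h\<close> is a list representing the tensor \<open>\<Delta>(h) \<in> H \<otimes>\<^sub>K H\<close> (Sweedler's sum
  \<open>h\<^sub>1 \<otimes> h\<^sub>2\<close>). The choice of representative carries no meaning: comultiplications are compared
  only up to \<open>tensor_eq\<close>, and Hopf algebras only up to isomorphism.
\<close>

record ('l, 'h) hopf = "('l, 'h) module" +
  comult :: "'h \<Rightarrow> ('h \<times> 'h) list"
  counit :: "'h \<Rightarrow> 'l"
  antipode :: "'h \<Rightarrow> 'h"

locale hopf_algebra =
  fixes K :: "'l :: field set" and H :: "('l, 'h, 'm) hopf_scheme" (structure)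
  assumes is_subfield: "subfield K (scalars UNIV)"
    and is_module: "module (scalars K) H"
    and is_ring: "ring H"
    and smult_mult_left: "\<lbrakk>a \<in> K; h \<in> carrier H; k \<in> carrier H\<rbrakk> \<Longrightarrow>
          (a \<odot>\<^bsub>H\<^esub> h) \<otimes>\<^bsub>H\<^esub> k = a \<odot>\<^bsub>H\<^esub> (h \<otimes>\<^bsub>H\<^esub> k)"
    and smult_mult_right: "\<lbrakk>a \<in> K; h \<in> carrier H; k \<in> carrier H\<rbrakk> \<Longrightarrow>
          h \<otimes>\<^bsub>H\<^esub> (a \<odot>\<^bsub>H\<^esub> k) = a \<odot>\<^bsub>H\<^esub> (h \<otimes>\<^bsub>H\<^esub> k)"
    and comult_closed: "h \<in> carrier H \<Longrightarrow> set (comult H h) \<subseteq> carrier H \<times> carrier H"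
    and comult_add: "\<lbrakk>h \<in> carrier H; k \<in> carrier H\<rbrakk> \<Longrightarrow>
          tensor_eq K H H (comult H (h \<oplus>\<^bsub>H\<^esub> k)) (comult H h @ comult H k)"
    and comult_smult: "\<lbrakk>a \<in> K; h \<in> carrier H\<rbrakk> \<Longrightarrow>
          tensor_eq K H H (comult H (a \<odot>\<^bsub>H\<^esub> h)) [(a \<odot>\<^bsub>H\<^esub> u, v). (u, v) \<leftarrow> comult H h]"
    and comult_mult: "\<lbrakk>h \<in> carrier H; k \<in> carrier H\<rbrakk> \<Longrightarrow>
          tensor_eq K H H (comult H (h \<otimes>\<^bsub>H\<^esub> k))
            [(u \<otimes>\<^bsub>H\<^esub> u', v \<otimes>\<^bsub>H\<^esub> v'). (u, v) \<leftarrow> comult H h, (u', v') \<leftarrow> comult H k]"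
    and comult_one: "tensor_eq K H H (comult H \<one>\<^bsub>H\<^esub>) [(\<one>\<^bsub>H\<^esub>, \<one>\<^bsub>H\<^esub>)]"
    and counit_linear: "linear_form K H (counit H)"
    and counit_mult: "\<lbrakk>h \<in> carrier H; k \<in> carrier H\<rbrakk> \<Longrightarrow>
          counit H (h \<otimes>\<^bsub>H\<^esub> k) = counit H h * counit H k"
    and counit_one: "counit H \<one>\<^bsub>H\<^esub> = 1"
    and coassoc: "h \<in> carrier H \<Longrightarrow>
          tensor3_eq K H H H
            [(u, u', v). (w, v) \<leftarrow> comult H h, (u, u') \<leftarrow> comult H w]
            [(u, v, v'). (u, w) \<leftarrow> comult H h, (v, v') \<leftarrow> comult H w]"
    and counit_left: "h \<in> carrier H \<Longrightarrow> list_add H [counit H u \<odot>\<^bsub>H\<^esub> v. (u, v) \<leftarrow> comult H h] = h"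
    and counit_right: "h \<in> carrier H \<Longrightarrow> list_add H [counit H v \<odot>\<^bsub>H\<^esub> u. (u, v) \<leftarrow> comult H h] = h"
    and antipode_closed: "h \<in> carrier H \<Longrightarrow> antipode H h \<in> carrier H"
    and antipode_add: "\<lbrakk>h \<in> carrier H; k \<in> carrier H\<rbrakk> \<Longrightarrow>
          antipode H (h \<oplus>\<^bsub>H\<^esub> k) = antipode H h \<oplus>\<^bsub>H\<^esub> antipode H k"
    and antipode_smult: "\<lbrakk>a \<in> K; h \<in> carrier H\<rbrakk> \<Longrightarrow>
          antipode H (a \<odot>\<^bsub>H\<^esub> h) = a \<odot>\<^bsub>H\<^esub> antipode H h"
    and antipode_left: "h \<in> carrier H \<Longrightarrow>
          list_add H [antipode H u \<otimes>\<^bsub>H\<^esub> v. (u, v) \<leftarrow> comult H h] = counit H h \<odot>\<^bsub>H\<^esub> \<one>\<^bsub>H\<^esub>"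
    and antipode_right: "h \<in> carrier H \<Longrightarrow>
          list_add H [u \<otimes>\<^bsub>H\<^esub> antipode H v. (u, v) \<leftarrow> comult H h] = counit H h \<odot>\<^bsub>H\<^esub> \<one>\<^bsub>H\<^esub>"

definition hopf_iso ::
    "'l :: field set \<Rightarrow> ('l, 'h, 'm) hopf_scheme \<Rightarrow> ('l, 'k, 'n) hopf_scheme \<Rightarrow> ('h \<Rightarrow> 'k) set" where
  "hopf_iso K H H' = {\<phi> \<in> ring_iso H H'.
     (\<forall>a \<in> K. \<forall>h \<in> carrier H. \<phi> (a \<odot>\<^bsub>H\<^esub> h) = a \<odot>\<^bsub>H'\<^esub> \<phi> h) \<and>
     (\<forall>h \<in> carrier H. tensor_eq K H' H' (comult H' (\<phi> h)) [(\<phi> u, \<phi> v). (u, v) \<leftarrow> comult H h]) \<and>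
     (\<forall>h \<in> carrier H. counit H' (\<phi> h) = counit H h) \<and>
     (\<forall>h \<in> carrier H. antipode H' (\<phi> h) = \<phi> (antipode H h))}"

text \<open>
  The group algebra \<open>K[N]\<close>: finitely supported functions \<open>f\<close>, standing for \<open>\<Sum> f(x) x\<close>, with
  \<open>\<Delta>(x) = x \<otimes> x\<close>, \<open>\<epsilon>(x) = 1\<close> and antipode \<open>x \<mapsto> x\<^sup>-\<^sup>1\<close> for \<open>x \<in> N\<close>.
\<close>

definition group_algebra :: "'l :: field set \<Rightarrow> ('a, 'x) monoid_scheme \<Rightarrow> ('l, 'a \<Rightarrow> 'l) hopf" where
  "group_algebra K N =
     (let \<delta> = (\<lambda>x c y. if y = x then c else 0) in
     \<lparr>carrier = {f. finite {x. f x \<noteq> 0} \<and> {x. f x \<noteq> 0} \<subseteq> carrier N \<and> range f \<subseteq> K},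
      monoid.mult = (\<lambda>f g x. if x \<in> carrier N
                       then \<Sum>y | f y \<noteq> 0. f y * g (inv\<^bsub>N\<^esub> y \<otimes>\<^bsub>N\<^esub> x) else 0),
      one = \<delta> \<one>\<^bsub>N\<^esub> 1,
      ring.zero = (\<lambda>x. 0),
      add = (\<lambda>f g x. f x + g x),
      smult = (\<lambda>a f x. a * f x),
      comult = (\<lambda>f. [(\<delta> x (f x), \<delta> x 1). x \<leftarrow> (SOME xs. set xs = {x. f x \<noteq> 0} \<and> distinct xs)]),
      counit = (\<lambda>f. \<Sum>x | f x \<noteq> 0. f x),
      antipode = (\<lambda>f x. if x \<in> carrier N then f (inv\<^bsub>N\<^esub> x) else 0)\<rparr>)"

definition top_module :: "('l :: field, 'l) module" where
  "top_module = \<lparr>carrier = UNIV, monoid.mult = (*), one = 1, ring.zero = 0, add = (+), smult = (*)\<rparr>"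

text \<open>
  The \<open>L\<close>-Hopf algebra \<open>L \<otimes>\<^sub>K H\<close>. Its comultiplication is
  \<open>\<Delta>(l \<otimes> h) = \<Sum> (l \<otimes> h\<^sub>1) \<otimes>\<^sub>L (1 \<otimes> h\<^sub>2)\<close>.
\<close>

definition base_change ::
    "'l :: field set \<Rightarrow> ('l, 'h, 'm) hopf_scheme \<Rightarrow> ('l, ('l \<times> 'h) list set) hopf" where
  "base_change K H =
     (let cls = tensor_class K top_module H in
     \<lparr>carrier = tensor_space K top_module H,
      monoid.mult = (\<lambda>c d. cls [(l * m, h \<otimes>\<^bsub>H\<^esub> k). (l, h) \<leftarrow> tensor_rep c, (m, k) \<leftarrow> tensor_rep d]),
      one = cls [(1, \<one>\<^bsub>H\<^esub>)],
      ring.zero = cls [],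
      add = (\<lambda>c d. cls (tensor_rep c @ tensor_rep d)),
      smult = (\<lambda>a c. cls [(a * l, h). (l, h) \<leftarrow> tensor_rep c]),
      comult = (\<lambda>c. [(cls [(l, u)], cls [(1, v)]). (l, h) \<leftarrow> tensor_rep c, (u, v) \<leftarrow> comult H h]),
      counit = (\<lambda>c. \<Sum>(l, h)\<leftarrow>tensor_rep c. l * counit H h),
      antipode = (\<lambda>c. cls [(l, antipode H h). (l, h) \<leftarrow> tensor_rep c])\<rparr>)"

section \<open>Hopf-Galois structures\<close>

definition module_algebra ::
    "'l :: field set \<Rightarrow> ('l, 'h, 'm) hopf_scheme \<Rightarrow> ('h \<Rightarrow> 'l \<Rightarrow> 'l) \<Rightarrow> bool" where
  "module_algebra K H act \<longleftrightarrow>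
     (\<forall>h \<in> carrier H. \<forall>x y. act h (x + y) = act h x + act h y) \<and>
     (\<forall>h \<in> carrier H. \<forall>k \<in> carrier H. \<forall>x. act (h \<oplus>\<^bsub>H\<^esub> k) x = act h x + act k x) \<and>
     (\<forall>a \<in> K. \<forall>h \<in> carrier H. \<forall>x. act (a \<odot>\<^bsub>H\<^esub> h) x = a * act h x \<and> act h (a * x) = a * act h x) \<and>
     (\<forall>x. act \<one>\<^bsub>H\<^esub> x = x) \<and>
     (\<forall>h \<in> carrier H. \<forall>k \<in> carrier H. \<forall>x. act (h \<otimes>\<^bsub>H\<^esub> k) x = act h (act k x)) \<and>
     (\<forall>h \<in> carrier H. \<forall>x y. act h (x * y) = (\<Sum>(u, v)\<leftarrow>comult H h. act u x * act v y)) \<and>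
     (\<forall>h \<in> carrier H. act h 1 = counit H h)"

definition endomorphisms :: "'l :: field set \<Rightarrow> ('l \<Rightarrow> 'l) set" where
  "endomorphisms K =
     {f. (\<forall>x y. f (x + y) = f x + f y) \<and> (\<forall>a \<in> K. \<forall>x. f (a * x) = a * f x)}"

text \<open>
  \<open>H\<close>-Galois means that \<open>L \<otimes>\<^sub>K H \<rightarrow> End\<^sub>K(L)\<close>, \<open>l \<otimes> h \<mapsto> (x \<mapsto> l (h \<cdot> x))\<close>, is bijective.
\<close>

definition hopf_galois_structure ::
    "'l :: field set \<Rightarrow> ('l, 'h, 'm) hopf_scheme \<times> ('h \<Rightarrow> 'l \<Rightarrow> 'l) \<Rightarrow> bool" where
  "hopf_galois_structure K = (\<lambda>(H, act). hopf_algebra K H \<and> module_algebra K H act \<and>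
     bij_betw (\<lambda>c x. \<Sum>(l, h)\<leftarrow>tensor_rep c. l * act h x)
       (tensor_space K top_module H) (endomorphisms K))"

definition has_type ::
    "'l :: field set \<Rightarrow> ('a, 'x) monoid_scheme \<Rightarrow>
     ('l, 'h, 'm) hopf_scheme \<times> ('h \<Rightarrow> 'l \<Rightarrow> 'l) \<Rightarrow> bool" where
  "has_type K N = (\<lambda>(H, act). hopf_iso UNIV (base_change K H) (group_algebra UNIV N) \<noteq> {})"

definition hgs_equiv ::
    "'l :: field set \<Rightarrow> ('l, 'h, 'm) hopf_scheme \<times> ('h \<Rightarrow> 'l \<Rightarrow> 'l) \<Rightarrow>
     ('l, 'k, 'n) hopf_scheme \<times> ('k \<Rightarrow> 'l \<Rightarrow> 'l) \<Rightarrow> bool" where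
  "hgs_equiv K = (\<lambda>(H, act) (H', act').
     \<exists>\<phi> \<in> hopf_iso K H H'. \<forall>h \<in> carrier H. \<forall>x. act' (\<phi> h) x = act h x)"

text \<open>
  The number of Hopf-Galois structures of type \<open>N\<close> on \<open>L/K\<close>, counted up to isomorphism of Hopf
  algebras compatible with the actions on \<open>L\<close>. Since \<open>dim\<^sub>K H = [L:K]\<close> for every Hopf-Galois
  structure, \<open>H\<close> and \<open>L\<close> are equipotent, so every structure is isomorphic to one whose
  underlying set consists of elements of the type \<^typ>\<open>'l\<close>.
\<close>

definition hgs_number :: "'l :: field set \<Rightarrow> ('a, 'x) monoid_scheme \<Rightarrow> nat" where
  "hgs_number K N =
     (let S = {A :: ('l, 'l) hopf \<times> ('l \<Rightarrow> 'l \<Rightarrow> 'l). hopf_galois_structure K A \<and> has_type K N A}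
      in card (S // {(A, B). A \<in> S \<and> B \<in> S \<and> hgs_equiv K A B}))"

end

theory Submission
  imports Defs "HOL-Library.Function_Algebras" "HOL-Number_Theory.Residues"
begin

text \<open>
  Both numbers are read off from one set: the bijections \<open>\<phi> : G \<rightarrow> N\<close> such that every
  \<open>t \<mapsto> \<phi>(s)\<^sup>-\<^sup>1 \<phi>(s t)\<close> is an automorphism of \<open>N\<close> in terms of \<open>\<phi>(t)\<close>. Such \<open>\<phi>\<close> are the
  parametrisations by \<open>G\<close> of regular subgroups of \<open>Hol(N)\<close>, so \<open>Aut G\<close> acts freely on them with
  orbits counted by \<open>e'(G,N)\<close>. By Galois descent each \<open>\<phi>\<close> also yields the Hopf-Galois structure
  \<open>L[N]\<^sup>G\<close> on \<open>L/K\<close>; all structures of type \<open>N\<close> arise in this way, because in \<open>L \<otimes> H \<cong> L[N]\<close> the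
  elements of \<open>N\<close> act on \<open>L\<close> by automorphisms. Two maps give the same structure iff they differ by
  \<open>Aut N\<close>, so the free orbits of \<open>Aut N\<close> are counted by \<open>e(G,N)\<close>.

  It remains to count the maps between \<open>\<int>\<^sub>P \<rtimes> \<int>\<^sub>q\<close> and the cyclic group, where \<open>P = p\<^sup>n\<close>. The
  automorphisms of these groups are affine, so \<open>\<phi>\<close> satisfies affine recursions under translation by
  the two generators. Bijectivity forces the multiplier of the first one to be unipotent modulo \<open>p\<close>,
  and the relations of \<open>G\<close> then leave an explicit family. When \<open>N\<close> is nonabelian the family
  appears twice, interchanged by \<open>\<phi> \<mapsto> \<phi>\<^sup>-\<^sup>1\<close> (values inverted in \<open>N\<close>).
\<close>

section \<open>Finite Galois extensions\<close>

text \<open>Let u be the number of units modulo P. Then |Aut G| = u P and |Aut C| = u (q - 1), while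
  there are 2 u P (1 + (q - 2) P) maps from G to G, u P (q - 1) from G to C and 2 u p^(n-1) P (q -
  1) from C to G; all six numbers are quotients of these. In the first count the exponent s induced
  on Z_q comes with a free parameter modulo P, except for s = 1, where it degenerates. The factor
  p^(n-1) counts unipotent multipliers U; they survive only for the cyclic source, since y x = x^k y
  forces U^(k - 1) = 1 with k - 1 prime to p. The obstacle on the field side is that tensors are
  lists modulo bilinear forms and that a given H is an arbitrary vector space with an abstract
  coproduct. Everything is therefore moved to L-valued functions on N, where the coproduct is
  supported on the diagonal and identities are compared pointwise; independence of automorphisms
  turns equality of operators on L into equality of functions.\<close>

lemma sum_sum_list: "(\<Sum>i\<in>I. \<Sum>x\<leftarrow>xs. f i x) = (\<Sum>x\<leftarrow>xs. \<Sum>i\<in>I. f i x)"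
  for f :: "'i \<Rightarrow> 'j \<Rightarrow> 'l :: comm_monoid_add"
  by (induction xs) (auto simp: sum.distrib)

locale galois_extension =
  fixes K :: "'l :: field set"
  assumes galois: "finite_galois K" and finite_Gal: "finite (carrier (gal_group K))"
begin

abbreviation "Gal \<equiv> carrier (gal_group K)"

lemma K_subfield: "subfield K (scalars UNIV)"
  using galois by (simp add: finite_galois_def)

lemma K_subring: "subring K (scalars UNIV)"
  by (rule subfieldE(1)[OF K_subfield])

lemma K_0 [simp]: "0 \<in> K" and K_1 [simp]: "1 \<in> K"
  using subringE(2,3)[OF K_subring] by (auto simp: scalars_def)

lemma K_add [intro]: "a \<in> K \<Longrightarrow> b \<in> K \<Longrightarrow> a + b \<in> K"
  and K_mult [intro]: "a \<in> K \<Longrightarrow> b \<in> K \<Longrightarrow> a * b \<in> K"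
  using subringE(6,7)[OF K_subring] by (auto simp: scalars_def)

lemma K_sum [intro]: "(\<And>i. i \<in> I \<Longrightarrow> f i \<in> K) \<Longrightarrow> sum f I \<in> K"
  by (induction I rule: infinite_finite_induct) auto

lemma Gal_bij: "s \<in> Gal \<Longrightarrow> bij s"
  and Gal_add: "s \<in> Gal \<Longrightarrow> s (x + y) = s x + s y"
  and Gal_mult: "s \<in> Gal \<Longrightarrow> s (x * y) = s x * s y"
  and Gal_K: "s \<in> Gal \<Longrightarrow> a \<in> K \<Longrightarrow> s a = a"
  by (auto simp: gal_group_def)

lemma Gal_0: "s \<in> Gal \<Longrightarrow> s 0 = 0" and Gal_1: "s \<in> Gal \<Longrightarrow> s 1 = 1"
  by (rule Gal_K; simp)+

lemma Gal_minus: "s \<in> Gal \<Longrightarrow> s (- x) = - s x"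
  by (metis Gal_0 Gal_add add.right_inverse minus_unique)

lemma Gal_sum: "s \<in> Gal \<Longrightarrow> s (sum f I) = (\<Sum>i\<in>I. s (f i))"
  by (induction I rule: infinite_finite_induct) (auto simp: Gal_0 Gal_add)

lemma Gal_sum_list: "s \<in> Gal \<Longrightarrow> s (\<Sum>i\<leftarrow>xs. f i) = (\<Sum>i\<leftarrow>xs. s (f i))"
  by (induction xs) (auto simp: Gal_0 Gal_add)

lemma Gal_inject: "s \<in> Gal \<Longrightarrow> s x = s y \<longleftrightarrow> x = y"
  using Gal_bij by (metis bij_pointE)

lemma Gal_id [simp]: "id \<in> Gal"
  by (auto simp: gal_group_def)

lemma Gal_comp [intro]: "s \<in> Gal \<Longrightarrow> t \<in> Gal \<Longrightarrow> s \<circ> t \<in> Gal"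
  by (auto simp: gal_group_def intro: bij_comp)

lemma Gal_inv [intro]: assumes "s \<in> Gal" shows "Hilbert_Choice.inv s \<in> Gal"
proof -
  have b: "bij s" using assms by (rule Gal_bij)
  have "Hilbert_Choice.inv s (x + y) = Hilbert_Choice.inv s x + Hilbert_Choice.inv s y" for x y
    using assms b by (metis Gal_add bij_inv_eq_iff)
  moreover have "Hilbert_Choice.inv s (x * y) = Hilbert_Choice.inv s x * Hilbert_Choice.inv s y" for x y
    using assms b by (metis Gal_mult bij_inv_eq_iff)
  moreover have "Hilbert_Choice.inv s a = a" if "a \<in> K" for a
    using assms b that by (metis Gal_K bij_inv_eq_iff)
  ultimately show ?thesis using b by (auto simp: gal_group_def bij_imp_bij_inv)
qed

lemma gal_mult [simp]: "s \<otimes>\<^bsub>gal_group K\<^esub> t = s \<circ> t"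
  and gal_one [simp]: "\<one>\<^bsub>gal_group K\<^esub> = id"
  by (auto simp: gal_group_def)

lemma group_Gal: "group (gal_group K)"
proof (rule groupI)
  fix s assume "s \<in> Gal"
  then show "\<exists>t\<in>Gal. t \<otimes>\<^bsub>gal_group K\<^esub> s = \<one>\<^bsub>gal_group K\<^esub>"
    by (intro bexI[of _ "Hilbert_Choice.inv s"]) (auto simp: Gal_bij bij_is_inj)
qed (auto simp: comp_assoc)

lemma Gal_inv_apply: "s \<in> Gal \<Longrightarrow> s (Hilbert_Choice.inv s x) = x" "s \<in> Gal \<Longrightarrow> Hilbert_Choice.inv s (s x) = x"
  by (auto simp: Gal_bij bij_is_surj surj_f_inv_f bij_is_inj)

lemma fixed_in_K: "(\<And>s. s \<in> Gal \<Longrightarrow> s x = x) \<Longrightarrow> x \<in> K"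
  using galois by (auto simp: finite_galois_def)

lemma Gal_bij_left: "s \<in> Gal \<Longrightarrow> bij_betw (\<lambda>t. s \<circ> t) Gal Gal"
  by (rule bij_betw_byWitness[where f' = "\<lambda>t. Hilbert_Choice.inv s \<circ> t"])
     (auto simp: fun_eq_iff Gal_inv_apply intro!: Gal_comp Gal_inv)

section \<open>Trace, dual coordinates and independence of automorphisms\<close>

definition tr :: "'l \<Rightarrow> 'l" where "tr x = (\<Sum>s\<in>Gal. s x)"

lemma tr_K: "tr x \<in> K"
proof (rule fixed_in_K)
  fix s assume s: "s \<in> Gal"
  have "s (tr x) = (\<Sum>t\<in>Gal. (s \<circ> t) x)" by (simp add: tr_def Gal_sum s)
  also have "\<dots> = (\<Sum>t\<in>Gal. t x)" using sum.reindex_bij_betw[OF Gal_bij_left[OF s], of "\<lambda>t. t x"] .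
  finally show "s (tr x) = tr x" by (simp add: tr_def)
qed

lemma tr_add: "tr (x + y) = tr x + tr y"
  by (simp add: tr_def Gal_add sum.distrib)

lemma tr_mult_K: "a \<in> K \<Longrightarrow> tr (a * x) = a * tr x"
  by (simp add: tr_def Gal_mult Gal_K sum_distrib_left)

text \<open>Artin's elimination: adjoining an automorphism \<open>r\<close> with \<open>r z \<noteq> z\<close> to \<open>S\<close> replaces
  \<open>\<Sum> y \<otimes> x\<close> by the normalised difference \<open>\<Sum> (r z y \<otimes> x - y \<otimes> z x)\<close>, which vanishes at \<open>r\<close>.\<close>

lemma ex_dual_coords:
  obtains xs :: "('l \<times> 'l) list"
  where "\<And>s. s \<in> Gal \<Longrightarrow> (\<Sum>(y, x)\<leftarrow>xs. y * s x) = (if s = id then 1 else 0)"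
proof -
  have "\<exists>xs. \<forall>s\<in>insert id S. (\<Sum>(y, x)\<leftarrow>xs. y * s x) = (if s = id then 1 else 0)"
    if "finite S" "S \<subseteq> Gal" for S
    using that
  proof (induction S)
    case empty
    show ?case by (intro exI[of _ "[(1,1)]"]) auto
  next
    case (insert r S)
    from insert.prems have "S \<subseteq> Gal" by blast
    from insert.IH[OF this] obtain xs where xs: "\<And>s. s \<in> insert id S \<Longrightarrow> (\<Sum>(y, x)\<leftarrow>xs. y * s x) = (if s = id then 1 else 0)"
      by blast
    show ?case
    proof (cases "r = id")
      case True
      then show ?thesis using xs by (intro exI[of _ xs]) auto
    next
      case False
      then obtain z where z: "r z \<noteq> z" by (auto simp: fun_eq_iff)
      let ?w = "r z - z"
      let ?ys = "map (\<lambda>(y,x). (y * r z / ?w, x)) xs @ map (\<lambda>(y,x). (- y / ?w, z * x)) xs"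
      have key: "(\<Sum>(y, x)\<leftarrow>?ys. y * s x) = (r z - s z) / ?w * (\<Sum>(y, x)\<leftarrow>xs. y * s x)"
        if "s \<in> Gal" for s
      proof -
        have 1: "(\<Sum>(y, x)\<leftarrow>map (\<lambda>(y,x). (y * r z / ?w, x)) xs. y * s x) = r z / ?w * (\<Sum>(y, x)\<leftarrow>xs. y * s x)"
          by (induction xs) (auto simp: algebra_simps)
        have 2: "(\<Sum>(y, x)\<leftarrow>map (\<lambda>(y,x). (- y / ?w, z * x)) xs. y * s x) = - (s z / ?w) * (\<Sum>(y, x)\<leftarrow>xs. y * s x)"
          using that by (induction xs) (auto simp: algebra_simps Gal_mult)
        show ?thesis unfolding map_append sum_list_append 1 2
          by (simp add: algebra_simps diff_divide_distrib)
      qed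
      show ?thesis
      proof (intro exI[of _ ?ys] ballI)
        fix s assume s: "s \<in> insert id (insert r S)"
        then have sG: "s \<in> Gal" using insert.prems by auto
        show "(\<Sum>(y, x)\<leftarrow>?ys. y * s x) = (if s = id then 1 else 0)"
          unfolding key[OF sG] using s xs[of s] xs[of id] z False by (cases "s = r") auto
      qed
    qed
  qed
  from this[OF finite_Gal order_refl] obtain xs where
    "\<forall>s\<in>insert id Gal. (\<Sum>(y, x)\<leftarrow>xs. y * s x) = (if s = id then 1 else 0)" by blast
  then show thesis using that[of xs] by auto
qed

text \<open>Under the map l \<otimes> m \<mapsto> (l * s m), indexed by s in Gal, this list
  represents the idempotent of the component s = id of L \<otimes> L. It is fixed by choice because
  the elimination singles out no canonical list.\<close>

definition dual_coords :: "('l \<times> 'l) list" where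
  "dual_coords = (SOME xs. \<forall>s\<in>Gal. (\<Sum>(y, x)\<leftarrow>xs. y * s x) = (if s = id then 1 else 0))"

lemma dual_coords: "s \<in> Gal \<Longrightarrow> (\<Sum>(y, x)\<leftarrow>dual_coords. y * s x) = (if s = id then 1 else 0)"
proof -
  have "\<exists>xs. \<forall>s\<in>Gal. (\<Sum>(y, x)\<leftarrow>xs. y * s x) = (if s = id then 1 else 0)"
    using ex_dual_coords by metis
  from someI_ex[OF this] show "s \<in> Gal \<Longrightarrow> ?thesis" unfolding dual_coords_def by blast
qed

text \<open>Pulling t out of the sum reduces the claim to the automorphism t^-1 s. Hence the
  matrices of conjugates (t y) and (s x), multiplied over the entries of the list, give the
  identity.\<close>

lemma dual_coords2:
  assumes s: "s \<in> Gal" and t: "t \<in> Gal"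
  shows "(\<Sum>(y, x)\<leftarrow>dual_coords. t y * s x) = (if s = t then 1 else 0)"
proof -
  let ?u = "Hilbert_Choice.inv t \<circ> s"
  have u: "?u \<in> Gal" using s t by (intro Gal_comp Gal_inv)
  have "(\<Sum>(y, x)\<leftarrow>dual_coords. t y * s x) = t (\<Sum>(y, x)\<leftarrow>dual_coords. y * ?u x)"
    using t by (subst Gal_sum_list) (auto simp: Gal_mult Gal_inv_apply case_prod_unfold)
  also have "\<dots> = (if ?u = id then 1 else 0)" unfolding dual_coords[OF u] using t by (simp add: Gal_0 Gal_1)
  also have "?u = id \<longleftrightarrow> s = t"
  proof
    assume "?u = id"
    then have "t (?u x) = t x" for x by simp
    then show "s = t" using t by (auto simp: Gal_inv_apply)
  next
    assume "s = t" then show "?u = id" using t by (auto simp: Gal_inv_apply)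
  qed
  finally show ?thesis .
qed

text \<open>Evaluating the relation at each x, weighting it by t y and summing over the dual
  coordinates isolates the coefficient of t.\<close>

lemma dedekind_independent:
  assumes "\<And>x. (\<Sum>s\<in>Gal. c s * s x) = 0" and t: "t \<in> Gal"
  shows "c t = 0"
proof -
  have "0 = (\<Sum>(y, x)\<leftarrow>dual_coords. t y * (\<Sum>s\<in>Gal. c s * s x))"
    using assms by (simp add: case_prod_unfold)
  also have "\<dots> = (\<Sum>(y, x)\<leftarrow>dual_coords. \<Sum>s\<in>Gal. c s * (t y * s x))"
    by (simp add: sum_distrib_left algebra_simps)
  also have "\<dots> = (\<Sum>s\<in>Gal. c s * (\<Sum>(y, x)\<leftarrow>dual_coords. t y * s x))"
    by (simp add: sum_sum_list[symmetric] sum_list_const_mult case_prod_unfold)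
  also have "\<dots> = (\<Sum>s\<in>Gal. if s = t then c s else 0)"
    using t by (intro sum.cong) (auto simp: dual_coords2)
  also have "\<dots> = c t" using t finite_Gal by simp
  finally show ?thesis by simp
qed

lemma dedekind_unique:
  assumes "\<And>x. (\<Sum>s\<in>Gal. c s * s x) = (\<Sum>s\<in>Gal. d s * s x)" and t: "t \<in> Gal"
  shows "c t = d t"
proof -
  have "(\<Sum>s\<in>Gal. (c s - d s) * s x) = 0" for x
    using assms(1)[of x] by (simp add: algebra_simps sum_subtractf)
  from dedekind_independent[OF this t] show ?thesis by simp
qed

text \<open>Writing out the trace, the conjugate s x appears with the weight \<Sum> y * s z, which
  vanishes unless s = id. So the first entries of the dual coordinates span L over K, with trace
  forms as coordinates.\<close>

lemma trace_expansion: "x = (\<Sum>(y, z)\<leftarrow>dual_coords. tr (z * x) * y)"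
proof -
  have "(\<Sum>(y, z)\<leftarrow>dual_coords. tr (z * x) * y) = (\<Sum>s\<in>Gal. s x * (\<Sum>(y, z)\<leftarrow>dual_coords. y * s z))"
    unfolding tr_def sum_list_const_mult[symmetric] sum_sum_list
    by (auto simp: sum_distrib_right sum_distrib_left case_prod_unfold Gal_mult algebra_simps intro!: arg_cong[of _ _ sum_list] map_cong)
  also have "\<dots> = (\<Sum>s\<in>Gal. if s = id then s x else 0)"
    by (intro sum.cong) (auto simp: dual_coords)
  also have "\<dots> = x" using finite_Gal by simp
  finally show ?thesis by simp
qed

lemma trace_separates: assumes "\<And>z. tr (z * x) = tr (z * y)" shows "x = y"
  using trace_expansion[of x] trace_expansion[of y] assms by simp

section \<open>Endomorphisms of L as combinations of automorphisms\<close>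

lemma endomorphism_0: "f \<in> endomorphisms K \<Longrightarrow> f 0 = 0"
  unfolding endomorphisms_def mem_Collect_eq by (metis K_0 mult_zero_left)

lemma endomorphism_sum_list:
  "f \<in> endomorphisms K \<Longrightarrow> f (\<Sum>i\<leftarrow>xs. g i) = (\<Sum>i\<leftarrow>xs. f (g i))"
  using endomorphism_0[of f] by (induction xs) (auto simp: endomorphisms_def)

definition end_coeff :: "('l \<Rightarrow> 'l) \<Rightarrow> ('l \<Rightarrow> 'l) \<Rightarrow> 'l" where
  "end_coeff f s = (\<Sum>(y, x)\<leftarrow>dual_coords. f y * s x)"

text \<open>Traces lie in K and pass through f, so applying f to the trace expansion of x and
  writing the traces out again leaves an L-combination of automorphisms.\<close>

lemma endomorphism_expansion:
  assumes f: "f \<in> endomorphisms K"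
  shows "f x = (\<Sum>s\<in>Gal. end_coeff f s * s x)"
proof -
  have "f x = (\<Sum>(y, z)\<leftarrow>dual_coords. f (tr (z * x) * y))"
    by (subst trace_expansion) (simp add: endomorphism_sum_list[OF f] case_prod_unfold)
  also have "\<dots> = (\<Sum>(y, z)\<leftarrow>dual_coords. tr (z * x) * f y)"
    using f by (simp add: endomorphisms_def tr_K)
  also have "\<dots> = (\<Sum>s\<in>Gal. end_coeff f s * s x)"
    unfolding tr_def end_coeff_def sum_list_mult_const[symmetric] sum_sum_list
    by (auto simp: sum_distrib_right sum_distrib_left case_prod_unfold Gal_mult algebra_simps intro!: arg_cong[of _ _ sum_list] map_cong)
  finally show ?thesis .
qed

lemma Gal_combination_endomorphism: "(\<lambda>x. \<Sum>s\<in>Gal. c s * s x) \<in> endomorphisms K"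
  by (auto simp: endomorphisms_def Gal_add Gal_mult Gal_K sum.distrib algebra_simps sum_distrib_left)

lemma Gal_endomorphism: "s \<in> Gal \<Longrightarrow> s \<in> endomorphisms K"
  by (auto simp: endomorphisms_def Gal_add Gal_mult Gal_K)

text \<open>Comparing the coefficients of s in f (x y) = f x * f y, read as functions of y, gives c
  s * s x = f x * c s. Any s with a nonzero coefficient is therefore equal to f, and f 1 = 1
  provides one.\<close>

lemma multiplicative_endomorphism_Gal:
  assumes f: "f \<in> endomorphisms K" and mult: "\<And>x y. f (x * y) = f x * f y" and one: "f 1 = 1"
  shows "f \<in> Gal"
proof -
  define c where "c = end_coeff f"
  have exp: "f x = (\<Sum>s\<in>Gal. c s * s x)" for x using endomorphism_expansion[OF f] by (simp add: c_def)
  have "\<exists>s\<in>Gal. c s \<noteq> 0"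
  proof (rule ccontr)
    assume "\<not> ?thesis"
    then have "(\<Sum>s\<in>Gal. c s * s 1) = 0" by simp
    then show False using exp[of 1] one by simp
  qed
  then obtain s where s: "s \<in> Gal" "c s \<noteq> 0" by blast
  have "f x = s x" for x
  proof -
    have "(\<Sum>s\<in>Gal. (c s * s x) * s y) = (\<Sum>s\<in>Gal. (f x * c s) * s y)" for y
    proof -
      have "(\<Sum>s\<in>Gal. (c s * s x) * s y) = f (x * y)"
        unfolding exp[of "x * y"] by (intro sum.cong) (simp_all add: Gal_mult mult.assoc)
      also have "\<dots> = f x * (\<Sum>s\<in>Gal. c s * s y)" using mult[of x y] exp[of y] by simp
      finally show ?thesis by (simp add: sum_distrib_left mult.assoc)
    qed
    from dedekind_unique[of "\<lambda>s. c s * s x" "\<lambda>s. f x * c s", OF this s(1)] s(2)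
    show ?thesis by simp
  qed
  then show ?thesis using s(1) by (metis ext)
qed

end

section \<open>Tensors and invariants in coordinates\<close>

lemma sum_fun_apply: "(\<Sum>i\<in>I. f i) x = (\<Sum>i\<in>I. f i x)" for f :: "'i \<Rightarrow> 'x \<Rightarrow> 'l :: comm_monoid_add"
  by (induction I rule: infinite_finite_induct) auto

interpretation fun_space: vector_space "\<lambda>(c :: 'l :: field) (f :: 'x \<Rightarrow> 'l) x. c * f x"
  by standard (auto simp: fun_eq_iff algebra_simps)

definition unit_fun :: "'x \<Rightarrow> 'x \<Rightarrow> 'l :: field" where
  "unit_fun x = (\<lambda>y. if y = x then 1 else 0)"

lemma unit_fun_expansion:
  assumes "finite \<Omega>" "\<And>x. x \<notin> \<Omega> \<Longrightarrow> f x = 0"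
  shows "f = (\<Sum>x\<in>\<Omega>. (\<lambda>y. f x * unit_fun x y))"
  using assms by (auto simp: fun_eq_iff sum_fun_apply unit_fun_def sum.delta' if_distrib[of "(*) _"] cong: if_cong)

lemma inj_unit_fun: "inj_on (unit_fun :: 'x \<Rightarrow> 'x \<Rightarrow> 'l :: field) \<Omega>"
  by (auto simp: inj_on_def unit_fun_def fun_eq_iff split: if_splits)

lemma independent_unit_fun:
  assumes "finite \<Omega>"
  shows "fun_space.independent ((unit_fun :: 'x \<Rightarrow> 'x \<Rightarrow> 'l :: field) ` \<Omega>)"
proof (rule fun_space.independent_if_scalars_zero)
  show "finite (unit_fun ` \<Omega> :: ('x \<Rightarrow> 'l) set)" using assms by simp
  fix g :: "('x \<Rightarrow> 'l) \<Rightarrow> 'l" and v :: "'x \<Rightarrow> 'l"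
  assume 0: "(\<Sum>v\<in>unit_fun ` \<Omega>. (\<lambda>x. g v * v x)) = 0" and "v \<in> unit_fun ` \<Omega>"
  then obtain y where y: "y \<in> \<Omega>" "v = unit_fun y" by blast
  have "(\<Sum>v\<in>unit_fun ` \<Omega>. (\<lambda>x. g v * v x)) y = (\<Sum>x\<in>\<Omega>. g (unit_fun x) * unit_fun x y)"
    by (simp add: sum.reindex[OF inj_unit_fun] sum_fun_apply)
  also have "\<dots> = (\<Sum>x\<in>\<Omega>. if x = y then g (unit_fun x) else 0)"
    by (intro sum.cong) (auto simp: unit_fun_def)
  also have "\<dots> = g v" using y assms by simp
  finally show "g v = 0" using 0 by simp
qed

text \<open>A pair of dual bases \<open>b\<close> and \<open>v \<mapsto> \<Sum>\<^sub>x r v x a x i\<close> of \<open>V\<close> over \<open>K\<close>; factoring the coordinates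
  through \<open>L\<close>-valued functions \<open>r v\<close> lets bilinear forms on \<open>V\<close> be evaluated by descent.\<close>

definition frame :: "'l :: field set \<Rightarrow> ('l, 'v, 'm) module_scheme \<Rightarrow> 'x set \<Rightarrow> ('v \<Rightarrow> 'x \<Rightarrow> 'l) \<Rightarrow>
    'i set \<Rightarrow> ('x \<Rightarrow> 'i \<Rightarrow> 'l) \<Rightarrow> ('i \<Rightarrow> 'v) \<Rightarrow> bool" where
  "frame K V \<Omega> r I a b \<longleftrightarrow> b ` I \<subseteq> carrier V \<and>
     (\<forall>f. linear_form K V f \<longrightarrow>
       (\<forall>v\<in>carrier V. f v = (\<Sum>x\<in>\<Omega>. r v x * (\<Sum>i\<in>I. a x i * f (b i)))))"

section \<open>Equality of tensors tested in coordinates\<close>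

lemma sum_list_cong: "(\<And>x. x \<in> set xs \<Longrightarrow> f x = g x) \<Longrightarrow> (\<Sum>x\<leftarrow>xs. f x) = (\<Sum>x\<leftarrow>xs. g x)"
  by (metis map_eq_conv)

text \<open>In frames every bilinear form is an L-combination, with coefficients \<open>C\<close>
  depending on the form alone, of the products \<open>r v x * r' w y\<close>. Lists with equal sums
  of these products cannot be told apart.\<close>

lemma tensor_eqI:
  assumes V: "frame K V \<Omega> r I a b" and W: "frame K W Y r' J a' b'"
    and s: "set s \<subseteq> carrier V \<times> carrier W" and t: "set t \<subseteq> carrier V \<times> carrier W"
    and eq: "\<And>x y. x \<in> \<Omega> \<Longrightarrow> y \<in> Y \<Longrightarrow>
      (\<Sum>(v, w)\<leftarrow>s. r v x * r' w y) = (\<Sum>(v, w)\<leftarrow>t. r v x * r' w y)"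
  shows "tensor_eq K V W s t"
  unfolding tensor_eq_def
proof (intro conjI s t allI impI, elim conjE)
  fix \<beta>
  assume \<beta>: "\<forall>v\<in>carrier V. linear_form K W (\<beta> v)" "\<forall>w\<in>carrier W. linear_form K V (\<lambda>v. \<beta> v w)"
  define C where "C x y = (\<Sum>i\<in>I. a x i * (\<Sum>j\<in>J. a' y j * \<beta> (b i) (b' j)))" for x y
  have bI: "b i \<in> carrier V" if "i \<in> I" for i using V that by (auto simp: frame_def)
  have exp: "\<beta> v w = (\<Sum>x\<in>\<Omega>. \<Sum>y\<in>Y. (r v x * r' w y) * C x y)" if "v \<in> carrier V" "w \<in> carrier W" for v w
  proof -
    have "\<beta> v w = (\<Sum>x\<in>\<Omega>. r v x * (\<Sum>i\<in>I. a x i * \<beta> (b i) w))"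
      using V \<beta>(2) that unfolding frame_def by blast
    also have "\<dots> = (\<Sum>x\<in>\<Omega>. r v x * (\<Sum>i\<in>I. a x i * (\<Sum>y\<in>Y. r' w y * (\<Sum>j\<in>J. a' y j * \<beta> (b i) (b' j)))))"
      using W \<beta>(1) bI that(2) unfolding frame_def by (intro sum.cong arg_cong2[of _ _ _ _ "(*)"] refl) blast+
    also have "\<dots> = (\<Sum>x\<in>\<Omega>. \<Sum>y\<in>Y. (r v x * r' w y) * C x y)"
      unfolding C_def sum_distrib_left
      by (intro sum.cong refl, subst sum.swap) (simp add: algebra_simps)
    finally show ?thesis .
  qed
  have sum: "(\<Sum>(v, w)\<leftarrow>u. \<beta> v w) = (\<Sum>x\<in>\<Omega>. \<Sum>y\<in>Y. (\<Sum>(v, w)\<leftarrow>u. r v x * r' w y) * C x y)"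
    if "set u \<subseteq> carrier V \<times> carrier W" for u
  proof -
    have "(\<Sum>(v, w)\<leftarrow>u. \<beta> v w) = (\<Sum>(v, w)\<leftarrow>u. \<Sum>x\<in>\<Omega>. \<Sum>y\<in>Y. (r v x * r' w y) * C x y)"
      using that exp by (intro sum_list_cong) auto
    also have "\<dots> = (\<Sum>x\<in>\<Omega>. \<Sum>y\<in>Y. (\<Sum>(v, w)\<leftarrow>u. r v x * r' w y) * C x y)"
      by (simp add: sum_sum_list sum_list_mult_const[symmetric] case_prod_unfold)
    finally show ?thesis .
  qed
  show "(\<Sum>(v, w)\<leftarrow>s. \<beta> v w) = (\<Sum>(v, w)\<leftarrow>t. \<beta> v w)"
    unfolding sum[OF s] sum[OF t] using eq by simp
qed

lemma tensor3_eqI: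
  assumes V: "frame K V \<Omega> r I a b" and W: "frame K W Y r' J a' b'" and Z: "frame K Z U r'' M a'' b''"
    and s: "set s \<subseteq> carrier V \<times> carrier W \<times> carrier Z" and t: "set t \<subseteq> carrier V \<times> carrier W \<times> carrier Z"
    and eq: "\<And>x y z. x \<in> \<Omega> \<Longrightarrow> y \<in> Y \<Longrightarrow> z \<in> U \<Longrightarrow>
      (\<Sum>(v, w, u)\<leftarrow>s. r v x * r' w y * r'' u z) = (\<Sum>(v, w, u)\<leftarrow>t. r v x * r' w y * r'' u z)"
  shows "tensor3_eq K V W Z s t"
  unfolding tensor3_eq_def
proof (intro conjI s t allI impI, elim conjE)
  fix \<beta>
  assume \<beta>: "\<forall>v\<in>carrier V. \<forall>w\<in>carrier W. linear_form K Z (\<lambda>x. \<beta> v w x)"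
    "\<forall>v\<in>carrier V. \<forall>x\<in>carrier Z. linear_form K W (\<lambda>w. \<beta> v w x)"
    "\<forall>w\<in>carrier W. \<forall>x\<in>carrier Z. linear_form K V (\<lambda>v. \<beta> v w x)"
  define C where "C x y z = (\<Sum>i\<in>I. a x i * (\<Sum>j\<in>J. a' y j * (\<Sum>m\<in>M. a'' z m * \<beta> (b i) (b' j) (b'' m))))" for x y z
  have bI: "b i \<in> carrier V" if "i \<in> I" for i using V that by (auto simp: frame_def)
  have bJ: "b' j \<in> carrier W" if "j \<in> J" for j using W that by (auto simp: frame_def)
  have exp: "\<beta> v w u = (\<Sum>x\<in>\<Omega>. \<Sum>y\<in>Y. \<Sum>z\<in>U. (r v x * r' w y * r'' u z) * C x y z)"
    if "v \<in> carrier V" "w \<in> carrier W" "u \<in> carrier Z" for v w u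
  proof -
    have "\<beta> v w u = (\<Sum>x\<in>\<Omega>. r v x * (\<Sum>i\<in>I. a x i * \<beta> (b i) w u))"
      using V \<beta>(3) that unfolding frame_def by blast
    also have "\<dots> = (\<Sum>x\<in>\<Omega>. r v x * (\<Sum>i\<in>I. a x i * (\<Sum>y\<in>Y. r' w y * (\<Sum>j\<in>J. a' y j * \<beta> (b i) (b' j) u))))"
      using W \<beta>(2) bI that unfolding frame_def by (intro sum.cong arg_cong2[of _ _ _ _ "(*)"] refl) blast+
    also have "\<dots> = (\<Sum>x\<in>\<Omega>. r v x * (\<Sum>i\<in>I. a x i * (\<Sum>y\<in>Y. r' w y * (\<Sum>j\<in>J. a' y j *
        (\<Sum>z\<in>U. r'' u z * (\<Sum>m\<in>M. a'' z m * \<beta> (b i) (b' j) (b'' m)))))))"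
      using Z \<beta>(1) bI bJ that unfolding frame_def by (intro sum.cong arg_cong2[of _ _ _ _ "(*)"] refl) blast+
    \<comment> \<open>All sums are flattened so that the three point indices can be moved outside
      the three basis indices by single interchanges.\<close>
    also have "\<dots> = (\<Sum>x\<in>\<Omega>. \<Sum>i\<in>I. \<Sum>y\<in>Y. \<Sum>j\<in>J. \<Sum>z\<in>U. r v x * r' w y * r'' u z *
        (a x i * (a' y j * (\<Sum>m\<in>M. a'' z m * \<beta> (b i) (b' j) (b'' m)))))"
      by (simp only: sum_distrib_left mult_ac)
    also have "\<dots> = (\<Sum>x\<in>\<Omega>. \<Sum>y\<in>Y. \<Sum>i\<in>I. \<Sum>z\<in>U. \<Sum>j\<in>J. r v x * r' w y * r'' u z *
        (a x i * (a' y j * (\<Sum>m\<in>M. a'' z m * \<beta> (b i) (b' j) (b'' m)))))"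
      by (rule sum.cong[OF refl], subst sum.swap, intro sum.cong refl, rule sum.swap)
    also have "\<dots> = (\<Sum>x\<in>\<Omega>. \<Sum>y\<in>Y. \<Sum>z\<in>U. \<Sum>i\<in>I. \<Sum>j\<in>J. r v x * r' w y * r'' u z *
        (a x i * (a' y j * (\<Sum>m\<in>M. a'' z m * \<beta> (b i) (b' j) (b'' m)))))"
      by (intro sum.cong refl, rule sum.swap)
    also have "\<dots> = (\<Sum>x\<in>\<Omega>. \<Sum>y\<in>Y. \<Sum>z\<in>U. (r v x * r' w y * r'' u z) * C x y z)"
      unfolding C_def by (simp only: sum_distrib_left)
    finally show ?thesis .
  qed
  have sum: "(\<Sum>(v, w, z)\<leftarrow>u. \<beta> v w z) = (\<Sum>x\<in>\<Omega>. \<Sum>y\<in>Y. \<Sum>z\<in>U. (\<Sum>(v, w, u)\<leftarrow>u. r v x * r' w y * r'' u z) * C x y z)"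
    if "set u \<subseteq> carrier V \<times> carrier W \<times> carrier Z" for u
  proof -
    have "(\<Sum>(v, w, z)\<leftarrow>u. \<beta> v w z) = (\<Sum>(v, w, u)\<leftarrow>u. \<Sum>x\<in>\<Omega>. \<Sum>y\<in>Y. \<Sum>z\<in>U. (r v x * r' w y * r'' u z) * C x y z)"
      using that exp by (intro sum_list_cong) auto
    also have "\<dots> = (\<Sum>x\<in>\<Omega>. \<Sum>y\<in>Y. \<Sum>z\<in>U. (\<Sum>(v, w, u)\<leftarrow>u. r v x * r' w y * r'' u z) * C x y z)"
      by (simp add: sum_sum_list sum_list_mult_const[symmetric] case_prod_unfold)
    finally show ?thesis .
  qed
  show "(\<Sum>(v, w, z)\<leftarrow>s. \<beta> v w z) = (\<Sum>(v, w, z)\<leftarrow>t. \<beta> v w z)"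
    unfolding sum[OF s] sum[OF t] using eq by simp
qed

lemma tensor_eq_refl: "set s \<subseteq> carrier V \<times> carrier W \<Longrightarrow> tensor_eq K V W s s"
  by (auto simp: tensor_eq_def)

lemma tensor_eq_sym: "tensor_eq K V W s t \<Longrightarrow> tensor_eq K V W t s"
  by (auto simp: tensor_eq_def)

lemma tensor_eq_trans: "tensor_eq K V W s t \<Longrightarrow> tensor_eq K V W t u \<Longrightarrow> tensor_eq K V W s u"
  by (simp add: tensor_eq_def)

lemma tensor_class_eq_iff:
  assumes "set s \<subseteq> carrier V \<times> carrier W"
  shows "tensor_class K V W s = tensor_class K V W t \<longleftrightarrow> tensor_eq K V W s t"
proof
  assume "tensor_class K V W s = tensor_class K V W t"
  then show "tensor_eq K V W s t"
    using tensor_eq_refl[OF assms, of K] tensor_eq_sym[of K V W t s]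
    unfolding tensor_class_def by blast
next
  assume "tensor_eq K V W s t"
  then show "tensor_class K V W s = tensor_class K V W t"
    unfolding tensor_class_def using tensor_eq_sym tensor_eq_trans by blast
qed

lemma tensor_rep_class:
  assumes "set s \<subseteq> carrier V \<times> carrier W"
  shows "tensor_eq K V W s (tensor_rep (tensor_class K V W s))"
proof -
  have "s \<in> tensor_class K V W s" using tensor_eq_refl[OF assms] by (simp add: tensor_class_def)
  then have "tensor_rep (tensor_class K V W s) \<in> tensor_class K V W s"
    unfolding tensor_rep_def by (rule someI)
  then show ?thesis by (simp add: tensor_class_def)
qed

lemma tensor_rep_space:
  assumes "c \<in> tensor_space K V W"
  shows "set (tensor_rep c) \<subseteq> carrier V \<times> carrier W" "tensor_class K V W (tensor_rep c) = c"
proof -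
  obtain s where s: "set s \<subseteq> carrier V \<times> carrier W" "c = tensor_class K V W s"
    using assms by (auto simp: tensor_space_def)
  have e: "tensor_eq K V W s (tensor_rep c)" using tensor_rep_class[OF s(1)] s(2) by simp
  then show 1: "set (tensor_rep c) \<subseteq> carrier V \<times> carrier W" by (simp add: tensor_eq_def)
  show "tensor_class K V W (tensor_rep c) = c"
    using tensor_class_eq_iff[OF 1] tensor_eq_sym[OF e] s(2) by simp
qed

lemma top_module_simps [simp]: "carrier top_module = UNIV" "x \<oplus>\<^bsub>top_module\<^esub> y = x + y"
  "a \<odot>\<^bsub>top_module\<^esub> x = a * x"
  by (auto simp: top_module_def)

text \<open>The fixed points of the semilinear Galois action on functions \<Omega> \<rightarrow> L
  that moves the points by \<open>T\<close> and the values by the automorphisms. Vanishing off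
  \<Omega> makes equality of such functions coincide with equality on \<Omega>.\<close>

definition invariants :: "'l :: field set \<Rightarrow> 'x set \<Rightarrow> (('l \<Rightarrow> 'l) \<Rightarrow> 'x \<Rightarrow> 'x) \<Rightarrow> ('x \<Rightarrow> 'l) set" where
  "invariants K \<Omega> T = {f. (\<forall>x. x \<notin> \<Omega> \<longrightarrow> f x = 0) \<and> (\<forall>s\<in>carrier (gal_group K). \<forall>x\<in>\<Omega>. f (T s x) = s (f x))}"

context galois_extension
begin

text \<open>\<open>tensor_eq\<close> only sees K-valued bilinear forms, whereas l * F h lies in L.
  The forms tr (z * _) bring it into K, and together they separate the points of L.\<close>

lemma tensor_eq_eval:
  assumes st: "tensor_eq K top_module H s t"
    and add: "\<And>h k. h \<in> carrier H \<Longrightarrow> k \<in> carrier H \<Longrightarrow> F (h \<oplus>\<^bsub>H\<^esub> k) = F h + F k"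
    and smult: "\<And>a h. a \<in> K \<Longrightarrow> h \<in> carrier H \<Longrightarrow> F (a \<odot>\<^bsub>H\<^esub> h) = a * F h"
  shows "(\<Sum>(l, h)\<leftarrow>s. l * F h) = (\<Sum>(l, h)\<leftarrow>t. l * F h)"
proof (rule trace_separates)
  fix z
  have tr_list: "tr (z * (\<Sum>(l, h)\<leftarrow>u. l * F h)) = (\<Sum>(l, h)\<leftarrow>u. tr (z * (l * F h)))" for u
  proof (induction u)
    case Nil
    show ?case using tr_mult_K[OF K_0] by simp
  qed (auto simp: tr_add distrib_left)
  have form: "linear_form K H (\<lambda>h. tr (z * (l * F h)))" for l
    using tr_mult_K[of _ "z * (l * F h)" for h]
    by (auto simp: linear_form_def tr_K add smult tr_add[symmetric] tr_mult_K[symmetric] algebra_simps)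
  have form': "linear_form K top_module (\<lambda>l. tr (z * (l * F h)))" for h
    by (auto simp: linear_form_def tr_K tr_add[symmetric] tr_mult_K[symmetric] algebra_simps)
  have "(\<Sum>(l, h)\<leftarrow>s. tr (z * (l * F h))) = (\<Sum>(l, h)\<leftarrow>t. tr (z * (l * F h)))"
    using st form form' unfolding tensor_eq_def by (elim conjE allE[of _ "\<lambda>l h. tr (z * (l * F h))"]) auto
  then show "tr (z * (\<Sum>(l, h)\<leftarrow>s. l * F h)) = tr (z * (\<Sum>(l, h)\<leftarrow>t. l * F h))"
    by (simp add: tr_list)
qed

end

section \<open>Galois descent for functions on a finite set with Galois action\<close>

locale gal_action = galois_extension K for K :: "'l :: field set" +
  fixes \<Omega> :: "'x set" and T :: "('l \<Rightarrow> 'l) \<Rightarrow> 'x \<Rightarrow> 'x"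
  assumes finite_Om: "finite \<Omega>"
    and T_closed: "s \<in> Gal \<Longrightarrow> x \<in> \<Omega> \<Longrightarrow> T s x \<in> \<Omega>"
    and T_id: "x \<in> \<Omega> \<Longrightarrow> T id x = x"
    and T_comp: "s \<in> Gal \<Longrightarrow> t \<in> Gal \<Longrightarrow> x \<in> \<Omega> \<Longrightarrow> T (s \<circ> t) x = T s (T t x)"
begin

lemma T_inv: assumes "s \<in> Gal" "x \<in> \<Omega>"
  shows "T (Hilbert_Choice.inv s) (T s x) = x" "T s (T (Hilbert_Choice.inv s) x) = x"
proof -
  have "Hilbert_Choice.inv s \<circ> s = id" "s \<circ> Hilbert_Choice.inv s = id"
    using assms by (auto simp: Gal_inv_apply)
  then show "T (Hilbert_Choice.inv s) (T s x) = x" "T s (T (Hilbert_Choice.inv s) x) = x"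
    using assms Gal_inv T_comp T_id by metis+
qed

abbreviation "Inv \<equiv> invariants K \<Omega> T"

text \<open>The sum of all conjugates of f under the semilinear action.\<close>

definition twisted_trace :: "('x \<Rightarrow> 'l) \<Rightarrow> 'x \<Rightarrow> 'l" where
  "twisted_trace f x = (if x \<in> \<Omega> then \<Sum>s\<in>Gal. s (f (T (Hilbert_Choice.inv s) x)) else 0)"

lemma twisted_trace_Inv: "twisted_trace f \<in> Inv"
  unfolding invariants_def
proof (intro CollectI conjI allI impI ballI)
  fix t x assume t: "t \<in> Gal" and x: "x \<in> \<Omega>"
  have "twisted_trace f (T t x) = (\<Sum>s\<in>Gal. s (f (T (Hilbert_Choice.inv s) (T t x))))"
    using t x T_closed by (simp add: twisted_trace_def)
  also have "\<dots> = (\<Sum>s\<in>Gal. (t \<circ> s) (f (T (Hilbert_Choice.inv (t \<circ> s)) (T t x))))"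
    by (rule sum.reindex_bij_betw[OF Gal_bij_left[OF t], symmetric])
  also have "\<dots> = (\<Sum>s\<in>Gal. t (s (f (T (Hilbert_Choice.inv s) x))))"
  proof (intro sum.cong refl)
    fix s assume s: "s \<in> Gal"
    have "Hilbert_Choice.inv (t \<circ> s) = Hilbert_Choice.inv s \<circ> Hilbert_Choice.inv t"
      using s t Gal_bij o_inv_distrib by (metis)
    then have "T (Hilbert_Choice.inv (t \<circ> s)) (T t x) = T (Hilbert_Choice.inv s) x"
      using s t x T_comp T_inv T_closed Gal_inv by simp
    then show "(t \<circ> s) (f (T (Hilbert_Choice.inv (t \<circ> s)) (T t x))) = t (s (f (T (Hilbert_Choice.inv s) x)))"
      by simp
  qed
  also have "\<dots> = t (twisted_trace f x)" using t x by (simp add: Gal_sum twisted_trace_def)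
  finally show "twisted_trace f (T t x) = t (twisted_trace f x)" .
qed (simp add: twisted_trace_def)

text \<open>As for the trace of L, the dual coordinates cancel all conjugates of f but f itself.
  This exhibits f as an L-combination of invariant functions.\<close>

lemma twisted_trace_expansion:
  assumes f: "\<And>x. x \<notin> \<Omega> \<Longrightarrow> f x = 0"
  shows "f x = (\<Sum>(y, z)\<leftarrow>dual_coords. y * twisted_trace (\<lambda>x. z * f x) x)"
proof (cases "x \<in> \<Omega>")
  case True
  have "(\<Sum>(y, z)\<leftarrow>dual_coords. y * twisted_trace (\<lambda>x. z * f x) x) =
        (\<Sum>(y, z)\<leftarrow>dual_coords. \<Sum>s\<in>Gal. (y * s z) * s (f (T (Hilbert_Choice.inv s) x)))"
    using True by (intro sum_list_cong) (auto simp: twisted_trace_def sum_distrib_left Gal_mult mult.assoc)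
  also have "\<dots> = (\<Sum>s\<in>Gal. (\<Sum>(y, z)\<leftarrow>dual_coords. y * s z) * s (f (T (Hilbert_Choice.inv s) x)))"
    by (simp add: sum_sum_list sum_list_mult_const[symmetric] case_prod_unfold)
  also have "\<dots> = (\<Sum>s\<in>Gal. if s = id then f (T (Hilbert_Choice.inv id) x) else 0)"
    by (intro sum.cong) (auto simp: dual_coords)
  also have "\<dots> = f x" using True finite_Gal T_id by simp
  finally show ?thesis by simp
qed (simp add: f twisted_trace_def case_prod_unfold)

lemma span_sum_list:
  "(\<And>i. i \<in> set xs \<Longrightarrow> g i \<in> S) \<Longrightarrow>
   (\<lambda>x. \<Sum>i\<leftarrow>xs. c i * g i x) \<in> fun_space.span (S :: ('x \<Rightarrow> 'l) set)"
proof (induction xs)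
  case Nil
  show ?case using fun_space.span_zero[of S] by (simp add: zero_fun_def)
next
  case (Cons i xs)
  have "(\<lambda>x. \<Sum>i\<leftarrow>i # xs. c i * g i x) = (\<lambda>x. c i * g i x) + (\<lambda>x. \<Sum>i\<leftarrow>xs. c i * g i x)"
    by (simp add: fun_eq_iff)
  then show ?case using Cons by (simp add: fun_space.span_add fun_space.span_scale fun_space.span_base)
qed

text \<open>A maximal L-independent set of invariants spans all functions on \<Omega> by the twisted
  trace expansion. So it has |\<Omega>| elements and may be indexed by \<Omega>; \<open>a\<close> is
  the inverse matrix of this basis. An invariant function has Galois-fixed coordinates, since the
  basis itself is invariant.\<close>

theorem descent_basis:
  obtains b :: "'x \<Rightarrow> 'x \<Rightarrow> 'l" and a :: "'x \<Rightarrow> 'x \<Rightarrow> 'l"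
  where "\<And>i. i \<in> \<Omega> \<Longrightarrow> b i \<in> Inv"
    and "\<And>x y. x \<in> \<Omega> \<Longrightarrow> y \<in> \<Omega> \<Longrightarrow> (\<Sum>i\<in>\<Omega>. a x i * b i y) = (if x = y then 1 else 0)"
    and "\<And>i j. i \<in> \<Omega> \<Longrightarrow> j \<in> \<Omega> \<Longrightarrow> (\<Sum>x\<in>\<Omega>. b i x * a x j) = (if i = j then 1 else 0)"
    and "\<And>f i. f \<in> Inv \<Longrightarrow> i \<in> \<Omega> \<Longrightarrow> (\<Sum>x\<in>\<Omega>. f x * a x i) \<in> K"
proof -
  let ?E = "unit_fun ` \<Omega> :: ('x \<Rightarrow> 'l) set"
  obtain B where B: "B \<subseteq> Inv" "fun_space.independent B" "Inv \<subseteq> fun_space.span B"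
    using fun_space.maximal_independent_subset by blast
  have finE: "finite ?E" using finite_Om by simp
  have suppE: "f \<in> fun_space.span ?E" if "\<And>x. x \<notin> \<Omega> \<Longrightarrow> f x = 0" for f :: "'x \<Rightarrow> 'l"
  proof (subst unit_fun_expansion[OF finite_Om that], assumption)
    show "(\<Sum>x\<in>\<Omega>. (\<lambda>y. f x * unit_fun x y)) \<in> fun_space.span ?E"
      by (intro fun_space.span_sum fun_space.span_scale fun_space.span_base) auto
  qed
  have BE: "B \<subseteq> fun_space.span ?E"
    using B(1) suppE by (auto simp: invariants_def)
  have Bcard: "finite B \<and> card B \<le> card ?E"
    using fun_space.independent_span_bound[OF finE B(2) BE] .
  have EB: "?E \<subseteq> fun_space.span B"
  proof
    fix e :: "'x \<Rightarrow> 'l" assume "e \<in> ?E"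
    then have e: "e x = 0" if "x \<notin> \<Omega>" for x using that by (auto simp: unit_fun_def)
    have "e = (\<lambda>x. \<Sum>i\<leftarrow>dual_coords. fst i * twisted_trace (\<lambda>x. snd i * e x) x)"
    proof
      fix x show "e x = (\<Sum>i\<leftarrow>dual_coords. fst i * twisted_trace (\<lambda>x. snd i * e x) x)"
        using twisted_trace_expansion[of e x] e unfolding case_prod_unfold by blast
    qed
    also have "\<dots> \<in> fun_space.span Inv"
      by (rule span_sum_list) (rule twisted_trace_Inv)
    also have "\<dots> \<subseteq> fun_space.span B"
      using B(3) fun_space.span_mono fun_space.span_span by blast
    finally show "e \<in> fun_space.span B" .
  qed
  have "card ?E \<le> card B"
    using fun_space.independent_span_bound[OF _ independent_unit_fun[OF finite_Om] EB] Bcard by simp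
  then have "card \<Omega> = card B" using Bcard card_image[OF inj_unit_fun[of \<Omega>]] by (metis le_antisym)
  then obtain b where b: "bij_betw b \<Omega> B" using finite_Om Bcard finite_same_card_bij by blast
  have bB: "b i \<in> B" if "i \<in> \<Omega>" for i using b that by (auto simp: bij_betw_def)
  \<comment> \<open>Agreement on \<Omega> is agreement everywhere, because invariants vanish off
    \<Omega>; independence in the full function space then applies.\<close>
  have indep: "c j = d j" if "\<And>y. y \<in> \<Omega> \<Longrightarrow> (\<Sum>i\<in>\<Omega>. c i * b i y) = (\<Sum>i\<in>\<Omega>. d i * b i y)" "j \<in> \<Omega>" for c d j
  proof -
    have z: "(\<Sum>i\<in>\<Omega>. (c i - d i) * b i y) = 0" for y
    proof (cases "y \<in> \<Omega>")
      case True
      then show ?thesis using that(1)[OF True] by (simp add: left_diff_distrib sum_subtractf)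
    next
      case False
      then have "b i y = 0" if "i \<in> \<Omega>" for i using bB[OF that] B(1) by (auto simp: invariants_def)
      then show ?thesis by simp
    qed
    let ?u = "\<lambda>v. c (inv_into \<Omega> b v) - d (inv_into \<Omega> b v)"
    have "(\<Sum>v\<in>B. (\<lambda>y. ?u v * v y)) = (\<Sum>i\<in>\<Omega>. (\<lambda>y. ?u (b i) * b i y))"
      by (rule sum.reindex_bij_betw[OF b, symmetric])
    also have "\<dots> = (\<Sum>i\<in>\<Omega>. (\<lambda>y. (c i - d i) * b i y))"
      using b by (intro sum.cong) (auto simp: bij_betw_def)
    also have "\<dots> = 0" using z by (simp add: fun_eq_iff sum_fun_apply)
    finally have "?u (b j) = 0"
      using fun_space.independentD[OF B(2) _ order_refl, of ?u "b j"] Bcard bB that by blast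
    then show ?thesis using b that by (auto simp: bij_betw_def)
  qed
  define a where "a x i = fun_space.representation B (unit_fun x) (b i)" for x i
  have ab: "(\<Sum>i\<in>\<Omega>. a x i * b i y) = (if x = y then 1 else 0)" if "x \<in> \<Omega>" for x y
  proof -
    have "(\<Sum>v\<in>B. (\<lambda>y. fun_space.representation B (unit_fun x) v * v y)) = unit_fun x"
      by (rule fun_space.sum_representation_eq[OF B(2)]) (use EB that Bcard in auto)
    then have "(\<Sum>i\<in>\<Omega>. (\<lambda>y. a x i * b i y)) = unit_fun x"
      unfolding a_def using sum.reindex_bij_betw[OF b, of "\<lambda>v. (\<lambda>y. fun_space.representation B (unit_fun x) v * v y)"] by simp
    then show ?thesis unfolding fun_eq_iff sum_fun_apply by (auto simp: unit_fun_def)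
  qed
  have exp: "f y = (\<Sum>i\<in>\<Omega>. (\<Sum>x\<in>\<Omega>. f x * a x i) * b i y)" if "y \<in> \<Omega>" for f y
  proof -
    have "(\<Sum>i\<in>\<Omega>. (\<Sum>x\<in>\<Omega>. f x * a x i) * b i y) = (\<Sum>x\<in>\<Omega>. f x * (\<Sum>i\<in>\<Omega>. a x i * b i y))"
      by (simp add: sum_distrib_left sum_distrib_right mult.assoc) (rule sum.swap)
    also have "\<dots> = (\<Sum>x\<in>\<Omega>. if x = y then f x else 0)" by (intro sum.cong) (auto simp: ab)
    also have "\<dots> = f y" using that finite_Om by simp
    finally show ?thesis by simp
  qed
  show thesis
  proof
    show "b i \<in> Inv" if "i \<in> \<Omega>" for i using bB[OF that] B(1) by blast
    show "(\<Sum>i\<in>\<Omega>. a x i * b i y) = (if x = y then 1 else 0)" if "x \<in> \<Omega>" "y \<in> \<Omega>" for x y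
      by (rule ab[OF that(1)])
    show "(\<Sum>x\<in>\<Omega>. b i x * a x j) = (if i = j then 1 else 0)" if "i \<in> \<Omega>" "j \<in> \<Omega>" for i j
    proof (rule indep[OF _ that(2)])
      fix y assume y: "y \<in> \<Omega>"
      have "(\<Sum>j\<in>\<Omega>. (if i = j then 1 else 0) * b j y) = b i y"
        using finite_Om that by (simp add: if_distrib[of "\<lambda>u. u * _"] cong: if_cong)
      then show "(\<Sum>j\<in>\<Omega>. (\<Sum>x\<in>\<Omega>. b i x * a x j) * b j y) = (\<Sum>j\<in>\<Omega>. (if i = j then 1 else 0) * b j y)"
        using exp[OF y, of "b i"] by simp
    qed
    show "(\<Sum>x\<in>\<Omega>. f x * a x i) \<in> K" if f: "f \<in> Inv" and i: "i \<in> \<Omega>" for f i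
    proof (rule fixed_in_K)
      fix s assume s: "s \<in> Gal"
      let ?c = "\<lambda>i. \<Sum>x\<in>\<Omega>. f x * a x i"
      \<comment> \<open>Both families are coordinates of the same f: the invariance of f and of the
        basis elements absorbs s.\<close>
      show "s (?c i) = ?c i"
      proof (rule indep[OF _ i])
        fix y assume y: "y \<in> \<Omega>"
        let ?z = "T (Hilbert_Choice.inv s) y"
        have z: "?z \<in> \<Omega>" "T s ?z = y" using y s T_closed Gal_inv T_inv by auto
        have bz: "b j y = s (b j ?z)" if "j \<in> \<Omega>" for j
        proof -
          have "b j \<in> Inv" using bB[OF that] B(1) by blast
          then have "b j (T s ?z) = s (b j ?z)" using s z(1) by (simp add: invariants_def)
          then show ?thesis unfolding z(2) .
        qed
        have "(\<Sum>j\<in>\<Omega>. s (?c j) * b j y) = s (\<Sum>j\<in>\<Omega>. ?c j * b j ?z)"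
          using s by (simp add: Gal_sum Gal_mult bz)
        also have "\<dots> = s (f ?z)" using exp[OF z(1), of f] by simp
        also have "\<dots> = f (T s ?z)" using f s z(1) by (simp add: invariants_def)
        also have "\<dots> = f y" unfolding z(2) ..
        also have "\<dots> = (\<Sum>j\<in>\<Omega>. ?c j * b j y)" using exp[OF y, of f] .
        finally show "(\<Sum>j\<in>\<Omega>. s (?c j) * b j y) = (\<Sum>j\<in>\<Omega>. ?c j * b j y)" .
      qed
    qed
  qed
qed

end

section \<open>Brace maps and regular subgroups\<close>

lemma card_eq_card_image_times_fibre:
  assumes "finite A" "\<And>a. a \<in> A \<Longrightarrow> card {b \<in> A. f b = f a} = k"
  shows "card A = card (f ` A) * k"
proof -
  have "A = (\<Union>y\<in>f ` A. {b \<in> A. f b = y})" by auto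
  then have "card A = card (\<Union>y\<in>f ` A. {b \<in> A. f b = y})" by simp
  also have "\<dots> = (\<Sum>y\<in>f ` A. card {b \<in> A. f b = y})"
    using assms(1) by (intro card_UN_disjoint) auto
  also have "\<dots> = (\<Sum>y\<in>f ` A. k)" using assms(2) by (intro sum.cong) auto
  finally show ?thesis by simp
qed

lemma autoD:
  assumes "f \<in> auto N"
  shows "f \<in> hom N N" "bij_betw f (carrier N) (carrier N)" "f \<in> extensional (carrier N)"
    "x \<in> carrier N \<Longrightarrow> f x \<in> carrier N"
    "x \<in> carrier N \<Longrightarrow> y \<in> carrier N \<Longrightarrow> f (x \<otimes>\<^bsub>N\<^esub> y) = f x \<otimes>\<^bsub>N\<^esub> f y"
    "x \<in> carrier N \<Longrightarrow> y \<in> carrier N \<Longrightarrow> f x = f y \<longleftrightarrow> x = y"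
  using assms by (auto simp: auto_def Bij_def hom_def bij_betw_def inj_on_def)

lemma autoI:
  assumes "bij_betw f (carrier N) (carrier N)" "f \<in> extensional (carrier N)"
    "\<And>x y. x \<in> carrier N \<Longrightarrow> y \<in> carrier N \<Longrightarrow> f (x \<otimes>\<^bsub>N\<^esub> y) = f x \<otimes>\<^bsub>N\<^esub> f y"
  shows "f \<in> auto N"
  using assms by (auto simp: auto_def Bij_def hom_def bij_betw_def)

lemma holomorph_simps:
  "carrier (holomorph N) = carrier N \<times> auto N"
  "a \<otimes>\<^bsub>holomorph N\<^esub> b = (fst a \<otimes>\<^bsub>N\<^esub> snd a (fst b), snd a \<otimes>\<^bsub>AutoGroup N\<^esub> snd b)"
  "\<one>\<^bsub>holomorph N\<^esub> = (\<one>\<^bsub>N\<^esub>, \<one>\<^bsub>AutoGroup N\<^esub>)"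
  by (auto simp: holomorph_def semidirect_product_def AutoGroup_def case_prod_unfold)

lemma AutoGroup_simps:
  "f \<in> auto N \<Longrightarrow> g \<in> auto N \<Longrightarrow> f \<otimes>\<^bsub>AutoGroup N\<^esub> g = compose (carrier N) f g"
  "\<one>\<^bsub>AutoGroup N\<^esub> = (\<lambda>x\<in>carrier N. x)" "carrier (AutoGroup N) = auto N"
  by (auto simp: AutoGroup_def BijGroup_def auto_def)

lemma finite_auto: assumes "finite (carrier N)" shows "finite (auto N)"
proof (rule finite_subset)
  show "auto N \<subseteq> carrier N \<rightarrow>\<^sub>E carrier N"
    by (auto simp: auto_def Bij_def hom_def PiE_def)
  show "finite (carrier N \<rightarrow>\<^sub>E carrier N)" using assms by (simp add: finite_PiE)
qed

text \<open>Bijective crossed homomorphisms \<open>\<phi> : G \<rightarrow> N\<close> for some action of \<open>G\<close> on \<open>N\<close>; transporting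
  the multiplication of \<open>N\<close> along \<open>\<phi>\<close> makes \<open>G\<close> a skew brace.\<close>

definition brace_maps :: "('g, 'x) monoid_scheme \<Rightarrow> ('a, 'y) monoid_scheme \<Rightarrow> ('g \<Rightarrow> 'a) set" where
  "brace_maps G N = {\<phi> \<in> extensional (carrier G). bij_betw \<phi> (carrier G) (carrier N) \<and>
     (\<forall>s\<in>carrier G. \<exists>\<alpha>\<in>auto N. \<forall>t\<in>carrier G. \<phi> (s \<otimes>\<^bsub>G\<^esub> t) = \<phi> s \<otimes>\<^bsub>N\<^esub> \<alpha> (\<phi> t))}"

lemma finite_brace_maps:
  assumes "finite (carrier G)" "finite (carrier N)" shows "finite (brace_maps G N)"
proof (rule finite_subset)
  show "brace_maps G N \<subseteq> carrier G \<rightarrow>\<^sub>E carrier N"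
    by (auto simp: brace_maps_def PiE_def bij_betw_def)
qed (use assms in \<open>simp add: finite_PiE\<close>)

section \<open>The action of G on N defined by a brace map\<close>

locale brace_map = G: group G + N: group N
  for G :: "('g, 'x) monoid_scheme" and N :: "('a, 'y) monoid_scheme" +
  fixes \<phi> assumes brace: "\<phi> \<in> brace_maps G N"
begin

lemma bij: "bij_betw \<phi> (carrier G) (carrier N)"
  and extens: "\<phi> \<in> extensional (carrier G)"
  using brace by (auto simp: brace_maps_def)

definition \<psi> where "\<psi> = inv_into (carrier G) \<phi>"

lemma closed [simp, intro]: "s \<in> carrier G \<Longrightarrow> \<phi> s \<in> carrier N"
  using bij by (auto simp: bij_betw_def)

lemma \<psi>_closed [simp, intro]: "g \<in> carrier N \<Longrightarrow> \<psi> g \<in> carrier G"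
  using bij by (auto simp: bij_betw_def \<psi>_def inv_into_into)

lemma \<phi>_\<psi> [simp]: "g \<in> carrier N \<Longrightarrow> \<phi> (\<psi> g) = g"
  and \<psi>_\<phi> [simp]: "s \<in> carrier G \<Longrightarrow> \<psi> (\<phi> s) = s"
  using bij by (auto simp: \<psi>_def bij_betw_def f_inv_into_f)

lemma inject: "s \<in> carrier G \<Longrightarrow> t \<in> carrier G \<Longrightarrow> \<phi> s = \<phi> t \<longleftrightarrow> s = t"
  using \<psi>_\<phi> by metis

text \<open>The lambda map of the skew brace. The automorphism required at s is determined by
  \<phi>, and this formula recovers it without a choice.\<close>

definition twist :: "'g \<Rightarrow> 'a \<Rightarrow> 'a" where
  "twist s = (\<lambda>g\<in>carrier N. inv\<^bsub>N\<^esub> \<phi> s \<otimes>\<^bsub>N\<^esub> \<phi> (s \<otimes>\<^bsub>G\<^esub> \<psi> g))"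

lemma twist_eqI:
  assumes s: "s \<in> carrier G" and \<alpha>: "\<alpha> \<in> extensional (carrier N)"
    "\<And>g. g \<in> carrier N \<Longrightarrow> \<alpha> g \<in> carrier N"
    and eq: "\<And>t. t \<in> carrier G \<Longrightarrow> \<phi> (s \<otimes>\<^bsub>G\<^esub> t) = \<phi> s \<otimes>\<^bsub>N\<^esub> \<alpha> (\<phi> t)"
  shows "twist s = \<alpha>"
proof (rule extensionalityI[OF _ \<alpha>(1)])
  fix g assume g: "g \<in> carrier N"
  have "\<phi> (s \<otimes>\<^bsub>G\<^esub> \<psi> g) = \<phi> s \<otimes>\<^bsub>N\<^esub> \<alpha> g" using eq[of "\<psi> g"] g by simp
  then show "twist s g = \<alpha> g" using g s \<alpha>(2)[OF g] by (simp add: twist_def N.m_assoc[symmetric])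
qed (simp add: twist_def)

lemma twist_auto: assumes s: "s \<in> carrier G" shows "twist s \<in> auto N"
proof -
  obtain \<alpha> where \<alpha>: "\<alpha> \<in> auto N" "\<forall>t\<in>carrier G. \<phi> (s \<otimes>\<^bsub>G\<^esub> t) = \<phi> s \<otimes>\<^bsub>N\<^esub> \<alpha> (\<phi> t)"
    using brace s by (auto simp: brace_maps_def)
  then show ?thesis using twist_eqI[OF s autoD(3)[OF \<alpha>(1)]] autoD(4)[OF \<alpha>(1)] by auto
qed

lemma twist_closed [simp, intro]: "s \<in> carrier G \<Longrightarrow> g \<in> carrier N \<Longrightarrow> twist s g \<in> carrier N"
  using autoD(4)[OF twist_auto] .

lemma twist_mult: "s \<in> carrier G \<Longrightarrow> g \<in> carrier N \<Longrightarrow> h \<in> carrier N \<Longrightarrow>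
    twist s (g \<otimes>\<^bsub>N\<^esub> h) = twist s g \<otimes>\<^bsub>N\<^esub> twist s h"
  using autoD(5)[OF twist_auto] .

lemma twist_1: assumes "s \<in> carrier G" shows "twist s \<one>\<^bsub>N\<^esub> = \<one>\<^bsub>N\<^esub>"
  using twist_mult[OF assms, of "\<one>\<^bsub>N\<^esub>" "\<one>\<^bsub>N\<^esub>"] assms by simp

lemma twist_inv:
  assumes "s \<in> carrier G" "g \<in> carrier N" shows "twist s (inv\<^bsub>N\<^esub> g) = inv\<^bsub>N\<^esub> twist s g"
proof -
  have "twist s (inv\<^bsub>N\<^esub> g) \<otimes>\<^bsub>N\<^esub> twist s g = \<one>\<^bsub>N\<^esub>"
    using twist_mult[of s "inv\<^bsub>N\<^esub> g" g] assms by (simp add: twist_1)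
  then show ?thesis using N.inv_equality[of "twist s (inv\<^bsub>N\<^esub> g)" "twist s g"] assms by simp
qed

lemma mult: "s \<in> carrier G \<Longrightarrow> t \<in> carrier G \<Longrightarrow> \<phi> (s \<otimes>\<^bsub>G\<^esub> t) = \<phi> s \<otimes>\<^bsub>N\<^esub> twist s (\<phi> t)"
  by (simp add: twist_def N.m_assoc[symmetric])

text \<open>Normalisation comes from the crossed homomorphism law: for t with \<phi> t = 1, the law
  for the product 1 t reads \<phi> t = \<phi> 1.\<close>

lemma one [simp]: "\<phi> \<one>\<^bsub>G\<^esub> = \<one>\<^bsub>N\<^esub>"
proof -
  obtain t where t: "t \<in> carrier G" "twist \<one>\<^bsub>G\<^esub> (\<phi> t) = \<one>\<^bsub>N\<^esub>"
    using \<phi>_\<psi>[OF N.one_closed] \<psi>_closed[OF N.one_closed] by (metis G.one_closed twist_1)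
  have "twist \<one>\<^bsub>G\<^esub> \<one>\<^bsub>N\<^esub> = \<one>\<^bsub>N\<^esub>" by (simp add: twist_1)
  then have "\<phi> t = \<one>\<^bsub>N\<^esub>" using t autoD(6)[OF twist_auto[of "\<one>\<^bsub>G\<^esub>"], of "\<phi> t" "\<one>\<^bsub>N\<^esub>"] by simp
  then show ?thesis using mult[of "\<one>\<^bsub>G\<^esub>" t] t by simp
qed

lemma \<psi>_one [simp]: "\<psi> \<one>\<^bsub>N\<^esub> = \<one>\<^bsub>G\<^esub>"
  using \<psi>_\<phi>[of "\<one>\<^bsub>G\<^esub>"] by simp

lemma twist_one: "g \<in> carrier N \<Longrightarrow> twist \<one>\<^bsub>G\<^esub> g = g"
  by (simp add: twist_def)

text \<open>Associativity in G: expand \<phi> (s t u) in both ways and cancel \<phi> (s t).\<close>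

lemma twist_comp:
  assumes "s \<in> carrier G" "t \<in> carrier G" "g \<in> carrier N"
  shows "twist (s \<otimes>\<^bsub>G\<^esub> t) g = twist s (twist t g)"
proof -
  obtain u where u: "u \<in> carrier G" "g = \<phi> u" using assms(3) \<phi>_\<psi> by (metis \<psi>_closed)
  have "\<phi> s \<otimes>\<^bsub>N\<^esub> twist s (\<phi> t) \<otimes>\<^bsub>N\<^esub> twist (s \<otimes>\<^bsub>G\<^esub> t) g = \<phi> (s \<otimes>\<^bsub>G\<^esub> t \<otimes>\<^bsub>G\<^esub> u)"
    using assms u by (simp add: mult)
  also have "\<dots> = \<phi> s \<otimes>\<^bsub>N\<^esub> twist s (\<phi> t) \<otimes>\<^bsub>N\<^esub> twist s (twist t g)"
    using assms u by (simp add: mult G.m_assoc twist_mult N.m_assoc)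
  finally show ?thesis using assms by simp
qed

lemma \<psi>_mult:
  assumes "s \<in> carrier G" "t \<in> carrier G" shows "s \<otimes>\<^bsub>G\<^esub> t = \<psi> (\<phi> s \<otimes>\<^bsub>N\<^esub> twist s (\<phi> t))"
  using mult[OF assms] \<psi>_\<phi>[of "s \<otimes>\<^bsub>G\<^esub> t"] assms by simp

text \<open>The automorphism attached to s is conjugated by \<theta>.\<close>

lemma post_auto:
  assumes \<theta>: "\<theta> \<in> auto N" shows "compose (carrier G) \<theta> \<phi> \<in> brace_maps G N"
  unfolding brace_maps_def
proof (intro CollectI conjI ballI)
  fix s assume s: "s \<in> carrier G"
  obtain \<theta>' where \<theta>': "\<theta>' \<in> auto N" "\<And>g. g \<in> carrier N \<Longrightarrow> \<theta>' (\<theta> g) = g"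
  proof -
    have "restrict (inv_into (carrier N) \<theta>) (carrier N) \<in> auto N"
      using \<theta> N.restrict_inv_into_hom restrict_inv_into_Bij by (auto simp: auto_def)
    moreover have "restrict (inv_into (carrier N) \<theta>) (carrier N) (\<theta> g) = g" if "g \<in> carrier N" for g
      using autoD(2)[OF \<theta>] autoD(4)[OF \<theta> that] that by (simp add: bij_betw_def)
    ultimately show thesis using that by blast
  qed
  let ?\<alpha> = "compose (carrier N) (compose (carrier N) \<theta> (twist s)) \<theta>'"
  have "?\<alpha> \<in> auto N"
    using \<theta> \<theta>'(1) twist_auto[OF s]
    by (auto simp: auto_def compose_Bij intro!: N.hom_compose)
  moreover have "compose (carrier G) \<theta> \<phi> (s \<otimes>\<^bsub>G\<^esub> t) = compose (carrier G) \<theta> \<phi> s \<otimes>\<^bsub>N\<^esub> ?\<alpha> (compose (carrier G) \<theta> \<phi> t)"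
    if "t \<in> carrier G" for t
    using that s \<theta> by (simp add: compose_def mult autoD(4,5) \<theta>')
  ultimately show "\<exists>\<alpha>\<in>auto N. \<forall>t\<in>carrier G. compose (carrier G) \<theta> \<phi> (s \<otimes>\<^bsub>G\<^esub> t) =
      compose (carrier G) \<theta> \<phi> s \<otimes>\<^bsub>N\<^esub> \<alpha> (compose (carrier G) \<theta> \<phi> t)" by blast
qed (auto intro: bij_betw_compose bij autoD(2)[OF \<theta>])

lemma pre_auto:
  assumes \<theta>: "\<theta> \<in> auto G" shows "compose (carrier G) \<phi> \<theta> \<in> brace_maps G N"
  unfolding brace_maps_def
proof (intro CollectI conjI ballI)
  fix s assume s: "s \<in> carrier G"
  have "compose (carrier G) \<phi> \<theta> (s \<otimes>\<^bsub>G\<^esub> t) = compose (carrier G) \<phi> \<theta> s \<otimes>\<^bsub>N\<^esub> twist (\<theta> s) (compose (carrier G) \<phi> \<theta> t)"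
    if "t \<in> carrier G" for t
    using that s \<theta> by (simp add: compose_def mult autoD(4,5))
  then show "\<exists>\<alpha>\<in>auto N. \<forall>t\<in>carrier G. compose (carrier G) \<phi> \<theta> (s \<otimes>\<^bsub>G\<^esub> t) =
      compose (carrier G) \<phi> \<theta> s \<otimes>\<^bsub>N\<^esub> \<alpha> (compose (carrier G) \<phi> \<theta> t)"
    using twist_auto autoD(4)[OF \<theta> s] by blast
qed (auto intro: bij_betw_compose bij autoD(2)[OF \<theta>])

text \<open>The subgroup of Hol(N) in which s acts on N as left multiplication by s, transported
  along \<phi>.\<close>

definition hol_image :: "('a \<times> ('a \<Rightarrow> 'a)) set" where
  "hol_image = (\<lambda>s. (\<phi> s, twist s)) ` carrier G"

lemma hol_hom: "(\<lambda>s. (\<phi> s, twist s)) \<in> hom G (holomorph N)"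
proof (rule homI)
  fix s t assume st: "s \<in> carrier G" "t \<in> carrier G"
  have "twist (s \<otimes>\<^bsub>G\<^esub> t) = compose (carrier N) (twist s) (twist t)"
    by (rule extensionalityI[of _ "carrier N"]) (use st in \<open>auto simp: compose_def twist_comp, simp add: twist_def\<close>)
  then show "(\<phi> (s \<otimes>\<^bsub>G\<^esub> t), twist (s \<otimes>\<^bsub>G\<^esub> t)) = (\<phi> s, twist s) \<otimes>\<^bsub>holomorph N\<^esub> (\<phi> t, twist t)"
    using st by (simp add: holomorph_simps mult AutoGroup_simps twist_auto)
qed (auto simp: holomorph_simps twist_auto)

end

context group
begin

lemma group_holomorph: "group (holomorph G)"
proof (rule groupI)
  interpret A: group "AutoGroup G" by (rule AutoGroup)
  fix x y z assume x: "x \<in> carrier (holomorph G)" and y: "y \<in> carrier (holomorph G)"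
  have xy: "snd x \<in> auto G" "snd y \<in> auto G" "fst x \<in> carrier G" "fst y \<in> carrier G"
    using x y by (auto simp: holomorph_simps)
  have comp: "(snd x \<otimes>\<^bsub>AutoGroup G\<^esub> snd y) a = snd x (snd y a)" if "a \<in> carrier G" for a
    using that xy by (simp add: AutoGroup_simps compose_def)
  show "x \<otimes>\<^bsub>holomorph G\<^esub> y \<in> carrier (holomorph G)"
    using xy A.m_closed[of "snd x" "snd y"] by (simp add: holomorph_simps AutoGroup_simps(3) autoD(4))
  assume z: "z \<in> carrier (holomorph G)"
  then have z: "snd z \<in> auto G" "fst z \<in> carrier G" by (auto simp: holomorph_simps)
  show "x \<otimes>\<^bsub>holomorph G\<^esub> y \<otimes>\<^bsub>holomorph G\<^esub> z = x \<otimes>\<^bsub>holomorph G\<^esub> (y \<otimes>\<^bsub>holomorph G\<^esub> z)"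
    using xy z comp[of "fst z"] A.m_assoc[of "snd x" "snd y" "snd z"]
    by (simp add: holomorph_simps AutoGroup_simps(3) autoD(4,5) m_assoc)
next
  interpret A: group "AutoGroup G" by (rule AutoGroup)
  show "\<one>\<^bsub>holomorph G\<^esub> \<in> carrier (holomorph G)"
    using A.one_closed by (simp add: holomorph_simps AutoGroup_simps)
  fix x assume x: "x \<in> carrier (holomorph G)"
  then have x': "snd x \<in> auto G" "fst x \<in> carrier G" by (auto simp: holomorph_simps)
  show "\<one>\<^bsub>holomorph G\<^esub> \<otimes>\<^bsub>holomorph G\<^esub> x = x"
    using x' A.l_one[of "snd x"] by (simp add: holomorph_simps AutoGroup_simps(2,3))
  obtain \<theta> where \<theta>: "\<theta> \<in> auto G" "\<theta> \<otimes>\<^bsub>AutoGroup G\<^esub> snd x = \<one>\<^bsub>AutoGroup G\<^esub>"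
    using A.l_inv_ex[of "snd x"] x' by (auto simp: AutoGroup_simps(3))
  show "\<exists>y\<in>carrier (holomorph G). y \<otimes>\<^bsub>holomorph G\<^esub> x = \<one>\<^bsub>holomorph G\<^esub>"
    by (rule bexI[of _ "(inv\<^bsub>G\<^esub> \<theta> (fst x), \<theta>)"])
       (use \<theta> x' in \<open>auto simp: holomorph_simps autoD(4)\<close>)
qed

end

context brace_map
begin

lemma hol_iso: "(\<lambda>s. (\<phi> s, twist s)) \<in> iso G ((holomorph N)\<lparr>carrier := hol_image\<rparr>)"
proof -
  have "inj_on (\<lambda>s. (\<phi> s, twist s)) (carrier G)" by (auto simp: inj_on_def inject)
  then show ?thesis using hol_hom by (auto simp: iso_def hom_def bij_betw_def hol_image_def)
qed

lemma hol_image_subgroup: "subgroup hol_image (holomorph N)"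
proof -
  interpret H: group "holomorph N" by (rule N.group_holomorph)
  interpret group_hom G "holomorph N" "\<lambda>s. (\<phi> s, twist s)"
    using hol_hom by unfold_locales
  show ?thesis using img_is_subgroup by (simp add: hol_image_def)
qed

text \<open>Along \<phi> the action becomes left multiplication of G on itself, so the only element
  taking a to b comes from \<psi> b (\<psi> a)^-1.\<close>

lemma hol_image_regular: "regular_subgroup N hol_image"
  unfolding regular_subgroup_def
proof (intro conjI ballI hol_image_subgroup)
  fix a b assume ab: "a \<in> carrier N" "b \<in> carrier N"
  have act: "holomorph_act N (\<phi> s, twist s) a = \<phi> (s \<otimes>\<^bsub>G\<^esub> \<psi> a)" if "s \<in> carrier G" for s
    using that ab by (simp add: holomorph_act_def mult)
  show "\<exists>!g. g \<in> hol_image \<and> holomorph_act N g a = b"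
  proof (intro ex1I[of _ "(\<phi> (\<psi> b \<otimes>\<^bsub>G\<^esub> inv\<^bsub>G\<^esub> \<psi> a), twist (\<psi> b \<otimes>\<^bsub>G\<^esub> inv\<^bsub>G\<^esub> \<psi> a))"] conjI; (elim conjE)?)
    show "(\<phi> (\<psi> b \<otimes>\<^bsub>G\<^esub> inv\<^bsub>G\<^esub> \<psi> a), twist (\<psi> b \<otimes>\<^bsub>G\<^esub> inv\<^bsub>G\<^esub> \<psi> a)) \<in> hol_image"
      unfolding hol_image_def using ab by blast
    show "holomorph_act N (\<phi> (\<psi> b \<otimes>\<^bsub>G\<^esub> inv\<^bsub>G\<^esub> \<psi> a), twist (\<psi> b \<otimes>\<^bsub>G\<^esub> inv\<^bsub>G\<^esub> \<psi> a)) a = b"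
      using ab act by (simp add: G.m_assoc)
    fix g assume "g \<in> hol_image" and eq: "holomorph_act N g a = b"
    then obtain s where s: "s \<in> carrier G" "g = (\<phi> s, twist s)" by (auto simp: hol_image_def)
    then have "s \<otimes>\<^bsub>G\<^esub> \<psi> a = \<psi> b" using act[OF s(1)] eq ab \<psi>_\<phi>[of "s \<otimes>\<^bsub>G\<^esub> \<psi> a"] by auto
    then have "s = \<psi> b \<otimes>\<^bsub>G\<^esub> inv\<^bsub>G\<^esub> \<psi> a" using s ab by (simp add: G.inv_solve_right)
    then show "g = (\<phi> (\<psi> b \<otimes>\<^bsub>G\<^esub> inv\<^bsub>G\<^esub> \<psi> a), twist (\<psi> b \<otimes>\<^bsub>G\<^esub> inv\<^bsub>G\<^esub> \<psi> a))" using s by simp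
  qed
qed

end

text \<open>Byott's translation: each of the two counts is an orbit count on the same set, for the free
  actions of \<open>Aut G\<close> by precomposition and of \<open>Aut N\<close> by postcomposition.\<close>

theorem card_brace_maps_e_prime:
  assumes G: "group G" and N: "group N" and fin: "finite (carrier G)" "finite (carrier N)"
  shows "card (brace_maps G N) = e_prime G N * card (auto G)"
proof -
  interpret G: group G by fact
  interpret N: group N by fact
  let ?F = "brace_map.hol_image G N"
  let ?tw = "brace_map.twist G N"
  have loc: "brace_map G N \<phi>" if "\<phi> \<in> brace_maps G N" for \<phi>
    using that G N by (simp add: brace_map_def brace_map_axioms_def)
  have image: "?F ` brace_maps G N = {\<Gamma>. regular_subgroup N \<Gamma> \<and> (holomorph N)\<lparr>carrier := \<Gamma>\<rparr> \<cong> G}"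
  proof (intro subset_antisym subsetI)
    fix \<Gamma> assume "\<Gamma> \<in> ?F ` brace_maps G N"
    then obtain \<phi> where \<phi>: "\<phi> \<in> brace_maps G N" "\<Gamma> = ?F \<phi>" by blast
    interpret brace_map G N \<phi> using loc \<phi>(1) .
    have "G \<cong> (holomorph N)\<lparr>carrier := \<Gamma>\<rparr>" using hol_iso \<phi>(2) unfolding is_iso_def by blast
    then show "\<Gamma> \<in> {\<Gamma>. regular_subgroup N \<Gamma> \<and> (holomorph N)\<lparr>carrier := \<Gamma>\<rparr> \<cong> G}"
      using hol_image_regular \<phi>(2) G.iso_sym by blast
  next
    fix \<Gamma> assume "\<Gamma> \<in> {\<Gamma>. regular_subgroup N \<Gamma> \<and> (holomorph N)\<lparr>carrier := \<Gamma>\<rparr> \<cong> G}"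
    then have reg: "regular_subgroup N \<Gamma>" and "(holomorph N)\<lparr>carrier := \<Gamma>\<rparr> \<cong> G" by auto
    moreover have sub: "subgroup \<Gamma> (holomorph N)" using reg by (simp add: regular_subgroup_def)
    ultimately have "G \<cong> (holomorph N)\<lparr>carrier := \<Gamma>\<rparr>"
      using group.iso_sym subgroup.subgroup_is_group N.group_holomorph by blast
    then obtain f where f: "f \<in> iso G ((holomorph N)\<lparr>carrier := \<Gamma>\<rparr>)" unfolding is_iso_def by blast
    have fG: "bij_betw f (carrier G) \<Gamma>" using f by (simp add: iso_def)
    have f\<Gamma>: "f s \<in> \<Gamma>" "fst (f s) \<in> carrier N" "snd (f s) \<in> auto N" if "s \<in> carrier G" for s
    proof -
      show "f s \<in> \<Gamma>" using fG that by (auto simp: bij_betw_def)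
      then have "f s \<in> carrier (holomorph N)" using subgroup.subset[OF sub] by blast
      then show "fst (f s) \<in> carrier N" "snd (f s) \<in> auto N" by (auto simp: holomorph_simps)
    qed
    have one: "\<alpha> \<one>\<^bsub>N\<^esub> = \<one>\<^bsub>N\<^esub>" if "\<alpha> \<in> auto N" for \<alpha>
      using autoD(5)[OF that, of "\<one>\<^bsub>N\<^esub>" "\<one>\<^bsub>N\<^esub>"] autoD(4)[OF that, of "\<one>\<^bsub>N\<^esub>"] by simp
    have act: "holomorph_act N g \<one>\<^bsub>N\<^esub> = fst g" if "g \<in> \<Gamma>" for g
    proof -
      have "g \<in> carrier N \<times> auto N" using that subgroup.subset[OF sub] by (auto simp: holomorph_simps)
      then have "fst g \<in> carrier N" "snd g \<one>\<^bsub>N\<^esub> = \<one>\<^bsub>N\<^esub>" using one[of "snd g"] by auto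
      then show ?thesis by (simp add: holomorph_act_def case_prod_unfold)
    qed
    have reg1: "\<exists>!g. g \<in> \<Gamma> \<and> fst g = b" if "b \<in> carrier N" for b
    proof -
      have "\<exists>!g. g \<in> \<Gamma> \<and> holomorph_act N g \<one>\<^bsub>N\<^esub> = b"
        using reg that N.one_closed unfolding regular_subgroup_def by blast
      then show ?thesis using act by metis
    qed
    \<comment> \<open>An element of Hol(N) sends the unit of N to its first component, so by
      regularity \<open>fst\<close> is a bijection from \<Gamma> to N. Composing it with the
      isomorphism \<open>f\<close> parametrises \<Gamma> by G.\<close>
    define \<phi> where "\<phi> = (\<lambda>s\<in>carrier G. fst (f s))"
    have fst_bij: "bij_betw fst \<Gamma> (carrier N)"
      unfolding bij_betw_def
    proof
      show "inj_on fst \<Gamma>" using reg1 subgroup.subset[OF sub] by (force simp: inj_on_def holomorph_simps)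
      show "fst ` \<Gamma> = carrier N"
        using reg1 subgroup.subset[OF sub] by (force simp: holomorph_simps)
    qed
    have "bij_betw (fst \<circ> f) (carrier G) (carrier N)" using bij_betw_trans[OF fG fst_bij] .
    then have bij: "bij_betw \<phi> (carrier G) (carrier N)"
      by (rule iffD1[OF bij_betw_cong, rotated]) (simp add: \<phi>_def)
    have mult_f: "\<phi> (s \<otimes>\<^bsub>G\<^esub> t) = \<phi> s \<otimes>\<^bsub>N\<^esub> snd (f s) (\<phi> t)" if "s \<in> carrier G" "t \<in> carrier G" for s t
      using f that by (simp add: \<phi>_def iso_def hom_def holomorph_simps)
    have \<phi>: "\<phi> \<in> brace_maps G N"
      unfolding brace_maps_def using bij mult_f f\<Gamma> by (auto simp: \<phi>_def)
    interpret brace_map G N \<phi> using loc \<phi> .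
    have "twist s = snd (f s)" if "s \<in> carrier G" for s
      using that f\<Gamma>[OF that] autoD(3,4) by (intro twist_eqI mult_f) auto
    then have "hol_image = f ` carrier G" unfolding hol_image_def by (auto simp: \<phi>_def image_def)
    then show "\<Gamma> \<in> ?F ` brace_maps G N" using \<phi> fG by (auto simp: bij_betw_def)
  qed
  have fibre: "card {\<chi> \<in> brace_maps G N. ?F \<chi> = ?F \<phi>} = card (auto G)" if \<phi>: "\<phi> \<in> brace_maps G N" for \<phi>
  proof -
    interpret \<phi>: brace_map G N \<phi> using loc \<phi> .
    have "bij_betw (\<lambda>\<theta>. compose (carrier G) \<phi> \<theta>) (auto G) {\<chi> \<in> brace_maps G N. ?F \<chi> = ?F \<phi>}"
    proof (rule bij_betwI')
      fix \<theta> \<theta>' assume \<theta>: "\<theta> \<in> auto G" "\<theta>' \<in> auto G"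
      show "compose (carrier G) \<phi> \<theta> = compose (carrier G) \<phi> \<theta>' \<longleftrightarrow> \<theta> = \<theta>'"
      proof
        assume eq: "compose (carrier G) \<phi> \<theta> = compose (carrier G) \<phi> \<theta>'"
        show "\<theta> = \<theta>'"
        proof (rule extensionalityI[OF autoD(3)[OF \<theta>(1)] autoD(3)[OF \<theta>(2)]])
          fix s assume s: "s \<in> carrier G"
          have "\<phi> (\<theta> s) = \<phi> (\<theta>' s)" using eq s by (metis compose_eq)
          then show "\<theta> s = \<theta>' s" using \<phi>.inject autoD(4) \<theta> s by metis
        qed
      qed simp
    next
      fix \<theta> assume \<theta>: "\<theta> \<in> auto G"
      let ?\<chi> = "compose (carrier G) \<phi> \<theta>"
      interpret \<chi>: brace_map G N ?\<chi> by (rule loc[OF \<phi>.pre_auto[OF \<theta>]])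
      have tw: "\<chi>.twist s = \<phi>.twist (\<theta> s)" if s: "s \<in> carrier G" for s
      proof (rule \<chi>.twist_eqI[OF s])
        show "\<phi>.twist (\<theta> s) \<in> extensional (carrier N)" by (simp add: \<phi>.twist_def)
        fix t assume "t \<in> carrier G"
        then show "?\<chi> (s \<otimes>\<^bsub>G\<^esub> t) = ?\<chi> s \<otimes>\<^bsub>N\<^esub> \<phi>.twist (\<theta> s) (?\<chi> t)"
          using s \<theta> by (simp add: compose_def \<phi>.mult autoD(4,5))
      qed (use s autoD(4)[OF \<theta>] in auto)
      have "\<chi>.hol_image = (\<lambda>s. (\<phi> (\<theta> s), \<phi>.twist (\<theta> s))) ` carrier G"
        unfolding \<chi>.hol_image_def by (intro image_cong) (auto simp: tw compose_eq)
      also have "\<dots> = (\<lambda>s. (\<phi> s, \<phi>.twist s)) ` \<theta> ` carrier G" by (simp add: image_image)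
      also have "\<theta> ` carrier G = carrier G" using autoD(2)[OF \<theta>] by (simp add: bij_betw_def)
      finally show "?\<chi> \<in> {\<chi> \<in> brace_maps G N. ?F \<chi> = ?F \<phi>}"
        using \<phi>.pre_auto[OF \<theta>] by (simp add: \<phi>.hol_image_def)
    next
      fix \<chi> assume "\<chi> \<in> {\<chi> \<in> brace_maps G N. ?F \<chi> = ?F \<phi>}"
      then have \<chi>: "\<chi> \<in> brace_maps G N" and im: "?F \<chi> = ?F \<phi>" by auto
      interpret \<chi>: brace_map G N \<chi> using loc \<chi> .
      \<comment> \<open>Two maps with the same subgroup are two parametrisations of it; \<theta> is
        the change of parameter.\<close>
      define \<theta> where "\<theta> = (\<lambda>s\<in>carrier G. \<phi>.\<psi> (\<chi> s))"
      have \<theta>: "\<theta> s \<in> carrier G" "\<phi> (\<theta> s) = \<chi> s" "\<phi>.twist (\<theta> s) = \<chi>.twist s" if s: "s \<in> carrier G" for s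
      proof -
        show 1: "\<theta> s \<in> carrier G" "\<phi> (\<theta> s) = \<chi> s" using s by (auto simp: \<theta>_def)
        have "(\<chi> s, \<chi>.twist s) \<in> \<phi>.hol_image" using im s by (auto simp: \<chi>.hol_image_def)
        then obtain u where u: "u \<in> carrier G" "\<chi> s = \<phi> u" "\<chi>.twist s = \<phi>.twist u"
          by (auto simp: \<phi>.hol_image_def)
        then have "u = \<theta> s" using 1 \<phi>.inject by metis
        then show "\<phi>.twist (\<theta> s) = \<chi>.twist s" using u by simp
      qed
      have "\<theta> \<in> auto G"
      proof (rule autoI)
        have "bij_betw (\<lambda>s. \<phi>.\<psi> (\<chi> s)) (carrier G) (carrier G)"
          using bij_betw_trans[OF \<chi>.bij bij_betw_inv_into[OF \<phi>.bij]] by (simp add: \<phi>.\<psi>_def comp_def)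
        then show "bij_betw \<theta> (carrier G) (carrier G)"
          by (rule iffD1[OF bij_betw_cong, rotated]) (simp add: \<theta>_def)
        fix s t assume st: "s \<in> carrier G" "t \<in> carrier G"
        have "\<phi> (\<theta> (s \<otimes>\<^bsub>G\<^esub> t)) = \<phi> (\<theta> s \<otimes>\<^bsub>G\<^esub> \<theta> t)"
          using st \<theta> by (simp add: \<chi>.mult \<phi>.mult)
        then show "\<theta> (s \<otimes>\<^bsub>G\<^esub> t) = \<theta> s \<otimes>\<^bsub>G\<^esub> \<theta> t"
          using \<phi>.inject[of "\<theta> (s \<otimes>\<^bsub>G\<^esub> t)" "\<theta> s \<otimes>\<^bsub>G\<^esub> \<theta> t"] st \<theta>(1) by (metis G.m_closed)
      qed (simp add: \<theta>_def)
      moreover have "\<chi> = compose (carrier G) \<phi> \<theta>"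
        by (rule extensionalityI[OF \<chi>.extens compose_extensional]) (simp add: compose_eq \<theta>)
      ultimately show "\<exists>\<theta>\<in>auto G. \<chi> = compose (carrier G) \<phi> \<theta>" by blast
    qed
    then show ?thesis by (simp add: bij_betw_same_card)
  qed
  show ?thesis
    unfolding e_prime_def image[symmetric]
    by (rule card_eq_card_image_times_fibre[OF finite_brace_maps[OF fin] fibre])
qed

lemma sum_list_map_concat:
  "(\<Sum>z\<leftarrow>concat (map G xs). F z) = (\<Sum>x\<leftarrow>xs. \<Sum>z\<leftarrow>G x. F z)" for F :: "'z \<Rightarrow> 'l :: monoid_add"
  by (induction xs) auto

section \<open>The Hopf-Galois structure of a brace map\<close>

definition convolution :: "('a, 'y) monoid_scheme \<Rightarrow> ('a \<Rightarrow> 'l :: field) \<Rightarrow> ('a \<Rightarrow> 'l) \<Rightarrow> 'a \<Rightarrow> 'l" where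
  "convolution N f f' = (\<lambda>x. if x \<in> carrier N then \<Sum>y\<in>carrier N. f y * f' (inv\<^bsub>N\<^esub> y \<otimes>\<^bsub>N\<^esub> x) else 0)"

definition reflection :: "('a, 'y) monoid_scheme \<Rightarrow> ('a \<Rightarrow> 'l :: field) \<Rightarrow> 'a \<Rightarrow> 'l" where
  "reflection N f = (\<lambda>x. if x \<in> carrier N then f (inv\<^bsub>N\<^esub> x) else 0)"

section \<open>Dual bases of invariant functions and frames\<close>

context gal_action
begin

lemma Inv_add: "f \<in> Inv \<Longrightarrow> g \<in> Inv \<Longrightarrow> (\<lambda>x. f x + g x) \<in> Inv"
  by (simp add: invariants_def Gal_add)

lemma Inv_smult: "c \<in> K \<Longrightarrow> f \<in> Inv \<Longrightarrow> (\<lambda>x. c * f x) \<in> Inv"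
  by (simp add: invariants_def Gal_mult Gal_K)

lemma Inv_mult: "f \<in> Inv \<Longrightarrow> g \<in> Inv \<Longrightarrow> (\<lambda>x. f x * g x) \<in> Inv"
  by (simp add: invariants_def Gal_mult)

lemma Inv_0: "(\<lambda>x. 0) \<in> Inv"
  by (simp add: invariants_def Gal_0)

lemma Inv_sum: "(\<And>i. i \<in> I \<Longrightarrow> c i \<in> K \<and> b i \<in> Inv) \<Longrightarrow> (\<lambda>x. \<Sum>i\<in>I. c i * b i x) \<in> Inv"
  by (induction I rule: infinite_finite_induct) (auto intro!: Inv_0 Inv_add Inv_smult)

lemma InvD: "f \<in> Inv \<Longrightarrow> x \<notin> \<Omega> \<Longrightarrow> f x = 0"
  "f \<in> Inv \<Longrightarrow> s \<in> Gal \<Longrightarrow> x \<in> \<Omega> \<Longrightarrow> f (T s x) = s (f x)"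
  by (auto simp: invariants_def)

lemma basis_expansion:
  fixes f :: "'x \<Rightarrow> 'l" and a :: "'x \<Rightarrow> 'x \<Rightarrow> 'l" and b :: "'x \<Rightarrow> 'x \<Rightarrow> 'l"
  assumes ab: "\<And>x y. x \<in> \<Omega> \<Longrightarrow> y \<in> \<Omega> \<Longrightarrow> (\<Sum>i\<in>\<Omega>. a x i * b i y) = (if x = y then 1 else 0)" and y: "y \<in> \<Omega>"
  shows "f y = (\<Sum>i\<in>\<Omega>. (\<Sum>x\<in>\<Omega>. f x * a x i) * b i y)"
proof -
  have "(\<Sum>i\<in>\<Omega>. (\<Sum>x\<in>\<Omega>. f x * a x i) * b i y) = (\<Sum>x\<in>\<Omega>. f x * (\<Sum>i\<in>\<Omega>. a x i * b i y))"
    by (simp add: sum_distrib_left sum_distrib_right mult.assoc) (rule sum.swap)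
  also have "\<dots> = (\<Sum>x\<in>\<Omega>. if x = y then f x else 0)" by (intro sum.cong) (auto simp: ab y)
  also have "\<dots> = f y" using y finite_Om by simp
  finally show ?thesis by simp
qed

text \<open>Applying s to a b = 1 and moving the points shows that the conjugates s (a x i) form the
  row at T s x of an inverse of the same matrix b, and the inverse is unique. Multiplying an
  invariant by such a column keeps it invariant, which is what the coproduct built later relies
  on.\<close>

lemma dual_basis_invariant:
  assumes b: "\<And>i. i \<in> \<Omega> \<Longrightarrow> b i \<in> Inv"
    and ab: "\<And>x y. x \<in> \<Omega> \<Longrightarrow> y \<in> \<Omega> \<Longrightarrow> (\<Sum>i\<in>\<Omega>. a x i * b i y) = (if x = y then 1 else 0)"
    and ba: "\<And>i j. i \<in> \<Omega> \<Longrightarrow> j \<in> \<Omega> \<Longrightarrow> (\<Sum>x\<in>\<Omega>. b i x * a x j) = (if i = j then 1 else 0)"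
    and j: "j \<in> \<Omega>"
  shows "(\<lambda>x. if x \<in> \<Omega> then a x j else 0) \<in> Inv"
proof -
  have "a (T s x) j = s (a x j)" if s: "s \<in> Gal" and x: "x \<in> \<Omega>" for s x
  proof -
    have e: "(\<Sum>i\<in>\<Omega>. s (a x i) * b i z) = (if T s x = z then 1 else 0)" if z: "z \<in> \<Omega>" for z
    proof -
      let ?y = "T (Hilbert_Choice.inv s) z"
      have y: "?y \<in> \<Omega>" "T s ?y = z" using s z T_closed Gal_inv T_inv by auto
      have bz: "b i z = s (b i ?y)" if "i \<in> \<Omega>" for i
        using InvD(2)[OF b[OF that] s y(1)] y(2) by simp
      have "(\<Sum>i\<in>\<Omega>. s (a x i) * b i z) = s (\<Sum>i\<in>\<Omega>. a x i * b i ?y)"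
        using s by (simp add: Gal_sum Gal_mult bz)
      also have "\<dots> = (if x = ?y then 1 else 0)" using x y s ab by (simp add: Gal_0 Gal_1)
      also have "x = ?y \<longleftrightarrow> T s x = z" using y(2) T_inv(1)[OF s x] by auto
      finally show ?thesis .
    qed
    have "s (a x j) = (\<Sum>i\<in>\<Omega>. s (a x i) * (\<Sum>z\<in>\<Omega>. b i z * a z j))"
      using j finite_Om by (simp add: ba if_distrib[of "(*) _"] cong: if_cong sum.cong)
    also have "\<dots> = (\<Sum>z\<in>\<Omega>. (\<Sum>i\<in>\<Omega>. s (a x i) * b i z) * a z j)"
      by (simp add: sum_distrib_left sum_distrib_right mult.assoc) (rule sum.swap)
    also have "\<dots> = (\<Sum>z\<in>\<Omega>. if z = T s x then a z j else 0)"
      by (intro sum.cong refl) (simp add: e)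
    also have "\<dots> = a (T s x) j" using T_closed[OF s x] finite_Om by simp
    finally show ?thesis by simp
  qed
  then show ?thesis by (auto simp: invariants_def T_closed)
qed

text \<open>A K-linear identification of V with the invariants carries a descent basis over to V.
  The coordinates of v lie in K, so a K-linear form is determined by its values on this basis;
  regrouping the sum puts the L-valued matrix \<open>a\<close> next to these values.\<close>

lemma frame_of_invariants:
  assumes r: "bij_betw r (carrier V) Inv"
    and add: "\<And>v w. v \<in> carrier V \<Longrightarrow> w \<in> carrier V \<Longrightarrow> v \<oplus>\<^bsub>V\<^esub> w \<in> carrier V \<and> r (v \<oplus>\<^bsub>V\<^esub> w) = (\<lambda>x. r v x + r w x)"
    and smult: "\<And>c v. c \<in> K \<Longrightarrow> v \<in> carrier V \<Longrightarrow> c \<odot>\<^bsub>V\<^esub> v \<in> carrier V \<and> r (c \<odot>\<^bsub>V\<^esub> v) = (\<lambda>x. c * r v x)"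
  obtains a e where "frame K V \<Omega> r \<Omega> a e" "\<And>i. i \<in> \<Omega> \<Longrightarrow> e i \<in> carrier V"
    "\<And>x y. x \<in> \<Omega> \<Longrightarrow> y \<in> \<Omega> \<Longrightarrow> (\<Sum>i\<in>\<Omega>. a x i * r (e i) y) = (if x = y then 1 else 0)"
    "\<And>j. j \<in> \<Omega> \<Longrightarrow> (\<lambda>x. if x \<in> \<Omega> then a x j else 0) \<in> Inv"
    "\<And>f i. f \<in> Inv \<Longrightarrow> i \<in> \<Omega> \<Longrightarrow> (\<Sum>x\<in>\<Omega>. f x * a x i) \<in> K"
proof -
  obtain b a where b: "\<And>i. i \<in> \<Omega> \<Longrightarrow> b i \<in> Inv"
    and ab: "\<And>x y. x \<in> \<Omega> \<Longrightarrow> y \<in> \<Omega> \<Longrightarrow> (\<Sum>i\<in>\<Omega>. a x i * b i y) = (if x = y then 1 else 0)"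
    and ba: "\<And>i j. i \<in> \<Omega> \<Longrightarrow> j \<in> \<Omega> \<Longrightarrow> (\<Sum>x\<in>\<Omega>. b i x * a x j) = (if i = j then 1 else 0)"
    and K: "\<And>f i. f \<in> Inv \<Longrightarrow> i \<in> \<Omega> \<Longrightarrow> (\<Sum>x\<in>\<Omega>. f x * a x i) \<in> K"
    by (rule descent_basis) (rule that; assumption)
  define R where "R = inv_into (carrier V) r"
  have rR: "r (R f) = f" "R f \<in> carrier V" if "f \<in> Inv" for f
    using r that by (auto simp: R_def bij_betw_def f_inv_into_f inv_into_into)
  have inj: "v = w" if "r v = r w" "v \<in> carrier V" "w \<in> carrier V" for v w
    using r that by (auto simp: bij_betw_def inj_on_def)
  define e where "e i = R (b i)" for i
  have e: "e i \<in> carrier V" "r (e i) = b i" if "i \<in> \<Omega>" for i using rR b that by (auto simp: e_def)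
  have "frame K V \<Omega> r \<Omega> a e"
    unfolding frame_def
  proof (intro conjI allI impI ballI)
    fix f v assume f: "linear_form K V f" and v: "v \<in> carrier V"
    have Radd: "f (R (\<lambda>x. g x + h x)) = f (R g) + f (R h)" if "g \<in> Inv" "h \<in> Inv" for g h
    proof -
      have "R (\<lambda>x. g x + h x) = R g \<oplus>\<^bsub>V\<^esub> R h"
      proof (rule inj)
        show "r (R (\<lambda>x. g x + h x)) = r (R g \<oplus>\<^bsub>V\<^esub> R h)"
          using add[of "R g" "R h"] rR[OF that(1)] rR[OF that(2)] rR(1)[OF Inv_add[OF that]] by simp
      qed (use add[of "R g" "R h"] rR[OF that(1)] rR[OF that(2)] rR(2)[OF Inv_add[OF that]] in auto)
      then show ?thesis using f rR that by (simp add: linear_form_def)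
    qed
    have Rsmult: "f (R (\<lambda>x. c * g x)) = c * f (R g)" if "c \<in> K" "g \<in> Inv" for c g
    proof -
      have "R (\<lambda>x. c * g x) = c \<odot>\<^bsub>V\<^esub> R g"
      proof (rule inj)
        show "r (R (\<lambda>x. c * g x)) = r (c \<odot>\<^bsub>V\<^esub> R g)"
          using smult[OF that(1), of "R g"] rR[OF that(2)] rR(1)[OF Inv_smult[OF that]] by simp
      qed (use smult[OF that(1), of "R g"] rR[OF that(2)] rR(2)[OF Inv_smult[OF that]] in auto)
      then show ?thesis using f rR that by (simp add: linear_form_def)
    qed
    have R0: "f (R (\<lambda>x. 0)) = 0" using Rsmult[OF K_0 Inv_0] by simp
    have Rsum: "f (R (\<lambda>x. \<Sum>i\<in>I. c i * b i x)) = (\<Sum>i\<in>I. c i * f (R (b i)))"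
      if "I \<subseteq> \<Omega>" "\<And>i. i \<in> I \<Longrightarrow> c i \<in> K" for I c
      using finite_subset[OF that(1) finite_Om] that
    proof (induction I)
      case empty
      show ?case using R0 by simp
    next
      case (insert i I)
      have "f (R (\<lambda>x. \<Sum>i\<in>insert i I. c i * b i x)) = f (R (\<lambda>x. c i * b i x + (\<Sum>i\<in>I. c i * b i x)))"
        using insert by simp
      also have "\<dots> = f (R (\<lambda>x. c i * b i x)) + f (R (\<lambda>x. \<Sum>i\<in>I. c i * b i x))"
        using insert b by (intro Radd Inv_smult Inv_sum) auto
      also have "\<dots> = (\<Sum>i\<in>insert i I. c i * f (R (b i)))"
        using insert b by (simp add: Rsmult)
      finally show ?case .
    qed
    have rv: "r v \<in> Inv" using r v by (auto simp: bij_betw_def)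
    let ?c = "\<lambda>i. \<Sum>x\<in>\<Omega>. r v x * a x i"
    have "r v = (\<lambda>y. \<Sum>i\<in>\<Omega>. ?c i * b i y)"
    proof
      fix y show "r v y = (\<Sum>i\<in>\<Omega>. ?c i * b i y)"
        using basis_expansion[OF ab, of y "r v"] InvD(1)[OF rv, of y] InvD(1)[OF b, of _ y]
        by (cases "y \<in> \<Omega>") auto
    qed
    then have "v = R (\<lambda>y. \<Sum>i\<in>\<Omega>. ?c i * b i y)"
      using inj[of v] v rR rv by metis
    then have "f v = (\<Sum>i\<in>\<Omega>. ?c i * f (e i))"
      using Rsum[OF order_refl, of ?c] K[OF rv] by (simp add: e_def)
    also have "\<dots> = (\<Sum>x\<in>\<Omega>. r v x * (\<Sum>i\<in>\<Omega>. a x i * f (e i)))"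
      by (simp add: sum_distrib_left sum_distrib_right mult.assoc) (rule sum.swap)
    finally show "f v = (\<Sum>x\<in>\<Omega>. r v x * (\<Sum>i\<in>\<Omega>. a x i * f (e i)))" .
  qed (use e in auto)
  then show thesis using that[of a e] e ab dual_basis_invariant[OF b ab ba] K by simp
qed

end

context galois_extension
begin

lemma gal_action_left: "gal_action K Gal (\<lambda>s t. s \<circ> t)"
  by unfold_locales (auto simp: finite_Gal)

text \<open>L is itself a space of invariants, for Gal acting on itself by left translation: l
  corresponds to the family of its conjugates, and l is read off at id. The factor L in L \<otimes>
  H thereby fits the same machinery as H.\<close>

lemma conjugates_invariant: "bij_betw (\<lambda>l s. if s \<in> Gal then s l else 0) UNIV (invariants K Gal (\<lambda>s t. s \<circ> t))"
proof (rule bij_betw_byWitness[where f' = "\<lambda>f. f id"])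
  show "(\<lambda>l s. if s \<in> Gal then s l else 0) ` UNIV \<subseteq> invariants K Gal (\<lambda>s t. s \<circ> t)"
    by (auto simp: invariants_def)
  show "\<forall>f\<in>invariants K Gal (\<lambda>s t. s \<circ> t). (\<lambda>s. if s \<in> Gal then s (f id) else 0) = f"
  proof
    fix f assume f: "f \<in> invariants K Gal (\<lambda>s t. s \<circ> t)"
    show "(\<lambda>s. if s \<in> Gal then s (f id) else 0) = f"
    proof
      fix s show "(if s \<in> Gal then s (f id) else 0) = f s"
      proof (cases "s \<in> Gal")
        case True
        then have "f (s \<circ> id) = s (f id)" using f Gal_id unfolding invariants_def by blast
        then show ?thesis using True by simp
      next
        case False
        then show ?thesis using f by (simp add: invariants_def)
      qed
    qed
  qed
qed auto

lemma top_frame: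
  obtains a e where "frame K top_module Gal (\<lambda>l s. if s \<in> Gal then s l else 0) Gal a e"
proof -
  interpret gal_action K Gal "\<lambda>s t. s \<circ> t" by (rule gal_action_left)
  show thesis
    by (rule frame_of_invariants[of "\<lambda>l s. if s \<in> Gal then s l else 0" "top_module :: ('l, 'l) module"])
       (use that in \<open>auto simp: conjugates_invariant Gal_add Gal_mult Gal_K\<close>)
qed

end

section \<open>The invariant part of L[N] and its action on L\<close>

locale descent = galois_extension K + brace_map "gal_group K" N \<phi>
  for K :: "'l :: field set" and N :: "('a, 'y) monoid_scheme" and \<phi>
begin

lemma finite_N: "finite (carrier N)"
  using bij finite_Gal bij_betw_finite by blast

sublocale A: gal_action K "carrier N" twist
proof
  fix s t g assume "s \<in> Gal" "t \<in> Gal" "g \<in> carrier N"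
  then show "twist (s \<circ> t) g = twist s (twist t g)" using twist_comp[of s t g] by simp
next
  fix g assume "g \<in> carrier N"
  then show "twist id g = g" using twist_one by simp
qed (auto simp: finite_N)

text \<open>The fixed ring of L[N] when Gal acts on coefficients as usual and on N through
  \<open>twist\<close>; it is the descended Hopf algebra.\<close>

abbreviation "W \<equiv> invariants K (carrier N) twist"

text \<open>The element \<open>\<Sum> f(g) g\<close> of \<open>L[N]\<close> acts on \<open>L\<close>, with \<open>g\<close> acting as the automorphism \<open>\<phi>\<^sup>-\<^sup>1(g)\<close>.\<close>

definition opr :: "('a \<Rightarrow> 'l) \<Rightarrow> 'l \<Rightarrow> 'l" where
  "opr f x = (\<Sum>g\<in>carrier N. f g * \<psi> g x)"

abbreviation "conv \<equiv> convolution N"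

abbreviation "anti \<equiv> reflection N"

definition op_image :: "('l \<Rightarrow> 'l) set" where "op_image = opr ` W"

lemma opr_Gal: "opr f x = (\<Sum>s\<in>Gal. f (\<phi> s) * s x)"
  unfolding opr_def by (subst sum.reindex_bij_betw[OF bij, symmetric]) simp

lemma opr_inject:
  assumes "opr f = opr f'" "g \<in> carrier N" shows "f g = f' g"
proof -
  have "(\<Sum>s\<in>Gal. f (\<phi> s) * s x) = (\<Sum>s\<in>Gal. f' (\<phi> s) * s x)" for x
    using assms(1) unfolding opr_Gal[symmetric] by simp
  from dedekind_unique[OF this, of "\<psi> g"] assms(2) show ?thesis by simp
qed

lemma opr_endomorphism: "opr f \<in> endomorphisms K"
  using Gal_combination_endomorphism[of "\<lambda>s. f (\<phi> s)"] unfolding opr_Gal[abs_def] .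

lemma endomorphism_opr:
  assumes "f \<in> endomorphisms K"
  obtains F where "\<And>g. g \<notin> carrier N \<Longrightarrow> F g = 0" "opr F = f"
proof (rule that[of "\<lambda>g. if g \<in> carrier N then end_coeff f (\<psi> g) else 0"])
  show "opr (\<lambda>g. if g \<in> carrier N then end_coeff f (\<psi> g) else 0) = f"
    by (rule ext) (simp add: opr_Gal endomorphism_expansion[OF assms])
qed simp

lemma opr_add: "opr (\<lambda>g. f g + f' g) x = opr f x + opr f' x"
  by (simp add: opr_def algebra_simps sum.distrib)

lemma opr_smult: "opr (\<lambda>g. c * f g) x = c * opr f x"
  by (simp add: opr_def algebra_simps sum_distrib_left)

lemma opr_unit: "g \<in> carrier N \<Longrightarrow> opr (unit_fun g) = \<psi> g"
  by (rule ext) (simp add: opr_def unit_fun_def finite_N if_distrib[of "\<lambda>u. u * _"] cong: if_cong)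

lemma opr_1: "opr f 1 = (\<Sum>g\<in>carrier N. f g)"
  by (simp add: opr_def Gal_1)

lemma bij_translate: "g \<in> carrier N \<Longrightarrow> bij_betw (\<lambda>h. g \<otimes>\<^bsub>N\<^esub> h) (carrier N) (carrier N)"
  by (rule bij_betw_byWitness[where f' = "\<lambda>h. inv\<^bsub>N\<^esub> g \<otimes>\<^bsub>N\<^esub> h"]) (auto simp: N.m_assoc[symmetric])

text \<open>Moving \<psi> g past the coefficients of f' replaces f' h by f' (twist (\<psi> g) h), by
  invariance, while \<psi> g \<psi> h is \<psi> of g twist (\<psi> g) h. Both carry the same twist,
  which a reindexing of h removes.\<close>

lemma opr_conv:
  assumes f': "f' \<in> W"
  shows "opr (conv f f') x = opr f (opr f' x)"
proof -
  have "opr f (opr f' x) = (\<Sum>g\<in>carrier N. f g * (\<Sum>h\<in>carrier N. f' h * \<psi> (g \<otimes>\<^bsub>N\<^esub> h) x))"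
    unfolding opr_def[of f]
  proof (intro sum.cong refl arg_cong2[of _ _ _ _ "(*)"])
    fix g assume g: "g \<in> carrier N"
    have tw: "bij_betw (twist (\<psi> g)) (carrier N) (carrier N)" using autoD(2)[OF twist_auto] g by simp
    have "\<psi> g (opr f' x) = (\<Sum>h\<in>carrier N. \<psi> g (f' h) * \<psi> g (\<psi> h x))"
      using g by (simp add: opr_def Gal_sum Gal_mult)
    also have "\<dots> = (\<Sum>h\<in>carrier N. f' (twist (\<psi> g) h) * \<psi> (g \<otimes>\<^bsub>N\<^esub> twist (\<psi> g) h) x)"
    proof (intro sum.cong refl arg_cong2[of _ _ _ _ "(*)"])
      fix h assume h: "h \<in> carrier N"
      show "\<psi> g (f' h) = f' (twist (\<psi> g) h)" using A.InvD(2)[OF f', of "\<psi> g" h] g h by simp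
      have "\<psi> g \<circ> \<psi> h = \<psi> (g \<otimes>\<^bsub>N\<^esub> twist (\<psi> g) h)"
        using \<psi>_mult[of "\<psi> g" "\<psi> h"] g h by simp
      then show "\<psi> g (\<psi> h x) = \<psi> (g \<otimes>\<^bsub>N\<^esub> twist (\<psi> g) h) x" by (metis comp_apply)
    qed
    also have "\<dots> = (\<Sum>h\<in>carrier N. f' h * \<psi> (g \<otimes>\<^bsub>N\<^esub> h) x)"
      by (rule sum.reindex_bij_betw[OF tw])
    finally show "\<psi> g (opr f' x) = (\<Sum>h\<in>carrier N. f' h * \<psi> (g \<otimes>\<^bsub>N\<^esub> h) x)" .
  qed
  also have "\<dots> = (\<Sum>g\<in>carrier N. \<Sum>h\<in>carrier N. f g * f' (inv\<^bsub>N\<^esub> g \<otimes>\<^bsub>N\<^esub> h) * \<psi> h x)"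
  proof (intro sum.cong refl)
    fix g assume g: "g \<in> carrier N"
    have "(\<Sum>h\<in>carrier N. f' (inv\<^bsub>N\<^esub> g \<otimes>\<^bsub>N\<^esub> h) * \<psi> h x) =
        (\<Sum>h\<in>carrier N. f' (inv\<^bsub>N\<^esub> g \<otimes>\<^bsub>N\<^esub> (g \<otimes>\<^bsub>N\<^esub> h)) * \<psi> (g \<otimes>\<^bsub>N\<^esub> h) x)"
      by (rule sum.reindex_bij_betw[OF bij_translate[OF g], symmetric])
    also have "\<dots> = (\<Sum>h\<in>carrier N. f' h * \<psi> (g \<otimes>\<^bsub>N\<^esub> h) x)"
      using g by (intro sum.cong) (simp_all add: N.m_assoc[symmetric])
    finally show "f g * (\<Sum>h\<in>carrier N. f' h * \<psi> (g \<otimes>\<^bsub>N\<^esub> h) x) =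
        (\<Sum>h\<in>carrier N. f g * f' (inv\<^bsub>N\<^esub> g \<otimes>\<^bsub>N\<^esub> h) * \<psi> h x)"
      unfolding mult.assoc sum_distrib_left[symmetric] by simp
  qed
  also have "\<dots> = opr (conv f f') x"
    unfolding opr_def convolution_def by (subst sum.swap) (simp add: sum_distrib_right)
  finally show ?thesis by simp
qed

lemma unit_W: "unit_fun \<one>\<^bsub>N\<^esub> \<in> W"
proof -
  have "twist s g = \<one>\<^bsub>N\<^esub> \<longleftrightarrow> g = \<one>\<^bsub>N\<^esub>" if "s \<in> Gal" "g \<in> carrier N" for s g
    using autoD(6)[OF twist_auto, of s g "\<one>\<^bsub>N\<^esub>"] that twist_1 by auto
  then show ?thesis by (auto simp: invariants_def unit_fun_def Gal_0 Gal_1)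
qed

lemma anti_W: "f \<in> W \<Longrightarrow> anti f \<in> W"
  by (simp add: invariants_def reflection_def twist_inv[symmetric])

lemma conv_W:
  assumes f: "f \<in> W" and f': "f' \<in> W" shows "conv f f' \<in> W"
  unfolding invariants_def
proof (intro CollectI conjI allI impI ballI)
  fix s g assume s: "s \<in> Gal" and g: "g \<in> carrier N"
  have tw: "bij_betw (twist s) (carrier N) (carrier N)" using autoD(2)[OF twist_auto[OF s]] .
  have "conv f f' (twist s g) = (\<Sum>y\<in>carrier N. f (twist s y) * f' (inv\<^bsub>N\<^esub> twist s y \<otimes>\<^bsub>N\<^esub> twist s g))"
    using s g by (simp add: convolution_def sum.reindex_bij_betw[OF tw, of "\<lambda>y. f y * f' (inv\<^bsub>N\<^esub> y \<otimes>\<^bsub>N\<^esub> twist s g)"])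
  also have "\<dots> = (\<Sum>y\<in>carrier N. s (f y) * s (f' (inv\<^bsub>N\<^esub> y \<otimes>\<^bsub>N\<^esub> g)))"
    using s g f f' by (intro sum.cong) (simp_all add: A.InvD(2) twist_mult[symmetric] twist_inv[symmetric])
  also have "\<dots> = s (conv f f' g)" using s g by (simp add: convolution_def Gal_sum Gal_mult)
  finally show "conv f f' (twist s g) = s (conv f f' g)" .
qed (simp add: convolution_def)

lemma sum_W_K: assumes f: "f \<in> W" shows "(\<Sum>g\<in>carrier N. f g) \<in> K"
proof (rule fixed_in_K)
  fix s assume s: "s \<in> Gal"
  have tw: "bij_betw (twist s) (carrier N) (carrier N)" using autoD(2)[OF twist_auto[OF s]] .
  have "s (\<Sum>g\<in>carrier N. f g) = (\<Sum>g\<in>carrier N. f (twist s g))"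
    using s f by (simp add: Gal_sum A.InvD(2))
  also have "\<dots> = (\<Sum>g\<in>carrier N. f g)" by (rule sum.reindex_bij_betw[OF tw])
  finally show "s (\<Sum>g\<in>carrier N. f g) = (\<Sum>g\<in>carrier N. f g)" .
qed

lemma W_eqI: assumes "f \<in> W" "f' \<in> W" "opr f = opr f'" shows "f = f'"
proof
  fix g show "f g = f' g"
    using opr_inject[OF assms(3), of g] A.InvD(1)[OF assms(1), of g] A.InvD(1)[OF assms(2), of g]
    by (cases "g \<in> carrier N") auto
qed

text \<open>Both \<open>L\<close> and \<open>W\<close> are spaces of invariants in spaces of the same dimension over \<open>L\<close>, hence
  isomorphic over \<open>K\<close>; this puts a model of every Hopf-Galois structure on the type of \<open>L\<close>.\<close>

lemma linear_param:
  obtains \<Theta> :: "'l \<Rightarrow> 'a \<Rightarrow> 'l" where "bij_betw \<Theta> UNIV W"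
    "\<And>x y. \<Theta> (x + y) = (\<lambda>g. \<Theta> x g + \<Theta> y g)" "\<And>c x. c \<in> K \<Longrightarrow> \<Theta> (c * x) = (\<lambda>g. c * \<Theta> x g)"
proof -
  interpret L: gal_action K Gal "\<lambda>s t. s \<circ> t" by (rule gal_action_left)
  obtain b a where b: "\<And>i. i \<in> carrier N \<Longrightarrow> b i \<in> W"
    and ab: "\<And>x y. x \<in> carrier N \<Longrightarrow> y \<in> carrier N \<Longrightarrow> (\<Sum>i\<in>carrier N. a x i * b i y) = (if x = y then 1 else 0)"
    and ba: "\<And>i j. i \<in> carrier N \<Longrightarrow> j \<in> carrier N \<Longrightarrow> (\<Sum>x\<in>carrier N. b i x * a x j) = (if i = j then 1 else 0)"
    and K: "\<And>f i. f \<in> W \<Longrightarrow> i \<in> carrier N \<Longrightarrow> (\<Sum>x\<in>carrier N. f x * a x i) \<in> K"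
    by (rule A.descent_basis) (rule that; assumption)
  obtain b' a' where b': "\<And>i. i \<in> Gal \<Longrightarrow> b' i \<in> L.Inv"
    and ab': "\<And>x y. x \<in> Gal \<Longrightarrow> y \<in> Gal \<Longrightarrow> (\<Sum>i\<in>Gal. a' x i * b' i y) = (if x = y then 1 else 0)"
    and ba': "\<And>i j. i \<in> Gal \<Longrightarrow> j \<in> Gal \<Longrightarrow> (\<Sum>x\<in>Gal. b' i x * a' x j) = (if i = j then 1 else 0)"
    and K': "\<And>f i. f \<in> L.Inv \<Longrightarrow> i \<in> Gal \<Longrightarrow> (\<Sum>x\<in>Gal. f x * a' x i) \<in> K"
    by (rule L.descent_basis) (rule that; assumption)
  define c where "c l i = (\<Sum>s\<in>Gal. s l * a' s i)" for l i
  \<comment> \<open>The K-coordinates of l in a descent basis of conjugates are reused in a descent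
    basis of \<open>W\<close>, with indices matched by \<phi>.\<close>
  define \<Theta> where "\<Theta> l = (\<lambda>g. \<Sum>i\<in>Gal. c l i * b (\<phi> i) g)" for l
  have cK: "c l i \<in> K" if i: "i \<in> Gal" for l i
  proof -
    have "(\<lambda>s. if s \<in> Gal then s l else 0) \<in> L.Inv"
      using conjugates_invariant by (auto simp: bij_betw_def)
    from K'[OF this i] show ?thesis by (simp add: c_def)
  qed
  define d where "d f i = (\<Sum>g\<in>carrier N. f g * a g (\<phi> i))" for f i
  define \<Xi> where "\<Xi> f = (\<Sum>i\<in>Gal. d f i * b' i id)" for f
  have b'_id: "b' i s = s (b' i id)" if "i \<in> Gal" "s \<in> Gal" for i s
    using L.InvD(2)[OF b'[OF that(1)] that(2) Gal_id] by simp
  have "bij_betw \<Theta> UNIV W"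
  proof (rule bij_betw_byWitness[where f' = \<Xi>])
    show "\<Theta> ` UNIV \<subseteq> W"
      unfolding \<Theta>_def using b cK by (auto intro!: A.Inv_sum)
    show "\<forall>l\<in>UNIV. \<Xi> (\<Theta> l) = l"
    proof
      fix l
      have d: "d (\<Theta> l) i = c l i" if i: "i \<in> Gal" for i
      proof -
        have "d (\<Theta> l) i = (\<Sum>j\<in>Gal. c l j * (\<Sum>g\<in>carrier N. b (\<phi> j) g * a g (\<phi> i)))"
          unfolding d_def \<Theta>_def by (simp add: sum_distrib_left sum_distrib_right mult.assoc) (rule sum.swap)
        also have "\<dots> = (\<Sum>j\<in>Gal. if j = i then c l j else 0)"
          using i by (intro sum.cong) (auto simp: ba inject)
        also have "\<dots> = c l i" using i finite_Gal by simp
        finally show ?thesis .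
      qed
      have "\<Xi> (\<Theta> l) = (\<Sum>i\<in>Gal. (\<Sum>s\<in>Gal. s l * a' s i) * b' i id)" unfolding \<Xi>_def by (simp add: d c_def)
      also have "\<dots> = id l" using L.basis_expansion[of a' b' id "\<lambda>s. s l"] ab' by simp
      finally show "\<Xi> (\<Theta> l) = l" by simp
    qed
    show "\<forall>f\<in>W. \<Theta> (\<Xi> f) = f"
    proof
      fix f assume f: "f \<in> W"
      have dK: "d f i \<in> K" if "i \<in> Gal" for i unfolding d_def using K[OF f, of "\<phi> i"] that by simp
      have c: "c (\<Xi> f) i = d f i" if i: "i \<in> Gal" for i
      proof -
        have "c (\<Xi> f) i = (\<Sum>s\<in>Gal. (\<Sum>j\<in>Gal. d f j * b' j s) * a' s i)"
          unfolding c_def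
        proof (intro sum.cong refl arg_cong2[of _ _ _ _ "(*)"])
          fix s assume s: "s \<in> Gal"
          have "s (\<Xi> f) = (\<Sum>j\<in>Gal. s (d f j) * s (b' j id))"
            unfolding \<Xi>_def by (simp add: Gal_sum[OF s] Gal_mult[OF s])
          also have "\<dots> = (\<Sum>j\<in>Gal. d f j * b' j s)"
          proof (intro sum.cong refl)
            fix j assume j: "j \<in> Gal"
            show "s (d f j) * s (b' j id) = d f j * b' j s"
              unfolding Gal_K[OF s dK[OF j]] b'_id[OF j s] ..
          qed
          finally show "s (\<Xi> f) = (\<Sum>j\<in>Gal. d f j * b' j s)" .
        qed
        also have "\<dots> = (\<Sum>j\<in>Gal. d f j * (\<Sum>s\<in>Gal. b' j s * a' s i))"
          by (simp add: sum_distrib_left sum_distrib_right mult.assoc) (rule sum.swap)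
        also have "\<dots> = (\<Sum>j\<in>Gal. if j = i then d f j else 0)"
          using i by (intro sum.cong) (auto simp: ba')
        also have "\<dots> = d f i" using i finite_Gal by simp
        finally show ?thesis .
      qed
      show "\<Theta> (\<Xi> f) = f"
      proof
        fix g
        have "\<Theta> (\<Xi> f) g = (\<Sum>i\<in>Gal. (\<Sum>h\<in>carrier N. f h * a h (\<phi> i)) * b (\<phi> i) g)"
          unfolding \<Theta>_def by (simp add: c) (simp add: d_def)
        also have "\<dots> = (\<Sum>i\<in>carrier N. (\<Sum>h\<in>carrier N. f h * a h i) * b i g)"
          by (rule sum.reindex_bij_betw[OF bij])
        also have "\<dots> = f g"
          using A.basis_expansion[of a b g f] ab A.InvD(1)[OF f, of g] A.InvD(1)[OF b, of _ g] by (cases "g \<in> carrier N") auto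
        finally show "\<Theta> (\<Xi> f) g = f g" .
      qed
    qed
  qed auto
  moreover have "\<Theta> (x + y) = (\<lambda>g. \<Theta> x g + \<Theta> y g)" for x y
    unfolding \<Theta>_def c_def by (simp add: Gal_add algebra_simps sum.distrib)
  moreover have "\<Theta> (k * x) = (\<lambda>g. k * \<Theta> x g)" if "k \<in> K" for k x
    unfolding \<Theta>_def c_def using that by (simp add: Gal_mult Gal_K mult.assoc sum_distrib_left[symmetric])
  ultimately show thesis by (rule that)
qed

end

section \<open>The group algebra L[N] of a finite group\<close>

locale finite_group_algebra = group N for N :: "('a, 'y) monoid_scheme" +
  assumes finite_N: "finite (carrier N)"
begin

abbreviation "GA \<equiv> group_algebra (UNIV :: 'l :: field set) N"

lemma GA_carrier: "f \<in> carrier GA \<longleftrightarrow> (\<forall>x. x \<notin> carrier N \<longrightarrow> f x = 0)"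
proof -
  have "{x. f x \<noteq> 0} \<subseteq> carrier N \<Longrightarrow> finite {x. f x \<noteq> 0}"
    using finite_N finite_subset by blast
  then show ?thesis by (auto simp: group_algebra_def Let_def)
qed

lemma GA_simps:
  "\<one>\<^bsub>GA\<^esub> = unit_fun \<one>\<^bsub>N\<^esub>" "f \<oplus>\<^bsub>GA\<^esub> g = (\<lambda>x. f x + g x)" "\<zero>\<^bsub>GA\<^esub> = (\<lambda>x. 0)"
  "c \<odot>\<^bsub>GA\<^esub> f = (\<lambda>x. c * f x)" "antipode GA f = reflection N f"
  by (auto simp: group_algebra_def Let_def unit_fun_def reflection_def)

lemma support_sum:
  assumes "f \<in> carrier GA" "\<And>x. f x = 0 \<Longrightarrow> F x = 0"
  shows "(\<Sum>x | f x \<noteq> 0. F x) = (\<Sum>x\<in>carrier N. F x)"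
proof (rule sum.mono_neutral_left[OF finite_N])
  show "{x. f x \<noteq> 0} \<subseteq> carrier N" using assms(1) unfolding GA_carrier by blast
qed (use assms(2) in auto)

lemma GA_mult: assumes "f \<in> carrier GA" shows "f \<otimes>\<^bsub>GA\<^esub> g = convolution N f g"
proof
  fix x
  have "(\<Sum>y | f y \<noteq> 0. f y * g (inv\<^bsub>N\<^esub> y \<otimes>\<^bsub>N\<^esub> x)) = (\<Sum>y\<in>carrier N. f y * g (inv\<^bsub>N\<^esub> y \<otimes>\<^bsub>N\<^esub> x))"
    using assms by (rule support_sum) simp
  then show "(f \<otimes>\<^bsub>GA\<^esub> g) x = convolution N f g x"
    by (simp add: group_algebra_def Let_def convolution_def)
qed

lemma GA_counit: assumes "f \<in> carrier GA" shows "counit GA f = (\<Sum>x\<in>carrier N. f x)"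
  using support_sum[OF assms, of f] by (simp add: group_algebra_def Let_def)

lemma GA_unit: "x \<in> carrier N \<Longrightarrow> unit_fun x \<in> carrier GA"
  by (auto simp: GA_carrier unit_fun_def)

lemma GA_comult:
  fixes f :: "'a \<Rightarrow> 'l :: field"
  assumes f: "f \<in> carrier GA"
  obtains xs where "set xs = {x. f x \<noteq> 0}" "distinct xs"
    "comult GA f = map (\<lambda>x. (\<lambda>y. if y = x then f x else 0, unit_fun x)) xs"
proof -
  have "finite {x. f x \<noteq> 0}" using f by (simp add: group_algebra_def Let_def)
  then have "\<exists>xs. set xs = {x. f x \<noteq> 0} \<and> distinct xs" by (rule finite_distinct_list)
  from someI_ex[OF this] show thesis
    by (intro that[of "SOME xs. set xs = {x. f x \<noteq> 0} \<and> distinct xs"])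
       (auto simp: group_algebra_def Let_def unit_fun_def)
qed

lemma GA_comult_closed:
  fixes f :: "'a \<Rightarrow> 'l :: field"
  assumes f: "f \<in> carrier GA"
  shows "set (comult GA f) \<subseteq> carrier GA \<times> carrier GA"
proof -
  have "x \<in> carrier N" if "f x \<noteq> 0" for x using f that unfolding GA_carrier by blast
  then show ?thesis by (rule_tac GA_comult[OF f]) (auto simp: GA_carrier unit_fun_def)
qed

text \<open>In coordinates the coproduct is supported on the diagonal of N \<times> N, whichever
  enumeration of the support was chosen.\<close>

lemma GA_comult_value:
  fixes f :: "'a \<Rightarrow> 'l :: field"
  assumes f: "f \<in> carrier GA"
  shows "(\<Sum>(u, v)\<leftarrow>comult GA f. u g * v g') = (if g = g' then f g else 0)"
proof (rule GA_comult[OF f])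
  fix xs assume xs: "set xs = {x. f x \<noteq> 0}" "distinct xs"
    "comult GA f = map (\<lambda>x. (\<lambda>y. if y = x then f x else 0, unit_fun x)) xs"
  have "(\<Sum>(u, v)\<leftarrow>comult GA f. u g * v g') = (\<Sum>x\<in>set xs. (if g = x then f x else 0) * unit_fun x g')"
    unfolding xs(3) by (simp add: sum_list_distinct_conv_sum_set[OF xs(2)] comp_def)
  also have "\<dots> = (\<Sum>x\<in>set xs. if x = g then f g * unit_fun g g' else 0)"
    by (intro sum.cong) auto
  also have "\<dots> = (if g \<in> set xs then f g * unit_fun g g' else 0)" by (rule sum.delta) simp
  also have "\<dots> = (if g = g' then f g else 0)" using xs(1) by (auto simp: unit_fun_def)
  finally show ?thesis .
qed

lemma GA_linear:
  fixes F :: "('a \<Rightarrow> 'l :: field) \<Rightarrow> 'l"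
  assumes F: "\<And>u v. u \<in> carrier GA \<Longrightarrow> v \<in> carrier GA \<Longrightarrow> F (\<lambda>x. u x + v x) = F u + F v"
    "\<And>c u. u \<in> carrier GA \<Longrightarrow> F (\<lambda>x. c * u x) = c * F u"
    and f: "f \<in> carrier GA"
  shows "F f = (\<Sum>x\<in>carrier N. f x * F (unit_fun x))"
proof -
  have "F (\<lambda>y. \<Sum>x\<in>I. f x * unit_fun x y) = (\<Sum>x\<in>I. f x * F (unit_fun x))" if "I \<subseteq> carrier N" for I
    using finite_subset[OF that finite_N] that
  proof (induction I)
    case empty
    show ?case using F(2)[of "\<lambda>x. 0" 0] by (simp add: GA_carrier)
  next
    case (insert x I)
    have c1: "(\<lambda>y. f x * unit_fun x y) \<in> carrier GA" "(\<lambda>y. \<Sum>x\<in>I. f x * unit_fun x y) \<in> carrier GA"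
      using insert.prems by (auto simp: GA_carrier unit_fun_def intro!: sum.neutral)
    have "F (\<lambda>y. \<Sum>x\<in>insert x I. f x * unit_fun x y) = F (\<lambda>y. f x * unit_fun x y + (\<Sum>x\<in>I. f x * unit_fun x y))"
      using insert.hyps by simp
    also have "\<dots> = f x * F (unit_fun x) + (\<Sum>x\<in>I. f x * F (unit_fun x))"
      using insert F(1)[OF c1] F(2)[OF GA_unit[of x], of "f x"] by simp
    finally show ?case using insert.hyps by simp
  qed
  from this[OF order_refl] have "F (\<lambda>y. \<Sum>x\<in>carrier N. f x * unit_fun x y) = (\<Sum>x\<in>carrier N. f x * F (unit_fun x))" .
  moreover have "f = (\<lambda>y. \<Sum>x\<in>carrier N. f x * unit_fun x y)"
  proof
    fix y
    have "f = (\<Sum>x\<in>carrier N. (\<lambda>y. f x * unit_fun x y))"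
      by (rule unit_fun_expansion[OF finite_N]) (use f in \<open>simp add: GA_carrier\<close>)
    from fun_cong[OF this, of y] show "f y = (\<Sum>x\<in>carrier N. f x * unit_fun x y)"
      by (simp only: sum_fun_apply)
  qed
  ultimately show ?thesis by simp
qed

text \<open>Over the base field L no descent takes place: the unit functions are a basis and the
  transition matrix is the identity.\<close>

lemma GA_frame: "frame (UNIV :: 'l :: field set) GA (carrier N) (\<lambda>f. f) (carrier N) (\<lambda>x i. if x = i then 1 else 0) unit_fun"
  unfolding frame_def
proof (intro conjI allI impI ballI)
  show "unit_fun ` carrier N \<subseteq> carrier GA" using GA_unit by blast
  fix F and f :: "'a \<Rightarrow> 'l" assume F: "linear_form (UNIV :: 'l set) GA F" and f: "f \<in> carrier GA"
  have "(\<Sum>i\<in>carrier N. (if x = i then 1 else 0) * F (unit_fun i)) = F (unit_fun x)" if "x \<in> carrier N" for x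
    using that finite_N by (simp add: if_distrib[of "\<lambda>u. u * _"] cong: if_cong)
  then show "F f = (\<Sum>x\<in>carrier N. f x * (\<Sum>i\<in>carrier N. (if x = i then 1 else 0) * F (unit_fun i)))"
    using F by (subst GA_linear[of F, OF _ _ f]) (auto simp: linear_form_def GA_simps)
qed

end

section \<open>Vector spaces and Hopf algebras modelled on the invariants of L[N]\<close>

locale descent_rep = descent K N \<phi>
  for K :: "'l :: field set" and N :: "('a, 'y) monoid_scheme" and \<phi> +
  fixes H :: "('l, 'h, 'm) hopf_scheme" and r :: "'h \<Rightarrow> 'a \<Rightarrow> 'l"
  assumes r_bij: "bij_betw r (carrier H) W"
    and H_add: "h \<in> carrier H \<Longrightarrow> k \<in> carrier H \<Longrightarrow> h \<oplus>\<^bsub>H\<^esub> k \<in> carrier H"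
    and r_add: "h \<in> carrier H \<Longrightarrow> k \<in> carrier H \<Longrightarrow> r (h \<oplus>\<^bsub>H\<^esub> k) = (\<lambda>g. r h g + r k g)"
    and H_smult: "c \<in> K \<Longrightarrow> h \<in> carrier H \<Longrightarrow> c \<odot>\<^bsub>H\<^esub> h \<in> carrier H"
    and r_smult: "c \<in> K \<Longrightarrow> h \<in> carrier H \<Longrightarrow> r (c \<odot>\<^bsub>H\<^esub> h) = (\<lambda>g. c * r h g)"
begin

lemma r_W: "h \<in> carrier H \<Longrightarrow> r h \<in> W"
  using r_bij by (auto simp: bij_betw_def)

lemma r_inject: "h \<in> carrier H \<Longrightarrow> k \<in> carrier H \<Longrightarrow> r h = r k \<Longrightarrow> h = k"
  using r_bij by (auto simp: bij_betw_def inj_on_def)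

definition act :: "'h \<Rightarrow> 'l \<Rightarrow> 'l" where "act h = opr (r h)"

lemma H_frame:
  obtains a e where "frame K H (carrier N) r (carrier N) a e"
    "\<And>i. i \<in> carrier N \<Longrightarrow> e i \<in> carrier H"
    "\<And>x y. x \<in> carrier N \<Longrightarrow> y \<in> carrier N \<Longrightarrow> (\<Sum>i\<in>carrier N. a x i * r (e i) y) = (if x = y then 1 else 0)"
    "\<And>j. j \<in> carrier N \<Longrightarrow> (\<lambda>x. if x \<in> carrier N then a x j else 0) \<in> W"
    "\<And>f i. f \<in> W \<Longrightarrow> i \<in> carrier N \<Longrightarrow> (\<Sum>x\<in>carrier N. f x * a x i) \<in> K"
  by (rule A.frame_of_invariants[OF r_bij]) (auto simp: H_add r_add H_smult r_smult intro: that)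

lemma tensor_eq_HHI:
  assumes "set s \<subseteq> carrier H \<times> carrier H" "set t \<subseteq> carrier H \<times> carrier H"
    "\<And>g g'. g \<in> carrier N \<Longrightarrow> g' \<in> carrier N \<Longrightarrow>
      (\<Sum>(u, v)\<leftarrow>s. r u g * r v g') = (\<Sum>(u, v)\<leftarrow>t. r u g * r v g')"
  shows "tensor_eq K H H s t"
proof (rule H_frame)
  fix a e assume "frame K H (carrier N) r (carrier N) a e"
  from tensor_eqI[OF this this assms] show ?thesis .
qed

text \<open>A tensor in H \<otimes> H is determined by the operation it induces on pairs (x, y):
  independence of automorphisms in x and then in y recovers its coordinates. So an action on
  products leaves no choice for a coproduct.\<close>

lemma tensor_eq_HHI_act:
  assumes s: "set s \<subseteq> carrier H \<times> carrier H" and t: "set t \<subseteq> carrier H \<times> carrier H"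
    and eq: "\<And>x y. (\<Sum>(u, v)\<leftarrow>s. act u x * act v y) = (\<Sum>(u, v)\<leftarrow>t. act u x * act v y)"
  shows "tensor_eq K H H s t"
proof (rule tensor_eq_HHI[OF s t])
  fix g g' assume g: "g \<in> carrier N" and g': "g' \<in> carrier N"
  have val: "(\<Sum>(u, v)\<leftarrow>w. act u x * act v y) = opr (\<lambda>g. opr (\<lambda>g'. \<Sum>(u, v)\<leftarrow>w. r u g * r v g') y) x" for w x y
  proof (induction w)
    case Nil
    show ?case by (simp add: opr_def)
  next
    case (Cons p w)
    have "opr (\<lambda>g. c * f g) z = c * opr f z" "opr (\<lambda>g. f g * c) z = opr f z * c" for c f z
      by (simp_all add: opr_def sum_distrib_left sum_distrib_right mult_ac)
    then show ?case using Cons by (simp add: case_prod_unfold opr_add act_def)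
  qed
  have "opr (\<lambda>g. opr (\<lambda>g'. \<Sum>(u, v)\<leftarrow>s. r u g * r v g') y) = opr (\<lambda>g. opr (\<lambda>g'. \<Sum>(u, v)\<leftarrow>t. r u g * r v g') y)" for y
    using eq[of _ y] unfolding val by auto
  from opr_inject[OF this g] have "opr (\<lambda>g'. \<Sum>(u, v)\<leftarrow>s. r u g * r v g') = opr (\<lambda>g'. \<Sum>(u, v)\<leftarrow>t. r u g * r v g')"
    by auto
  from opr_inject[OF this g'] show "(\<Sum>(u, v)\<leftarrow>s. r u g * r v g') = (\<Sum>(u, v)\<leftarrow>t. r u g * r v g')" .
qed

lemma tensor3_eq_HI:
  assumes "set s \<subseteq> carrier H \<times> carrier H \<times> carrier H" "set t \<subseteq> carrier H \<times> carrier H \<times> carrier H"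
    "\<And>x y z. x \<in> carrier N \<Longrightarrow> y \<in> carrier N \<Longrightarrow> z \<in> carrier N \<Longrightarrow>
      (\<Sum>(u, v, w)\<leftarrow>s. r u x * r v y * r w z) = (\<Sum>(u, v, w)\<leftarrow>t. r u x * r v y * r w z)"
  shows "tensor3_eq K H H H s t"
proof (rule H_frame)
  fix a e assume "frame K H (carrier N) r (carrier N) a e"
  from tensor3_eqI[OF this this this assms] show ?thesis .
qed

definition coords :: "('l \<times> 'h) list \<Rightarrow> 'a \<Rightarrow> 'l" where
  "coords s g = (\<Sum>(l, h)\<leftarrow>s. l * r h g)"

text \<open>Equal tensors have equal coordinates because evaluation respects
  \<open>tensor_eq\<close>. Conversely, the frames test the products of \<sigma> l and r h g; since
  r h is invariant, their sum is \<sigma> applied to the coordinate function at the point that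
  \<open>twist \<sigma>\<close> moves to g.\<close>

lemma tensor_eq_LH_iff:
  assumes s: "set s \<subseteq> UNIV \<times> carrier H" and t: "set t \<subseteq> UNIV \<times> carrier H"
  shows "tensor_eq K top_module H s t \<longleftrightarrow> coords s = coords t"
proof
  assume "tensor_eq K top_module H s t"
  then have "(\<Sum>(l, h)\<leftarrow>s. l * r h g) = (\<Sum>(l, h)\<leftarrow>t. l * r h g)" for g
    by (rule tensor_eq_eval) (auto simp: r_add r_smult)
  then show "coords s = coords t" by (auto simp: coords_def)
next
  assume eq: "coords s = coords t"
  show "tensor_eq K top_module H s t"
  proof (rule top_frame, rule H_frame)
    fix a :: "('l \<Rightarrow> 'l) \<Rightarrow> ('l \<Rightarrow> 'l) \<Rightarrow> 'l" and e a' e'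
    assume 1: "frame K top_module Gal (\<lambda>l s. if s \<in> Gal then s l else 0) Gal a e"
      and 2: "frame K H (carrier N) r (carrier N) a' e'"
    show ?thesis
    proof (rule tensor_eqI[OF 1 2])
      fix \<sigma> g assume \<sigma>: "\<sigma> \<in> Gal" and g: "g \<in> carrier N"
      let ?g = "twist (Hilbert_Choice.inv \<sigma>) g"
      have g': "?g \<in> carrier N" "twist \<sigma> ?g = g" using \<sigma> g A.T_inv(2) Gal_inv by auto
      have "(\<Sum>(l, h)\<leftarrow>u. (if \<sigma> \<in> Gal then \<sigma> l else 0) * r h g) = \<sigma> (coords u ?g)"
        if "set u \<subseteq> UNIV \<times> carrier H" for u
      proof -
        have rg: "r h g = \<sigma> (r h ?g)" if "h \<in> carrier H" for h
          using A.InvD(2)[OF r_W[OF that] \<sigma> g'(1)] g'(2) by simp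
        show ?thesis unfolding coords_def Gal_sum_list[OF \<sigma>]
          using that \<sigma> rg by (intro sum_list_cong) (auto simp: Gal_mult)
      qed
      then show "(\<Sum>(l, h)\<leftarrow>s. (if \<sigma> \<in> Gal then \<sigma> l else 0) * r h g) =
          (\<Sum>(l, h)\<leftarrow>t. (if \<sigma> \<in> Gal then \<sigma> l else 0) * r h g)" using s t eq by simp
    qed (use s t in auto)
  qed
qed

lemma coords_off: assumes "set s \<subseteq> UNIV \<times> carrier H" "g \<notin> carrier N" shows "coords s g = 0"
  unfolding coords_def using A.InvD(1)[OF r_W assms(2)] assms(1)
  by (induction s) auto

lemma coords_surj:
  assumes "\<And>g. g \<notin> carrier N \<Longrightarrow> f g = 0"
  obtains s where "set s \<subseteq> UNIV \<times> carrier H" "coords s = f"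
proof (rule H_frame)
  fix a e assume e: "\<And>i. i \<in> carrier N \<Longrightarrow> e i \<in> carrier H"
    and ae: "\<And>x y. x \<in> carrier N \<Longrightarrow> y \<in> carrier N \<Longrightarrow> (\<Sum>i\<in>carrier N. a x i * r (e i) y) = (if x = y then 1 else 0)"
  obtain xs where xs: "set xs = carrier N" "distinct xs" using finite_distinct_list[OF finite_N] by blast
  let ?s = "map (\<lambda>i. (\<Sum>x\<in>carrier N. f x * a x i, e i)) xs"
  have s: "set ?s \<subseteq> UNIV \<times> carrier H" using e xs by auto
  have "coords ?s g = f g" for g
  proof (cases "g \<in> carrier N")
    case True
    have "coords ?s g = (\<Sum>i\<in>carrier N. (\<Sum>x\<in>carrier N. f x * a x i) * r (e i) g)"
      unfolding coords_def by (simp add: comp_def sum_list_distinct_conv_sum_set[OF xs(2)] xs(1))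
    also have "\<dots> = f g" using A.basis_expansion[of a "\<lambda>i. r (e i)" g f] ae True by simp
    finally show ?thesis .
  qed (use coords_off[OF s] assms in auto)
  then show thesis using s that by blast
qed

lemma act_sum_coords: "(\<Sum>(l, h)\<leftarrow>s. l * act h x) = opr (coords s) x"
  unfolding act_def opr_def coords_def sum_list_mult_const[symmetric]
  by (simp add: sum_sum_list sum_distrib_left mult.assoc case_prod_unfold)

end

context galois_extension
begin

lemma K_uminus: "a \<in> K \<Longrightarrow> - a \<in> K"
  using fixed_in_K[of "- a"] by (simp add: Gal_minus Gal_K)

lemma cring_scalars: "cring (scalars K)"
proof (rule cringI)
  show "abelian_group (scalars K)"
    by (rule abelian_groupI) (auto simp: scalars_def intro!: bexI[of _ "- _"] K_uminus)
  show "comm_monoid (scalars K)"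
    by (rule comm_monoidI) (auto simp: scalars_def)
qed (auto simp: scalars_def algebra_simps)

end

text \<open>The Hopf operations as seen in L[N]: convolution, diagonal coproduct, augmentation and
  inversion. All axioms of a Hopf-Galois structure of type N are consequences of these coordinate
  descriptions.\<close>

locale hopf_rep = descent_rep K N \<phi> H r
  for K :: "'l :: field set" and N :: "('a, 'y) monoid_scheme" and \<phi> and H :: "('l, 'h, 'm) hopf_scheme" and r +
  assumes H_abelian: "abelian_group H"
    and H_mult: "h \<in> carrier H \<Longrightarrow> k \<in> carrier H \<Longrightarrow> h \<otimes>\<^bsub>H\<^esub> k \<in> carrier H"
    and r_mult: "h \<in> carrier H \<Longrightarrow> k \<in> carrier H \<Longrightarrow> r (h \<otimes>\<^bsub>H\<^esub> k) = conv (r h) (r k)"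
    and H_one: "\<one>\<^bsub>H\<^esub> \<in> carrier H" and r_one: "r \<one>\<^bsub>H\<^esub> = unit_fun \<one>\<^bsub>N\<^esub>"
    and H_comult: "h \<in> carrier H \<Longrightarrow> set (comult H h) \<subseteq> carrier H \<times> carrier H"
    and r_comult: "h \<in> carrier H \<Longrightarrow> g \<in> carrier N \<Longrightarrow> g' \<in> carrier N \<Longrightarrow>
      (\<Sum>(u, v)\<leftarrow>comult H h. r u g * r v g') = (if g = g' then r h g else 0)"
    and r_counit: "h \<in> carrier H \<Longrightarrow> counit H h = (\<Sum>g\<in>carrier N. r h g)"
    and H_antipode: "h \<in> carrier H \<Longrightarrow> antipode H h \<in> carrier H"
    and r_antipode: "h \<in> carrier H \<Longrightarrow> r (antipode H h) = anti (r h)"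
begin

interpretation H: abelian_group H by (rule H_abelian)

sublocale GA: finite_group_algebra N
  by unfold_locales (rule finite_N)

lemma act_add: "h \<in> carrier H \<Longrightarrow> k \<in> carrier H \<Longrightarrow> act (h \<oplus>\<^bsub>H\<^esub> k) x = act h x + act k x"
  by (simp add: act_def r_add opr_add)

lemma act_smult: "c \<in> K \<Longrightarrow> h \<in> carrier H \<Longrightarrow> act (c \<odot>\<^bsub>H\<^esub> h) x = c * act h x"
  by (simp add: act_def r_smult opr_smult)

lemma act_mult: "h \<in> carrier H \<Longrightarrow> k \<in> carrier H \<Longrightarrow> act (h \<otimes>\<^bsub>H\<^esub> k) x = act h (act k x)"
  by (simp add: act_def r_mult opr_conv r_W)

lemma act_one: "act \<one>\<^bsub>H\<^esub> x = x"
  by (simp add: act_def r_one opr_unit)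

lemma act_endo: "act h (x + y) = act h x + act h y" "c \<in> K \<Longrightarrow> act h (c * x) = c * act h x"
  using opr_endomorphism[of "r h"] by (auto simp: act_def endomorphisms_def)

text \<open>H acts faithfully, so ring and module identities in H are checked as identities of
  operators on L.\<close>

lemma act_inject: assumes "h \<in> carrier H" "k \<in> carrier H" "\<And>x. act h x = act k x" shows "h = k"
proof -
  have "opr (r h) = opr (r k)" using assms(3) unfolding act_def by auto
  then show ?thesis using assms(1,2) r_W W_eqI r_inject by metis
qed

lemma H_ring: "ring H"
proof (rule ringI[OF H_abelian])
  show "Group.monoid H"
    by (rule monoidI) (auto simp: H_mult H_one act_mult act_one intro!: act_inject)
qed (auto simp: H_mult act_mult act_add act_endo intro!: act_inject)

lemma H_module: "module (scalars K) H"
proof (rule moduleI[OF cring_scalars H_abelian])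
  fix c x assume "c \<in> carrier (scalars K)" "x \<in> carrier H"
  then show "c \<odot>\<^bsub>H\<^esub> x \<in> carrier H" by (simp add: H_smult scalars_def)
next
  fix c d x assume "c \<in> carrier (scalars K)" "d \<in> carrier (scalars K)" "x \<in> carrier H"
  then show "(c \<oplus>\<^bsub>scalars K\<^esub> d) \<odot>\<^bsub>H\<^esub> x = c \<odot>\<^bsub>H\<^esub> x \<oplus>\<^bsub>H\<^esub> d \<odot>\<^bsub>H\<^esub> x"
    "(c \<otimes>\<^bsub>scalars K\<^esub> d) \<odot>\<^bsub>H\<^esub> x = c \<odot>\<^bsub>H\<^esub> (d \<odot>\<^bsub>H\<^esub> x)"
    by (auto intro!: act_inject simp: scalars_def H_smult act_smult act_add K_add K_mult algebra_simps)
next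
  fix c x y assume "c \<in> carrier (scalars K)" "x \<in> carrier H" "y \<in> carrier H"
  then show "c \<odot>\<^bsub>H\<^esub> (x \<oplus>\<^bsub>H\<^esub> y) = c \<odot>\<^bsub>H\<^esub> x \<oplus>\<^bsub>H\<^esub> c \<odot>\<^bsub>H\<^esub> y"
    by (auto intro!: act_inject simp: scalars_def H_smult act_smult act_add algebra_simps)
next
  fix x assume "x \<in> carrier H"
  then show "\<one>\<^bsub>scalars K\<^esub> \<odot>\<^bsub>H\<^esub> x = x"
    by (auto intro!: act_inject simp: scalars_def H_smult act_smult)
qed

lemma r_zero: "r \<zero>\<^bsub>H\<^esub> g = 0"
proof -
  have "r \<zero>\<^bsub>H\<^esub> g = r \<zero>\<^bsub>H\<^esub> g + r \<zero>\<^bsub>H\<^esub> g"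
    using fun_cong[OF r_add[of "\<zero>\<^bsub>H\<^esub>" "\<zero>\<^bsub>H\<^esub>"], of g] by simp
  then show ?thesis by (metis add_cancel_left_left)
qed

lemma list_add_closed: "set hs \<subseteq> carrier H \<Longrightarrow> list_add H hs \<in> carrier H"
  by (induction hs) (auto simp: list_add_def)

lemma r_list_add: "set hs \<subseteq> carrier H \<Longrightarrow> r (list_add H hs) g = (\<Sum>h\<leftarrow>hs. r h g)"
proof (induction hs)
  case (Cons h hs)
  then show ?case using list_add_closed[of hs] by (simp add: list_add_def r_add)
qed (simp add: list_add_def r_zero)

lemma H_eqI:
  assumes "h \<in> carrier H" "k \<in> carrier H" "\<And>g. g \<in> carrier N \<Longrightarrow> r h g = r k g" shows "h = k"
proof (rule r_inject[OF assms(1,2)])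
  show "r h = r k"
    using assms(3) A.InvD(1)[OF r_W[OF assms(1)]] A.InvD(1)[OF r_W[OF assms(2)]] by (metis (full_types) HOL.ext)
qed

lemma comultD: "h \<in> carrier H \<Longrightarrow> (u, v) \<in> set (comult H h) \<Longrightarrow> u \<in> carrier H \<and> v \<in> carrier H"
  using H_comult by blast

lemma counit_K: "h \<in> carrier H \<Longrightarrow> counit H h \<in> K"
  using sum_W_K r_W by (simp add: r_counit)

lemma r_counit_smult: "h \<in> carrier H \<Longrightarrow> k \<in> carrier H \<Longrightarrow>
    r (counit H h \<odot>\<^bsub>H\<^esub> k) = (\<lambda>g. (\<Sum>y\<in>carrier N. r h y) * r k g)"
  by (simp add: r_smult[OF counit_K] r_counit[symmetric])

text \<open>The diagonal coproduct summed against an arbitrary kernel; with suitable kernels this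
  gives the multiplicativity of the coproduct and the action on products.\<close>

lemma comult_sum:
  assumes h: "h \<in> carrier H"
  shows "(\<Sum>(u, v)\<leftarrow>comult H h. \<Sum>g\<in>carrier N. \<Sum>g'\<in>carrier N. r u g * r v g' * F g g') = (\<Sum>g\<in>carrier N. r h g * F g g)"
proof -
  have "(\<Sum>(u, v)\<leftarrow>comult H h. \<Sum>g\<in>carrier N. \<Sum>g'\<in>carrier N. r u g * r v g' * F g g') =
      (\<Sum>g\<in>carrier N. \<Sum>g'\<in>carrier N. (\<Sum>(u, v)\<leftarrow>comult H h. r u g * r v g') * F g g')"
    by (simp add: case_prod_unfold sum_sum_list sum_list_mult_const[symmetric])
  also have "\<dots> = (\<Sum>g\<in>carrier N. \<Sum>g'\<in>carrier N. if g' = g then r h g * F g g else 0)"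
    by (intro sum.cong refl) (simp add: r_comult[OF h])
  also have "\<dots> = (\<Sum>g\<in>carrier N. r h g * F g g)"
    by (intro sum.cong refl) (simp add: finite_N)
  finally show ?thesis .
qed

lemma comult_sum_conv:
  assumes h: "h \<in> carrier H" and k: "k \<in> carrier H" and g: "g \<in> carrier N" "g' \<in> carrier N"
  shows "(\<Sum>(u, v)\<leftarrow>comult H h. \<Sum>(u', v')\<leftarrow>comult H k. r (u \<otimes>\<^bsub>H\<^esub> u') g * r (v \<otimes>\<^bsub>H\<^esub> v') g') =
    (if g = g' then conv (r h) (r k) g else 0)"
proof -
  have "(\<Sum>(u, v)\<leftarrow>comult H h. \<Sum>(u', v')\<leftarrow>comult H k. r (u \<otimes>\<^bsub>H\<^esub> u') g * r (v \<otimes>\<^bsub>H\<^esub> v') g') =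
    (\<Sum>(u, v)\<leftarrow>comult H h. \<Sum>(u', v')\<leftarrow>comult H k. \<Sum>y\<in>carrier N. \<Sum>y'\<in>carrier N. r u y * r v y' *
      (r u' (inv\<^bsub>N\<^esub> y \<otimes>\<^bsub>N\<^esub> g) * r v' (inv\<^bsub>N\<^esub> y' \<otimes>\<^bsub>N\<^esub> g')))"
    using comultD[OF h] comultD[OF k] g
    by (intro sum_list_cong) (auto intro!: sum_list_cong simp: r_mult convolution_def sum_product algebra_simps)
  also have "\<dots> = (\<Sum>(u, v)\<leftarrow>comult H h. \<Sum>y\<in>carrier N. \<Sum>y'\<in>carrier N. r u y * r v y' *
      (\<Sum>(u', v')\<leftarrow>comult H k. r u' (inv\<^bsub>N\<^esub> y \<otimes>\<^bsub>N\<^esub> g) * r v' (inv\<^bsub>N\<^esub> y' \<otimes>\<^bsub>N\<^esub> g')))"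
    by (simp add: case_prod_unfold sum_sum_list[symmetric] sum_list_const_mult)
  also have "\<dots> = (\<Sum>y\<in>carrier N. r h y * (\<Sum>(u', v')\<leftarrow>comult H k. r u' (inv\<^bsub>N\<^esub> y \<otimes>\<^bsub>N\<^esub> g) * r v' (inv\<^bsub>N\<^esub> y \<otimes>\<^bsub>N\<^esub> g')))"
    by (rule comult_sum[OF h])
  also have "\<dots> = (\<Sum>y\<in>carrier N. r h y * (if g = g' then r k (inv\<^bsub>N\<^esub> y \<otimes>\<^bsub>N\<^esub> g) else 0))"
    using g by (intro sum.cong) (simp_all add: r_comult[OF k])
  also have "\<dots> = (if g = g' then conv (r h) (r k) g else 0)"
    using g by (simp add: convolution_def)
  finally show ?thesis .
qed

text \<open>Both iterated coproducts have the coordinates r h x for x = y = z and 0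
  elsewhere.\<close>

lemma H_coassoc:
  assumes h: "h \<in> carrier H"
  shows "tensor3_eq K H H H
    [(u, u', v). (w, v) \<leftarrow> comult H h, (u, u') \<leftarrow> comult H w]
    [(u, v, v'). (u, w) \<leftarrow> comult H h, (v, v') \<leftarrow> comult H w]"
proof (rule tensor3_eq_HI)
  fix x y z assume xyz: "x \<in> carrier N" "y \<in> carrier N" "z \<in> carrier N"
  have "(\<Sum>(u, v, w)\<leftarrow>[(u, u', v). (w, v) \<leftarrow> comult H h, (u, u') \<leftarrow> comult H w]. r u x * r v y * r w z) =
      (\<Sum>(w, v)\<leftarrow>comult H h. (\<Sum>(u, u')\<leftarrow>comult H w. r u x * r u' y) * r v z)"
    by (simp add: sum_list_map_concat case_prod_unfold comp_def sum_list_mult_const[symmetric])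
  also have "\<dots> = (\<Sum>(w, v)\<leftarrow>comult H h. (if x = y then 1 else 0) * (r w x * r v z))"
    using comultD[OF h] xyz by (intro sum_list_cong) (auto simp: r_comult)
  also have "\<dots> = (if x = y then 1 else 0) * (\<Sum>(w, v)\<leftarrow>comult H h. r w x * r v z)"
    by (simp add: sum_list_const_mult case_prod_unfold)
  also have "\<dots> = (if y = z then 1 else 0) * (\<Sum>(u, w)\<leftarrow>comult H h. r u x * r w y)"
    using xyz by (simp add: r_comult[OF h])
  also have "\<dots> = (\<Sum>(u, w)\<leftarrow>comult H h. (if y = z then 1 else 0) * (r u x * r w y))"
    by (simp add: sum_list_const_mult case_prod_unfold)
  also have "\<dots> = (\<Sum>(u, w)\<leftarrow>comult H h. r u x * (\<Sum>(v, v')\<leftarrow>comult H w. r v y * r v' z))"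
    using comultD[OF h] xyz by (intro sum_list_cong) (auto simp: r_comult)
  also have "\<dots> = (\<Sum>p\<leftarrow>comult H h. \<Sum>q\<leftarrow>comult H (snd p). r (fst p) x * r (fst q) y * r (snd q) z)"
    by (simp only: case_prod_unfold sum_list_const_mult mult.assoc)
  also have "\<dots> = (\<Sum>(u, v, w)\<leftarrow>[(u, v, v'). (u, w) \<leftarrow> comult H h, (v, v') \<leftarrow> comult H w]. r u x * r v y * r w z)"
    by (simp add: sum_list_map_concat case_prod_unfold comp_def)
  finally show "(\<Sum>(u, v, w)\<leftarrow>[(u, u', v). (w, v) \<leftarrow> comult H h, (u, u') \<leftarrow> comult H w]. r u x * r v y * r w z) =
    (\<Sum>(u, v, w)\<leftarrow>[(u, v, v'). (u, w) \<leftarrow> comult H h, (v, v') \<leftarrow> comult H w]. r u x * r v y * r w z)" .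
qed (auto dest: comultD[OF h] comultD)

lemma H_counit_list:
  assumes h: "h \<in> carrier H"
  shows "list_add H [counit H u \<odot>\<^bsub>H\<^esub> v. (u, v) \<leftarrow> comult H h] = h"
    and "list_add H [counit H v \<odot>\<^bsub>H\<^esub> u. (u, v) \<leftarrow> comult H h] = h"
proof -
  have c: "set [counit H u \<odot>\<^bsub>H\<^esub> v. (u, v) \<leftarrow> comult H h] \<subseteq> carrier H"
    "set [counit H v \<odot>\<^bsub>H\<^esub> u. (u, v) \<leftarrow> comult H h] \<subseteq> carrier H"
    using comultD[OF h] by (auto simp: H_smult counit_K)
  have one: "(\<Sum>y\<in>carrier N. if g = y then r h y else 0) = r h g" if "g \<in> carrier N" for g
    using that finite_N by simp
  show "list_add H [counit H u \<odot>\<^bsub>H\<^esub> v. (u, v) \<leftarrow> comult H h] = h"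
  proof (rule H_eqI[OF list_add_closed[OF c(1)] h])
    fix g assume g: "g \<in> carrier N"
    have "r (list_add H [counit H u \<odot>\<^bsub>H\<^esub> v. (u, v) \<leftarrow> comult H h]) g = (\<Sum>(u, v)\<leftarrow>comult H h. \<Sum>y\<in>carrier N. r u y * r v g)"
      unfolding r_list_add[OF c(1)] map_map
      using comultD[OF h] by (intro sum_list_cong) (auto simp: r_counit_smult sum_distrib_right)
    also have "\<dots> = (\<Sum>y\<in>carrier N. if g = y then r h y else 0)"
      using g by (simp add: sum_sum_list[symmetric] case_prod_unfold)
        (intro sum.cong, auto simp: r_comult[OF h, unfolded case_prod_unfold])
    finally show "r (list_add H [counit H u \<odot>\<^bsub>H\<^esub> v. (u, v) \<leftarrow> comult H h]) g = r h g" using one g by simp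
  qed
  show "list_add H [counit H v \<odot>\<^bsub>H\<^esub> u. (u, v) \<leftarrow> comult H h] = h"
  proof (rule H_eqI[OF list_add_closed[OF c(2)] h])
    fix g assume g: "g \<in> carrier N"
    have "r (list_add H [counit H v \<odot>\<^bsub>H\<^esub> u. (u, v) \<leftarrow> comult H h]) g = (\<Sum>(u, v)\<leftarrow>comult H h. \<Sum>y\<in>carrier N. r u g * r v y)"
      unfolding r_list_add[OF c(2)] map_map
      using comultD[OF h] by (intro sum_list_cong) (auto simp: r_counit_smult sum_distrib_left mult.commute)
    also have "\<dots> = (\<Sum>y\<in>carrier N. if g = y then r h y else 0)"
      using g by (simp add: sum_sum_list[symmetric] case_prod_unfold)
        (intro sum.cong, auto simp: r_comult[OF h, unfolded case_prod_unfold])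
    finally show "r (list_add H [counit H v \<odot>\<^bsub>H\<^esub> u. (u, v) \<leftarrow> comult H h]) g = r h g" using one g by simp
  qed
qed

text \<open>On the diagonal the two arguments must coincide, which reads y^-1 = y^-1 g in the first
  sum and y = g^-1 y in the second. Either forces g = 1, and there the sum is the counit.\<close>

lemma H_antipode_list:
  assumes h: "h \<in> carrier H"
  shows "list_add H [antipode H u \<otimes>\<^bsub>H\<^esub> v. (u, v) \<leftarrow> comult H h] = counit H h \<odot>\<^bsub>H\<^esub> \<one>\<^bsub>H\<^esub>"
    and "list_add H [u \<otimes>\<^bsub>H\<^esub> antipode H v. (u, v) \<leftarrow> comult H h] = counit H h \<odot>\<^bsub>H\<^esub> \<one>\<^bsub>H\<^esub>"
proof -
  have c: "set [antipode H u \<otimes>\<^bsub>H\<^esub> v. (u, v) \<leftarrow> comult H h] \<subseteq> carrier H"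
    "set [u \<otimes>\<^bsub>H\<^esub> antipode H v. (u, v) \<leftarrow> comult H h] \<subseteq> carrier H"
    using comultD[OF h] by (auto simp: H_mult H_antipode)
  have rhs: "counit H h \<odot>\<^bsub>H\<^esub> \<one>\<^bsub>H\<^esub> \<in> carrier H" using h by (simp add: H_smult counit_K H_one)
  have rrhs: "r (counit H h \<odot>\<^bsub>H\<^esub> \<one>\<^bsub>H\<^esub>) g = (if g = \<one>\<^bsub>N\<^esub> then (\<Sum>y\<in>carrier N. r h y) else 0)" for g
    using h by (simp add: r_counit_smult H_one r_one unit_fun_def)
  have bij_inv: "bij_betw (\<lambda>y. inv\<^bsub>N\<^esub> y) (carrier N) (carrier N)"
    by (rule bij_betw_byWitness[where f' = "\<lambda>y. inv\<^bsub>N\<^esub> y"]) auto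
  show "list_add H [antipode H u \<otimes>\<^bsub>H\<^esub> v. (u, v) \<leftarrow> comult H h] = counit H h \<odot>\<^bsub>H\<^esub> \<one>\<^bsub>H\<^esub>"
  proof (rule H_eqI[OF list_add_closed[OF c(1)] rhs])
    fix g assume g: "g \<in> carrier N"
    have "r (list_add H [antipode H u \<otimes>\<^bsub>H\<^esub> v. (u, v) \<leftarrow> comult H h]) g =
        (\<Sum>(u, v)\<leftarrow>comult H h. \<Sum>y\<in>carrier N. r u (inv\<^bsub>N\<^esub> y) * r v (inv\<^bsub>N\<^esub> y \<otimes>\<^bsub>N\<^esub> g))"
      unfolding r_list_add[OF c(1)] map_map using comultD[OF h] g
      by (intro sum_list_cong) (auto simp: comp_def r_mult H_antipode r_antipode convolution_def reflection_def intro!: sum.cong)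
    also have "\<dots> = (\<Sum>y\<in>carrier N. if inv\<^bsub>N\<^esub> y = inv\<^bsub>N\<^esub> y \<otimes>\<^bsub>N\<^esub> g then r h (inv\<^bsub>N\<^esub> y) else 0)"
      using g by (simp add: sum_sum_list[symmetric] case_prod_unfold)
        (intro sum.cong, auto simp: r_comult[OF h, unfolded case_prod_unfold])
    also have "\<dots> = (\<Sum>y\<in>carrier N. if g = \<one>\<^bsub>N\<^esub> then r h (inv\<^bsub>N\<^esub> y) else 0)"
      using g by (intro sum.cong refl if_cong) (auto simp: eq_commute[of "inv\<^bsub>N\<^esub> _"])
    also have "\<dots> = (if g = \<one>\<^bsub>N\<^esub> then (\<Sum>y\<in>carrier N. r h y) else 0)"
      using sum.reindex_bij_betw[OF bij_inv, of "r h"] by simp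
    finally show "r (list_add H [antipode H u \<otimes>\<^bsub>H\<^esub> v. (u, v) \<leftarrow> comult H h]) g = r (counit H h \<odot>\<^bsub>H\<^esub> \<one>\<^bsub>H\<^esub>) g"
      by (simp add: rrhs)
  qed
  show "list_add H [u \<otimes>\<^bsub>H\<^esub> antipode H v. (u, v) \<leftarrow> comult H h] = counit H h \<odot>\<^bsub>H\<^esub> \<one>\<^bsub>H\<^esub>"
  proof (rule H_eqI[OF list_add_closed[OF c(2)] rhs])
    fix g assume g: "g \<in> carrier N"
    have "r (list_add H [u \<otimes>\<^bsub>H\<^esub> antipode H v. (u, v) \<leftarrow> comult H h]) g =
        (\<Sum>(u, v)\<leftarrow>comult H h. \<Sum>y\<in>carrier N. r u y * r v (inv\<^bsub>N\<^esub> g \<otimes>\<^bsub>N\<^esub> y))"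
      unfolding r_list_add[OF c(2)] map_map using comultD[OF h] g
      by (intro sum_list_cong) (auto simp: comp_def r_mult H_antipode r_antipode convolution_def reflection_def N.inv_mult_group intro!: sum.cong)
    also have "\<dots> = (\<Sum>y\<in>carrier N. if y = inv\<^bsub>N\<^esub> g \<otimes>\<^bsub>N\<^esub> y then r h y else 0)"
      using g by (simp add: sum_sum_list[symmetric] case_prod_unfold)
        (intro sum.cong, auto simp: r_comult[OF h, unfolded case_prod_unfold])
    also have "\<dots> = (\<Sum>y\<in>carrier N. if g = \<one>\<^bsub>N\<^esub> then r h y else 0)"
    proof (intro sum.cong refl if_cong)
      fix y assume y: "y \<in> carrier N"
      have "y = inv\<^bsub>N\<^esub> g \<otimes>\<^bsub>N\<^esub> y \<longleftrightarrow> g \<otimes>\<^bsub>N\<^esub> y = y"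
        using y g by (metis N.inv_solve_left)
      then show "y = inv\<^bsub>N\<^esub> g \<otimes>\<^bsub>N\<^esub> y \<longleftrightarrow> g = \<one>\<^bsub>N\<^esub>" using y g by simp
    qed
    also have "\<dots> = (if g = \<one>\<^bsub>N\<^esub> then (\<Sum>y\<in>carrier N. r h y) else 0)" by simp
    finally show "r (list_add H [u \<otimes>\<^bsub>H\<^esub> antipode H v. (u, v) \<leftarrow> comult H h]) g = r (counit H h \<odot>\<^bsub>H\<^esub> \<one>\<^bsub>H\<^esub>) g"
      by (simp add: rrhs)
  qed
qed

text \<open>The sum of the coefficients is the operator applied to 1. The inner operator yields an
  element of K at 1, and the outer one is K-linear.\<close>

lemma sum_conv:
  "f \<in> W \<Longrightarrow> f' \<in> W \<Longrightarrow> (\<Sum>g\<in>carrier N. conv f f' g) = (\<Sum>g\<in>carrier N. f g) * (\<Sum>g\<in>carrier N. f' g)"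
  using opr_conv[of f' f 1] opr_endomorphism[of f] sum_W_K[of f']
  unfolding opr_1 endomorphisms_def mem_Collect_eq by (metis mult.commute mult.right_neutral opr_1)

lemma H_smult_mult:
  assumes "a \<in> K" "h \<in> carrier H" "k \<in> carrier H"
  shows "(a \<odot>\<^bsub>H\<^esub> h) \<otimes>\<^bsub>H\<^esub> k = a \<odot>\<^bsub>H\<^esub> (h \<otimes>\<^bsub>H\<^esub> k)"
    and "h \<otimes>\<^bsub>H\<^esub> (a \<odot>\<^bsub>H\<^esub> k) = a \<odot>\<^bsub>H\<^esub> (h \<otimes>\<^bsub>H\<^esub> k)"
  using assms by (auto intro!: act_inject simp: H_mult H_smult act_mult act_smult act_endo)

lemma H_hopf: "hopf_algebra K H"
proof (rule hopf_algebra.intro)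
  fix h assume h: "h \<in> carrier H"
  note cl = comultD[OF h]
  { fix a assume a: "a \<in> K"
    show "antipode H (a \<odot>\<^bsub>H\<^esub> h) = a \<odot>\<^bsub>H\<^esub> antipode H h"
      using a h by (intro H_eqI) (auto simp: H_antipode H_smult r_antipode r_smult reflection_def)
    show "tensor_eq K H H (comult H (a \<odot>\<^bsub>H\<^esub> h)) [(a \<odot>\<^bsub>H\<^esub> u, v). (u, v) \<leftarrow> comult H h]"
    proof (rule tensor_eq_HHI)
      fix g g' assume g: "g \<in> carrier N" "g' \<in> carrier N"
      have "(\<Sum>(u, v)\<leftarrow>[(a \<odot>\<^bsub>H\<^esub> u, v). (u, v) \<leftarrow> comult H h]. r u g * r v g') = (\<Sum>(u, v)\<leftarrow>comult H h. a * (r u g * r v g'))"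
        unfolding map_map using cl a by (intro sum_list_cong) (auto simp: r_smult)
      also have "\<dots> = a * (\<Sum>(u, v)\<leftarrow>comult H h. r u g * r v g')" by (simp only: sum_list_const_mult case_prod_unfold)
      finally show "(\<Sum>(u, v)\<leftarrow>comult H (a \<odot>\<^bsub>H\<^esub> h). r u g * r v g') =
          (\<Sum>(u, v)\<leftarrow>[(a \<odot>\<^bsub>H\<^esub> u, v). (u, v) \<leftarrow> comult H h]. r u g * r v g')"
        using g h a by (simp add: r_comult H_smult r_smult)
    qed (use cl h a H_smult H_comult in \<open>auto simp: H_comult H_smult\<close>) }
  { fix k assume k: "k \<in> carrier H"
    show "antipode H (h \<oplus>\<^bsub>H\<^esub> k) = antipode H h \<oplus>\<^bsub>H\<^esub> antipode H k"
      using h k by (intro H_eqI) (auto simp: H_antipode r_antipode r_add reflection_def)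
    show "tensor_eq K H H (comult H (h \<oplus>\<^bsub>H\<^esub> k)) (comult H h @ comult H k)"
      using h k by (intro tensor_eq_HHI) (simp_all add: r_comult r_add H_comult)
    show "tensor_eq K H H (comult H (h \<otimes>\<^bsub>H\<^esub> k))
      [(u \<otimes>\<^bsub>H\<^esub> u', v \<otimes>\<^bsub>H\<^esub> v'). (u, v) \<leftarrow> comult H h, (u', v') \<leftarrow> comult H k]"
    proof (rule tensor_eq_HHI)
      fix g g' assume g: "g \<in> carrier N" "g' \<in> carrier N"
      show "(\<Sum>(u, v)\<leftarrow>comult H (h \<otimes>\<^bsub>H\<^esub> k). r u g * r v g') =
        (\<Sum>(u, v)\<leftarrow>[(u \<otimes>\<^bsub>H\<^esub> u', v \<otimes>\<^bsub>H\<^esub> v'). (u, v) \<leftarrow> comult H h, (u', v') \<leftarrow> comult H k]. r u g * r v g')"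
        using comult_sum_conv[OF h k g] r_comult[OF H_mult[OF h k] g] h k
        by (simp add: r_mult sum_list_map_concat case_prod_unfold comp_def)
    qed (use cl comultD[OF k] h k in \<open>auto simp: H_comult H_mult\<close>)
    show "counit H (h \<otimes>\<^bsub>H\<^esub> k) = counit H h * counit H k"
      using h k by (simp add: r_counit H_mult r_mult sum_conv r_W) }
next
  show "tensor_eq K H H (comult H \<one>\<^bsub>H\<^esub>) [(\<one>\<^bsub>H\<^esub>, \<one>\<^bsub>H\<^esub>)]"
    by (rule tensor_eq_HHI) (auto simp: H_comult H_one r_comult r_one unit_fun_def)
  show "linear_form K H (counit H)"
    by (auto simp: linear_form_def sum_W_K r_W r_counit H_add r_add H_smult r_smult sum.distrib sum_distrib_left)
  show "counit H \<one>\<^bsub>H\<^esub> = 1"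
    by (simp add: r_counit H_one r_one unit_fun_def finite_N)
qed (rule K_subfield H_module H_ring H_smult_mult H_comult H_coassoc H_counit_list
       H_antipode H_antipode_list; assumption?)+

text \<open>For products, the kernel \<psi> g x * \<psi> g' y restricted to the diagonal is \<psi> g
  (x y), since \<psi> g is an automorphism.\<close>

lemma H_module_algebra: "module_algebra K H act"
proof -
  have "act h (x * y) = (\<Sum>(u, v)\<leftarrow>comult H h. act u x * act v y)" if h: "h \<in> carrier H" for h x y
  proof -
    have "(\<Sum>(u, v)\<leftarrow>comult H h. act u x * act v y) =
        (\<Sum>(u, v)\<leftarrow>comult H h. \<Sum>g\<in>carrier N. \<Sum>g'\<in>carrier N. r u g * r v g' * (\<psi> g x * \<psi> g' y))"
      by (simp add: act_def opr_def sum_product mult_ac)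
    also have "\<dots> = act h (x * y)"
      unfolding comult_sum[OF h] act_def opr_def by (intro sum.cong) (auto simp: Gal_mult)
    finally show ?thesis by simp
  qed
  moreover have "act h 1 = counit H h" if "h \<in> carrier H" for h
    using that by (simp add: act_def opr_1 r_counit)
  ultimately show ?thesis
    by (simp add: module_algebra_def act_add act_smult act_mult act_one act_endo)
qed

section \<open>Base change to L and the Galois condition\<close>

abbreviation "LH \<equiv> tensor_space K top_module H"
abbreviation "cls \<equiv> tensor_class K top_module H"

lemma cls_LH: "set s \<subseteq> UNIV \<times> carrier H \<Longrightarrow> cls s \<in> LH"
  by (auto simp: tensor_space_def)

lemma rep_LH: "c \<in> LH \<Longrightarrow> set (tensor_rep c) \<subseteq> UNIV \<times> carrier H"
  using tensor_rep_space(1)[of c K top_module H] by simp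

lemma coords_rep: assumes s: "set s \<subseteq> UNIV \<times> carrier H" shows "coords (tensor_rep (cls s)) = coords s"
  using tensor_rep_class[of s top_module H K] s tensor_eq_LH_iff[OF s rep_LH[OF cls_LH[OF s]]] by simp

lemma coords_bij: "bij_betw (\<lambda>c. coords (tensor_rep c)) LH {f. \<forall>g. g \<notin> carrier N \<longrightarrow> f g = 0}"
  unfolding bij_betw_def
proof (intro conjI subset_antisym subsetI)
  show "inj_on (\<lambda>c. coords (tensor_rep c)) LH"
  proof (rule inj_onI)
    fix c d assume c: "c \<in> LH" and d: "d \<in> LH" and "coords (tensor_rep c) = coords (tensor_rep d)"
    then have "tensor_eq K top_module H (tensor_rep c) (tensor_rep d)"
      using tensor_eq_LH_iff rep_LH by blast
    then have "cls (tensor_rep c) = cls (tensor_rep d)"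
      using tensor_class_eq_iff[of "tensor_rep c" top_module H] rep_LH[OF c] by simp
    then show "c = d" using tensor_rep_space(2) c d by metis
  qed
  fix f :: "'a \<Rightarrow> 'l" assume "f \<in> {f. \<forall>g. g \<notin> carrier N \<longrightarrow> f g = 0}"
  then obtain s where s: "set s \<subseteq> UNIV \<times> carrier H" "coords s = f" using coords_surj[of f] by blast
  then show "f \<in> (\<lambda>c. coords (tensor_rep c)) ` LH"
    using coords_rep[OF s(1)] cls_LH[OF s(1)] by (intro image_eqI[of _ _ "cls s"]) auto
qed (use coords_off rep_LH in auto)

text \<open>The canonical map L \<otimes> H \<rightarrow> End(L) factors as coordinates followed by
  \<open>opr\<close>. The first map is bijective by descent; the second because automorphisms are
  independent and span the endomorphisms over L.\<close>

lemma H_galois: "hopf_galois_structure K (H, act)"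
proof -
  have "bij_betw opr {f. \<forall>g. g \<notin> carrier N \<longrightarrow> f g = 0} (endomorphisms K)"
    unfolding bij_betw_def
  proof (intro conjI subset_antisym subsetI)
    show "inj_on opr {f. \<forall>g. g \<notin> carrier N \<longrightarrow> f g = 0}"
    proof (intro inj_onI HOL.ext)
      fix f f' g assume "f \<in> {f. \<forall>g. g \<notin> carrier N \<longrightarrow> f g = 0}" "f' \<in> {f. \<forall>g. g \<notin> carrier N \<longrightarrow> f g = 0}" "opr f = opr f'"
      then show "f g = f' g" using opr_inject[of f f' g] by (cases "g \<in> carrier N") auto
    qed
    fix f assume "f \<in> endomorphisms K"
    then show "f \<in> opr ` {f. \<forall>g. g \<notin> carrier N \<longrightarrow> f g = 0}" by (rule endomorphism_opr) auto
  qed (use opr_endomorphism in auto)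
  from bij_betw_trans[OF coords_bij this]
  have "bij_betw (\<lambda>c x. \<Sum>(l, h)\<leftarrow>tensor_rep c. l * act h x) LH (endomorphisms K)"
    unfolding act_sum_coords comp_def by (simp add: fun_eq_iff cong: bij_betw_cong)
  then show ?thesis by (simp add: hopf_galois_structure_def H_hopf H_module_algebra)
qed

end

definition structure_image :: "('l, 'h, 'm) hopf_scheme \<times> ('h \<Rightarrow> 'l \<Rightarrow> 'l) \<Rightarrow> ('l \<Rightarrow> 'l) set" where
  "structure_image A = snd A ` carrier (fst A)"

context hopf_rep
begin

lemma coords_single: "coords [(l, h)] g = l * r h g"
  by (simp add: coords_def)

lemma coords_append: "coords (s @ t) g = coords s g + coords t g"
  by (simp add: coords_def)

lemma coords_scale: "coords [(a * l, h). (l, h) \<leftarrow> s] g = a * coords s g"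
  unfolding coords_def by (simp add: sum_list_const_mult[symmetric] case_prod_unfold comp_def mult.assoc)

lemma product_list_closed:
  assumes "set s \<subseteq> UNIV \<times> carrier H" "set t \<subseteq> UNIV \<times> carrier H"
  shows "set [(l * m, h \<otimes>\<^bsub>H\<^esub> k). (l, h) \<leftarrow> s, (m, k) \<leftarrow> t] \<subseteq> UNIV \<times> carrier H"
proof -
  have "h \<otimes>\<^bsub>H\<^esub> k \<in> carrier H" if "(l, h) \<in> set s" "(m, k) \<in> set t" for l h m k
    using that assms by (blast intro: H_mult)
  then show ?thesis by auto
qed

lemma coords_mult:
  assumes s: "set s \<subseteq> UNIV \<times> carrier H" and t: "set t \<subseteq> UNIV \<times> carrier H"
  shows "coords [(l * m, h \<otimes>\<^bsub>H\<^esub> k). (l, h) \<leftarrow> s, (m, k) \<leftarrow> t] = conv (coords s) (coords t)"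
proof
  fix g
  show "coords [(l * m, h \<otimes>\<^bsub>H\<^esub> k). (l, h) \<leftarrow> s, (m, k) \<leftarrow> t] g = conv (coords s) (coords t) g"
  proof (cases "g \<in> carrier N")
    case True
    have "coords [(l * m, h \<otimes>\<^bsub>H\<^esub> k). (l, h) \<leftarrow> s, (m, k) \<leftarrow> t] g =
        (\<Sum>(l, h)\<leftarrow>s. \<Sum>(m, k)\<leftarrow>t. l * m * r (h \<otimes>\<^bsub>H\<^esub> k) g)"
      by (simp add: coords_def sum_list_map_concat case_prod_unfold comp_def)
    also have "\<dots> = (\<Sum>(l, h)\<leftarrow>s. \<Sum>(m, k)\<leftarrow>t. \<Sum>y\<in>carrier N. (l * r h y) * (m * r k (inv\<^bsub>N\<^esub> y \<otimes>\<^bsub>N\<^esub> g)))"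
    proof (intro sum_list_cong, clarify, intro sum_list_cong, clarify)
      fix l h m k assume "(l, h) \<in> set s" "(m, k) \<in> set t"
      then have "h \<in> carrier H" "k \<in> carrier H" using s t by auto
      then have "l * m * r (h \<otimes>\<^bsub>H\<^esub> k) g = l * m * (\<Sum>y\<in>carrier N. r h y * r k (inv\<^bsub>N\<^esub> y \<otimes>\<^bsub>N\<^esub> g))"
        using True by (simp add: r_mult convolution_def)
      also have "\<dots> = (\<Sum>y\<in>carrier N. (l * r h y) * (m * r k (inv\<^bsub>N\<^esub> y \<otimes>\<^bsub>N\<^esub> g)))"
        unfolding sum_distrib_left by (intro sum.cong refl) (simp only: mult_ac)
      finally show "l * m * r (h \<otimes>\<^bsub>H\<^esub> k) g = (\<Sum>y\<in>carrier N. (l * r h y) * (m * r k (inv\<^bsub>N\<^esub> y \<otimes>\<^bsub>N\<^esub> g)))" .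
    qed
    also have "\<dots> = (\<Sum>y\<in>carrier N. \<Sum>(l, h)\<leftarrow>s. (l * r h y) * (\<Sum>(m, k)\<leftarrow>t. m * r k (inv\<^bsub>N\<^esub> y \<otimes>\<^bsub>N\<^esub> g)))"
      by (simp only: case_prod_unfold sum_sum_list[symmetric] sum_list_const_mult)
    also have "\<dots> = conv (coords s) (coords t) g"
      using True by (simp only: coords_def convolution_def case_prod_unfold sum_list_mult_const if_True)
    finally show ?thesis .
  next
    case False
    then show ?thesis by (simp add: coords_off[OF product_list_closed[OF s t]] convolution_def)
  qed
qed

lemma BC_simps:
  "carrier (base_change K H) = LH"
  "c \<otimes>\<^bsub>base_change K H\<^esub> d = cls [(l * m, h \<otimes>\<^bsub>H\<^esub> k). (l, h) \<leftarrow> tensor_rep c, (m, k) \<leftarrow> tensor_rep d]"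
  "\<one>\<^bsub>base_change K H\<^esub> = cls [(1, \<one>\<^bsub>H\<^esub>)]"
  "c \<oplus>\<^bsub>base_change K H\<^esub> d = cls (tensor_rep c @ tensor_rep d)"
  "a \<odot>\<^bsub>base_change K H\<^esub> c = cls [(a * l, h). (l, h) \<leftarrow> tensor_rep c]"
  "comult (base_change K H) c = [(cls [(l, u)], cls [(1, v)]). (l, h) \<leftarrow> tensor_rep c, (u, v) \<leftarrow> comult H h]"
  "counit (base_change K H) c = (\<Sum>(l, h)\<leftarrow>tensor_rep c. l * counit H h)"
  "antipode (base_change K H) c = cls [(l, antipode H h). (l, h) \<leftarrow> tensor_rep c]"
  by (auto simp: base_change_def Let_def)

lemma coords_GA: "c \<in> LH \<Longrightarrow> coords (tensor_rep c) \<in> carrier (group_algebra UNIV N)"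
  using coords_off[OF rep_LH] by (auto simp: GA.GA_carrier)

text \<open>The coordinate map is the required isomorphism. Each operation of the base change is
  defined through an arbitrary representative, so it is first evaluated on coordinates, which depend
  on the class alone.\<close>

lemma BC_iso: "(\<lambda>c. coords (tensor_rep c)) \<in> hopf_iso UNIV (base_change K H) (group_algebra UNIV N)"
  unfolding hopf_iso_def
proof (intro CollectI conjI ballI)
  let ?f = "\<lambda>c. coords (tensor_rep c)"
  have hom: "?f \<in> ring_hom (base_change K H) (group_algebra UNIV N)"
  proof (rule ring_hom_memI)
    fix c d assume "c \<in> carrier (base_change K H)" "d \<in> carrier (base_change K H)"
    then have c: "c \<in> LH" and d: "d \<in> LH" by (auto simp: BC_simps)
    note rc = rep_LH[OF c] and rd = rep_LH[OF d]
    note product_list_closed[OF rc rd]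
    then show "?f (c \<otimes>\<^bsub>base_change K H\<^esub> d) = ?f c \<otimes>\<^bsub>group_algebra UNIV N\<^esub> ?f d"
      unfolding BC_simps GA.GA_mult[OF coords_GA[OF c]] by (simp only: coords_rep coords_mult[OF rc rd])
    show "?f (c \<oplus>\<^bsub>base_change K H\<^esub> d) = ?f c \<oplus>\<^bsub>group_algebra UNIV N\<^esub> ?f d"
      using rc rd by (simp add: BC_simps GA.GA_simps coords_rep) (simp add: coords_append fun_eq_iff)
  next
    show "?f \<one>\<^bsub>base_change K H\<^esub> = \<one>\<^bsub>group_algebra UNIV N\<^esub>"
      by (simp add: BC_simps GA.GA_simps coords_rep H_one) (simp add: coords_def[abs_def] r_one)
  qed (auto simp: BC_simps coords_GA)
  have "{f. \<forall>g. g \<notin> carrier N \<longrightarrow> f g = 0} = carrier (group_algebra (UNIV :: 'l set) N)"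
    using GA.GA_carrier by blast
  then have "bij_betw ?f (carrier (base_change K H)) (carrier (group_algebra UNIV N))"
    using coords_bij by (simp add: BC_simps)
  then show "?f \<in> ring_iso (base_change K H) (group_algebra UNIV N)"
    using hom by (simp add: ring_iso_def)
next
  fix c assume "c \<in> carrier (base_change K H)"
  then have c: "c \<in> LH" by (simp add: BC_simps)
  note rc = rep_LH[OF c]
  let ?f = "\<lambda>c. coords (tensor_rep c)"
  { fix a
    have "set [(a * l, h). (l, h) \<leftarrow> tensor_rep c] \<subseteq> UNIV \<times> carrier H" using rc by auto
    then show "?f (a \<odot>\<^bsub>base_change K H\<^esub> c) = a \<odot>\<^bsub>group_algebra UNIV N\<^esub> ?f c"
      unfolding BC_simps GA.GA_simps by (simp only: coords_rep coords_scale[abs_def]) }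
  have sum_coords: "(\<Sum>g\<in>carrier N. coords s g) = (\<Sum>(l, h)\<leftarrow>s. l * counit H h)"
    if "set s \<subseteq> UNIV \<times> carrier H" for s
    unfolding coords_def sum_sum_list using that
    by (intro sum_list_cong) (auto simp: r_counit sum_distrib_left)
  show "counit (group_algebra UNIV N) (?f c) = counit (base_change K H) c"
    unfolding GA.GA_counit[OF coords_GA[OF c]] BC_simps by (rule sum_coords[OF rc])
  have "set [(l, antipode H h). (l, h) \<leftarrow> tensor_rep c] \<subseteq> UNIV \<times> carrier H"
    using rc by (auto simp: H_antipode)
  moreover have "coords [(l, antipode H h). (l, h) \<leftarrow> tensor_rep c] = anti (?f c)"
  proof
    fix g
    have "coords [(l, antipode H h). (l, h) \<leftarrow> tensor_rep c] g = (\<Sum>(l, h)\<leftarrow>tensor_rep c. l * anti (r h) g)"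
      unfolding coords_def map_map using rc by (intro sum_list_cong) (auto simp: r_antipode)
    then show "coords [(l, antipode H h). (l, h) \<leftarrow> tensor_rep c] g = anti (?f c) g"
      by (simp add: reflection_def coords_def case_prod_unfold)
  qed
  ultimately show "antipode (group_algebra UNIV N) (?f c) = ?f (antipode (base_change K H) c)"
    unfolding BC_simps GA.GA_simps by (simp only: coords_rep)
  show "tensor_eq UNIV (group_algebra UNIV N) (group_algebra UNIV N) (comult (group_algebra UNIV N) (?f c))
      [(?f u, ?f v). (u, v) \<leftarrow> comult (base_change K H) c]"
  proof (rule tensor_eqI[OF GA.GA_frame GA.GA_frame GA.GA_comult_closed[OF coords_GA[OF c]]])
    have cl: "cls [(l, u)] \<in> LH" "cls [(1, v)] \<in> LH"
      if "(l, h) \<in> set (tensor_rep c)" "(u, v) \<in> set (comult H h)" for l h u v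
      using that rc comultD[of h u v] by (auto intro!: cls_LH)
    then show "set [(?f u, ?f v). (u, v) \<leftarrow> comult (base_change K H) c] \<subseteq>
        carrier (group_algebra UNIV N) \<times> carrier (group_algebra UNIV N)"
      unfolding BC_simps by (auto intro!: coords_GA)
    fix g g' assume g: "g \<in> carrier N" "g' \<in> carrier N"
    have "(\<Sum>(v, w)\<leftarrow>[(?f u, ?f v). (u, v) \<leftarrow> comult (base_change K H) c]. v g * w g') =
        (\<Sum>(l, h)\<leftarrow>tensor_rep c. \<Sum>(u, v)\<leftarrow>comult H h. ?f (cls [(l, u)]) g * ?f (cls [(1, v)]) g')"
      unfolding BC_simps by (simp add: sum_list_map_concat case_prod_unfold comp_def)
    also have "\<dots> = (\<Sum>(l, h)\<leftarrow>tensor_rep c. l * (\<Sum>(u, v)\<leftarrow>comult H h. r u g * r v g'))"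
    proof (intro sum_list_cong, clarify)
      fix l h assume lh: "(l, h) \<in> set (tensor_rep c)"
      then have h: "h \<in> carrier H" using rc by auto
      have "(\<Sum>(u, v)\<leftarrow>comult H h. ?f (cls [(l, u)]) g * ?f (cls [(1, v)]) g') =
          (\<Sum>(u, v)\<leftarrow>comult H h. l * (r u g * r v g'))"
        using comultD[OF h] by (intro sum_list_cong) (auto simp: coords_rep coords_single)
      then show "(\<Sum>(u, v)\<leftarrow>comult H h. ?f (cls [(l, u)]) g * ?f (cls [(1, v)]) g') =
          l * (\<Sum>(u, v)\<leftarrow>comult H h. r u g * r v g')"
        by (simp only: case_prod_unfold sum_list_const_mult)
    qed
    also have "\<dots> = (\<Sum>(l, h)\<leftarrow>tensor_rep c. l * (if g = g' then r h g else 0))"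
      using rc g by (intro sum_list_cong) (auto simp: r_comult)
    also have "\<dots> = (if g = g' then ?f c g else 0)"
      by (simp add: coords_def case_prod_unfold)
    finally show "(\<Sum>(v, w)\<leftarrow>comult (group_algebra UNIV N) (?f c). v g * w g') =
        (\<Sum>(v, w)\<leftarrow>[(?f u, ?f v). (u, v) \<leftarrow> comult (base_change K H) c]. v g * w g')"
      using GA.GA_comult_value[OF coords_GA[OF c]] by simp
  qed
qed

lemma H_type: "has_type K N (H, act)"
  using BC_iso unfolding has_type_def by auto

lemma H_image: "structure_image (H, act) = op_image"
proof -
  have "op_image = opr ` r ` carrier H" using r_bij by (simp add: op_image_def bij_betw_def)
  then show ?thesis by (simp add: structure_image_def act_def image_image)
qed

end

section \<open>Existence of a structure for every brace map\<close>

context descent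
begin

text \<open>Transport of structure: the additive group of L carries the operations of
  \<open>W\<close> pulled back along the K-linear bijection \<Theta>, which makes the result a Hopf
  algebra of the type being counted.\<close>

theorem structure_exists:
  "\<exists>A :: ('l, 'l) hopf \<times> ('l \<Rightarrow> 'l \<Rightarrow> 'l). hopf_galois_structure K A \<and> has_type K N A \<and> structure_image A = op_image"
proof (rule linear_param)
  fix \<Theta> :: "'l \<Rightarrow> 'a \<Rightarrow> 'l"
  assume bij\<Theta>: "bij_betw \<Theta> UNIV W"
    and add: "\<And>x y. \<Theta> (x + y) = (\<lambda>g. \<Theta> x g + \<Theta> y g)"
    and smult: "\<And>c x. c \<in> K \<Longrightarrow> \<Theta> (c * x) = (\<lambda>g. c * \<Theta> x g)"
  define \<Xi> where "\<Xi> = inv_into UNIV \<Theta>"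
  have \<Theta>\<Xi>: "\<Theta> (\<Xi> f) = f" if "f \<in> W" for f
    using bij\<Theta> that by (simp add: \<Xi>_def bij_betw_def f_inv_into_f)
  have \<Theta>W: "\<Theta> x \<in> W" for x using bij\<Theta> by (auto simp: bij_betw_def)
  show ?thesis
  proof (rule A.frame_of_invariants[of \<Theta> "top_module :: ('l, 'l) module"])
    fix a :: "'a \<Rightarrow> 'a \<Rightarrow> 'l" and e
    assume ae: "\<And>x y. x \<in> carrier N \<Longrightarrow> y \<in> carrier N \<Longrightarrow> (\<Sum>i\<in>carrier N. a x i * \<Theta> (e i) y) = (if x = y then 1 else 0)"
      and aW: "\<And>j. j \<in> carrier N \<Longrightarrow> (\<lambda>x. if x \<in> carrier N then a x j else 0) \<in> W"
    obtain xs where xs: "set xs = carrier N" "distinct xs" using finite_distinct_list[OF finite_N] by blast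
    have aW': "(\<lambda>g. \<Theta> x g * a g j) \<in> W" if "j \<in> carrier N" for x j
    proof -
      have "(\<lambda>g. \<Theta> x g * a g j) = (\<lambda>g. \<Theta> x g * (if g \<in> carrier N then a g j else 0))"
        using A.InvD(1)[OF \<Theta>W[of x]] by auto
      then show ?thesis using A.Inv_mult[OF \<Theta>W aW[OF that], of x] by simp
    qed
    \<comment> \<open>With dual bases e and a, the coproduct of f is \<Sum> (f a_j) \<otimes> e_j:
      its coordinate at (g, g') is f g * \<Sum> a g j * e_j g', that is f g on the diagonal and 0
      off it. The left factors stay in \<open>W\<close> because the columns of a are
      invariant.\<close>
    define H :: "('l, 'l) hopf" where "H = \<lparr>carrier = UNIV, monoid.mult = (\<lambda>x y. \<Xi> (conv (\<Theta> x) (\<Theta> y))),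
      one = \<Xi> (unit_fun \<one>\<^bsub>N\<^esub>), ring.zero = 0, add = (+), smult = (*),
      comult = (\<lambda>x. map (\<lambda>j. (\<Xi> (\<lambda>g. \<Theta> x g * a g j), e j)) xs),
      counit = (\<lambda>x. \<Sum>g\<in>carrier N. \<Theta> x g), antipode = (\<lambda>x. \<Xi> (anti (\<Theta> x)))\<rparr>"
    have rep: "descent_rep K N \<phi> H \<Theta>"
      by unfold_locales (auto simp: H_def bij\<Theta> add smult)
    interpret hopf_rep K N \<phi> H \<Theta>
    proof (rule hopf_rep.intro[OF rep], rule hopf_rep_axioms.intro)
      have "\<exists>y. y + x = (0 :: 'l)" for x by (rule exI[of _ "- x"]) simp
      moreover have "\<exists>y. x + y = (0 :: 'l)" for x by (rule exI[of _ "- x"]) simp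
      ultimately show "abelian_group H"
        by (intro abelian_groupI) (auto simp: H_def)
      fix h g g' assume g: "g \<in> carrier N" "g' \<in> carrier N"
      have "(\<Sum>(u, v)\<leftarrow>comult H h. \<Theta> u g * \<Theta> v g') = (\<Sum>j\<leftarrow>xs. \<Theta> h g * (a g j * \<Theta> (e j) g'))"
        unfolding H_def hopf.simps map_map using xs
        by (intro sum_list_cong) (auto simp: \<Theta>\<Xi> aW')
      also have "\<dots> = \<Theta> h g * (\<Sum>j\<in>carrier N. a g j * \<Theta> (e j) g')"
        by (simp add: sum_list_distinct_conv_sum_set[OF xs(2)] xs(1) sum_list_const_mult)
      finally show "(\<Sum>(u, v)\<leftarrow>comult H h. \<Theta> u g * \<Theta> v g') = (if g = g' then \<Theta> h g else 0)"
        using ae g by simp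
    qed (auto simp: H_def \<Theta>\<Xi> \<Theta>W conv_W unit_W anti_W)
    show ?thesis using H_galois H_type H_image by blast
  qed (auto simp: bij\<Theta> add smult)
qed

text \<open>Expresses the product of N through operators: expand the unit function at h in
  invariants b_j and let g act in front. The element g h then appears as a combination of \<psi> g
  composed with operators of the structure.\<close>

lemma \<psi>_translate:
  assumes g: "g \<in> carrier N" and h: "h \<in> carrier N"
    and b: "\<And>j. j \<in> carrier N \<Longrightarrow> b j \<in> W"
    and c: "\<And>y. y \<in> carrier N \<Longrightarrow> (\<Sum>j\<in>carrier N. c j * b j y) = (if h = y then 1 else 0)"
  shows "\<psi> (g \<otimes>\<^bsub>N\<^esub> h) x = (\<Sum>j\<in>carrier N. c j * \<psi> g (opr (b j) x))"
proof -
  have u: "\<psi> g (opr (b j) x) = (\<Sum>y\<in>carrier N. b j (inv\<^bsub>N\<^esub> g \<otimes>\<^bsub>N\<^esub> y) * \<psi> y x)" if j: "j \<in> carrier N" for j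
  proof -
    have "\<psi> g (opr (b j) x) = opr (conv (unit_fun g) (b j)) x"
      using opr_conv[OF b[OF j], of "unit_fun g" x] opr_unit[OF g] by simp
    also have "conv (unit_fun g) (b j) y = b j (inv\<^bsub>N\<^esub> g \<otimes>\<^bsub>N\<^esub> y)" if "y \<in> carrier N" for y
      using that g by (simp add: convolution_def unit_fun_def finite_N if_distrib[of "\<lambda>u. u * _"] cong: if_cong)
    then have "opr (conv (unit_fun g) (b j)) x = (\<Sum>y\<in>carrier N. b j (inv\<^bsub>N\<^esub> g \<otimes>\<^bsub>N\<^esub> y) * \<psi> y x)"
      by (simp add: opr_def)
    finally show ?thesis .
  qed
  have "(\<Sum>j\<in>carrier N. c j * \<psi> g (opr (b j) x)) =
      (\<Sum>j\<in>carrier N. \<Sum>y\<in>carrier N. c j * b j (inv\<^bsub>N\<^esub> g \<otimes>\<^bsub>N\<^esub> y) * \<psi> y x)"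
    by (simp add: u sum_distrib_left mult.assoc)
  also have "\<dots> = (\<Sum>y\<in>carrier N. (\<Sum>j\<in>carrier N. c j * b j (inv\<^bsub>N\<^esub> g \<otimes>\<^bsub>N\<^esub> y)) * \<psi> y x)"
    by (subst sum.swap) (simp add: sum_distrib_right)
  also have "\<dots> = (\<Sum>y\<in>carrier N. if y = g \<otimes>\<^bsub>N\<^esub> h then \<psi> y x else 0)"
  proof (intro sum.cong refl)
    fix y assume y: "y \<in> carrier N"
    have "h = inv\<^bsub>N\<^esub> g \<otimes>\<^bsub>N\<^esub> y \<longleftrightarrow> y = g \<otimes>\<^bsub>N\<^esub> h" using g h y N.inv_solve_left by blast
    then show "(\<Sum>j\<in>carrier N. c j * b j (inv\<^bsub>N\<^esub> g \<otimes>\<^bsub>N\<^esub> y)) * \<psi> y x = (if y = g \<otimes>\<^bsub>N\<^esub> h then \<psi> y x else 0)"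
      using c[of "inv\<^bsub>N\<^esub> g \<otimes>\<^bsub>N\<^esub> y"] g y by simp
  qed
  also have "\<dots> = \<psi> (g \<otimes>\<^bsub>N\<^esub> h) x" using g h finite_N by simp
  finally show ?thesis by simp
qed

end

section \<open>When two brace maps define the same operators on L\<close>

locale two_descents = \<phi>: descent K N \<phi> + \<chi>: descent K N \<chi>
  for K :: "'l :: field set" and N :: "('a, 'y) monoid_scheme" and \<phi> \<chi>
begin

text \<open>Composing with \<theta> only renames the elements of N; the automorphism of L attached
  to an element and its renaming is the same.\<close>

lemma op_image_compose:
  assumes \<theta>: "\<theta> \<in> auto N" and eq: "\<chi> = compose \<phi>.Gal \<theta> \<phi>" and f: "f \<in> \<chi>.W"
  shows "(\<lambda>g. if g \<in> carrier N then f (\<theta> g) else 0) \<in> \<phi>.W"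
    "\<phi>.opr (\<lambda>g. if g \<in> carrier N then f (\<theta> g) else 0) = \<chi>.opr f"
proof -
  have \<chi>: "\<chi> s = \<theta> (\<phi> s)" if "s \<in> \<phi>.Gal" for s using that eq by (simp add: compose_eq)
  have tw: "\<chi>.twist s (\<theta> g) = \<theta> (\<phi>.twist s g)" if s: "s \<in> \<phi>.Gal" and g: "g \<in> carrier N" for s g
  proof -
    have "\<chi> s \<otimes>\<^bsub>N\<^esub> \<chi>.twist s (\<theta> g) = \<chi> (s \<circ> \<phi>.\<psi> g)"
      using \<chi>.mult[of s "\<phi>.\<psi> g"] s g by (simp add: \<chi>)
    also have "\<dots> = \<chi> s \<otimes>\<^bsub>N\<^esub> \<theta> (\<phi>.twist s g)"
      using \<phi>.mult[of s "\<phi>.\<psi> g"] s g by (simp add: \<chi> \<phi>.Gal_comp autoD(5)[OF \<theta>])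
    finally show ?thesis
      using s g \<chi>.closed[of s] autoD(4)[OF \<theta>] by simp
  qed
  show "(\<lambda>g. if g \<in> carrier N then f (\<theta> g) else 0) \<in> \<phi>.W"
    unfolding invariants_def using tw autoD(4)[OF \<theta>] \<chi>.A.InvD(2)[OF f]
    by (auto simp: tw[symmetric])
  show "\<phi>.opr (\<lambda>g. if g \<in> carrier N then f (\<theta> g) else 0) = \<chi>.opr f"
    by (rule HOL.ext) (simp add: \<phi>.opr_Gal \<chi>.opr_Gal \<chi>)
qed

text \<open>The candidate \<theta> matches elements of N that act as the same automorphism of L. It
  is multiplicative because the product of N can be read off from the operators: a descent basis for
  \<phi> has counterparts for \<chi> with equal operators and, after renaming by \<theta>, equal
  coefficients.\<close>

lemma op_image_eq_imp:
  assumes im: "\<phi>.op_image = \<chi>.op_image"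
  obtains \<theta> where "\<theta> \<in> auto N" "\<chi> = compose \<phi>.Gal \<theta> \<phi>"
proof -
  define \<theta> where "\<theta> = (\<lambda>g\<in>carrier N. \<chi> (\<phi>.\<psi> g))"
  have \<theta>: "\<theta> g \<in> carrier N" "\<chi>.\<psi> (\<theta> g) = \<phi>.\<psi> g" if "g \<in> carrier N" for g
    using that by (auto simp: \<theta>_def)
  have "\<theta> \<in> auto N"
  proof (rule autoI)
    have "bij_betw (\<lambda>g. \<chi> (\<phi>.\<psi> g)) (carrier N) (carrier N)"
      using bij_betw_trans[OF bij_betw_inv_into[OF \<phi>.bij] \<chi>.bij] by (simp add: \<phi>.\<psi>_def comp_def)
    then show "bij_betw \<theta> (carrier N) (carrier N)"
      by (rule iffD1[OF bij_betw_cong, rotated]) (simp add: \<theta>_def)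
    fix g h assume g: "g \<in> carrier N" and h: "h \<in> carrier N"
    show "\<theta> (g \<otimes>\<^bsub>N\<^esub> h) = \<theta> g \<otimes>\<^bsub>N\<^esub> \<theta> h"
    proof (rule \<phi>.A.descent_basis)
      fix b a :: "'a \<Rightarrow> 'a \<Rightarrow> 'l"
      assume b: "\<And>i. i \<in> carrier N \<Longrightarrow> b i \<in> \<phi>.W"
        and ab: "\<And>x y. x \<in> carrier N \<Longrightarrow> y \<in> carrier N \<Longrightarrow> (\<Sum>i\<in>carrier N. a x i * b i y) = (if x = y then 1 else 0)"
      have "\<forall>i\<in>carrier N. \<exists>f\<in>\<chi>.W. \<chi>.opr f = \<phi>.opr (b i)"
      proof
        fix i assume "i \<in> carrier N"
        then have "\<phi>.opr (b i) \<in> \<chi>.op_image" using im b unfolding \<phi>.op_image_def by blast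
        then show "\<exists>f\<in>\<chi>.W. \<chi>.opr f = \<phi>.opr (b i)" unfolding \<chi>.op_image_def by force
      qed
      then obtain b' where b': "\<And>i. i \<in> carrier N \<Longrightarrow> b' i \<in> \<chi>.W" "\<And>i. i \<in> carrier N \<Longrightarrow> \<chi>.opr (b' i) = \<phi>.opr (b i)"
        by metis
      have b'b: "b' i y = b i (\<phi> (\<chi>.\<psi> y))" if i: "i \<in> carrier N" and y: "y \<in> carrier N" for i y
      proof -
        have "(\<Sum>s\<in>\<phi>.Gal. b' i (\<chi> s) * s x) = (\<Sum>s\<in>\<phi>.Gal. b i (\<phi> s) * s x)" for x
          using b'(2)[OF i] unfolding \<phi>.opr_Gal[symmetric] \<chi>.opr_Gal[symmetric] by simp
        from \<phi>.dedekind_unique[OF this, of "\<chi>.\<psi> y"] y show ?thesis by simp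
      qed
      have "(\<Sum>j\<in>carrier N. a h j * b' j y) = (if \<theta> h = y then 1 else 0)" if y: "y \<in> carrier N" for y
      proof -
        have "h = \<phi> (\<chi>.\<psi> y) \<longleftrightarrow> \<theta> h = y"
          using h y \<theta>[OF h] by (metis \<chi>.\<phi>_\<psi> \<chi>.\<psi>_closed \<phi>.\<phi>_\<psi> \<phi>.\<psi>_\<phi>)
        then show ?thesis using ab[OF h, of "\<phi> (\<chi>.\<psi> y)"] y by (simp add: b'b)
      qed
      from \<chi>.\<psi>_translate[OF \<theta>(1)[OF g] \<theta>(1)[OF h] b'(1) this]
      have "\<chi>.\<psi> (\<theta> g \<otimes>\<^bsub>N\<^esub> \<theta> h) x = (\<Sum>j\<in>carrier N. a h j * \<phi>.\<psi> g (\<phi>.opr (b j) x))" for x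
        using b'(2) \<theta>(2)[OF g] by simp
      also have "\<dots> x = \<phi>.\<psi> (g \<otimes>\<^bsub>N\<^esub> h) x" for x
        using \<phi>.\<psi>_translate[OF g h b ab[OF h]] by simp
      finally have "\<chi>.\<psi> (\<theta> g \<otimes>\<^bsub>N\<^esub> \<theta> h) = \<phi>.\<psi> (g \<otimes>\<^bsub>N\<^esub> h)" by blast
      then show "\<theta> (g \<otimes>\<^bsub>N\<^esub> h) = \<theta> g \<otimes>\<^bsub>N\<^esub> \<theta> h"
        using \<chi>.\<phi>_\<psi>[of "\<theta> g \<otimes>\<^bsub>N\<^esub> \<theta> h"] g h \<theta>(1) by (simp add: \<theta>_def)
    qed
  qed (simp add: \<theta>_def)
  moreover have "\<chi> = compose \<phi>.Gal \<theta> \<phi>"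
    by (rule extensionalityI[OF \<chi>.extens compose_extensional]) (simp add: compose_eq \<theta>_def)
  ultimately show thesis by (rule that)
qed

end

section \<open>Elements of trace 1 and separating linear forms\<close>

context galois_extension
begin

lemma Gal_inverse: "s \<in> Gal \<Longrightarrow> s (inverse x) = inverse (s x)"
proof (cases "x = 0")
  case False
  assume s: "s \<in> Gal"
  have "s x * s (inverse x) = 1" using False Gal_mult[OF s, of x "inverse x"] Gal_1[OF s] by simp
  then show ?thesis by (metis inverse_unique)
qed (simp add: Gal_0)

lemma K_inverse: "a \<in> K \<Longrightarrow> inverse a \<in> K"
  by (rule fixed_in_K) (simp add: Gal_inverse Gal_K)

text \<open>Independence of automorphisms keeps the trace from vanishing identically, and a nonzero
  value can be scaled within K.\<close>

lemma ex_trace_1: obtains c where "tr c = 1"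
proof -
  have "\<exists>x. tr x \<noteq> 0"
    using dedekind_independent[of "\<lambda>_. 1" id] Gal_id by (auto simp: tr_def)
  then obtain x where x: "tr x \<noteq> 0" by blast
  have "tr (inverse (tr x) * x) = inverse (tr x) * tr x"
    by (rule tr_mult_K[OF K_inverse[OF tr_K]])
  then have "tr (inverse (tr x) * x) = 1" using x by simp
  then show thesis by (rule that)
qed

text \<open>\<open>H\<close> is not assumed finite-dimensional, so separating points needs Zorn's lemma: a maximal
  subspace avoiding \<open>h\<close> is the kernel of a linear form with value \<open>1\<close> at \<open>h\<close>.\<close>

lemma linear_forms_separate:
  assumes H: "module (scalars K) H" and h: "h \<in> carrier H" "h \<noteq> \<zero>\<^bsub>H\<^esub>"
  obtains f where "linear_form K H f" "f h \<noteq> 0"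
proof -
  interpret H: module "scalars K" H by (rule H)
  have sc: "carrier (scalars K) = K" "\<one>\<^bsub>scalars K\<^esub> = 1" "\<zero>\<^bsub>scalars K\<^esub> = 0"
    "a \<oplus>\<^bsub>scalars K\<^esub> b = a + b" "a \<otimes>\<^bsub>scalars K\<^esub> b = a * b" for a b
    by (auto simp: scalars_def)
  note smult_closed = H.smult_closed[unfolded sc]
    and l_distr = H.smult_l_distr[unfolded sc] and r_distr = H.smult_r_distr[unfolded sc]
    and assoc1 = H.smult_assoc1[unfolded sc] and smult_one = H.smult_one[unfolded sc]
  have l_null: "0 \<odot>\<^bsub>H\<^esub> x = \<zero>\<^bsub>H\<^esub>" if "x \<in> carrier H" for x
    using H.smult_l_null[OF that] by (simp add: sc)
  define sub where "sub M \<longleftrightarrow> M \<subseteq> carrier H \<and> \<zero>\<^bsub>H\<^esub> \<in> M \<and> (\<forall>x\<in>M. \<forall>y\<in>M. x \<oplus>\<^bsub>H\<^esub> y \<in> M) \<and>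
    (\<forall>a\<in>K. \<forall>x\<in>M. a \<odot>\<^bsub>H\<^esub> x \<in> M)" for M
  let ?A = "{M. sub M \<and> h \<notin> M}"
  have "\<exists>M\<in>?A. \<forall>X'\<in>?A. M \<subseteq> X' \<longrightarrow> X' = M"
  proof (rule subset_Zorn_nonempty)
    have "sub {\<zero>\<^bsub>H\<^esub>}" unfolding sub_def using H.smult_r_null by (auto simp: sc)
    then show "?A \<noteq> {}" using h by auto
    fix C assume C: "C \<noteq> {}" "subset.chain ?A C"
    have "\<Union>C \<subseteq> carrier H" "\<zero>\<^bsub>H\<^esub> \<in> \<Union>C" "h \<notin> \<Union>C"
      using C by (auto simp: subset_chain_def sub_def)
    moreover have "x \<oplus>\<^bsub>H\<^esub> y \<in> \<Union>C" if xy: "x \<in> \<Union>C" "y \<in> \<Union>C" for x y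
    proof -
      obtain M M' where M: "M \<in> C" "x \<in> M" "M' \<in> C" "y \<in> M'" using xy by blast
      then consider "M \<subseteq> M'" | "M' \<subseteq> M" using C(2) by (auto simp: subset_chain_def)
      then show ?thesis
      proof cases
        case 1
        moreover have "sub M'" using C(2) M by (auto simp: subset_chain_def)
        ultimately have "x \<oplus>\<^bsub>H\<^esub> y \<in> M'" using M unfolding sub_def by blast
        then show ?thesis using M by blast
      next
        case 2
        moreover have "sub M" using C(2) M by (auto simp: subset_chain_def)
        ultimately have "x \<oplus>\<^bsub>H\<^esub> y \<in> M" using M unfolding sub_def by blast
        then show ?thesis using M by blast
      qed
    qed
    moreover have "a \<odot>\<^bsub>H\<^esub> x \<in> \<Union>C" if ax: "a \<in> K" "x \<in> \<Union>C" for a x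
    proof -
      obtain M where M: "M \<in> C" "x \<in> M" using ax(2) by blast
      then have "sub M" using C(2) by (auto simp: subset_chain_def)
      then have "a \<odot>\<^bsub>H\<^esub> x \<in> M" using M ax(1) unfolding sub_def by blast
      then show ?thesis using M by blast
    qed
    ultimately show "\<Union>C \<in> ?A" unfolding sub_def by blast
  qed
  then obtain M where M: "sub M" "h \<notin> M" and max: "\<And>M'. sub M' \<Longrightarrow> h \<notin> M' \<Longrightarrow> M \<subseteq> M' \<Longrightarrow> M' = M"
    by blast
  have Mc: "x \<in> carrier H" if "x \<in> M" for x using M(1) that by (auto simp: sub_def)
  have Madd: "x \<oplus>\<^bsub>H\<^esub> y \<in> M" if "x \<in> M" "y \<in> M" for x y using M(1) that by (auto simp: sub_def)
  have Msm: "a \<odot>\<^bsub>H\<^esub> x \<in> M" if "a \<in> K" "x \<in> M" for a x using M(1) that by (auto simp: sub_def)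
  have M0: "\<zero>\<^bsub>H\<^esub> \<in> M" using M(1) by (auto simp: sub_def)
  have decomp: "\<exists>c\<in>K. \<exists>m\<in>M. v = m \<oplus>\<^bsub>H\<^esub> c \<odot>\<^bsub>H\<^esub> h" if v: "v \<in> carrier H" for v
  proof (cases "v \<in> M")
    case True
    then show ?thesis using h v by (intro bexI[of _ 0] bexI[of _ v]) (auto simp: l_null)
  next
    case False
    \<comment> \<open>Maximality of M forces h into M + K v; solving that equation for v writes v in
      M + K h.\<close>
    let ?M' = "{m \<oplus>\<^bsub>H\<^esub> c \<odot>\<^bsub>H\<^esub> v | m c. m \<in> M \<and> c \<in> K}"
    have "sub ?M'"
      unfolding sub_def
    proof (intro conjI ballI)
      show "?M' \<subseteq> carrier H" using Mc v by (auto simp: smult_closed)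
      show "\<zero>\<^bsub>H\<^esub> \<in> ?M'" using M0 v by (auto intro!: exI[of _ "\<zero>\<^bsub>H\<^esub>"] exI[of _ 0] simp: l_null)
      fix x assume "x \<in> ?M'"
      then obtain m c where x: "x = m \<oplus>\<^bsub>H\<^esub> c \<odot>\<^bsub>H\<^esub> v" "m \<in> M" "c \<in> K" by blast
      { fix y assume "y \<in> ?M'"
        then obtain m' c' where y: "y = m' \<oplus>\<^bsub>H\<^esub> c' \<odot>\<^bsub>H\<^esub> v" "m' \<in> M" "c' \<in> K" by blast
        have "x \<oplus>\<^bsub>H\<^esub> y = (m \<oplus>\<^bsub>H\<^esub> m') \<oplus>\<^bsub>H\<^esub> (c + c') \<odot>\<^bsub>H\<^esub> v"
          using x y v Mc by (simp add: l_distr smult_closed H.M.add.m_ac)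
        then show "x \<oplus>\<^bsub>H\<^esub> y \<in> ?M'" using x y Madd by blast }
      fix a assume a: "a \<in> K"
      have "a \<odot>\<^bsub>H\<^esub> x = a \<odot>\<^bsub>H\<^esub> m \<oplus>\<^bsub>H\<^esub> (a * c) \<odot>\<^bsub>H\<^esub> v"
        using x a v Mc by (simp add: r_distr smult_closed assoc1)
      then show "a \<odot>\<^bsub>H\<^esub> x \<in> ?M'" using x a Msm by blast
    qed
    moreover have "M \<subseteq> ?M'"
    proof
      fix m assume m: "m \<in> M"
      then have "m = m \<oplus>\<^bsub>H\<^esub> 0 \<odot>\<^bsub>H\<^esub> v" using v Mc by (simp add: l_null)
      then show "m \<in> ?M'" using m K_0 by blast
    qed
    moreover have "v \<in> ?M'"
    proof -
      have "v = \<zero>\<^bsub>H\<^esub> \<oplus>\<^bsub>H\<^esub> 1 \<odot>\<^bsub>H\<^esub> v" using v by (simp add: smult_one)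
      then show ?thesis using M0 K_1 by blast
    qed
    ultimately have "h \<in> ?M'" using max[of ?M'] False by blast
    then obtain m c where mc: "h = m \<oplus>\<^bsub>H\<^esub> c \<odot>\<^bsub>H\<^esub> v" "m \<in> M" "c \<in> K" by blast
    have c0: "c \<noteq> 0" using mc M(2) v Mc by (auto simp: l_null)
    let ?d = "inverse c"
    have d: "?d \<in> K" "- ?d \<in> K" using K_inverse mc(3) K_uminus by auto
    have "?d \<odot>\<^bsub>H\<^esub> h = ?d \<odot>\<^bsub>H\<^esub> m \<oplus>\<^bsub>H\<^esub> v"
      using mc c0 d v Mc by (simp add: r_distr smult_closed assoc1[symmetric] smult_one)
    then have "(- ?d) \<odot>\<^bsub>H\<^esub> m \<oplus>\<^bsub>H\<^esub> ?d \<odot>\<^bsub>H\<^esub> h = ((- ?d) \<odot>\<^bsub>H\<^esub> m \<oplus>\<^bsub>H\<^esub> ?d \<odot>\<^bsub>H\<^esub> m) \<oplus>\<^bsub>H\<^esub> v"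
      using mc d v Mc by (simp add: smult_closed H.M.add.m_assoc)
    also have "(- ?d) \<odot>\<^bsub>H\<^esub> m \<oplus>\<^bsub>H\<^esub> ?d \<odot>\<^bsub>H\<^esub> m = \<zero>\<^bsub>H\<^esub>"
      using l_distr[of "- ?d" ?d m] mc d Mc by (simp add: l_null)
    finally have "v = (- ?d) \<odot>\<^bsub>H\<^esub> m \<oplus>\<^bsub>H\<^esub> ?d \<odot>\<^bsub>H\<^esub> h" using v by simp
    then show ?thesis using d Msm mc(2) by blast
  qed
  have uniq: "c = c'" if "m \<oplus>\<^bsub>H\<^esub> c \<odot>\<^bsub>H\<^esub> h = m' \<oplus>\<^bsub>H\<^esub> c' \<odot>\<^bsub>H\<^esub> h" "m \<in> M" "m' \<in> M" "c \<in> K" "c' \<in> K" for m m' c c'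
  proof (rule ccontr)
    assume "c \<noteq> c'"
    then have ne: "c - c' \<noteq> 0" by simp
    have mi: "(- 1) \<odot>\<^bsub>H\<^esub> m \<oplus>\<^bsub>H\<^esub> m = \<zero>\<^bsub>H\<^esub>"
      using l_distr[of "- 1" 1 m] that Mc K_uminus[OF K_1] by (simp add: l_null smult_one)
    have ch: "c \<odot>\<^bsub>H\<^esub> h = ((- 1) \<odot>\<^bsub>H\<^esub> m \<oplus>\<^bsub>H\<^esub> m') \<oplus>\<^bsub>H\<^esub> c' \<odot>\<^bsub>H\<^esub> h"
    proof -
      have "c \<odot>\<^bsub>H\<^esub> h = ((- 1) \<odot>\<^bsub>H\<^esub> m \<oplus>\<^bsub>H\<^esub> m) \<oplus>\<^bsub>H\<^esub> c \<odot>\<^bsub>H\<^esub> h" using mi h that by (simp add: smult_closed)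
      also have "\<dots> = (- 1) \<odot>\<^bsub>H\<^esub> m \<oplus>\<^bsub>H\<^esub> (m' \<oplus>\<^bsub>H\<^esub> c' \<odot>\<^bsub>H\<^esub> h)"
        unfolding that(1)[symmetric] using h that Mc K_uminus[OF K_1] by (simp add: smult_closed H.M.add.m_assoc)
      also have "\<dots> = ((- 1) \<odot>\<^bsub>H\<^esub> m \<oplus>\<^bsub>H\<^esub> m') \<oplus>\<^bsub>H\<^esub> c' \<odot>\<^bsub>H\<^esub> h"
        using h that Mc K_uminus[OF K_1] by (simp add: smult_closed H.M.add.m_assoc)
      finally show ?thesis .
    qed
    let ?w = "(- 1) \<odot>\<^bsub>H\<^esub> m \<oplus>\<^bsub>H\<^esub> m'"
    have w: "?w \<in> M" using that Madd Msm K_uminus[OF K_1] by blast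
    have cc: "c - c' \<in> K" using K_add[OF that(4) K_uminus[OF that(5)]] by simp
    have "(c - c') \<odot>\<^bsub>H\<^esub> h \<oplus>\<^bsub>H\<^esub> c' \<odot>\<^bsub>H\<^esub> h = ?w \<oplus>\<^bsub>H\<^esub> c' \<odot>\<^bsub>H\<^esub> h"
      using l_distr[OF cc that(5) h(1)] ch by simp
    then have "(c - c') \<odot>\<^bsub>H\<^esub> h = ?w" using h w Mc cc that by (simp add: smult_closed)
    then have "inverse (c - c') \<odot>\<^bsub>H\<^esub> ((c - c') \<odot>\<^bsub>H\<^esub> h) \<in> M" using w Msm K_inverse[OF cc] by simp
    then show False using M(2) ne cc h K_inverse[OF cc] by (simp add: assoc1[symmetric] smult_one)
  qed
  define f where "f v = (THE c. c \<in> K \<and> (\<exists>m\<in>M. v = m \<oplus>\<^bsub>H\<^esub> c \<odot>\<^bsub>H\<^esub> h))" for v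
  have f: "f v = c" if "v = m \<oplus>\<^bsub>H\<^esub> c \<odot>\<^bsub>H\<^esub> h" "m \<in> M" "c \<in> K" for v m c
    unfolding f_def using that uniq by (intro the_equality) blast+
  have "linear_form K H f"
    unfolding linear_form_def
  proof (intro conjI ballI)
    fix v assume v: "v \<in> carrier H"
    obtain c m where vm: "v = m \<oplus>\<^bsub>H\<^esub> c \<odot>\<^bsub>H\<^esub> h" "m \<in> M" "c \<in> K" using decomp[OF v] by blast
    show "f v \<in> K" using f[OF vm] vm by simp
    { fix w assume w: "w \<in> carrier H"
      obtain d k where wm: "w = k \<oplus>\<^bsub>H\<^esub> d \<odot>\<^bsub>H\<^esub> h" "k \<in> M" "d \<in> K" using decomp[OF w] by blast
      have "v \<oplus>\<^bsub>H\<^esub> w = (m \<oplus>\<^bsub>H\<^esub> k) \<oplus>\<^bsub>H\<^esub> (c + d) \<odot>\<^bsub>H\<^esub> h"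
        using vm wm h Mc by (simp add: l_distr smult_closed H.M.add.m_ac)
      then show "f (v \<oplus>\<^bsub>H\<^esub> w) = f v + f w"
        using f[OF vm] f[OF wm] f[of _ "m \<oplus>\<^bsub>H\<^esub> k" "c + d"] vm wm Madd by auto }
    fix a assume a: "a \<in> K"
    have "a \<odot>\<^bsub>H\<^esub> v = a \<odot>\<^bsub>H\<^esub> m \<oplus>\<^bsub>H\<^esub> (a * c) \<odot>\<^bsub>H\<^esub> h"
      using vm a h Mc by (simp add: r_distr smult_closed assoc1)
    then show "f (a \<odot>\<^bsub>H\<^esub> v) = a * f v"
      using f[OF vm] f[of _ "a \<odot>\<^bsub>H\<^esub> m" "a * c"] vm a Msm by auto
  qed
  moreover have "f h = 1"
    using f[of h "\<zero>\<^bsub>H\<^esub>" 1] h M0 by (simp add: smult_one)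
  ultimately show thesis using that[of f] by simp
qed

end

section \<open>The brace map of a Hopf-Galois structure\<close>

locale typed_structure = galois_extension K + finite_group_algebra N
  for K :: "'l :: field set" and N :: "('a, 'y) monoid_scheme" +
  fixes H :: "('l, 'h, 'm) hopf_scheme" and act :: "'h \<Rightarrow> 'l \<Rightarrow> 'l" and \<Psi> :: "('l \<times> 'h) list set \<Rightarrow> 'a \<Rightarrow> 'l"
  assumes galois_structure: "hopf_galois_structure K (H, act)"
    and iso: "\<Psi> \<in> hopf_iso UNIV (base_change K H) (group_algebra UNIV N)"
begin

abbreviation "GA' \<equiv> group_algebra (UNIV :: 'l set) N"
abbreviation "LH \<equiv> tensor_space K top_module H"
abbreviation "cls \<equiv> tensor_class K top_module H"

lemma is_hopf: "hopf_algebra K H" and is_module_algebra: "module_algebra K H act"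
  and galois_bij: "bij_betw (\<lambda>c x. \<Sum>(l, h)\<leftarrow>tensor_rep c. l * act h x) LH (endomorphisms K)"
  using galois_structure by (auto simp: hopf_galois_structure_def)

interpretation Ho: hopf_algebra K H by (rule is_hopf)
interpretation Hm: module "scalars K" H by (rule Ho.is_module)
interpretation Hr: ring H by (rule Ho.is_ring)

lemma H_closed:
  "h \<in> carrier H \<Longrightarrow> k \<in> carrier H \<Longrightarrow> h \<oplus>\<^bsub>H\<^esub> k \<in> carrier H"
  "h \<in> carrier H \<Longrightarrow> k \<in> carrier H \<Longrightarrow> h \<otimes>\<^bsub>H\<^esub> k \<in> carrier H"
  "a \<in> K \<Longrightarrow> h \<in> carrier H \<Longrightarrow> a \<odot>\<^bsub>H\<^esub> h \<in> carrier H"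
  using Hm.smult_closed by (auto simp: scalars_def)

lemma act_simps:
  "h \<in> carrier H \<Longrightarrow> act h (x + y) = act h x + act h y"
  "h \<in> carrier H \<Longrightarrow> k \<in> carrier H \<Longrightarrow> act (h \<oplus>\<^bsub>H\<^esub> k) x = act h x + act k x"
  "a \<in> K \<Longrightarrow> h \<in> carrier H \<Longrightarrow> act (a \<odot>\<^bsub>H\<^esub> h) x = a * act h x"
  "a \<in> K \<Longrightarrow> h \<in> carrier H \<Longrightarrow> act h (a * x) = a * act h x"
  "h \<in> carrier H \<Longrightarrow> k \<in> carrier H \<Longrightarrow> act (h \<otimes>\<^bsub>H\<^esub> k) x = act h (act k x)"
  "h \<in> carrier H \<Longrightarrow> act h (x * y) = (\<Sum>(u, v)\<leftarrow>comult H h. act u x * act v y)"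
  "h \<in> carrier H \<Longrightarrow> act h 1 = counit H h"
  using is_module_algebra by (auto simp: module_algebra_def)

lemma comultD: "h \<in> carrier H \<Longrightarrow> (u, v) \<in> set (comult H h) \<Longrightarrow> u \<in> carrier H \<and> v \<in> carrier H"
  using Ho.comult_closed by blast

text \<open>For t = id this is the canonical map of the Galois condition. The variants for other t
  make visible how Gal acts on the factor L of L \<otimes> H.\<close>

definition ev :: "('l \<Rightarrow> 'l) \<Rightarrow> ('l \<times> 'h) list \<Rightarrow> 'l \<Rightarrow> 'l" where
  "ev t s x = (\<Sum>(l, h)\<leftarrow>s. l * t (act h x))"

lemma ev_cong: "tensor_eq K top_module H s s' \<Longrightarrow> t \<in> Gal \<Longrightarrow> ev t s x = ev t s' x"
  unfolding ev_def by (rule tensor_eq_eval) (auto simp: act_simps Gal_add Gal_mult Gal_K)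

lemma cls_LH: "set s \<subseteq> UNIV \<times> carrier H \<Longrightarrow> cls s \<in> LH"
  by (auto simp: tensor_space_def)

lemma rep_LH: "c \<in> LH \<Longrightarrow> set (tensor_rep c) \<subseteq> UNIV \<times> carrier H"
  using tensor_rep_space(1)[of c K top_module H] by simp

lemma ev_rep: "set s \<subseteq> UNIV \<times> carrier H \<Longrightarrow> t \<in> Gal \<Longrightarrow> ev t (tensor_rep (cls s)) x = ev t s x"
  using ev_cong[OF tensor_eq_sym[OF tensor_rep_class]] by simp

lemma ev_id_inject:
  assumes "c \<in> LH" "d \<in> LH" "\<And>x. ev id (tensor_rep c) x = ev id (tensor_rep d) x" shows "c = d"
proof -
  have "(\<lambda>x. \<Sum>(l, h)\<leftarrow>tensor_rep c. l * act h x) = (\<lambda>x. \<Sum>(l, h)\<leftarrow>tensor_rep d. l * act h x)"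
    using assms(3) by (simp add: ev_def)
  then show ?thesis using galois_bij assms(1,2) unfolding bij_betw_def inj_on_def by blast
qed

lemma ev_append: "ev t (s @ s') x = ev t s x + ev t s' x"
  by (simp add: ev_def)

lemma ev_scale: "ev t [(a * l, h). (l, h) \<leftarrow> s] x = a * ev t s x"
  by (simp add: ev_def sum_list_const_mult[symmetric] case_prod_unfold comp_def mult.assoc)

lemma BC_simps:
  "carrier (base_change K H) = LH"
  "c \<otimes>\<^bsub>base_change K H\<^esub> d = cls [(l * m, h \<otimes>\<^bsub>H\<^esub> k). (l, h) \<leftarrow> tensor_rep c, (m, k) \<leftarrow> tensor_rep d]"
  "\<one>\<^bsub>base_change K H\<^esub> = cls [(1, \<one>\<^bsub>H\<^esub>)]"
  "c \<oplus>\<^bsub>base_change K H\<^esub> d = cls (tensor_rep c @ tensor_rep d)"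
  "a \<odot>\<^bsub>base_change K H\<^esub> c = cls [(a * l, h). (l, h) \<leftarrow> tensor_rep c]"
  "comult (base_change K H) c = [(cls [(l, u)], cls [(1, v)]). (l, h) \<leftarrow> tensor_rep c, (u, v) \<leftarrow> comult H h]"
  "counit (base_change K H) c = (\<Sum>(l, h)\<leftarrow>tensor_rep c. l * counit H h)"
  "antipode (base_change K H) c = cls [(l, antipode H h). (l, h) \<leftarrow> tensor_rep c]"
  by (auto simp: base_change_def Let_def)

lemma \<Psi>:
  "bij_betw \<Psi> LH (carrier GA')"
  "c \<in> LH \<Longrightarrow> d \<in> LH \<Longrightarrow> \<Psi> (c \<otimes>\<^bsub>base_change K H\<^esub> d) = \<Psi> c \<otimes>\<^bsub>GA'\<^esub> \<Psi> d"
  "c \<in> LH \<Longrightarrow> d \<in> LH \<Longrightarrow> \<Psi> (c \<oplus>\<^bsub>base_change K H\<^esub> d) = \<Psi> c \<oplus>\<^bsub>GA'\<^esub> \<Psi> d"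
  "c \<in> LH \<Longrightarrow> \<Psi> (a \<odot>\<^bsub>base_change K H\<^esub> c) = a \<odot>\<^bsub>GA'\<^esub> \<Psi> c"
  "c \<in> LH \<Longrightarrow> tensor_eq UNIV GA' GA' (comult GA' (\<Psi> c)) [(\<Psi> u, \<Psi> v). (u, v) \<leftarrow> comult (base_change K H) c]"
  "c \<in> LH \<Longrightarrow> counit GA' (\<Psi> c) = counit (base_change K H) c"
  "c \<in> LH \<Longrightarrow> antipode GA' (\<Psi> c) = \<Psi> (antipode (base_change K H) c)"
  using iso by (auto simp: hopf_iso_def ring_iso_def ring_hom_def BC_simps(1))

definition Q :: "('a \<Rightarrow> 'l) \<Rightarrow> ('l \<times> 'h) list set" where "Q = inv_into LH \<Psi>"

lemma Q: "f \<in> carrier GA' \<Longrightarrow> Q f \<in> LH" "f \<in> carrier GA' \<Longrightarrow> \<Psi> (Q f) = f" "c \<in> LH \<Longrightarrow> Q (\<Psi> c) = c"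
  and \<Psi>_closed: "c \<in> LH \<Longrightarrow> \<Psi> c \<in> carrier GA'"
  using \<Psi>(1) by (auto simp: Q_def bij_betw_def f_inv_into_f inv_into_into)

lemma QU: "g \<in> carrier N \<Longrightarrow> Q (unit_fun g) \<in> LH" "g \<in> carrier N \<Longrightarrow> \<Psi> (Q (unit_fun g)) = unit_fun g"
  by (simp_all add: Q(1,2) GA_unit)

definition EV :: "('l \<Rightarrow> 'l) \<Rightarrow> ('a \<Rightarrow> 'l) \<Rightarrow> 'l \<Rightarrow> 'l" where
  "EV t f = ev t (tensor_rep (Q f))"

lemma EV_\<Psi>: "c \<in> LH \<Longrightarrow> EV t (\<Psi> c) x = ev t (tensor_rep c) x"
  by (simp add: EV_def Q)

lemma EV_cls: "set s \<subseteq> UNIV \<times> carrier H \<Longrightarrow> t \<in> Gal \<Longrightarrow> EV t (\<Psi> (cls s)) x = ev t s x"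
  by (simp add: EV_\<Psi> cls_LH ev_rep)

lemma EV_add:
  assumes "f \<in> carrier GA'" "f' \<in> carrier GA'" and t: "t \<in> Gal"
  shows "EV t (\<lambda>x. f x + f' x) x = EV t f x + EV t f' x"
proof -
  have "\<Psi> (cls (tensor_rep (Q f) @ tensor_rep (Q f'))) = (\<lambda>x. f x + f' x)"
    using \<Psi>(3)[of "Q f" "Q f'"] assms by (simp add: Q BC_simps GA_simps)
  moreover have "set (tensor_rep (Q f) @ tensor_rep (Q f')) \<subseteq> UNIV \<times> carrier H"
    using rep_LH Q assms by simp
  ultimately show ?thesis using EV_cls[of "tensor_rep (Q f) @ tensor_rep (Q f')" t x] t
    by (simp add: ev_append EV_def)
qed

lemma EV_smult:
  assumes "f \<in> carrier GA'" and t: "t \<in> Gal"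
  shows "EV t (\<lambda>x. c * f x) x = c * EV t f x"
proof -
  let ?s = "[(c * l, h). (l, h) \<leftarrow> tensor_rep (Q f)]"
  have "\<Psi> (cls ?s) = (\<lambda>x. c * f x)"
    using \<Psi>(4)[of "Q f" c] assms by (simp add: Q BC_simps GA_simps)
  moreover have "set ?s \<subseteq> UNIV \<times> carrier H"
    using rep_LH[OF Q(1)[OF assms(1)]] by auto
  ultimately show ?thesis using EV_cls[of ?s t x] t unfolding ev_scale by (simp add: EV_def)
qed

text \<open>The element \<open>g\<close> of \<open>N\<close>, viewed in \<open>L \<otimes> H\<close>, acting on \<open>L\<close> by \<open>l \<otimes> h \<mapsto> (x \<mapsto> l t(h \<cdot> x))\<close>; being
  grouplike, it acts as an element of the Galois group.\<close>

definition P :: "'a \<Rightarrow> ('l \<Rightarrow> 'l) \<Rightarrow> 'l \<Rightarrow> 'l" where "P g t = EV t (unit_fun g)"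

lemma EV_expansion:
  assumes "f \<in> carrier GA'" "t \<in> Gal" shows "EV t f x = (\<Sum>g\<in>carrier N. f g * P g t x)"
  unfolding P_def
  by (rule GA_linear[of "\<lambda>f. EV t f x", OF _ _ assms(1)]) (auto simp: EV_add EV_smult assms)

lemma unit_list:
  assumes "g \<in> carrier N"
  shows "comult GA' (unit_fun g) = [(unit_fun g, unit_fun g)]"
proof (rule GA_comult[OF GA_unit[OF assms]])
  fix xs assume xs: "set xs = {x. unit_fun g x \<noteq> (0 :: 'l)}" "distinct xs"
    "comult GA' (unit_fun g) = map (\<lambda>x. (\<lambda>y. if y = x then unit_fun g x else 0, unit_fun x)) xs"
  have "set xs = {g}" unfolding xs(1) by (auto simp: unit_fun_def)
  then have "xs = [g]" using xs(2)
    by (metis distinct.simps(2) insertI1 list.set_cases list.set_intros(2) list.simps(15) set_empty singletonD subset_singletonD subset_insertI empty_iff neq_Nil_conv)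
  then show ?thesis using xs(3) by (auto simp: unit_fun_def fun_eq_iff)
qed

text \<open>Evaluate the bilinear form EV t _ x * EV t _ y on the coproduct of g in two ways: in
  L[N] it is g \<otimes> g, giving the product, while in L \<otimes> H the rule for H acting on x y
  reassembles the value at x y.\<close>

lemma P_mult_apply:
  assumes g: "g \<in> carrier N" and t: "t \<in> Gal"
  shows "P g t (x * y) = P g t x * P g t y"
proof -
  let ?c = "Q (unit_fun g)"
  have c: "?c \<in> LH" "\<Psi> ?c = unit_fun g" using QU[OF g] by auto
  define \<beta> where "\<beta> f f' = EV t f x * EV t f' y" for f f'
  have "\<forall>v\<in>carrier GA'. linear_form UNIV GA' (\<beta> v)" "\<forall>w\<in>carrier GA'. linear_form UNIV GA' (\<lambda>v. \<beta> v w)"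
    by (auto simp: linear_form_def \<beta>_def GA_simps EV_add EV_smult t algebra_simps)
  then have "(\<Sum>(u, v)\<leftarrow>comult GA' (\<Psi> ?c). \<beta> u v) = (\<Sum>(u, v)\<leftarrow>[(\<Psi> u, \<Psi> v). (u, v) \<leftarrow> comult (base_change K H) ?c]. \<beta> u v)"
    using \<Psi>(5)[OF c(1)] unfolding tensor_eq_def by blast
  moreover have "(\<Sum>(u, v)\<leftarrow>comult GA' (\<Psi> ?c). \<beta> u v) = P g t x * P g t y"
    using c g by (simp add: unit_list \<beta>_def P_def)
  moreover have "(\<Sum>(u, v)\<leftarrow>[(\<Psi> u, \<Psi> v). (u, v) \<leftarrow> comult (base_change K H) ?c]. \<beta> u v) = P g t (x * y)"
  proof -
    have "(\<Sum>(u, v)\<leftarrow>[(\<Psi> u, \<Psi> v). (u, v) \<leftarrow> comult (base_change K H) ?c]. \<beta> u v) =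
        (\<Sum>(l, h)\<leftarrow>tensor_rep ?c. \<Sum>(u, v)\<leftarrow>comult H h. \<beta> (\<Psi> (cls [(l, u)])) (\<Psi> (cls [(1, v)])))"
      unfolding BC_simps by (simp add: sum_list_map_concat case_prod_unfold comp_def)
    also have "\<dots> = (\<Sum>(l, h)\<leftarrow>tensor_rep ?c. l * t (act h (x * y)))"
    proof (intro sum_list_cong, clarify)
      fix l h assume "(l, h) \<in> set (tensor_rep ?c)"
      then have h: "h \<in> carrier H" using rep_LH[OF c(1)] by auto
      have "(\<Sum>(u, v)\<leftarrow>comult H h. \<beta> (\<Psi> (cls [(l, u)])) (\<Psi> (cls [(1, v)]))) =
          (\<Sum>(u, v)\<leftarrow>comult H h. l * t (act u x * act v y))"
        using comultD[OF h] t by (intro sum_list_cong) (auto simp: \<beta>_def EV_cls ev_def Gal_mult)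
      also have "\<dots> = l * t (act h (x * y))"
        unfolding act_simps(6)[OF h] Gal_sum_list[OF t] by (simp only: sum_list_const_mult case_prod_unfold)
      finally show "(\<Sum>(u, v)\<leftarrow>comult H h. \<beta> (\<Psi> (cls [(l, u)])) (\<Psi> (cls [(1, v)]))) = l * t (act h (x * y))" .
    qed
    finally show ?thesis by (simp add: P_def EV_def ev_def)
  qed
  ultimately show ?thesis by simp
qed

lemma P_Gal: assumes g: "g \<in> carrier N" and t: "t \<in> Gal" shows "P g t \<in> Gal"
proof (rule multiplicative_endomorphism_Gal)
  let ?c = "Q (unit_fun g)"
  have c: "?c \<in> LH" "\<Psi> ?c = unit_fun g" using QU[OF g] by auto
  note rc = rep_LH[OF c(1)]
  have P: "P g t x = (\<Sum>(l, h)\<leftarrow>tensor_rep ?c. l * t (act h x))" for x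
    by (simp add: P_def EV_def ev_def)
  have "P g t (x + y) = P g t x + P g t y" for x y
  proof -
    have "P g t (x + y) = (\<Sum>(l, h)\<leftarrow>tensor_rep ?c. l * t (act h x) + l * t (act h y))"
      unfolding P using rc t by (intro sum_list_cong) (auto simp: act_simps Gal_add distrib_left)
    then show ?thesis unfolding P by (simp add: case_prod_unfold sum_list_addf)
  qed
  moreover have "P g t (a * x) = a * P g t x" if a: "a \<in> K" for a x
  proof -
    have "P g t (a * x) = (\<Sum>(l, h)\<leftarrow>tensor_rep ?c. a * (l * t (act h x)))"
      unfolding P using rc t a by (intro sum_list_cong) (auto simp: act_simps Gal_mult Gal_K)
    then show ?thesis unfolding P by (simp only: case_prod_unfold sum_list_const_mult)
  qed
  ultimately show "P g t \<in> endomorphisms K" by (simp add: endomorphisms_def)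
  have "P g t 1 = (\<Sum>(l, h)\<leftarrow>tensor_rep ?c. l * counit H h)"
  proof -
    have "counit H h \<in> K" if "h \<in> carrier H" for h
      using Ho.counit_linear that by (simp add: linear_form_def)
    then show ?thesis
      unfolding P using rc t by (intro sum_list_cong) (auto simp: act_simps(7) Gal_K)
  qed
  also have "\<dots> = counit GA' (unit_fun g)" using \<Psi>(6)[OF c(1)] c(2) by (simp add: BC_simps)
  also have "\<dots> = 1" using GA_counit[OF GA_unit[OF g], where ?'b = 'l] g finite_N by (simp add: unit_fun_def)
  finally show "P g t 1 = 1" .
qed (rule P_mult_apply[OF g t])

text \<open>Carrying out the sum over the representative of g first produces the automorphism
  \<open>P g t\<close>, which then takes the place of t for g'. So N acts on Gal from the right by t
  \<mapsto> \<open>P g t\<close>.\<close>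

lemma P_comp:
  assumes g: "g \<in> carrier N" and g': "g' \<in> carrier N" and t: "t \<in> Gal"
  shows "P (g \<otimes>\<^bsub>N\<^esub> g') t = P g' (P g t)"
proof
  fix x
  let ?c = "Q (unit_fun g)" and ?d = "Q (unit_fun g')"
  have c: "?c \<in> LH" "\<Psi> ?c = unit_fun g" and d: "?d \<in> LH" "\<Psi> ?d = unit_fun g'"
    using QU[OF g] QU[OF g'] by auto
  note rc = rep_LH[OF c(1)] and rd = rep_LH[OF d(1)]
  let ?s = "[(l * m, h \<otimes>\<^bsub>H\<^esub> k). (l, h) \<leftarrow> tensor_rep ?c, (m, k) \<leftarrow> tensor_rep ?d]"
  have "convolution N (unit_fun g) (unit_fun g') = (unit_fun (g \<otimes>\<^bsub>N\<^esub> g') :: 'a \<Rightarrow> 'l)"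
  proof
    fix y
    have "(\<Sum>z\<in>carrier N. unit_fun g z * unit_fun g' (inv\<^bsub>N\<^esub> z \<otimes>\<^bsub>N\<^esub> y)) =
        (\<Sum>z\<in>carrier N. if z = g then unit_fun g' (inv\<^bsub>N\<^esub> g \<otimes>\<^bsub>N\<^esub> y) else (0 :: 'l))"
      by (intro sum.cong) (auto simp: unit_fun_def)
    also have "\<dots> = unit_fun g' (inv\<^bsub>N\<^esub> g \<otimes>\<^bsub>N\<^esub> y)" using g finite_N by simp
    finally show "convolution N (unit_fun g) (unit_fun g') y = (unit_fun (g \<otimes>\<^bsub>N\<^esub> g') y :: 'l)"
      using g g' inv_solve_left[of g' g y] by (auto simp: convolution_def unit_fun_def)
  qed
  then have \<Psi>s: "\<Psi> (cls ?s) = unit_fun (g \<otimes>\<^bsub>N\<^esub> g')"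
    using \<Psi>(2)[OF c(1) d(1)] by (simp add: c d BC_simps GA_mult[OF GA_unit[OF g]])
  have s: "set ?s \<subseteq> UNIV \<times> carrier H"
  proof -
    have "h \<otimes>\<^bsub>H\<^esub> k \<in> carrier H" if "(l, h) \<in> set (tensor_rep ?c)" "(m, k) \<in> set (tensor_rep ?d)" for l h m k
      using that rc rd by (blast intro: H_closed)
    then show ?thesis by auto
  qed
  have "P (g \<otimes>\<^bsub>N\<^esub> g') t x = ev t ?s x"
    unfolding P_def \<Psi>s[symmetric] by (rule EV_cls[OF s t])
  also have "\<dots> = (\<Sum>(l, h)\<leftarrow>tensor_rep ?c. \<Sum>(m, k)\<leftarrow>tensor_rep ?d. l * m * t (act (h \<otimes>\<^bsub>H\<^esub> k) x))"
    by (simp add: ev_def sum_list_map_concat case_prod_unfold comp_def)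
  also have "\<dots> = (\<Sum>(l, h)\<leftarrow>tensor_rep ?c. \<Sum>(m, k)\<leftarrow>tensor_rep ?d. m * (l * t (act h (act k x))))"
    using rc rd by (intro sum_list_cong, clarify, intro sum_list_cong, clarify) (subst act_simps(5), auto)
  also have "\<dots> = (\<Sum>(m, k)\<leftarrow>tensor_rep ?d. \<Sum>(l, h)\<leftarrow>tensor_rep ?c. m * (l * t (act h (act k x))))"
  proof -
    have "(\<Sum>x\<leftarrow>xs. \<Sum>y\<leftarrow>ys. F x y) = (\<Sum>y\<leftarrow>ys. \<Sum>x\<leftarrow>xs. F x y)" for xs :: "('l \<times> 'h) list" and ys :: "('l \<times> 'h) list" and F :: "_ \<Rightarrow> _ \<Rightarrow> 'l"
      by (induction xs) (auto simp: sum_list_addf)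
    then show ?thesis by (simp add: case_prod_unfold)
  qed
  also have "\<dots> = (\<Sum>(m, k)\<leftarrow>tensor_rep ?d. m * P g t (act k x))"
    by (simp only: P_def EV_def ev_def sum_list_const_mult case_prod_unfold)
  also have "\<dots> = P g' (P g t) x" by (simp add: P_def EV_def ev_def)
  finally show "P (g \<otimes>\<^bsub>N\<^esub> g') t x = P g' (P g t) x" .
qed

definition E :: "'a \<Rightarrow> 'l \<Rightarrow> 'l" where "E g = P g id"

lemma E_Gal: "g \<in> carrier N \<Longrightarrow> E g \<in> Gal"
  by (simp add: E_def P_Gal)

lemma E_inject: assumes "g \<in> carrier N" "g' \<in> carrier N" "E g = E g'" shows "g = g'"
proof -
  have "Q (unit_fun g) = Q (unit_fun g')"
    by (rule ev_id_inject) (use assms QU in \<open>auto simp: E_def P_def EV_def\<close>)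
  then have "unit_fun g = (unit_fun g' :: 'a \<Rightarrow> 'l)" using QU(2) assms(1,2) by metis
  then show ?thesis using inj_unit_fun[of UNIV] by (auto simp: inj_on_def)
qed

text \<open>By the Galois condition s is an L-combination of the automorphisms \<open>E g\<close>.
  Were s none of them, independence would give its coefficient 1 on one side and 0 on the
  other.\<close>

lemma E_surj: assumes s: "s \<in> Gal" shows "s \<in> E ` carrier N"
proof (rule ccontr)
  assume no: "s \<notin> E ` carrier N"
  obtain c where c: "c \<in> LH" "(\<lambda>x. \<Sum>(l, h)\<leftarrow>tensor_rep c. l * act h x) = s"
    using galois_bij Gal_endomorphism[OF s] unfolding bij_betw_def by (metis (no_types, lifting) imageE)
  let ?f = "\<Psi> c"
  have f: "s x = (\<Sum>g\<in>carrier N. ?f g * E g x)" for x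
    using EV_expansion[OF \<Psi>_closed[OF c(1)] Gal_id, of x] fun_cong[OF c(2), of x] EV_\<Psi>[OF c(1), of id x]
    by (simp add: E_def ev_def)
  have "(\<Sum>u\<in>Gal. (if u = s then 1 else 0) * u x) = (\<Sum>u\<in>Gal. (\<Sum>g\<in>{g \<in> carrier N. E g = u}. ?f g) * u x)" for x
  proof -
    have "(\<Sum>u\<in>Gal. (\<Sum>g\<in>{g \<in> carrier N. E g = u}. ?f g) * u x) = (\<Sum>u\<in>Gal. \<Sum>g\<in>{g \<in> carrier N. E g = u}. ?f g * E g x)"
      by (simp add: sum_distrib_right)
    also have "\<dots> = s x" unfolding f using E_Gal finite_N finite_Gal by (intro sum.group) auto
    also have "s x = (\<Sum>u\<in>Gal. (if u = s then 1 else 0) * u x)"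
      using s finite_Gal by (simp add: if_distrib[of "\<lambda>u. u * _"] cong: if_cong)
    finally show ?thesis by simp
  qed
  from dedekind_unique[OF this s] have "1 = (\<Sum>g\<in>{g \<in> carrier N. E g = s}. ?f g)" by simp
  also have "{g \<in> carrier N. E g = s} = {}" using no by blast
  finally show False by simp
qed

lemma E_bij: "bij_betw E (carrier N) Gal"
  using E_inject E_surj E_Gal unfolding bij_betw_def inj_on_def by blast

definition \<phi> :: "('l \<Rightarrow> 'l) \<Rightarrow> 'a" where "\<phi> = (\<lambda>s\<in>Gal. inv_into (carrier N) E s)"

lemma \<phi>_closed: "s \<in> Gal \<Longrightarrow> \<phi> s \<in> carrier N" and E_\<phi>: "s \<in> Gal \<Longrightarrow> E (\<phi> s) = s"
  and \<phi>_E: "g \<in> carrier N \<Longrightarrow> \<phi> (E g) = g"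
  using E_bij E_surj E_Gal by (auto simp: \<phi>_def inv_into_into f_inv_into_f bij_betw_def)

text \<open>The action of t^-1, through the coefficients, on the elements of N inside L \<otimes> H.
  It is expressed by automorphisms of L and turns out to be inverse to
  \<open>twist t\<close>.\<close>

definition \<beta> :: "('l \<Rightarrow> 'l) \<Rightarrow> 'a \<Rightarrow> 'a" where "\<beta> t = (\<lambda>g\<in>carrier N. \<phi> (Hilbert_Choice.inv t \<circ> P g t))"

lemma \<beta>_closed: "t \<in> Gal \<Longrightarrow> g \<in> carrier N \<Longrightarrow> \<beta> t g \<in> carrier N"
  and P_\<beta>: "t \<in> Gal \<Longrightarrow> g \<in> carrier N \<Longrightarrow> P g t = t \<circ> E (\<beta> t g)"
proof -
  assume t: "t \<in> Gal" and g: "g \<in> carrier N"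
  have "Hilbert_Choice.inv t \<circ> P g t \<in> Gal" using t g P_Gal Gal_inv by blast
  then show "\<beta> t g \<in> carrier N" "P g t = t \<circ> E (\<beta> t g)"
    using t g by (auto simp: \<beta>_def \<phi>_closed E_\<phi> fun_eq_iff Gal_inv_apply)
qed

text \<open>Applying t^-1 to the coefficients of a representative of g gives an element whose
  canonical image is \<open>E (\<beta> t g)\<close>. As the canonical map is injective, that element
  is \<beta> t g itself, and its evaluations at every other s agree too.\<close>

lemma P_left:
  assumes t: "t \<in> Gal" and s: "s \<in> Gal" and g: "g \<in> carrier N"
  shows "P g (t \<circ> s) = t \<circ> P (\<beta> t g) s"
proof -
  let ?c = "Q (unit_fun g)" and ?i = "Hilbert_Choice.inv t"
  have c: "?c \<in> LH" using QU[OF g] by auto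
  note rc = rep_LH[OF c]
  let ?s = "[(?i l, h). (l, h) \<leftarrow> tensor_rep ?c]"
  have i: "?i \<in> Gal" using t by blast
  have rs: "set ?s \<subseteq> UNIV \<times> carrier H" using rc by auto
  have ev: "ev u ?s x = ?i (P g (t \<circ> u) x)" if u: "u \<in> Gal" for u x
    unfolding P_def EV_def ev_def Gal_sum_list[OF i] using t i
    by (simp add: case_prod_unfold comp_def Gal_mult Gal_inv_apply)
  have "cls ?s = Q (unit_fun (\<beta> t g))"
  proof (rule ev_id_inject[OF cls_LH[OF rs] Q(1)[OF GA_unit[OF \<beta>_closed[OF t g]]]])
    fix x
    have "ev id (tensor_rep (cls ?s)) x = ?i (P g t x)" using ev[OF Gal_id] ev_rep[OF rs Gal_id] by simp
    also have "\<dots> = E (\<beta> t g) x" using t by (simp add: P_\<beta>[OF t g] Gal_inv_apply)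
    finally show "ev id (tensor_rep (cls ?s)) x = ev id (tensor_rep (Q (unit_fun (\<beta> t g)))) x"
      by (simp add: E_def P_def EV_def)
  qed
  then have "P (\<beta> t g) s x = ?i (P g (t \<circ> s) x)" for x
    using ev[OF s, of x] ev_rep[OF rs s, of x] by (simp add: P_def EV_def)
  then show ?thesis using t by (auto simp: Gal_inv_apply)
qed

text \<open>Evaluate the product g h at t, bring t to the front with \<open>P_left\<close>, and
  cancel it.\<close>

lemma \<beta>_mult:
  assumes t: "t \<in> Gal" and g: "g \<in> carrier N" and h: "h \<in> carrier N"
  shows "\<beta> t (g \<otimes>\<^bsub>N\<^esub> h) = \<beta> t g \<otimes>\<^bsub>N\<^esub> \<beta> t h"
proof (rule E_inject)
  have "t \<circ> E (\<beta> t (g \<otimes>\<^bsub>N\<^esub> h)) = P h (P g t)"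
    using P_\<beta>[OF t, of "g \<otimes>\<^bsub>N\<^esub> h"] g h t by (simp add: P_comp)
  also have "\<dots> = P h (t \<circ> E (\<beta> t g))" by (simp add: P_\<beta>[OF t g])
  also have "\<dots> = t \<circ> P (\<beta> t h) (E (\<beta> t g))"
    by (rule P_left[OF t E_Gal[OF \<beta>_closed[OF t g]] h])
  also have "\<dots> = t \<circ> E (\<beta> t g \<otimes>\<^bsub>N\<^esub> \<beta> t h)"
    using P_comp[OF \<beta>_closed[OF t g] \<beta>_closed[OF t h] Gal_id] by (simp add: E_def)
  finally show "E (\<beta> t (g \<otimes>\<^bsub>N\<^esub> h)) = E (\<beta> t g \<otimes>\<^bsub>N\<^esub> \<beta> t h)"
    using t by (auto simp: fun_eq_iff Gal_inject)
qed (use t g h \<beta>_closed in auto)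

lemma P_E: "k \<in> carrier N \<Longrightarrow> g \<in> carrier N \<Longrightarrow> P g (E k) = E (k \<otimes>\<^bsub>N\<^esub> g)"
  by (simp add: E_def P_comp)

lemma \<beta>_auto: assumes t: "t \<in> Gal" shows "\<beta> t \<in> auto N"
proof (rule autoI)
  have inj: "inj_on (\<beta> t) (carrier N)"
  proof (rule inj_onI)
    fix g h assume g: "g \<in> carrier N" and h: "h \<in> carrier N" and eq: "\<beta> t g = \<beta> t h"
    have "P g t = P h t" using P_\<beta>[OF t] g h eq by simp
    then have "E (\<phi> t \<otimes>\<^bsub>N\<^esub> g) = E (\<phi> t \<otimes>\<^bsub>N\<^esub> h)"
      using P_E[OF \<phi>_closed[OF t]] g h by (simp add: E_\<phi> t)
    then have "\<phi> t \<otimes>\<^bsub>N\<^esub> g = \<phi> t \<otimes>\<^bsub>N\<^esub> h" 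
      using E_inject[OF m_closed[OF \<phi>_closed[OF t] g] m_closed[OF \<phi>_closed[OF t] h]] by simp
    then show "g = h" using g h \<phi>_closed[OF t] by simp
  qed
  moreover have "\<beta> t ` carrier N \<subseteq> carrier N" using \<beta>_closed[OF t] by blast
  ultimately show "bij_betw (\<beta> t) (carrier N) (carrier N)"
    using finite_N by (simp add: bij_betw_def endo_inj_surj)
qed (use \<beta>_mult[OF t] in \<open>auto simp: \<beta>_def\<close>)

text \<open>Since \<open>P g\<close> takes \<open>E k\<close> to \<open>E (k g)\<close>, composing t
  with \<open>E (\<beta> t g)\<close> corresponds to \<phi> t times g. The automorphism to be
  exhibited is therefore the inverse of \<open>\<beta> t\<close>.\<close>

lemma \<phi>_brace: "\<phi> \<in> brace_maps (gal_group K) N"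
  unfolding brace_maps_def
proof (intro CollectI conjI ballI)
  have "bij_betw (inv_into (carrier N) E) Gal (carrier N)" by (rule bij_betw_inv_into[OF E_bij])
  then show "bij_betw \<phi> Gal (carrier N)"
    by (rule iffD1[OF bij_betw_cong, rotated]) (simp add: \<phi>_def)
  fix t assume t: "t \<in> Gal"
  let ?\<alpha> = "restrict (inv_into (carrier N) (\<beta> t)) (carrier N)"
  have "?\<alpha> \<in> auto N"
    using \<beta>_auto[OF t] restrict_inv_into_hom restrict_inv_into_Bij by (auto simp: auto_def)
  moreover have "\<phi> (t \<circ> s) = \<phi> t \<otimes>\<^bsub>N\<^esub> ?\<alpha> (\<phi> s)" if s: "s \<in> Gal" for s
  proof -
    obtain h where h: "h \<in> carrier N" "\<beta> t h = \<phi> s"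
      using autoD(2)[OF \<beta>_auto[OF t]] \<phi>_closed[OF s] by (metis bij_betw_imp_surj_on imageE)
    have "t \<circ> s = P h t" using P_\<beta>[OF t h(1)] h(2) s by (simp add: E_\<phi>)
    also have "\<dots> = E (\<phi> t \<otimes>\<^bsub>N\<^esub> h)" using P_E[OF \<phi>_closed[OF t] h(1)] t by (simp add: E_\<phi>)
    finally have "\<phi> (t \<circ> s) = \<phi> t \<otimes>\<^bsub>N\<^esub> h" using h \<phi>_closed[OF t] by (simp add: \<phi>_E)
    moreover have "?\<alpha> (\<phi> s) = h"
      using h autoD(2)[OF \<beta>_auto[OF t]] \<phi>_closed[OF s] by (simp add: bij_betw_def flip: h(2))
    ultimately show ?thesis by simp
  qed
  ultimately show "\<exists>\<alpha>\<in>auto N. \<forall>s\<in>Gal. \<phi> (t \<otimes>\<^bsub>gal_group K\<^esub> s) = \<phi> t \<otimes>\<^bsub>N\<^esub> \<alpha> (\<phi> s)"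
    by (intro bexI[of _ ?\<alpha>] ballI) (simp_all only: gal_mult)
qed (simp add: \<phi>_def)

end

section \<open>Identifying H with the invariants of its brace map\<close>

context typed_structure
begin

interpretation Ho: hopf_algebra K H by (rule is_hopf)
interpretation Hm: module "scalars K" H by (rule Ho.is_module)

sublocale D: descent K N \<phi>
proof -
  have "brace_map (gal_group K) N \<phi>"
    using \<phi>_brace group_Gal group_axioms by (simp add: brace_map_def brace_map_axioms_def)
  then show "descent K N \<phi>" using galois_extension_axioms by (simp add: descent_def)
qed

lemma \<psi>_E: assumes "g \<in> carrier N" shows "D.\<psi> g = E g"
  using D.\<psi>_\<phi>[of "E g"] assms by (simp add: E_Gal \<phi>_E)

lemma twist_\<beta>:
  assumes t: "t \<in> Gal" and g: "g \<in> carrier N" shows "D.twist t (\<beta> t g) = g"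
proof -
  have "t \<circ> E (\<beta> t g) = E (\<phi> t \<otimes>\<^bsub>N\<^esub> g)"
    using P_\<beta>[OF t g] P_E[OF \<phi>_closed[OF t] g] by (simp add: E_\<phi> t)
  then have "\<phi> (t \<circ> E (\<beta> t g)) = \<phi> t \<otimes>\<^bsub>N\<^esub> g" using t g \<phi>_closed by (simp add: \<phi>_E)
  moreover have "\<phi> (t \<circ> E (\<beta> t g)) = \<phi> t \<otimes>\<^bsub>N\<^esub> D.twist t (\<beta> t g)"
    using D.mult[of t "E (\<beta> t g)"] t g by (simp add: E_Gal \<beta>_closed \<phi>_E)
  ultimately show ?thesis using t g \<beta>_closed \<phi>_closed by simp
qed

lemma bij_\<beta>: "t \<in> Gal \<Longrightarrow> bij_betw (\<beta> t) (carrier N) (carrier N)"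
  using autoD(2)[OF \<beta>_auto] .

lemma EV_opr: "f \<in> carrier GA' \<Longrightarrow> EV id f x = D.opr f x"
  by (simp add: EV_expansion D.opr_def \<psi>_E) (simp add: E_def)

definition r :: "'h \<Rightarrow> 'a \<Rightarrow> 'l" where "r h = \<Psi> (cls [(1, h)])"

lemma r_GA: "h \<in> carrier H \<Longrightarrow> r h \<in> carrier GA'"
  by (simp add: r_def \<Psi>_closed cls_LH)

lemma EV_r: "h \<in> carrier H \<Longrightarrow> t \<in> Gal \<Longrightarrow> EV t (r h) x = t (act h x)"
  by (simp add: r_def EV_cls ev_def)

lemma act_opr: "h \<in> carrier H \<Longrightarrow> act h x = D.opr (r h) x"
  using EV_r[of h id x] EV_opr[OF r_GA] by simp

lemma GA_opr_eqI: assumes "f \<in> carrier GA'" "f' \<in> carrier GA'" "\<And>x. D.opr f x = D.opr f' x" shows "f = f'"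
proof
  fix g
  have "D.opr f = D.opr f'" using assms(3) by blast
  then show "f g = f' g" using D.opr_inject[of f f' g] assms(1,2) by (cases "g \<in> carrier N") (auto simp: GA_carrier)
qed

text \<open>The function with values t^-1 (r h (twist t g)) induces t^-1 after x \<mapsto> t (h x),
  which is the action of h again. Equal operators have equal coefficients, so r h is
  invariant.\<close>

lemma r_W: assumes h: "h \<in> carrier H" shows "r h \<in> D.W"
  unfolding invariants_def
proof (intro CollectI conjI ballI allI impI)
  show "r h x = 0" if "x \<notin> carrier N" for x using r_GA[OF h] that by (simp add: GA_carrier)
  fix t g assume t: "t \<in> Gal" and g: "g \<in> carrier N"
  let ?i = "Hilbert_Choice.inv t"
  let ?F = "\<lambda>g. if g \<in> carrier N then ?i (r h (D.twist t g)) else 0"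
  have "?F = r h"
  proof (rule GA_opr_eqI)
    fix x
    have "D.opr ?F x = (\<Sum>g\<in>carrier N. ?F (\<beta> t g) * E (\<beta> t g) x)"
      unfolding D.opr_def by (subst sum.reindex_bij_betw[OF bij_\<beta>[OF t], symmetric]) (simp add: \<psi>_E \<beta>_closed t)
    also have "\<dots> = (\<Sum>g\<in>carrier N. ?i (r h g * P g t x))"
      using t Gal_inv[OF t] by (intro sum.cong) (simp_all add: \<beta>_closed twist_\<beta> P_\<beta> Gal_mult Gal_inv_apply)
    also have "\<dots> = ?i (EV t (r h) x)" using t Gal_inv[OF t] by (simp add: EV_expansion r_GA h Gal_sum)
    also have "\<dots> = D.opr (r h) x" using t by (simp add: EV_r h Gal_inv_apply act_opr)
    finally show "D.opr ?F x = D.opr (r h) x" .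
  qed (use r_GA[OF h] in \<open>auto simp: GA_carrier\<close>)
  then have "?i (r h (D.twist t g)) = r h g" using fun_cong[of ?F "r h" g] g by simp
  then have "t (?i (r h (D.twist t g))) = t (r h g)" by simp
  then show "r h (D.twist t g) = t (r h g)" using t by (simp add: Gal_inv_apply)
qed

text \<open>If 1 \<otimes> h and 1 \<otimes> k agreed, every K-linear form on H would take the same
  value at h and k; a form that is nonzero at h - k excludes this.\<close>

lemma r_inject: assumes h: "h \<in> carrier H" and k: "k \<in> carrier H" and eq: "r h = r k" shows "h = k"
proof (rule ccontr)
  assume ne: "h \<noteq> k"
  have s: "set [(1 :: 'l, h)] \<subseteq> UNIV \<times> carrier H" "set [(1 :: 'l, k)] \<subseteq> UNIV \<times> carrier H" using h k by auto
  have "cls [(1, h)] = cls [(1, k)]"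
    using eq \<Psi>(1) cls_LH[OF s(1)] cls_LH[OF s(2)] by (simp add: r_def bij_betw_def inj_on_def)
  then have t: "tensor_eq K top_module H [(1, h)] [(1, k)]"
    using tensor_class_eq_iff[of "[(1, h)]" top_module H K "[(1, k)]"] s by auto
  let ?d = "h \<ominus>\<^bsub>H\<^esub> k"
  have d: "?d \<in> carrier H" "h = ?d \<oplus>\<^bsub>H\<^esub> k" using h k by (simp_all add: a_minus_def Hm.M.add.m_assoc Hm.M.l_neg)
  then have "?d \<noteq> \<zero>\<^bsub>H\<^esub>" using ne k by auto
  then obtain f where f: "linear_form K H f" "f ?d \<noteq> 0"
    using linear_forms_separate[OF Ho.is_module d(1)] by blast
  have "f h = f ?d + f k" using f(1) d k unfolding linear_form_def by metis
  moreover have "f h = f k"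
    using tensor_eq_eval[OF t, of f] f(1) by (simp add: linear_form_def)
  ultimately show False using f(2) by simp
qed

lemma list_add_closed: "set hs \<subseteq> carrier H \<Longrightarrow> list_add H hs \<in> carrier H"
  by (induction hs) (auto simp: list_add_def)

lemma act_zero: "act \<zero>\<^bsub>H\<^esub> x = 0"
proof -
  have "act \<zero>\<^bsub>H\<^esub> x = act \<zero>\<^bsub>H\<^esub> x + act \<zero>\<^bsub>H\<^esub> x"
    using act_simps(2)[of "\<zero>\<^bsub>H\<^esub>" "\<zero>\<^bsub>H\<^esub>" x] by simp
  then show ?thesis by (metis add_cancel_left_left)
qed

lemma act_list_add: "set hs \<subseteq> carrier H \<Longrightarrow> act (list_add H hs) x = (\<Sum>h\<leftarrow>hs. act h x)"
proof (induction hs)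
  case (Cons h hs)
  then show ?case using list_add_closed[of hs] act_simps(2)[of h "list_add H hs" x] by (simp add: list_add_def)
qed (simp add: list_add_def act_zero)

text \<open>Averaging with c of trace 1: for f represented by \<Sum> l \<otimes> h, the element
  \<Sum> tr (c l) h of H acts as a sum of conjugates of the action of f weighted by t c. By
  invariance each conjugate acts as f, and the weights add up to 1.\<close>

lemma r_surj: assumes f: "f \<in> D.W" shows "f \<in> r ` carrier H"
proof (rule ex_trace_1)
  fix c assume c: "tr c = 1"
  have fG: "f \<in> carrier GA'" using D.A.InvD(1)[OF f] by (simp add: GA_carrier)
  let ?s = "tensor_rep (Q f)"
  have s: "set ?s \<subseteq> UNIV \<times> carrier H" using rep_LH Q(1)[OF fG] by blast
  let ?hs = "[tr (c * l) \<odot>\<^bsub>H\<^esub> h. (l, h) \<leftarrow> ?s]"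
  have hs: "set ?hs \<subseteq> carrier H" using s by (auto simp: H_closed tr_K)
  let ?h = "list_add H ?hs"
  have h: "?h \<in> carrier H" by (rule list_add_closed[OF hs])
  have twisted: "t (EV (Hilbert_Choice.inv t) f x) = D.opr f x" if t: "t \<in> Gal" for t x
  proof -
    let ?i = "Hilbert_Choice.inv t"
    have i: "?i \<in> Gal" using t by blast
    have "t (EV ?i f x) = (\<Sum>g\<in>carrier N. t (f g) * E (\<beta> ?i g) x)"
      unfolding EV_expansion[OF fG i] Gal_sum[OF t]
      using t by (intro sum.cong) (simp_all add: P_\<beta>[OF i] Gal_mult Gal_inv_apply)
    also have "\<dots> = (\<Sum>g\<in>carrier N. f (\<beta> ?i g) * E (\<beta> ?i g) x)"
    proof (intro sum.cong refl arg_cong2[of _ _ _ _ "(*)"])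
      fix g assume g: "g \<in> carrier N"
      have "D.twist t g = D.twist t (D.twist ?i (\<beta> ?i g))" by (simp add: twist_\<beta>[OF i g])
      also have "\<dots> = \<beta> ?i g" using D.A.T_inv(2)[OF t \<beta>_closed[OF i g]] .
      finally show "t (f g) = f (\<beta> ?i g)" using D.A.InvD(2)[OF f t g] by simp
    qed
    also have "\<dots> = (\<Sum>g\<in>carrier N. f g * E g x)" by (rule sum.reindex_bij_betw[OF bij_\<beta>[OF i]])
    also have "\<dots> = D.opr f x" by (simp add: D.opr_def \<psi>_E)
    finally show ?thesis .
  qed
  have "act ?h x = D.opr f x" for x
  proof -
    have "act ?h x = (\<Sum>(l, h)\<leftarrow>?s. \<Sum>t\<in>Gal. t c * t (l * Hilbert_Choice.inv t (act h x)))"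
      unfolding act_list_add[OF hs] map_map
    proof (intro sum_list_cong, clarify)
      fix l h assume "(l, h) \<in> set ?s"
      then have "h \<in> carrier H" using s by auto
      then have "act (tr (c * l) \<odot>\<^bsub>H\<^esub> h) x = tr (c * l) * act h x" by (rule act_simps(3)[OF tr_K])
      also have "\<dots> = (\<Sum>t\<in>Gal. t c * t (l * Hilbert_Choice.inv t (act h x)))"
        unfolding tr_def sum_distrib_right by (intro sum.cong refl) (simp add: Gal_mult Gal_inv_apply mult.assoc)
      finally show "((\<lambda>h. act h x) \<circ> (\<lambda>(l, h). tr (c * l) \<odot>\<^bsub>H\<^esub> h)) (l, h) =
          (\<Sum>t\<in>Gal. t c * t (l * Hilbert_Choice.inv t (act h x)))" by simp
    qed
    also have "\<dots> = (\<Sum>t\<in>Gal. t c * t (EV (Hilbert_Choice.inv t) f x))"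
      unfolding case_prod_unfold sum_sum_list[symmetric]
      by (intro sum.cong refl) (simp add: EV_def ev_def Gal_sum_list sum_list_const_mult case_prod_unfold)
    also have "\<dots> = (\<Sum>t\<in>Gal. t c * D.opr f x)" by (intro sum.cong) (simp_all add: twisted)
    also have "\<dots> = D.opr f x" using c by (simp add: sum_distrib_right[symmetric] tr_def)
    finally show ?thesis .
  qed
  then have "r ?h = f" by (intro GA_opr_eqI[OF r_GA[OF h] fG]) (simp add: act_opr[OF h])
  then show ?thesis using h by (intro image_eqI[of _ _ ?h]) simp_all
qed

sublocale R: descent_rep K N \<phi> H r
proof
  show "bij_betw r (carrier H) D.W"
    using r_inject r_W r_surj unfolding bij_betw_def inj_on_def by blast
  fix h k assume h: "h \<in> carrier H" and k: "k \<in> carrier H"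
  show "r (h \<oplus>\<^bsub>H\<^esub> k) = (\<lambda>g. r h g + r k g)"
  proof (rule GA_opr_eqI)
    fix x show "D.opr (r (h \<oplus>\<^bsub>H\<^esub> k)) x = D.opr (\<lambda>g. r h g + r k g) x"
      using h k by (simp add: D.opr_add act_opr[symmetric] H_closed act_simps)
  qed (use r_GA h k in \<open>auto simp: H_closed GA_carrier\<close>)
next
  fix c h assume c: "c \<in> K" and h: "h \<in> carrier H"
  show "r (c \<odot>\<^bsub>H\<^esub> h) = (\<lambda>g. c * r h g)"
  proof (rule GA_opr_eqI)
    fix x show "D.opr (r (c \<odot>\<^bsub>H\<^esub> h)) x = D.opr (\<lambda>g. c * r h g) x"
      using h c by (simp add: D.opr_smult act_opr[symmetric] H_closed act_simps)
  qed (use r_GA[OF h] r_GA[of "c \<odot>\<^bsub>H\<^esub> h"] h c in \<open>auto simp: H_closed GA_carrier\<close>)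
qed (auto simp: H_closed)

text \<open>The antipode of the base change is computed on an arbitrary representative of the class
  of 1 \<otimes> h. Comparing actions on L shows that the result is the class of 1 \<otimes>
  S(h).\<close>

lemma r_antipode: assumes h: "h \<in> carrier H" shows "r (antipode H h) = reflection N (r h)"
proof -
  let ?c = "cls [(1, h)]"
  have s: "set [(1 :: 'l, h)] \<subseteq> UNIV \<times> carrier H" "set [(1 :: 'l, antipode H h)] \<subseteq> UNIV \<times> carrier H"
    using h Ho.antipode_closed by auto
  have c: "?c \<in> LH" by (rule cls_LH[OF s(1)])
  let ?S = "[(l, antipode H k). (l, k) \<leftarrow> tensor_rep ?c]"
  have S: "set ?S \<subseteq> UNIV \<times> carrier H" using rep_LH[OF c] by (auto simp: Ho.antipode_closed)
  have "cls ?S = cls [(1, antipode H h)]"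
  proof (rule ev_id_inject[OF cls_LH[OF S] cls_LH[OF s(2)]])
    fix x
    have "ev id ?S x = (\<Sum>(l, k)\<leftarrow>tensor_rep ?c. l * act (antipode H k) x)"
      by (simp add: ev_def case_prod_unfold comp_def)
    also have "\<dots> = (\<Sum>(l, k)\<leftarrow>[(1, h)]. l * act (antipode H k) x)"
      by (rule tensor_eq_eval[OF tensor_eq_sym[OF tensor_rep_class]])
        (use s in \<open>auto simp: Ho.antipode_add Ho.antipode_smult act_simps Ho.antipode_closed\<close>)
    also have "\<dots> = ev id [(1, antipode H h)] x" by (simp add: ev_def)
    finally show "ev id (tensor_rep (cls ?S)) x = ev id (tensor_rep (cls [(1, antipode H h)])) x"
      unfolding ev_rep[OF S Gal_id] ev_rep[OF s(2) Gal_id] .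
  qed
  then have "r (antipode H h) = \<Psi> (antipode (base_change K H) ?c)" by (simp add: r_def BC_simps)
  also have "\<dots> = reflection N (r h)" using \<Psi>(7)[OF c] by (simp add: r_def GA_simps)
  finally show ?thesis .
qed

lemma image_op_image: "structure_image (H, act) = D.op_image"
proof -
  have "act ` carrier H = D.opr ` r ` carrier H"
    unfolding image_image using act_opr by (intro image_cong) auto
  then show ?thesis using R.r_bij by (simp add: structure_image_def D.op_image_def bij_betw_def)
qed

end

section \<open>Structures with the same operators are isomorphic\<close>

context typed_structure
begin

lemma act_faithful:
  assumes h: "h \<in> carrier H" and k: "k \<in> carrier H" and eq: "\<And>x. act h x = act k x" shows "h = k"
proof (rule r_inject[OF h k GA_opr_eqI[OF r_GA[OF h] r_GA[OF k]]])
  fix x show "D.opr (r h) x = D.opr (r k) x" using eq[of x] by (simp add: act_opr h k)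
qed

lemma act_one: "act \<one>\<^bsub>H\<^esub> x = x"
  using is_module_algebra by (simp add: module_algebra_def)

lemma one_closed_H: "\<one>\<^bsub>H\<^esub> \<in> carrier H"
  using hopf_algebra.is_ring[OF is_hopf] by (simp add: ring.ring_simprules)

end

locale two_typed = S: typed_structure K N H act \<Psi> + S': typed_structure K N H' act' \<Psi>'
  for K :: "'l :: field set" and N :: "('a, 'y) monoid_scheme"
    and H :: "('l, 'h, 'm) hopf_scheme" and act \<Psi>
    and H' :: "('l, 'k, 'n) hopf_scheme" and act' \<Psi>' +
  assumes same_image: "act ` carrier H = act' ` carrier H'"
begin

definition F :: "'h \<Rightarrow> 'k" where "F h = (SOME k. k \<in> carrier H' \<and> act' k = act h)"

lemma F: assumes "h \<in> carrier H" shows "F h \<in> carrier H'" "act' (F h) = act h"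
proof -
  have "act h \<in> act' ` carrier H'" using assms same_image by blast
  then have "\<exists>k. k \<in> carrier H' \<and> act' k = act h" by force
  from someI_ex[OF this] show "F h \<in> carrier H'" "act' (F h) = act h" by (auto simp: F_def)
qed

lemma F_eqI: "h \<in> carrier H \<Longrightarrow> k \<in> carrier H' \<Longrightarrow> (\<And>x. act' k x = act h x) \<Longrightarrow> F h = k"
  by (rule S'.act_faithful) (auto simp: F)

sublocale D: two_descents K N S.\<phi> S'.\<phi>
  using S.D.descent_axioms S'.D.descent_axioms by (simp add: two_descents_def)

text \<open>The antipode does not occur in the axioms of the action, so the brace maps are compared
  instead: equal operators make them differ by an automorphism of N, and automorphisms commute with
  inversion.\<close>

lemma F_antipode:
  assumes h: "h \<in> carrier H" shows "antipode H' (F h) = F (antipode H h)"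
proof (rule F_eqI[symmetric])
  show a: "antipode H h \<in> carrier H" "antipode H' (F h) \<in> carrier H'"
    using hopf_algebra.antipode_closed[OF S.is_hopf h] hopf_algebra.antipode_closed[OF S'.is_hopf F(1)[OF h]] by auto
  have im: "S.D.op_image = S'.D.op_image"
    using S.image_op_image S'.image_op_image same_image by (simp add: structure_image_def)
  show "act' (antipode H' (F h)) x = act (antipode H h) x" for x
  proof (rule D.op_image_eq_imp[OF im])
    fix \<theta> assume \<theta>: "\<theta> \<in> auto N" "S'.\<phi> = compose (carrier (gal_group K)) \<theta> S.\<phi>"
    let ?f = "S'.r (F h)"
    have f: "?f \<in> S'.D.W" by (rule S'.r_W[OF F(1)[OF h]])
    have "S.D.opr (\<lambda>g. if g \<in> carrier N then ?f (\<theta> g) else 0) = S'.D.opr ?f"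
      by (rule D.op_image_compose(2)[OF \<theta> f])
    also have "\<dots> = S.D.opr (S.r h)"
      using S'.act_opr[OF F(1)[OF h]] S.act_opr[OF h] F(2)[OF h] by auto
    finally have eq: "S.D.opr (\<lambda>g. if g \<in> carrier N then ?f (\<theta> g) else 0) = S.D.opr (S.r h)" .
    have rh: "?f (\<theta> g) = S.r h g" if "g \<in> carrier N" for g
      using S.D.opr_inject[OF eq that] that by simp
    have \<theta>inv: "inv\<^bsub>N\<^esub> \<theta> g = \<theta> (inv\<^bsub>N\<^esub> g)" if g: "g \<in> carrier N" for g
    proof -
      have "group_hom N N \<theta>" using autoD(1)[OF \<theta>(1)] by unfold_locales
      from group_hom.hom_inv[OF this g] show ?thesis by simp
    qed
    have "act' (antipode H' (F h)) x = S'.D.opr (reflection N ?f) x"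
      using S'.act_opr[OF a(2)] S'.r_antipode[OF F(1)[OF h]] by simp
    also have "\<dots> = S.D.opr (\<lambda>g. if g \<in> carrier N then reflection N ?f (\<theta> g) else 0) x"
      using D.op_image_compose(2)[OF \<theta> S'.D.anti_W[OF f]] by simp
    also have "\<dots> = S.D.opr (reflection N (S.r h)) x"
      unfolding S.D.opr_def by (intro sum.cong refl) (simp add: reflection_def autoD(4)[OF \<theta>(1)] \<theta>inv rh)
    also have "\<dots> = act (antipode H h) x"
      using S.act_opr[OF a(1)] S.r_antipode[OF h] by simp
    finally show ?thesis .
  qed
qed

text \<open>Ring operations, scalars and counit are visible in the action and transfer by
  faithfulness. The coproduct transfers because it is determined by the action on products.\<close>

lemma F_iso: "F \<in> hopf_iso K H H'"
  unfolding hopf_iso_def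
proof (intro CollectI conjI ballI)
  have "F \<in> ring_hom H H'"
  proof (rule ring_hom_memI)
    show "F \<one>\<^bsub>H\<^esub> = \<one>\<^bsub>H'\<^esub>"
      by (rule F_eqI) (auto simp: S.one_closed_H S'.one_closed_H S.act_one S'.act_one)
  qed (auto simp: F S.H_closed S'.H_closed S.act_simps S'.act_simps intro!: F_eqI)
  moreover have "bij_betw F (carrier H) (carrier H')"
    unfolding bij_betw_def
  proof (intro conjI subset_antisym subsetI)
    show "inj_on F (carrier H)"
    proof (rule inj_onI)
      fix h k assume h: "h \<in> carrier H" and k: "k \<in> carrier H" and "F h = F k"
      then have "act h = act k" using F(2)[OF h] F(2)[OF k] by simp
      then show "h = k" using S.act_faithful h k by simp
    qed
    fix k assume k: "k \<in> carrier H'"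
    then obtain h where h: "h \<in> carrier H" "act' k = act h" using same_image by force
    then have "F h = k" using k by (intro F_eqI) auto
    then show "k \<in> F ` carrier H" using h by blast
  qed (use F in auto)
  ultimately show "F \<in> ring_iso H H'" by (simp add: ring_iso_def)
next
  fix a h assume "a \<in> K" "h \<in> carrier H"
  then show "F (a \<odot>\<^bsub>H\<^esub> h) = a \<odot>\<^bsub>H'\<^esub> F h"
    by (intro F_eqI) (auto simp: F S.H_closed S'.H_closed S.act_simps S'.act_simps)
next
  fix h assume h: "h \<in> carrier H"
  note Fh = F[OF h]
  show "counit H' (F h) = counit H h"
    using S'.act_simps(7)[OF Fh(1)] S.act_simps(7)[OF h] Fh(2) by simp
  show "antipode H' (F h) = F (antipode H h)" by (rule F_antipode[OF h])
  show "tensor_eq K H' H' (comult H' (F h)) [(F u, F v). (u, v) \<leftarrow> comult H h]"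
  proof (rule S'.R.tensor_eq_HHI_act)
    show c: "set (comult H' (F h)) \<subseteq> carrier H' \<times> carrier H'"
      by (rule hopf_algebra.comult_closed[OF S'.is_hopf Fh(1)])
    show "set [(F u, F v). (u, v) \<leftarrow> comult H h] \<subseteq> carrier H' \<times> carrier H'"
      using S.comultD[OF h] F(1) by auto
    have ra: "S'.R.act k x = act' k x" if "k \<in> carrier H'" for k x
      using that by (simp add: S'.R.act_def S'.act_opr)
    fix x y
    have "(\<Sum>(u, v)\<leftarrow>comult H' (F h). S'.R.act u x * S'.R.act v y) = (\<Sum>(u, v)\<leftarrow>comult H' (F h). act' u x * act' v y)"
      using c ra by (intro sum_list_cong) auto
    also have "\<dots> = act h (x * y)" using S'.act_simps(6)[OF Fh(1)] Fh(2) by simp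
    also have "\<dots> = (\<Sum>(u, v)\<leftarrow>comult H h. act u x * act v y)" by (rule S.act_simps(6)[OF h])
    also have "\<dots> = (\<Sum>(u, v)\<leftarrow>[(F u, F v). (u, v) \<leftarrow> comult H h]. S'.R.act u x * S'.R.act v y)"
      unfolding map_map using S.comultD[OF h] by (intro sum_list_cong) (auto simp: F ra)
    finally show "(\<Sum>(u, v)\<leftarrow>comult H' (F h). S'.R.act u x * S'.R.act v y) =
        (\<Sum>(u, v)\<leftarrow>[(F u, F v). (u, v) \<leftarrow> comult H h]. S'.R.act u x * S'.R.act v y)" .
  qed
qed

end

lemma card_quotient_eq_card_image:
  assumes "R \<subseteq> S \<times> S" "\<And>a b. a \<in> S \<Longrightarrow> b \<in> S \<Longrightarrow> (a, b) \<in> R \<longleftrightarrow> f a = f b"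
  shows "card (S // R) = card (f ` S)"
proof -
  have cl: "R `` {a} = {b \<in> S. f b = f a}" if "a \<in> S" for a using assms that by auto
  have "S // R = (\<lambda>y. {b \<in> S. f b = y}) ` f ` S"
    using cl by (auto simp: quotient_def image_image)
  moreover have "inj_on (\<lambda>y. {b \<in> S. f b = y}) (f ` S)" by (auto simp: inj_on_def)
  ultimately show ?thesis by (simp add: card_image)
qed

text \<open>Greither and Pareigis: a Hopf-Galois structure is determined by its image in \<open>End\<^sub>K(L)\<close>, and
  the possible images correspond to the orbits of \<open>Aut N\<close> on \<open>brace_maps\<close>.\<close>

theorem card_brace_maps_hgs_number:
  fixes K :: "'l :: field set" and N :: "('a, 'y) monoid_scheme"
  assumes ge: "galois_extension K" and N: "group N" and fin: "finite (carrier N)"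
  shows "card (brace_maps (gal_group K) N) = hgs_number K N * card (auto N)"
proof -
  interpret galois_extension K by (rule ge)
  interpret N: group N by (rule N)
  have fga: "finite_group_algebra N" using fin N by (simp add: finite_group_algebra_def finite_group_algebra_axioms_def)
  let ?B = "brace_maps (gal_group K) N"
  let ?f = "\<lambda>\<phi>. descent.op_image K N \<phi>"
  define S where "S = {A :: ('l, 'l) hopf \<times> ('l \<Rightarrow> 'l \<Rightarrow> 'l). hopf_galois_structure K A \<and> has_type K N A}"
  have loc: "descent K N \<phi>" if "\<phi> \<in> ?B" for \<phi>
    using that ge N group_Gal by (simp add: descent_def brace_map_def brace_map_axioms_def)
  have typed: "\<exists>\<Psi>. typed_structure K N (fst A) (snd A) \<Psi>" if AS: "A \<in> S" for A
  proof -
    obtain \<Psi> where "\<Psi> \<in> hopf_iso UNIV (base_change K (fst A)) (group_algebra UNIV N)"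
      using AS by (auto simp: S_def has_type_def case_prod_unfold)
    then have "typed_structure K N (fst A) (snd A) \<Psi>"
      using AS ge fga by (simp add: typed_structure_def typed_structure_axioms_def S_def)
    then show ?thesis by blast
  qed
  have equiv: "hgs_equiv K A A' \<longleftrightarrow> structure_image A = structure_image A'" if A: "A \<in> S" and A': "A' \<in> S" for A A'
  proof
    assume "hgs_equiv K A A'"
    then obtain F where F: "F \<in> hopf_iso K (fst A) (fst A')" "\<And>h x. h \<in> carrier (fst A) \<Longrightarrow> snd A' (F h) x = snd A h x"
      by (auto simp: hgs_equiv_def case_prod_unfold)
    have "snd A' (F h) = snd A h" if "h \<in> carrier (fst A)" for h using F(2)[OF that] by blast
    then have "structure_image A = snd A' ` F ` carrier (fst A)"
      by (simp add: structure_image_def image_image cong: image_cong)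
    also have "F ` carrier (fst A) = carrier (fst A')" using F(1) by (simp add: hopf_iso_def ring_iso_def bij_betw_def)
    finally show "structure_image A = structure_image A'" by (simp add: structure_image_def)
  next
    assume eq: "structure_image A = structure_image A'"
    obtain \<Psi> \<Psi>' where T: "typed_structure K N (fst A) (snd A) \<Psi>" "typed_structure K N (fst A') (snd A') \<Psi>'"
      using typed A A' by blast
    interpret two_typed K N "fst A" "snd A" \<Psi> "fst A'" "snd A'" \<Psi>'
      using T eq by (simp add: two_typed_def two_typed_axioms_def structure_image_def)
    show "hgs_equiv K A A'"
      unfolding hgs_equiv_def case_prod_unfold by (intro bexI[OF _ F_iso] ballI allI) (simp add: F)
  qed
  have "hgs_number K N = card (structure_image ` S)"
    unfolding hgs_number_def Let_def S_def[symmetric]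
    by (rule card_quotient_eq_card_image) (auto simp: equiv)
  also have "structure_image ` S = ?f ` ?B"
  proof (intro subset_antisym subsetI)
    fix I assume "I \<in> structure_image ` S"
    then obtain A where A: "A \<in> S" "I = structure_image A" by blast
    obtain \<Psi> where "typed_structure K N (fst A) (snd A) \<Psi>" using typed[OF A(1)] by blast
    then interpret typed_structure K N "fst A" "snd A" \<Psi> .
    show "I \<in> ?f ` ?B" using image_op_image A(2) \<phi>_brace by auto
  next
    fix I assume "I \<in> ?f ` ?B"
    then obtain \<phi> where \<phi>: "\<phi> \<in> ?B" "I = ?f \<phi>" by blast
    show "I \<in> structure_image ` S"
      using descent.structure_exists[OF loc[OF \<phi>(1)]] \<phi>(2) unfolding S_def by blast
  qed
  finally have num: "hgs_number K N = card (?f ` ?B)" .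
  have fibre: "card {\<chi> \<in> ?B. ?f \<chi> = ?f \<phi>} = card (auto N)" if \<phi>: "\<phi> \<in> ?B" for \<phi>
  proof -
    interpret \<phi>: descent K N \<phi> using loc[OF \<phi>] .
    have "bij_betw (\<lambda>\<theta>. compose Gal \<theta> \<phi>) (auto N) {\<chi> \<in> ?B. ?f \<chi> = ?f \<phi>}"
    proof (rule bij_betwI')
      fix \<theta> \<theta>' assume \<theta>: "\<theta> \<in> auto N" "\<theta>' \<in> auto N"
      show "compose Gal \<theta> \<phi> = compose Gal \<theta>' \<phi> \<longleftrightarrow> \<theta> = \<theta>'"
      proof
        assume eq: "compose Gal \<theta> \<phi> = compose Gal \<theta>' \<phi>"
        show "\<theta> = \<theta>'"
        proof (rule extensionalityI[OF autoD(3)[OF \<theta>(1)] autoD(3)[OF \<theta>(2)]])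
          fix g assume g: "g \<in> carrier N"
          show "\<theta> g = \<theta>' g" using fun_cong[OF eq, of "\<phi>.\<psi> g"] g by (simp add: compose_eq)
        qed
      qed simp
    next
      fix \<theta> assume \<theta>: "\<theta> \<in> auto N"
      let ?\<chi> = "compose Gal \<theta> \<phi>"
      have \<chi>: "?\<chi> \<in> ?B" by (rule \<phi>.post_auto[OF \<theta>])
      interpret \<chi>: descent K N ?\<chi> using loc[OF \<chi>] .
      interpret two_descents K N \<phi> ?\<chi> by unfold_locales
      interpret r: two_descents K N ?\<chi> \<phi> by unfold_locales
      let ?\<theta>' = "restrict (inv_into (carrier N) \<theta>) (carrier N)"
      have \<theta>': "?\<theta>' \<in> auto N"
        using \<theta> N.restrict_inv_into_hom restrict_inv_into_Bij by (auto simp: auto_def)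
      have bk: "\<phi> = compose Gal ?\<theta>' ?\<chi>"
        by (rule extensionalityI[OF \<phi>.extens compose_extensional])
          (use autoD(2,4)[OF \<theta>] in \<open>auto simp: compose_eq bij_betw_def\<close>)
      have "?f ?\<chi> = ?f \<phi>"
      proof (intro subset_antisym subsetI)
        fix h assume "h \<in> \<chi>.op_image"
        then obtain f where f: "f \<in> \<chi>.W" "h = \<chi>.opr f" by (auto simp: \<chi>.op_image_def)
        show "h \<in> \<phi>.op_image"
          unfolding \<phi>.op_image_def f(2) op_image_compose(2)[OF \<theta> refl f(1), symmetric]
          by (rule imageI[OF op_image_compose(1)[OF \<theta> refl f(1)]])
      next
        fix h assume "h \<in> \<phi>.op_image"
        then obtain f where f: "f \<in> \<phi>.W" "h = \<phi>.opr f" by (auto simp: \<phi>.op_image_def)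
        show "h \<in> \<chi>.op_image"
          unfolding \<chi>.op_image_def f(2) r.op_image_compose(2)[OF \<theta>' bk f(1), symmetric]
          by (rule imageI[OF r.op_image_compose(1)[OF \<theta>' bk f(1)]])
      qed
      then show "?\<chi> \<in> {\<chi> \<in> ?B. ?f \<chi> = ?f \<phi>}" using \<chi> by simp
    next
      fix \<chi> assume "\<chi> \<in> {\<chi> \<in> ?B. ?f \<chi> = ?f \<phi>}"
      then have \<chi>: "\<chi> \<in> ?B" and im: "?f \<chi> = ?f \<phi>" by auto
      interpret \<chi>: descent K N \<chi> using loc[OF \<chi>] .
      interpret two_descents K N \<phi> \<chi> by unfold_locales
      show "\<exists>\<theta>\<in>auto N. \<chi> = compose Gal \<theta> \<phi>"
      proof (rule op_image_eq_imp[OF im[symmetric]])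
        fix \<theta> assume "\<theta> \<in> auto N" "\<chi> = compose Gal \<theta> \<phi>"
        then show ?thesis by blast
      qed
    qed
    then show ?thesis by (simp add: bij_betw_same_card)
  qed
  show ?thesis
    unfolding num by (rule card_eq_card_image_times_fibre[OF finite_brace_maps[OF finite_Gal fin] fibre])
qed

section \<open>Transport of automorphisms and brace maps along isomorphisms\<close>

lemma (in group) autoI_hom:
  "\<theta> \<in> hom G G \<Longrightarrow> bij_betw \<theta> (carrier G) (carrier G) \<Longrightarrow> restrict \<theta> (carrier G) \<in> auto G"
  by (rule autoI) (auto simp: hom_def cong: bij_betw_cong)

lemma iso_conj_auto:
  assumes g: "g \<in> iso N N'" and N: "group N" "group N'" and \<alpha>: "\<alpha> \<in> auto N"
  shows "(\<lambda>x\<in>carrier N'. g (\<alpha> (inv_into (carrier N) g x))) \<in> auto N'"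
proof -
  let ?i = "inv_into (carrier N) g"
  have "?i \<in> iso N' N" using group.iso_set_sym[OF N(1) g] .
  then have i: "bij_betw ?i (carrier N') (carrier N)" "\<And>x. x \<in> carrier N' \<Longrightarrow> ?i x \<in> carrier N"
    "\<And>x y. x \<in> carrier N' \<Longrightarrow> y \<in> carrier N' \<Longrightarrow> ?i (x \<otimes>\<^bsub>N'\<^esub> y) = ?i x \<otimes>\<^bsub>N\<^esub> ?i y"
    by (auto simp: iso_def hom_def)
  have gb: "bij_betw g (carrier N) (carrier N')"
    and gm: "\<And>x y. x \<in> carrier N \<Longrightarrow> y \<in> carrier N \<Longrightarrow> g (x \<otimes>\<^bsub>N\<^esub> y) = g x \<otimes>\<^bsub>N'\<^esub> g y"
    using g by (auto simp: iso_def hom_def)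
  show ?thesis
  proof (rule autoI)
    have "bij_betw (g \<circ> (\<alpha> \<circ> ?i)) (carrier N') (carrier N')"
      by (rule bij_betw_trans[OF bij_betw_trans[OF i(1) autoD(2)[OF \<alpha>]] gb])
    then show "bij_betw (\<lambda>x\<in>carrier N'. g (\<alpha> (?i x))) (carrier N') (carrier N')"
      by (rule iffD1[OF bij_betw_cong, rotated]) simp
    fix x y assume "x \<in> carrier N'" "y \<in> carrier N'"
    then show "(\<lambda>x\<in>carrier N'. g (\<alpha> (?i x))) (x \<otimes>\<^bsub>N'\<^esub> y) =
        (\<lambda>x\<in>carrier N'. g (\<alpha> (?i x))) x \<otimes>\<^bsub>N'\<^esub> (\<lambda>x\<in>carrier N'. g (\<alpha> (?i x))) y"
      using group.is_monoid[OF N(2)] by (simp add: monoid.m_closed i gm autoD(4,5)[OF \<alpha>])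
  qed simp
qed

text \<open>Conjugation by the isomorphism is injective; the opposite inequality is the same one for
  the inverse isomorphism.\<close>

lemma card_auto_iso_le:
  assumes iso: "N \<cong> N'" and N: "group N" "group N'" and fin: "finite (carrier N')"
  shows "card (auto N) \<le> card (auto N')"
proof -
  obtain g where g: "g \<in> iso N N'" using iso by (auto simp: is_iso_def)
  let ?F = "\<lambda>\<alpha>. \<lambda>x\<in>carrier N'. g (\<alpha> (inv_into (carrier N) g x))"
  have gb: "bij_betw g (carrier N) (carrier N')" using g by (simp add: iso_def)
  have "inj_on ?F (auto N)"
  proof (rule inj_onI)
    fix \<alpha> \<beta> assume a: "\<alpha> \<in> auto N" "\<beta> \<in> auto N" and eq: "?F \<alpha> = ?F \<beta>"
    show "\<alpha> = \<beta>"
    proof (rule extensionalityI[OF autoD(3)[OF a(1)] autoD(3)[OF a(2)]])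
      fix x assume x: "x \<in> carrier N"
      have "g x \<in> carrier N'" "inv_into (carrier N) g (g x) = x" using gb x by (auto simp: bij_betw_def)
      then have "g (\<alpha> x) = g (\<beta> x)" using fun_cong[OF eq, of "g x"] by simp
      then show "\<alpha> x = \<beta> x" using gb autoD(4)[OF a(1) x] autoD(4)[OF a(2) x] by (auto simp: bij_betw_def inj_on_def)
    qed
  qed
  then show ?thesis
    using iso_conj_auto[OF g N] finite_auto[OF fin] by (intro card_inj_on_le[of ?F]) auto
qed

lemma card_auto_iso:
  assumes iso: "N \<cong> N'" and N: "group N" "group N'" and fin: "finite (carrier N)"
  shows "card (auto N) = card (auto N')"
proof -
  have "finite (carrier N')" using iso_finite[OF iso] fin by simp
  then show ?thesis
    using card_auto_iso_le[OF iso N] card_auto_iso_le[OF group.iso_sym[OF N(1) iso] N(2,1) fin] by simp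
qed

lemma card_brace_maps_iso_le:
  assumes iso: "G \<cong> G'" "N \<cong> N'" and gr: "group G" "group G'" "group N" "group N'"
    and fin: "finite (carrier G')" "finite (carrier N')"
  shows "card (brace_maps G N) \<le> card (brace_maps G' N')"
proof -
  interpret G': group G' by (rule gr(2))
  obtain f where f: "f \<in> iso G' G" using group.iso_sym[OF gr(1) iso(1)] by (auto simp: is_iso_def)
  obtain g where g: "g \<in> iso N N'" using iso by (auto simp: is_iso_def)
  let ?i = "inv_into (carrier N) g"
  have fb: "bij_betw f (carrier G') (carrier G)" and gb: "bij_betw g (carrier N) (carrier N')"
    using f g by (simp_all add: iso_def)
  have fc: "f s \<in> carrier G" if "s \<in> carrier G'" for s using fb that by (auto simp: bij_betw_def)
  have fm: "f (s \<otimes>\<^bsub>G'\<^esub> t) = f s \<otimes>\<^bsub>G\<^esub> f t" if "s \<in> carrier G'" "t \<in> carrier G'" for s t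
    using f that by (simp add: iso_def hom_def)
  have gm: "g (s \<otimes>\<^bsub>N\<^esub> t) = g s \<otimes>\<^bsub>N'\<^esub> g t" if "s \<in> carrier N" "t \<in> carrier N" for s t
    using g that by (simp add: iso_def hom_def)
  have gi: "?i (g x) = x" "g x \<in> carrier N'" if "x \<in> carrier N" for x using gb that by (auto simp: bij_betw_def)
  let ?F = "\<lambda>\<phi>. \<lambda>s\<in>carrier G'. g (\<phi> (f s))"
  have mem: "?F \<phi> \<in> brace_maps G' N'" if \<phi>: "\<phi> \<in> brace_maps G N" for \<phi>
    unfolding brace_maps_def
  proof (intro CollectI conjI ballI)
    have pb: "bij_betw \<phi> (carrier G) (carrier N)" using \<phi> by (simp add: brace_maps_def)
    have pc: "\<phi> s \<in> carrier N" if "s \<in> carrier G" for s using pb that by (auto simp: bij_betw_def)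
    have "bij_betw (g \<circ> (\<phi> \<circ> f)) (carrier G') (carrier N')"
      using fb pb gb by (blast intro: bij_betw_trans)
    then show "bij_betw (?F \<phi>) (carrier G') (carrier N')"
      by (rule iffD1[OF bij_betw_cong, rotated]) simp
    fix s assume s: "s \<in> carrier G'"
    obtain \<alpha> where \<alpha>: "\<alpha> \<in> auto N" "\<forall>t\<in>carrier G. \<phi> (f s \<otimes>\<^bsub>G\<^esub> t) = \<phi> (f s) \<otimes>\<^bsub>N\<^esub> \<alpha> (\<phi> t)"
      using \<phi> fc[OF s] by (auto simp: brace_maps_def)
    have "?F \<phi> (s \<otimes>\<^bsub>G'\<^esub> t) = ?F \<phi> s \<otimes>\<^bsub>N'\<^esub> (\<lambda>x\<in>carrier N'. g (\<alpha> (?i x))) (?F \<phi> t)" if t: "t \<in> carrier G'" for t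
      using s t \<alpha> by (simp add: fm fc pc gm gi autoD(4))
    then show "\<exists>\<alpha>\<in>auto N'. \<forall>t\<in>carrier G'. ?F \<phi> (s \<otimes>\<^bsub>G'\<^esub> t) = ?F \<phi> s \<otimes>\<^bsub>N'\<^esub> \<alpha> (?F \<phi> t)"
      using iso_conj_auto[OF g gr(3,4) \<alpha>(1)] by blast
  qed simp
  have "inj_on ?F (brace_maps G N)"
  proof (rule inj_onI)
    fix \<phi> \<chi> assume a: "\<phi> \<in> brace_maps G N" "\<chi> \<in> brace_maps G N" and eq: "?F \<phi> = ?F \<chi>"
    have ext: "\<phi> \<in> extensional (carrier G)" "\<chi> \<in> extensional (carrier G)" using a by (auto simp: brace_maps_def)
    have c: "\<phi> x \<in> carrier N" "\<chi> x \<in> carrier N" if "x \<in> carrier G" for x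
      using a that by (auto simp: brace_maps_def bij_betw_def)
    show "\<phi> = \<chi>"
    proof (rule extensionalityI[OF ext])
      fix x assume x: "x \<in> carrier G"
      then obtain s where s: "s \<in> carrier G'" "x = f s" using fb by (auto simp: bij_betw_def)
      have "g (\<phi> x) = g (\<chi> x)" using fun_cong[OF eq, of s] s by simp
      then show "\<phi> x = \<chi> x" using gb c[OF x] by (auto simp: bij_betw_def inj_on_def)
    qed
  qed
  then show ?thesis using mem finite_brace_maps[OF fin] by (intro card_inj_on_le[of ?F]) auto
qed

lemma card_brace_maps_iso:
  assumes iso: "G \<cong> G'" "N \<cong> N'" and gr: "group G" "group G'" "group N" "group N'"
    and fin: "finite (carrier G)" "finite (carrier N)"
  shows "card (brace_maps G N) = card (brace_maps G' N')"
proof -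
  have "finite (carrier G')" "finite (carrier N')" using iso_finite iso fin by blast+
  then show ?thesis
    using card_brace_maps_iso_le[OF iso gr]
      card_brace_maps_iso_le[OF group.iso_sym[OF gr(1) iso(1)] group.iso_sym[OF gr(3) iso(2)] gr(2,1,4,3) fin] by simp
qed

text \<open>Inverting the values of a brace map replaces the skew brace by its opposite.\<close>

context brace_map
begin

lemma inverse_brace_map: "(\<lambda>s\<in>carrier G. inv\<^bsub>N\<^esub> \<phi> s) \<in> brace_maps G N"
  unfolding brace_maps_def
proof (intro CollectI conjI ballI)
  have "bij_betw (\<lambda>x. inv\<^bsub>N\<^esub> x) (carrier N) (carrier N)"
    by (rule bij_betw_byWitness[where f' = "\<lambda>x. inv\<^bsub>N\<^esub> x"]) auto
  then have "bij_betw (m_inv N \<circ> \<phi>) (carrier G) (carrier N)" by (rule bij_betw_trans[OF bij])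
  then show "bij_betw (\<lambda>s\<in>carrier G. inv\<^bsub>N\<^esub> \<phi> s) (carrier G) (carrier N)"
    by (rule iffD1[OF bij_betw_cong, rotated]) simp
  fix s assume s: "s \<in> carrier G"
  \<comment> \<open>Inverting \<phi> s * twist s (\<phi> t) reverses the factors. Moving (\<phi>
    s)^-1 back to the left turns the automorphism into \<open>twist s\<close> followed by
    conjugation with \<phi> s.\<close>
  let ?c = "\<lambda>x. \<phi> s \<otimes>\<^bsub>N\<^esub> twist s x \<otimes>\<^bsub>N\<^esub> inv\<^bsub>N\<^esub> \<phi> s"
  have "?c \<in> hom N N"
    using s by (auto simp: hom_def twist_mult N.m_assoc N.inv_solve_left)
  moreover have "inj_on ?c (carrier N)"
    using s autoD(6)[OF twist_auto[OF s]] by (auto simp: inj_on_def)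
  moreover have "?c ` carrier N = carrier N"
  proof (intro subset_antisym subsetI)
    fix y assume y: "y \<in> carrier N"
    have "inv\<^bsub>N\<^esub> \<phi> s \<otimes>\<^bsub>N\<^esub> y \<otimes>\<^bsub>N\<^esub> \<phi> s \<in> carrier N" using y s by simp
    then obtain x where x: "x \<in> carrier N" "twist s x = inv\<^bsub>N\<^esub> \<phi> s \<otimes>\<^bsub>N\<^esub> y \<otimes>\<^bsub>N\<^esub> \<phi> s"
      using autoD(2)[OF twist_auto[OF s]] by (metis (no_types, lifting) bij_betw_imp_surj_on imageE)
    have "?c x = (\<phi> s \<otimes>\<^bsub>N\<^esub> inv\<^bsub>N\<^esub> \<phi> s) \<otimes>\<^bsub>N\<^esub> y \<otimes>\<^bsub>N\<^esub> (\<phi> s \<otimes>\<^bsub>N\<^esub> inv\<^bsub>N\<^esub> \<phi> s)"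
      unfolding x(2) using s y by (simp only: N.m_assoc N.m_closed N.inv_closed closed)
    then have "?c x = y" using s y by simp
    then show "y \<in> ?c ` carrier N" using x(1) by blast
  qed (use s in auto)
  ultimately have "restrict ?c (carrier N) \<in> auto N" by (intro N.autoI_hom) (auto simp: bij_betw_def)
  moreover have "(\<lambda>s\<in>carrier G. inv\<^bsub>N\<^esub> \<phi> s) (s \<otimes>\<^bsub>G\<^esub> t) =
      (\<lambda>s\<in>carrier G. inv\<^bsub>N\<^esub> \<phi> s) s \<otimes>\<^bsub>N\<^esub> restrict ?c (carrier N) ((\<lambda>s\<in>carrier G. inv\<^bsub>N\<^esub> \<phi> s) t)"
    if t: "t \<in> carrier G" for t
    using s t by (simp add: mult N.inv_mult_group twist_inv N.m_assoc[symmetric])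
  ultimately show "\<exists>\<alpha>\<in>auto N. \<forall>t\<in>carrier G. (\<lambda>s\<in>carrier G. inv\<^bsub>N\<^esub> \<phi> s) (s \<otimes>\<^bsub>G\<^esub> t) =
      (\<lambda>s\<in>carrier G. inv\<^bsub>N\<^esub> \<phi> s) s \<otimes>\<^bsub>N\<^esub> \<alpha> ((\<lambda>s\<in>carrier G. inv\<^bsub>N\<^esub> \<phi> s) t)"
    by blast
qed simp

end

section \<open>The groups of order \<open>p\<^sup>n q\<close>\<close>

definition geom :: "int \<Rightarrow> nat \<Rightarrow> int" where "geom u a = (\<Sum>i<a. u ^ i)"

lemma geom_0 [simp]: "geom u 0 = 0" and geom_1 [simp]: "geom u (Suc 0) = 1"
  and geom_one [simp]: "geom 1 a = int a"
  by (auto simp: geom_def)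

lemma geom_Suc: "geom u (Suc a) = 1 + u * geom u a"
  by (simp only: geom_def sum.lessThan_Suc_shift) (simp add: sum_distrib_left)

lemma geom_Suc': "geom u (Suc a) = geom u a + u ^ a"
  by (simp add: geom_def)

lemma geom_add: "geom u (a + b) = geom u a + u ^ a * geom u b"
  by (induction a) (auto simp: geom_Suc algebra_simps)

lemma geom_mult: "geom u (a * b) = geom u a * geom (u ^ a) b"
proof (induction b)
  case (Suc b)
  have "geom u (a * Suc b) = geom u (a * b) + u ^ (a * b) * geom u a"
    using geom_add[of u "a * b" a] by (simp add: add.commute)
  then show ?case using Suc by (simp add: geom_Suc' power_mult algebra_simps)
qed simp

lemma geom_telescope: "(u - 1) * geom u a = u ^ a - 1"
  by (induction a) (auto simp: geom_Suc algebra_simps)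

locale odd_prime_power =
  fixes p n P :: nat
  assumes p: "Factorial_Ring.prime p" and odd_p: "odd p" and n: "n \<ge> 1" and P: "P = p ^ n"
begin

lemma p_gt_2: "p > 2" using prime_gt_1_nat[OF p] odd_p by (cases "p = 2") auto

lemma P_pos: "P > 0" using p by (simp add: P prime_gt_0_nat)

lemma P_ge_3: "P \<ge> 3"
proof -
  have "p ^ 1 \<le> p ^ n" using n p_gt_2 by (intro power_increasing) auto
  then show ?thesis using p_gt_2 P by simp
qed

lemma prime_int_p: "Factorial_Ring.prime (int p)" using p by simp

lemma p_dvd_P: "int p dvd int P" using n by (simp add: P dvd_power)

lemma cong_p: "[a = b] (mod int P) \<Longrightarrow> [a = b] (mod int p)"
  by (rule cong_dvd_modulus[OF _ p_dvd_P])

lemma p_dvd_cong: "[a = b] (mod int P) \<Longrightarrow> int p dvd a \<longleftrightarrow> int p dvd b"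
  by (rule cong_dvd_iff[OF cong_p])

lemma coprime_P_iff: "coprime a (int P) \<longleftrightarrow> \<not> int p dvd a"
proof -
  have "coprime a (int P) \<longleftrightarrow> coprime a (int p)" using n by (simp add: P)
  also have "\<dots> \<longleftrightarrow> \<not> int p dvd a"
  proof
    assume "coprime a (int p)"
    then show "\<not> int p dvd a" using prime_int_p coprime_common_divisor[of a "int p" "int p"] by auto
  next
    assume "\<not> int p dvd a"
    then show "coprime a (int p)" using prime_imp_coprime[OF prime_int_p] by (simp add: coprime_commute)
  qed
  finally show ?thesis .
qed

lemma cancel_left: "\<not> int p dvd a \<Longrightarrow> [a * x = a * y] (mod int P) \<longleftrightarrow> [x = y] (mod int P)"
  by (rule cong_mult_lcancel) (simp add: coprime_P_iff)

lemma ex_inverse: assumes "\<not> int p dvd a" obtains b where "[a * b = 1] (mod int P)"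
  using cong_solve_coprime_int[of a "int P"] assms coprime_P_iff[of a] by blast

lemma not_dvd_mult: "\<not> int p dvd a \<Longrightarrow> \<not> int p dvd b \<Longrightarrow> \<not> int p dvd a * b"
  using prime_int_p by (simp add: prime_dvd_mult_iff)

lemma not_dvd_power: "\<not> int p dvd a \<Longrightarrow> \<not> int p dvd a ^ i"
  using prime_int_p prime_dvd_power by blast

lemma geom_cong_p:
  assumes "[u = 1] (mod int p)" shows "[geom u a = int a] (mod int p)"
proof (induction a)
  case (Suc a)
  have "[u * geom u a = 1 * int a] (mod int p)" using assms Suc by (intro cong_mult)
  from cong_add[OF cong_refl[of 1] this] show ?case by (simp add: geom_Suc)
qed simp

text \<open>Here \<open>p\<close> odd is essential: it makes \<open>\<Sum>\<^sub>i i w p\<close>, summed over \<open>i < p\<close>, divisible by \<open>p\<^sup>2\<close>.\<close>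

lemma geom_p:
  assumes "[u = 1] (mod int p)" obtains t where "geom u p = int p * (1 + int p * t)"
proof -
  have "int p dvd u - 1" using assms by (simp add: cong_iff_dvd_diff)
  then obtain w where w: "u = 1 + int p * w" by (auto simp: dvd_def algebra_simps)
  have pw: "\<exists>c. u ^ i = 1 + int i * int p * w + int p * int p * c" for i
  proof (induction i)
    case (Suc i)
    then obtain c where c: "u ^ i = 1 + int i * int p * w + int p * int p * c" by blast
    have "u ^ Suc i = 1 + int (Suc i) * int p * w + int p * int p * (c + int i * w * w + w * int p * c)"
    proof -
      have "u ^ Suc i = (1 + int p * w) * (1 + int i * int p * w + int p * int p * c)"
        by (simp only: power_Suc c) (simp only: w)
      then show ?thesis by (simp add: algebra_simps)
    qed
    then show ?case by blast
  qed (auto intro: exI[of _ 0])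
  then obtain c where c: "\<And>i. u ^ i = 1 + int i * int p * w + int p * int p * c i" by metis
  obtain h where h: "p = 2 * h + 1" using odd_p by (auto elim: oddE)
  have "2 * (\<Sum>i<j. int i) = int j * (int j - 1)" for j
    by (induction j) (auto simp: algebra_simps)
  moreover have "int p - 1 = 2 * int h" by (simp add: h)
  ultimately have "2 * (\<Sum>i<p. int i) = int p * (2 * int h)" by metis
  then have tri: "(\<Sum>i<p. int i) = int p * int h" by linarith
  have "geom u p = (\<Sum>i<p. 1 + int i * (int p * w) + int p * int p * c i)"
    unfolding geom_def by (intro sum.cong) (simp_all add: c)
  also have "\<dots> = int p + int p * int h * (int p * w) + int p * int p * (\<Sum>i<p. c i)"
    by (simp add: sum.distrib sum_distrib_left sum_distrib_right[symmetric] tri)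
  also have "\<dots> = int p * (1 + int p * (int h * w + (\<Sum>i<p. c i)))" by (simp add: algebra_simps)
  finally show thesis by (rule that)
qed

text \<open>Lifting the exponent: for a = b p the sum factors as geom u b * geom (u^b) p, and the
  second factor is p times a unit. Induction on j then removes one factor p from both sides.\<close>

lemma dvd_geom_iff:
  assumes u: "[u = 1] (mod int p)"
  shows "int p ^ j dvd geom u a \<longleftrightarrow> p ^ j dvd a"
proof (induction j arbitrary: a)
  case (Suc j)
  have base: "int p dvd geom u a \<longleftrightarrow> p dvd a"
    using cong_dvd_iff[OF geom_cong_p[OF u, of a]] by simp
  show ?case
  proof (cases "p dvd a")
    case True
    then obtain b where b: "a = b * p" by (metis dvd_def mult.commute)
    have "[u ^ b = 1] (mod int p)" using cong_pow[OF u, of b] by simp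
    then obtain t where t: "geom (u ^ b) p = int p * (1 + int p * t)" by (rule geom_p)
    have "\<not> int p dvd 1 + int p * t"
      using prime_int_p by (metis dvd_add_left_iff dvd_triv_left not_prime_unit)
    then have cop: "coprime (int p ^ j) (1 + int p * t)"
      using prime_imp_coprime[OF prime_int_p] by simp
    have "int p ^ Suc j dvd geom u a \<longleftrightarrow> int p * int p ^ j dvd int p * (geom u b * (1 + int p * t))"
      by (simp add: b geom_mult t algebra_simps)
    also have "\<dots> \<longleftrightarrow> int p ^ j dvd geom u b * (1 + int p * t)" using p_gt_2 by (subst dvd_mult_cancel_left) auto
    also have "\<dots> \<longleftrightarrow> int p ^ j dvd geom u b" using cop by (simp add: coprime_dvd_mult_left_iff)
    also have "\<dots> \<longleftrightarrow> p ^ j dvd b" by (rule Suc.IH)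
    also have "\<dots> \<longleftrightarrow> p ^ Suc j dvd a" using p_gt_2 b by (simp add: mult.commute)
    finally show ?thesis .
  next
    case False
    then have "\<not> p ^ Suc j dvd a" by (metis dvd_mult_left power_Suc)
    moreover have "\<not> int p ^ Suc j dvd geom u a" using base False by (metis dvd_mult_left power_Suc)
    ultimately show ?thesis by blast
  qed
qed simp

text \<open>In u^(p^j) - 1 = (u - 1) geom u (p^j), the first factor contributes p and the second
  p^j.\<close>

lemma dvd_pow_minus_1:
  assumes u: "[u = 1] (mod int p)" shows "[u ^ p ^ j = 1] (mod (int p ^ Suc j))"
proof -
  have "int p dvd u - 1" using u by (simp add: cong_iff_dvd_diff)
  moreover have "int p ^ j dvd geom u (p ^ j)" using dvd_geom_iff[OF u] by simp
  ultimately have "int p * int p ^ j dvd (u - 1) * geom u (p ^ j)" by (rule mult_dvd_mono)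
  then show ?thesis by (simp add: geom_telescope cong_iff_dvd_diff)
qed

lemma unipotent:
  assumes u: "[u = 1] (mod int p)" shows "[u ^ p ^ (n - 1) = 1] (mod int P)"
  using dvd_pow_minus_1[OF u, of "n - 1"] n by (simp add: P)

lemma unipotent_P:
  assumes u: "[u = 1] (mod int p)" shows "[u ^ P = 1] (mod int P)"
proof -
  have "P = p ^ (n - 1) * p" using n by (simp add: P power_eq_if mult.commute)
  then show ?thesis using cong_pow[OF unipotent[OF u], of p] by (simp add: power_mult)
qed

lemma geom_P: assumes u: "[u = 1] (mod int p)" shows "[geom u P = 0] (mod int P)"
  using dvd_geom_iff[OF u, of n P] by (simp add: P cong_0_iff)

text \<open>A difference of two geometric sums is a power of u, hence a unit, times a geometric sum
  whose length is the difference of the indices. So P divides that difference.\<close>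

lemma geom_inject:
  assumes u: "[u = 1] (mod int p)" and eq: "[geom u a = geom u b] (mod int P)" and ab: "a < P" "b < P"
  shows "a = b"
proof -
  have le: "a = b" if "[geom u a = geom u b] (mod int P)" "a < P" "b < P" "a \<le> b" for a b
  proof -
    have up: "\<not> int p dvd u" using cong_dvd_iff[OF u] prime_int_p by (metis not_prime_unit)
    have "geom u b - geom u a = u ^ a * geom u (b - a)" using geom_add[of u a "b - a"] that by simp
    then have "int P dvd u ^ a * geom u (b - a)" using that(1) by (metis cong_iff_dvd_diff cong_sym)
    then have "int P dvd geom u (b - a)"
      using coprime_P_iff not_dvd_power[OF up, of a] by (metis coprime_commute coprime_dvd_mult_right_iff)
    then have "P dvd b - a" using dvd_geom_iff[OF u, of n] by (simp add: P)
    then show "a = b" using that by (metis diff_is_0_eq dvd_imp_le le_antisym less_imp_diff_less not_le zero_less_diff)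
  qed
  show ?thesis using le[of a b] le[of b a] eq ab cong_sym by (metis nat_le_linear)
qed

lemma geom_mod: assumes u: "[u = 1] (mod int p)" shows "[geom u (a mod P) = geom u a] (mod int P)"
proof -
  have "geom u a = geom u (P * (a div P)) + u ^ (P * (a div P)) * geom u (a mod P)"
    using geom_add[of u "P * (a div P)" "a mod P"] by simp
  moreover have "[geom u (P * (a div P)) = 0] (mod int P)"
    using cong_mult[OF geom_P[OF u] cong_refl[of "geom (u ^ P) (a div P)"]] by (simp add: geom_mult)
  moreover have "[u ^ (P * (a div P)) = 1] (mod int P)"
    using cong_pow[OF unipotent_P[OF u], of "a div P"] by (simp add: power_mult)
  ultimately have "[geom u a = 0 + 1 * geom u (a mod P)] (mod int P)"
    using cong_add cong_mult cong_refl by metis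
  then show ?thesis by (simp add: cong_sym)
qed

lemma power_coprime_1:
  assumes "[u ^ a = 1] (mod m)" "[u ^ b = 1] (mod m)" "coprime a b" "a \<noteq> 0"
  shows "[u = 1] (mod (m :: int))"
proof -
  obtain x y where xy: "a * x = b * y + 1" using bezout_nat[OF assms(4), of b] assms(3) by (auto simp: coprime_iff_gcd_eq_1)
  have "[u ^ (a * x) = 1] (mod m)" using cong_pow[OF assms(1), of x] by (simp add: power_mult)
  moreover have "[u ^ (b * y) = 1] (mod m)" using cong_pow[OF assms(2), of y] by (simp add: power_mult)
  then have "[u ^ (b * y) * u = 1 * u] (mod m)" by (rule cong_mult[OF _ cong_refl])
  ultimately show ?thesis using xy by (metis Suc_eq_plus1 cong_sym cong_trans mult_1 power_Suc2)
qed

text \<open>Iterated Fermat; it turns a relation U^P = 1 into U = 1 modulo p.\<close>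

lemma fermat_P: "[u ^ P = u] (mod int p)"
proof -
  have fermat: "[u ^ p = u] (mod int p)" for u :: int
  proof (cases "int p dvd u")
    case True
    then have "int p dvd u ^ p" using p_gt_2 by (intro dvd_trans[OF True dvd_power]) auto
    then show ?thesis using True by (simp add: cong_iff_dvd_diff)
  next
    case False
    define a where "a = nat (u mod int p)"
    have a: "[int a = u] (mod int p)" using p_gt_2 by (simp add: a_def)
    have "\<not> p dvd a" using cong_dvd_iff[OF a] False by (metis int_dvd_int_iff)
    then have "[a ^ (p - 1) = 1] (mod p)" by (rule fermat_theorem[OF p])
    then have "[int a ^ (p - 1) = 1] (mod int p)" using cong_int_iff[of "a ^ (p - 1)" 1 p] by simp
    from cong_mult[OF this cong_refl[of "int a"]] have "[int a ^ p = int a] (mod int p)"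
      using p_gt_2 by (simp add: power_eq_if mult.commute)
    then show ?thesis using a cong_pow[OF a, of p] by (metis cong_sym cong_trans)
  qed
  have "[u ^ p ^ j = u] (mod int p)" for j
  proof (induction j)
    case (Suc j)
    have "[(u ^ p ^ j) ^ p = u] (mod int p)" using fermat Suc cong_trans by blast
    then show ?case by (simp add: power_mult[symmetric] mult.commute)
  qed simp
  then show ?thesis by (simp add: P)
qed

end

text \<open>A congruence certified by cofactors: once the multipliers of the known congruences are
  named, only a polynomial identity is left. The next two lemmas do the same for two and three
  congruences.\<close>

lemma cong_comb1:
  assumes "[a = b] (mod m)" "x - y = ca * (a - b)" shows "[x = y] (mod (m :: int))"
  using assms by (simp add: cong_iff_dvd_diff)

lemma cong_comb2:
  assumes "[a = b] (mod m)" "[c = d] (mod m)" "x - y = ca * (a - b) + cb * (c - d)"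
  shows "[x = y] (mod (m :: int))"
  using assms by (simp add: cong_iff_dvd_diff)

lemma cong_comb3:
  assumes "[a = b] (mod m)" "[c = d] (mod m)" "[e = f] (mod m)"
    "x - y = ca * (a - b) + cb * (c - d) + cc * (e - f)"
  shows "[x = y] (mod (m :: int))"
  using assms by (simp add: cong_iff_dvd_diff)

text \<open>The model \<open>sd P q m\<close> of \<open>\<int>\<^sub>P \<rtimes> \<int>\<^sub>q\<close>: pairs \<open>(a, b)\<close> stand for \<open>x\<^sup>a y\<^sup>b\<close> with
  \<open>y x y\<^sup>-\<^sup>1 = x\<^sup>m\<close>; for \<open>m = 1\<close> it is the cyclic group.\<close>

definition sd :: "nat \<Rightarrow> nat \<Rightarrow> int \<Rightarrow> (int \<times> nat) monoid" where
  "sd P q m = \<lparr>carrier = {0..<int P} \<times> {..<q},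
     monoid.mult = (\<lambda>s t. ((fst s + m ^ snd s * fst t) mod int P, (snd s + snd t) mod q)), one = (0, 0)\<rparr>"

lemma sd_simps:
  "carrier (sd P q m) = {0..<int P} \<times> {..<q}"
  "s \<otimes>\<^bsub>sd P q m\<^esub> t = ((fst s + m ^ snd s * fst t) mod int P, (snd s + snd t) mod q)"
  "\<one>\<^bsub>sd P q m\<^esub> = (0, 0)"
  by (auto simp: sd_def)

section \<open>Arithmetic of the model groups, and families of brace maps\<close>

locale pq_model = odd_prime_power p n P for p n P :: nat +
  fixes q :: nat and k :: int
  assumes q: "Factorial_Ring.prime q" and odd_q: "odd q" and q_less_p: "q < p"
    and k_range: "0 \<le> k" "k < int P" and k_q: "[k ^ q = 1] (mod int P)" and k_1: "k \<noteq> 1"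
begin

abbreviation "M \<equiv> sd P q"
abbreviation "cP a b \<equiv> [a = b] (mod int P)"
abbreviation "Cr \<equiv> {0..<int P} \<times> {..<q}"

lemma q_ge_3: "q \<ge> 3" using prime_gt_1_nat[OF q] odd_q by (cases "q = 2") auto

lemma finite_Cr: "finite Cr" by simp

lemma card_Cr: "card Cr = P * q" by simp

lemma cP_eqI: "a \<in> {0..<int P} \<Longrightarrow> b \<in> {0..<int P} \<Longrightarrow> cP a b \<Longrightarrow> a = b"
  by (simp add: cong_def)

lemma mod_range [simp]: "a mod int P \<in> {0..<int P}" using P_pos by simp

lemma mod_less_q [simp]: "a mod q < q" using q_ge_3 by simp

lemma coprime_q_P: "coprime q P"
proof -
  have "coprime q p" using q p q_less_p by (intro primes_coprime) auto
  then show ?thesis by (simp add: P)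
qed

lemma pow_mod: assumes "cP (w ^ q) 1" shows "cP (w ^ (i mod q)) (w ^ i)"
proof -
  have "w ^ i = (w ^ q) ^ (i div q) * w ^ (i mod q)"
    by (simp add: power_mult[symmetric] power_add[symmetric])
  moreover have "cP ((w ^ q) ^ (i div q) * w ^ (i mod q)) (1 ^ (i div q) * w ^ (i mod q))"
    by (intro cong_mult cong_pow assms cong_refl)
  ultimately show ?thesis by (simp add: cong_sym)
qed

lemma root_unit: assumes "cP (w ^ q) 1" shows "\<not> int p dvd w"
proof
  assume "int p dvd w"
  then have "int p dvd w ^ q" using q_ge_3 by (intro dvd_trans[OF _ dvd_power]) auto
  then have "int p dvd 1" using p_dvd_cong[OF assms] by simp
  then show False using prime_int_p not_prime_unit by blast
qed

text \<open>An element that is 1 modulo p has order dividing P, and P is prime to q.\<close>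

lemma root_p: assumes "cP (w ^ q) 1" "[w = 1] (mod int p)" shows "cP w 1"
  using power_coprime_1[OF unipotent_P[OF assms(2)] assms(1)] coprime_q_P P_pos by (simp add: coprime_commute)

lemma k_unit: "\<not> int p dvd k" by (rule root_unit[OF k_q])

lemma k_ge_2: "k \<ge> 2" using k_unit k_range k_1 by (cases "k = 0") auto

lemma k_not_cong_1: "\<not> cP k 1"
  using cP_eqI[of k 1] k_range k_1 P_ge_3 by auto

text \<open>If p divided the difference, k^(i - j), for j \<le> i, would be 1 modulo p and hence
  modulo P; as i - j is prime to q, so would be k. This is the source of the invertible coefficients
  in the linear equations below.\<close>

lemma k_diff_unit: assumes "i mod q \<noteq> j mod q" shows "\<not> int p dvd k ^ i - k ^ j"
proof -
  have le: "\<not> int p dvd k ^ i - k ^ j" if ij: "i mod q \<noteq> j mod q" "j \<le> i" for i j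
  proof
    assume "int p dvd k ^ i - k ^ j"
    moreover have "k ^ i - k ^ j = k ^ j * (k ^ (i - j) - 1)"
      using ij(2) by (simp add: algebra_simps power_add[symmetric])
    ultimately have "int p dvd k ^ (i - j) - 1"
      using not_dvd_power[OF k_unit, of j] prime_int_p by (simp add: prime_dvd_mult_iff)
    then have 1: "[k ^ (i - j) = 1] (mod int p)" by (simp add: cong_iff_dvd_diff)
    have "cP ((k ^ (i - j)) ^ q) 1"
      using cong_pow[OF k_q, of "i - j"] by (simp add: power_mult[symmetric] mult.commute)
    from root_p[OF this 1] have d: "cP (k ^ (i - j)) 1" .
    have "\<not> q dvd i - j"
    proof
      assume "q dvd i - j"
      then have "i mod q = j mod q" using ij(2) by (metis mod_eq_dvd_iff_nat)
      then show False using ij by simp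
    qed
    then have "coprime (i - j) q" using prime_imp_coprime[OF q, of "i - j"] by (simp add: coprime_commute)
    moreover have "i - j \<noteq> 0" using ij by auto
    ultimately show False using power_coprime_1[OF d k_q] k_not_cong_1 by blast
  qed
  show ?thesis
  proof (cases "j \<le> i")
    case False
    then have "\<not> int p dvd k ^ j - k ^ i" using le[of j i] assms by auto
    then show ?thesis by (metis dvd_minus_iff minus_diff_eq)
  qed (use le assms in auto)
qed

lemma k_minus_1_unit: "\<not> int p dvd k - 1"
  using k_diff_unit[of 1 0] q_ge_3 by simp

lemma M_mult_cong: "cP (fst (s \<otimes>\<^bsub>M m\<^esub> t)) (fst s + m ^ snd s * fst t)"
  by (simp add: sd_simps)

lemma M_closed: "s \<in> Cr \<Longrightarrow> t \<in> Cr \<Longrightarrow> s \<otimes>\<^bsub>M m\<^esub> t \<in> Cr"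
  using P_pos by (auto simp: sd_simps)

lemma group_M: assumes m: "cP (m ^ q) 1" shows "group (M m)"
proof (rule groupI)
  show "s \<otimes>\<^bsub>M m\<^esub> t \<in> carrier (M m)" if "s \<in> carrier (M m)" "t \<in> carrier (M m)" for s t
    using M_closed that by (simp add: sd_simps(1))
  show "\<one>\<^bsub>M m\<^esub> \<in> carrier (M m)" using P_pos q_ge_3 by (simp add: sd_simps)
  show "\<one>\<^bsub>M m\<^esub> \<otimes>\<^bsub>M m\<^esub> s = s" if "s \<in> carrier (M m)" for s
    using that by (auto simp: sd_simps)
next
  fix s t u assume "s \<in> carrier (M m)" "t \<in> carrier (M m)" "u \<in> carrier (M m)"
  have "cP (fst (s \<otimes>\<^bsub>M m\<^esub> t \<otimes>\<^bsub>M m\<^esub> u)) (fst s + m ^ snd s * fst t + m ^ (snd s + snd t) * fst u)"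
  proof -
    have "cP (fst (s \<otimes>\<^bsub>M m\<^esub> t \<otimes>\<^bsub>M m\<^esub> u)) (fst (s \<otimes>\<^bsub>M m\<^esub> t) + m ^ snd (s \<otimes>\<^bsub>M m\<^esub> t) * fst u)" (is "cP _ ?e1")
      by (rule M_mult_cong)
    also have "cP ?e1 (fst s + m ^ snd s * fst t + m ^ (snd s + snd t) * fst u)"
      by (intro cong_add cong_mult M_mult_cong cong_refl) (simp add: sd_simps pow_mod[OF m])
    finally show ?thesis .
  qed
  moreover have "cP (fst (s \<otimes>\<^bsub>M m\<^esub> (t \<otimes>\<^bsub>M m\<^esub> u))) (fst s + m ^ snd s * fst t + m ^ (snd s + snd t) * fst u)"
  proof -
    have "cP (fst (s \<otimes>\<^bsub>M m\<^esub> (t \<otimes>\<^bsub>M m\<^esub> u))) (fst s + m ^ snd s * fst (t \<otimes>\<^bsub>M m\<^esub> u))" (is "cP _ ?e2")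
      by (rule M_mult_cong)
    also have "cP ?e2 (fst s + m ^ snd s * (fst t + m ^ snd t * fst u))"
      by (intro cong_add cong_mult M_mult_cong cong_refl)
    finally show ?thesis by (simp add: algebra_simps power_add)
  qed
  ultimately have "cP (fst (s \<otimes>\<^bsub>M m\<^esub> t \<otimes>\<^bsub>M m\<^esub> u)) (fst (s \<otimes>\<^bsub>M m\<^esub> (t \<otimes>\<^bsub>M m\<^esub> u)))"
    using cong_sym cong_trans by blast
  then have "fst (s \<otimes>\<^bsub>M m\<^esub> t \<otimes>\<^bsub>M m\<^esub> u) = fst (s \<otimes>\<^bsub>M m\<^esub> (t \<otimes>\<^bsub>M m\<^esub> u))"
    by (intro cP_eqI) (simp_all only: sd_simps(2) fst_conv mod_range)
  then show "s \<otimes>\<^bsub>M m\<^esub> t \<otimes>\<^bsub>M m\<^esub> u = s \<otimes>\<^bsub>M m\<^esub> (t \<otimes>\<^bsub>M m\<^esub> u)"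
    by (intro prod_eqI) (simp_all add: sd_simps mod_simps add.assoc)
next
  fix s assume s: "s \<in> carrier (M m)"
  let ?i = "((- (m ^ (q - snd s) * fst s)) mod int P, (q - snd s) mod q)"
  have "cP (- (m ^ (q - snd s) * fst s) mod int P + m ^ ((q - snd s) mod q) * fst s)
      (- (m ^ (q - snd s) * fst s) + m ^ (q - snd s) * fst s)"
    by (intro cong_add cong_mult cong_refl pow_mod m) simp
  then have "fst (?i \<otimes>\<^bsub>M m\<^esub> s) = 0" by (simp add: sd_simps cong_def)
  moreover have "snd (?i \<otimes>\<^bsub>M m\<^esub> s) = 0" using s by (auto simp: sd_simps mod_simps)
  moreover have "?i \<in> carrier (M m)" using P_pos by (simp add: sd_simps(1))
  ultimately show "\<exists>t\<in>carrier (M m). t \<otimes>\<^bsub>M m\<^esub> s = \<one>\<^bsub>M m\<^esub>"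
    by (intro bexI[of _ ?i] prod_eqI) (auto simp: sd_simps(3))
qed

text \<open>The map x \<mapsto> x^u, y \<mapsto> x^(r (1 - l)) y: along powers of y the contribution
  r (1 - l) accumulates to r (1 - l^b).\<close>

definition aff :: "int \<Rightarrow> int \<Rightarrow> int \<Rightarrow> int \<times> nat \<Rightarrow> int \<times> nat" where
  "aff l u r = (\<lambda>s\<in>Cr. ((u * fst s + r * (1 - l ^ snd s)) mod int P, snd s))"

lemma aff_closed: "s \<in> Cr \<Longrightarrow> aff l u r s \<in> Cr"
  using P_pos by (auto simp: aff_def)

lemma aff_auto:
  assumes l: "cP (l ^ q) 1" and u: "\<not> int p dvd u" shows "aff l u r \<in> auto (M l)"
proof (rule autoI)
  have "inj_on (aff l u r) Cr"
  proof (rule inj_onI)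
    fix s t assume st: "s \<in> Cr" "t \<in> Cr" and eq: "aff l u r s = aff l u r t"
    have b: "snd s = snd t" using eq st by (simp add: aff_def)
    have "cP (u * fst s + r * (1 - l ^ snd s)) (u * fst t + r * (1 - l ^ snd t))"
      using arg_cong[OF eq, of fst] st unfolding cong_def by (simp add: aff_def)
    then have "cP (u * fst s) (u * fst t)" by (rule cong_comb1[where ca = 1]) (simp add: b)
    then have "cP (fst s) (fst t)" using cancel_left[OF u] by simp
    then have "fst s = fst t" using st by (intro cP_eqI) auto
    then show "s = t" using b by (simp add: prod_eqI)
  qed
  moreover have "aff l u r ` Cr \<subseteq> Cr" using aff_closed by blast
  ultimately show "bij_betw (aff l u r) (carrier (M l)) (carrier (M l))"
    using endo_inj_surj[OF finite_Cr] unfolding sd_simps(1) bij_betw_def by blast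
  fix s t assume "s \<in> carrier (M l)" "t \<in> carrier (M l)"
  then have st: "s \<in> Cr" "t \<in> Cr" by (simp_all add: sd_simps(1))
  let ?s = "aff l u r s" and ?t = "aff l u r t"
  have f: "cP (fst (aff l u r s)) (u * fst s + r * (1 - l ^ snd s))" "snd (aff l u r s) = snd s" if "s \<in> Cr" for s
    using that by (simp_all add: aff_def)
  have c1: "cP (l ^ ((snd s + snd t) mod q)) (l ^ (snd s + snd t))" by (rule pow_mod[OF l])
  have "cP (fst (aff l u r (s \<otimes>\<^bsub>M l\<^esub> t))) (u * fst (s \<otimes>\<^bsub>M l\<^esub> t) + r * (1 - l ^ snd (s \<otimes>\<^bsub>M l\<^esub> t)))" (is "cP _ ?e3")
    by (rule f(1)[OF M_closed[OF st]])
  also have "cP ?e3 (u * (fst s + l ^ snd s * fst t) + r * (1 - l ^ (snd s + snd t)))" (is "cP _ ?e4")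
    by (rule cong_comb2[OF M_mult_cong[of l s t] c1, where ca = u and cb = "- r"]) (simp add: sd_simps(2) algebra_simps)
  also have "cP ?e4 (fst ?s + l ^ snd ?s * fst ?t)" (is "cP _ ?e5")
    by (rule cong_comb2[OF f(1)[OF st(1)] f(1)[OF st(2)], where ca = "- 1" and cb = "- (l ^ snd s)"])
      (simp add: f(2) st algebra_simps power_add)
  also have "cP ?e5 (fst (?s \<otimes>\<^bsub>M l\<^esub> ?t))" by (rule cong_sym[OF M_mult_cong])
  finally have "fst (aff l u r (s \<otimes>\<^bsub>M l\<^esub> t)) = fst (?s \<otimes>\<^bsub>M l\<^esub> ?t)"
    using M_closed[OF aff_closed[OF st(1)] aff_closed[OF st(2)]] aff_closed[OF M_closed[OF st]]
    by (intro cP_eqI) (simp_all only: mem_Times_iff)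
  then show "aff l u r (s \<otimes>\<^bsub>M l\<^esub> t) = ?s \<otimes>\<^bsub>M l\<^esub> ?t"
    using st M_closed[OF st] by (intro prod_eqI) (simp_all add: f(2), simp add: sd_simps f(2))
qed (simp add: aff_def sd_simps(1))

text \<open>A criterion free of explicit automorphisms: translation by s has to act on values x^z
  y^b by z \<mapsto> A + U z + R l^b and b \<mapsto> d + b. At z = b = 0 this gives \<phi> s, and
  dividing by \<phi> s on the left leaves \<open>aff\<close> with parameters l^-d U and - l^-d
  R.\<close>

lemma brace_mapI:
  assumes l: "cP (l ^ q) 1" and ext: "\<phi> \<in> extensional Cr" and bij: "bij_betw \<phi> Cr Cr" and one: "\<phi> (0, 0) = (0, 0)"
    and T: "\<And>s. s \<in> Cr \<Longrightarrow> \<exists>A U R d. \<not> int p dvd U \<and> (\<forall>t\<in>Cr.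
      cP (fst (\<phi> (s \<otimes>\<^bsub>M m\<^esub> t))) (A + U * fst (\<phi> t) + R * l ^ snd (\<phi> t)) \<and> snd (\<phi> (s \<otimes>\<^bsub>M m\<^esub> t)) = (d + snd (\<phi> t)) mod q)"
  shows "\<phi> \<in> brace_maps (M m) (M l)"
  unfolding brace_maps_def sd_simps(1)
proof (intro CollectI conjI ext bij ballI)
  fix s assume s: "s \<in> Cr"
  obtain A U R d where U: "\<not> int p dvd U" and
    T1: "\<And>t. t \<in> Cr \<Longrightarrow> cP (fst (\<phi> (s \<otimes>\<^bsub>M m\<^esub> t))) (A + U * fst (\<phi> t) + R * l ^ snd (\<phi> t))" and
    T2: "\<And>t. t \<in> Cr \<Longrightarrow> snd (\<phi> (s \<otimes>\<^bsub>M m\<^esub> t)) = (d + snd (\<phi> t)) mod q" using T[OF s] by blast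
  have \<phi>c: "\<phi> t \<in> Cr" if "t \<in> Cr" for t using bij that by (auto simp: bij_betw_def)
  \<comment> \<open>The inverse of l^d written as a power with natural exponent.\<close>
  let ?i = "l ^ ((q - 1) * d)"
  have inv: "cP (l ^ d * ?i) 1"
  proof -
    have "d + (q - 1) * d = q * d" using q_ge_3 by (cases q) auto
    then have "l ^ d * ?i = (l ^ q) ^ d" by (simp add: power_add[symmetric] power_mult[symmetric])
    then show ?thesis using cong_pow[OF l, of d] by simp
  qed
  have lu: "\<not> int p dvd ?i" by (rule not_dvd_power[OF root_unit[OF l]])
  let ?\<alpha> = "aff l (?i * U) (- ?i * R)"
  have e: "(0, 0) \<in> Cr" "s \<otimes>\<^bsub>M m\<^esub> (0, 0) = s" using P_pos q_ge_3 s by (auto simp: sd_simps)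
  have \<phi>s: "cP (fst (\<phi> s)) (A + R)" "snd (\<phi> s) = d mod q" using T1[OF e(1)] T2[OF e(1)] e(2) one by simp_all
  have "\<phi> (s \<otimes>\<^bsub>M m\<^esub> t) = \<phi> s \<otimes>\<^bsub>M l\<^esub> ?\<alpha> (\<phi> t)" if t: "t \<in> Cr" for t
  proof (rule prod_eqI)
    have al: "cP (fst (?\<alpha> (\<phi> t))) (?i * U * fst (\<phi> t) + (- ?i * R) * (1 - l ^ snd (\<phi> t)))" "snd (?\<alpha> (\<phi> t)) = snd (\<phi> t)"
      using \<phi>c[OF t] by (simp_all add: aff_def)
    show "snd (\<phi> (s \<otimes>\<^bsub>M m\<^esub> t)) = snd (\<phi> s \<otimes>\<^bsub>M l\<^esub> ?\<alpha> (\<phi> t))"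
      using T2[OF t] \<phi>s(2) al(2) by (simp add: sd_simps mod_simps)
    have "cP (fst (\<phi> s \<otimes>\<^bsub>M l\<^esub> ?\<alpha> (\<phi> t))) (fst (\<phi> s) + l ^ snd (\<phi> s) * fst (?\<alpha> (\<phi> t)))" (is "cP _ ?e6") by (rule M_mult_cong)
    also have "cP ?e6 ((A + R) + l ^ d * (?i * U * fst (\<phi> t) + (- ?i * R) * (1 - l ^ snd (\<phi> t))))" (is "cP _ ?e7")
      unfolding \<phi>s(2) by (intro cong_add cong_mult \<phi>s(1) al(1) pow_mod[OF l])
    also have "cP ?e7 (A + U * fst (\<phi> t) + R * l ^ snd (\<phi> t))" (is "cP _ ?e8")
      by (rule cong_comb1[OF inv, where ca = "U * fst (\<phi> t) - R * (1 - l ^ snd (\<phi> t))"]) (simp add: algebra_simps)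
    also have "cP ?e8 (fst (\<phi> (s \<otimes>\<^bsub>M m\<^esub> t)))" by (rule cong_sym[OF T1[OF t]])
    finally have "cP (fst (\<phi> (s \<otimes>\<^bsub>M m\<^esub> t))) (fst (\<phi> s \<otimes>\<^bsub>M l\<^esub> ?\<alpha> (\<phi> t)))" by (rule cong_sym)
    then show "fst (\<phi> (s \<otimes>\<^bsub>M m\<^esub> t)) = fst (\<phi> s \<otimes>\<^bsub>M l\<^esub> ?\<alpha> (\<phi> t))"
      using \<phi>c[OF M_closed[OF s t]] M_closed[OF \<phi>c[OF s] aff_closed[OF \<phi>c[OF t]]]
      by (intro cP_eqI) (simp_all only: mem_Times_iff)
  qed
  then show "\<exists>\<alpha>\<in>auto (M l). \<forall>t\<in>Cr. \<phi> (s \<otimes>\<^bsub>M m\<^esub> t) = \<phi> s \<otimes>\<^bsub>M l\<^esub> \<alpha> (\<phi> t)"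
    using aff_auto[OF l not_dvd_mult[OF lu U]] by blast
qed

text \<open>Translation by the generator of \<open>\<int>\<^sub>P\<close> acts on the \<open>\<int>\<^sub>P\<close>-part of the values by \<open>z \<mapsto> A + U z\<close>, whence
  the geometric sum.\<close>

definition fam :: "int \<Rightarrow> int \<Rightarrow> int \<Rightarrow> int \<Rightarrow> int \<Rightarrow> int \<Rightarrow> nat \<Rightarrow> int \<times> nat \<Rightarrow> int \<times> nat" where
  "fam m l U A B D s = (\<lambda>t\<in>Cr. ((A * geom U (nat (fst t)) + B * (1 - m ^ snd t) + D * (l ^ (s * snd t) - m ^ snd t)) mod int P,
     (s * snd t) mod q))"

lemma fam_val:
  assumes "t \<in> Cr"
  shows "cP (fst (fam m l U A B D s t)) (A * geom U (nat (fst t)) + B * (1 - m ^ snd t) + D * (l ^ (s * snd t) - m ^ snd t))"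
    "snd (fam m l U A B D s t) = (s * snd t) mod q"
  using assms by (simp_all add: fam_def)

lemma mult_q_cancel:
  assumes "s \<in> {1..<q}" "(s * b) mod q = (s * b') mod q" "b < q" "b' < q" shows "b = b'"
proof -
  have "\<not> q dvd s" using assms(1) by (auto dest: dvd_imp_le)
  then have "coprime s q" using prime_imp_coprime[OF q, of s] by (simp add: coprime_commute)
  moreover have "[s * b = s * b'] (mod q)" using assms(2) by (simp add: cong_def)
  ultimately have "[b = b'] (mod q)" by (simp add: cong_mult_lcancel_nat)
  then show ?thesis using assms(3,4) by (simp add: cong_def)
qed

text \<open>The exponent of y is recovered because s is prime to q. What remains is A times a
  geometric sum, which separates the exponents of x.\<close>

lemma fam_bij:
  assumes A: "\<not> int p dvd A" and U: "[U = 1] (mod int p)" and s: "s \<in> {1..<q}"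
  shows "bij_betw (fam m l U A B D s) Cr Cr"
proof -
  have "inj_on (fam m l U A B D s) Cr"
  proof (rule inj_onI)
    fix t t' assume t: "t \<in> Cr" and t': "t' \<in> Cr" and eq: "fam m l U A B D s t = fam m l U A B D s t'"
    have b: "snd t = snd t'"
      using mult_q_cancel[OF s, of "snd t" "snd t'"] fam_val(2)[OF t] fam_val(2)[OF t'] eq t t'
      by (metis lessThan_iff mem_Times_iff)
    let ?r = "B * (1 - m ^ snd t) + D * (l ^ (s * snd t) - m ^ snd t)"
    have "cP (A * geom U (nat (fst t)) + ?r) (A * geom U (nat (fst t')) + ?r)"
      using eq t t' b by (simp add: fam_def cong_def add.assoc)
    then have "cP (A * geom U (nat (fst t))) (A * geom U (nat (fst t')))" by (simp only: cong_add_rcancel)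
    then have "cP (geom U (nat (fst t))) (geom U (nat (fst t')))" using cancel_left[OF A] by simp
    moreover have "nat (fst t) < P" "nat (fst t') < P" using t t' by auto
    ultimately have "nat (fst t) = nat (fst t')" by (rule geom_inject[OF U])
    then have "fst t = fst t'" using t t' by auto
    then show "t = t'" using b by (simp add: prod_eqI)
  qed
  moreover have "fam m l U A B D s ` Cr \<subseteq> Cr" using P_pos q_ge_3 by (auto simp: fam_def)
  ultimately show ?thesis using endo_inj_surj[OF finite_Cr] unfolding bij_betw_def by blast
qed

text \<open>If U = 1, the geometric sum is linear and the factor m^d from moving y^d past x passes
  through it. If m = 1, exponents of x merely add and the sums compose. Either way
  \<open>brace_mapI\<close> applies with R = D (l^(s d) - v), where v is the multiplier of
  z.\<close>

lemma fam_brace: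
  assumes A: "\<not> int p dvd A" and U: "[U = 1] (mod int p)" and s: "s \<in> {1..<q}"
    and m: "cP (m ^ q) 1" "m \<ge> 0" and l: "cP (l ^ q) 1" and c: "m = 1 \<or> U = 1"
  shows "fam m l U A B D s \<in> brace_maps (M m) (M l)" (is "?\<phi> \<in> _")
proof (rule brace_mapI[OF l _ fam_bij[OF A U s]])
  show "?\<phi> (0, 0) = (0, 0)" using P_pos q_ge_3 by (simp add: fam_def)
  fix x assume x: "x \<in> Cr"
  let ?c = "nat (fst x)" and ?d = "snd x"
  have Uu: "\<not> int p dvd U" using cong_dvd_iff[OF U] prime_int_p not_prime_unit by (metis int_dvd_int_iff of_nat_1)
  have sndx: "snd (?\<phi> (x \<otimes>\<^bsub>M m\<^esub> t)) = (s * ?d + snd (?\<phi> t)) mod q" if t: "t \<in> Cr" for t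
    unfolding fam_val(2)[OF M_closed[OF x t]] fam_val(2)[OF t] by (simp add: sd_simps mod_simps distrib_left)
  have l1: "cP (l ^ (s * snd (x \<otimes>\<^bsub>M m\<^esub> t))) (l ^ (s * (?d + snd t)))" for t
  proof -
    have "cP (l ^ (s * snd (x \<otimes>\<^bsub>M m\<^esub> t))) (l ^ ((s * snd (x \<otimes>\<^bsub>M m\<^esub> t)) mod q))" by (rule cong_sym[OF pow_mod[OF l]])
    also have "(s * snd (x \<otimes>\<^bsub>M m\<^esub> t)) mod q = (s * (?d + snd t)) mod q" by (simp add: sd_simps mod_simps)
    also have "cP (l ^ ((s * (?d + snd t)) mod q)) (l ^ (s * (?d + snd t)))" by (rule pow_mod[OF l])
    finally show ?thesis .
  qed
  have m1: "cP (m ^ snd (x \<otimes>\<^bsub>M m\<^esub> t)) (m ^ (?d + snd t))" for t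
    using pow_mod[OF m(1)] by (simp add: sd_simps)
  have l2: "cP (l ^ snd (?\<phi> t)) (l ^ (s * snd t))" if "t \<in> Cr" for t
    unfolding fam_val(2)[OF that] by (rule pow_mod[OF l])
  have g: "cP (geom U (nat (fst (x \<otimes>\<^bsub>M m\<^esub> t)))) (geom U (nat (fst x + m ^ ?d * fst t)))" if t: "t \<in> Cr" for t
  proof -
    have "fst x + m ^ ?d * fst t \<ge> 0" using x t m(2) by auto
    then have "nat (fst (x \<otimes>\<^bsub>M m\<^esub> t)) = nat (fst x + m ^ ?d * fst t) mod P"
      by (simp add: sd_simps nat_mod_distrib)
    then show ?thesis using geom_mod[OF U] by simp
  qed
  show "\<exists>A U R d. \<not> int p dvd U \<and> (\<forall>t\<in>Cr. cP (fst (?\<phi> (x \<otimes>\<^bsub>M m\<^esub> t))) (A + U * fst (?\<phi> t) + R * l ^ snd (?\<phi> t)) \<and>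
      snd (?\<phi> (x \<otimes>\<^bsub>M m\<^esub> t)) = (d + snd (?\<phi> t)) mod q)"
  proof (cases "U = 1")
    case True
    have "cP (fst (?\<phi> (x \<otimes>\<^bsub>M m\<^esub> t))) ((A * fst x + B * (1 - m ^ ?d)) + m ^ ?d * fst (?\<phi> t) + D * (l ^ (s * ?d) - m ^ ?d) * l ^ snd (?\<phi> t))"
      if t: "t \<in> Cr" for t
    proof -
      have "cP (fst (?\<phi> (x \<otimes>\<^bsub>M m\<^esub> t))) (A * geom U (nat (fst x + m ^ ?d * fst t)) + B * (1 - m ^ (?d + snd t)) + D * (l ^ (s * (?d + snd t)) - m ^ (?d + snd t)))"
        using fam_val(1)[OF M_closed[OF x t], of m l U A B D s m]
        by (rule cong_trans) (intro cong_add cong_mult cong_diff cong_refl g[OF t] m1 l1)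
      also have "A * geom U (nat (fst x + m ^ ?d * fst t)) + B * (1 - m ^ (?d + snd t)) + D * (l ^ (s * (?d + snd t)) - m ^ (?d + snd t)) =
          (A * fst x + B * (1 - m ^ ?d)) + m ^ ?d * (A * geom U (nat (fst t)) + B * (1 - m ^ snd t) + D * (l ^ (s * snd t) - m ^ snd t)) +
          D * (l ^ (s * ?d) - m ^ ?d) * l ^ (s * snd t)" (is "_ = ?e9")
      proof -
        have "int (nat (fst x + m ^ ?d * fst t)) = fst x + m ^ ?d * fst t" "int (nat (fst t)) = fst t"
          using x t m(2) by auto
        then show ?thesis unfolding True by (simp add: algebra_simps power_add)
      qed
      also have "cP ?e9 ((A * fst x + B * (1 - m ^ ?d)) + m ^ ?d * fst (?\<phi> t) + D * (l ^ (s * ?d) - m ^ ?d) * l ^ snd (?\<phi> t))"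
        by (intro cong_add cong_mult cong_refl cong_sym[OF fam_val(1)[OF t]] cong_sym[OF l2[OF t]])
      finally show ?thesis .
    qed
    then show ?thesis using sndx not_dvd_power[OF root_unit[OF m(1)], of ?d] by blast
  next
    case False
    then have m1': "m = 1" using c by blast
    have "cP (fst (?\<phi> (x \<otimes>\<^bsub>M m\<^esub> t))) ((A * geom U ?c - D + U ^ ?c * D) + U ^ ?c * fst (?\<phi> t) + D * (l ^ (s * ?d) - U ^ ?c) * l ^ snd (?\<phi> t))"
      if t: "t \<in> Cr" for t
    proof -
      have "cP (fst (?\<phi> (x \<otimes>\<^bsub>M m\<^esub> t))) (A * geom U (nat (fst x + m ^ ?d * fst t)) + B * (1 - m ^ (?d + snd t)) + D * (l ^ (s * (?d + snd t)) - m ^ (?d + snd t)))"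
        using fam_val(1)[OF M_closed[OF x t], of m l U A B D s m]
        by (rule cong_trans) (intro cong_add cong_mult cong_diff cong_refl g[OF t] m1 l1)
      also have "A * geom U (nat (fst x + m ^ ?d * fst t)) + B * (1 - m ^ (?d + snd t)) + D * (l ^ (s * (?d + snd t)) - m ^ (?d + snd t)) =
          (A * geom U ?c - D + U ^ ?c * D) + U ^ ?c * (A * geom U (nat (fst t)) + B * (1 - m ^ snd t) + D * (l ^ (s * snd t) - m ^ snd t)) +
          D * (l ^ (s * ?d) - U ^ ?c) * l ^ (s * snd t)" (is "_ = ?e10")
      proof -
        have e: "nat (fst x + m ^ ?d * fst t) = ?c + nat (fst t)"
          using x t m1' by (auto simp: nat_add_distrib)
        show ?thesis unfolding e geom_add using m1' by (simp add: algebra_simps power_add)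
      qed
      also have "cP ?e10 ((A * geom U ?c - D + U ^ ?c * D) + U ^ ?c * fst (?\<phi> t) + D * (l ^ (s * ?d) - U ^ ?c) * l ^ snd (?\<phi> t))"
        by (intro cong_add cong_mult cong_refl cong_sym[OF fam_val(1)[OF t]] cong_sym[OF l2[OF t]])
      finally show ?thesis .
    qed
    then show ?thesis using sndx not_dvd_power[OF Uu, of ?c] by blast
  qed
qed (simp add: fam_def)

end

section \<open>Automorphisms of the two model groups\<close>

context pq_model
begin

definition xpow :: "nat \<Rightarrow> int \<times> nat" where "xpow j = (int j mod int P, 0)"
definition ypow :: "nat \<Rightarrow> int \<times> nat" where "ypow j = (0, j mod q)"

lemma xpow_Cr [simp]: "xpow j \<in> Cr" and ypow_Cr [simp]: "ypow j \<in> Cr"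
  using P_pos q_ge_3 by (auto simp: xpow_def ypow_def)

lemma xpow_0: "xpow 0 = (0, 0)" and ypow_0: "ypow 0 = (0, 0)" and xpow_P: "xpow P = (0, 0)" and ypow_q: "ypow q = (0, 0)"
  by (auto simp: xpow_def ypow_def)

lemma one_Cr: "(0, 0) \<in> Cr" using xpow_Cr[of 0] by (simp only: xpow_0)

lemma xpow_Suc: "xpow (Suc j) = xpow 1 \<otimes>\<^bsub>M m\<^esub> xpow j"
  using P_ge_3 by (simp add: xpow_def sd_simps mod_simps)

lemma ypow_Suc: "ypow (Suc j) = ypow 1 \<otimes>\<^bsub>M m\<^esub> ypow j"
  using q_ge_3 by (simp add: ypow_def sd_simps mod_simps)

lemma decompose: "s \<in> Cr \<Longrightarrow> s = xpow (nat (fst s)) \<otimes>\<^bsub>M m\<^esub> ypow (snd s)"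
  by (auto simp: xpow_def ypow_def sd_simps intro!: prod_eqI)

lemma relation: assumes "m \<ge> 0" shows "ypow 1 \<otimes>\<^bsub>M m\<^esub> xpow 1 = xpow (nat m) \<otimes>\<^bsub>M m\<^esub> ypow 1"
  using assms P_ge_3 q_ge_3 by (simp add: xpow_def ypow_def sd_simps)

lemma q_dvd_mult_P: "(v * P) mod q = 0 \<Longrightarrow> v < q \<Longrightarrow> v = 0"
  using coprime_q_P by (metis coprime_dvd_mult_left_iff dvd_imp_le mod_0_imp_dvd not_le gr0I)

lemma P_eq: "P = p * p ^ (n - 1)" using n P by (cases n) auto

lemma xpow_eq_1: assumes "xpow (p ^ (n - 1)) = (0, 0)" shows False
proof -
  have "p ^ (n - 1) < P" using n p_gt_2 by (simp add: P)
  then show False using assms p_gt_2 by (simp add: xpow_def)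
qed

text \<open>x has order P, prime to q, so its image has no y-part. The exponent u is a unit, as
  otherwise x^(p^(n-1)) would be sent to the unit element.\<close>

lemma auto_powers:
  assumes l: "cP (l ^ q) 1" and \<alpha>: "\<alpha> \<in> auto (M l)"
  obtains u t w where "\<not> int p dvd u" "u \<in> {0..<int P}" "t \<in> {0..<int P}" "w < q" "\<alpha> (ypow 1) = (t, w)"
    "\<And>j. \<alpha> (xpow j) = ((u * int j) mod int P, 0)" "\<And>j. snd (\<alpha> (ypow j)) = (w * j) mod q"
proof -
  interpret G: group "M l" by (rule group_M[OF l])
  note \<alpha>' = autoD[OF \<alpha>, unfolded sd_simps(1)]
  have \<alpha>1: "\<alpha> (0, 0) = (0, 0)"
  proof -
    have "(0, 0) \<otimes>\<^bsub>M l\<^esub> (0, 0) = (0, 0)" by (simp add: sd_simps)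
    then have "\<alpha> (0, 0) \<otimes>\<^bsub>M l\<^esub> \<alpha> (0, 0) = \<alpha> (0, 0)" using \<alpha>'(5)[OF one_Cr one_Cr] by simp
    moreover have "\<alpha> (0, 0) \<in> carrier (M l)" using \<alpha>'(4)[OF one_Cr] by (simp add: sd_simps(1))
    ultimately show ?thesis using G.l_cancel_one[of "\<alpha> (0,0)" "\<alpha> (0,0)"] by (simp add: sd_simps(3))
  qed
  obtain u v where uv: "\<alpha> (xpow 1) = (u, v)" by fastforce
  obtain t w where tw: "\<alpha> (ypow 1) = (t, w)" by fastforce
  have r: "u \<in> {0..<int P}" "v < q" "t \<in> {0..<int P}" "w < q"
    using \<alpha>'(4)[OF xpow_Cr[of 1]] \<alpha>'(4)[OF ypow_Cr[of 1]] uv tw by auto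
  have sx: "snd (\<alpha> (xpow j)) = (v * j) mod q" for j
  proof (induction j)
    case (Suc j)
    then show ?case unfolding xpow_Suc[of j l] \<alpha>'(5)[OF xpow_Cr xpow_Cr] by (simp add: sd_simps uv[unfolded One_nat_def] mod_simps)
  qed (simp add: xpow_0 \<alpha>1)
  have v: "v = 0" using q_dvd_mult_P[of v] sx[of P] r by (simp add: xpow_P \<alpha>1)
  have fx: "fst (\<alpha> (xpow j)) = (u * int j) mod int P" for j
  proof (induction j)
    case (Suc j)
    then show ?case unfolding xpow_Suc[of j l] \<alpha>'(5)[OF xpow_Cr xpow_Cr] by (simp add: sd_simps uv[unfolded One_nat_def] v mod_simps algebra_simps)
  qed (simp add: xpow_0 \<alpha>1)
  have ax: "\<alpha> (xpow j) = ((u * int j) mod int P, 0)" for j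
    using sx[of j] fx[of j] v by (simp add: prod_eq_iff)
  have u: "\<not> int p dvd u"
  proof
    assume "int p dvd u"
    then have "int p * int p ^ (n - 1) dvd u * int (p ^ (n - 1))" by (intro mult_dvd_mono) auto
    then have "int P dvd u * int (p ^ (n - 1))" by (simp add: P_eq)
    then have "\<alpha> (xpow (p ^ (n - 1))) = \<alpha> (0, 0)" unfolding ax \<alpha>1 by (simp only: dvd_imp_mod_0)
    then show False using \<alpha>'(6)[OF xpow_Cr one_Cr] xpow_eq_1 by blast
  qed
  have sy: "snd (\<alpha> (ypow j)) = (w * j) mod q" for j
  proof (induction j)
    case (Suc j)
    then show ?case unfolding ypow_Suc[of j l] \<alpha>'(5)[OF ypow_Cr ypow_Cr] by (simp add: sd_simps tw[unfolded One_nat_def] mod_simps)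
  qed (simp add: ypow_0 \<alpha>1)
  show thesis by (rule that[OF u r(1,3,4) tw ax sy])
qed

text \<open>The relation y x = x^k y gives k^w = k for the y-exponent w of the image of y, and
  powers of k separate residues modulo q, so w = 1. The x-part of the image of y^j is then t geom k
  j, which has the form r (1 - k^j) because 1 - k is a unit.\<close>

lemma auto_k_form:
  assumes \<alpha>: "\<alpha> \<in> auto (M k)"
  obtains u r where "\<not> int p dvd u" "u \<in> {0..<int P}" "r \<in> {0..<int P}" "\<alpha> = aff k u r"
proof (rule auto_powers[OF k_q \<alpha>])
  note \<alpha>' = autoD[OF \<alpha>, unfolded sd_simps(1)]
  fix u t w
  assume u: "\<not> int p dvd u" "u \<in> {0..<int P}" and t: "t \<in> {0..<int P}" and w: "w < q" and y: "\<alpha> (ypow 1) = (t, w)"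
    and x: "\<And>j. \<alpha> (xpow j) = ((u * int j) mod int P, 0)" and sy: "\<And>j. snd (\<alpha> (ypow j)) = (w * j) mod q"
  have "\<alpha> (ypow 1) \<otimes>\<^bsub>M k\<^esub> \<alpha> (xpow 1) = \<alpha> (xpow (nat k)) \<otimes>\<^bsub>M k\<^esub> \<alpha> (ypow 1)"
    using arg_cong[OF relation[OF k_range(1)], of \<alpha>] unfolding \<alpha>'(5)[OF ypow_Cr xpow_Cr] \<alpha>'(5)[OF xpow_Cr ypow_Cr] .
  then have "cP (t + k ^ w * u) (u * k + t)"
    using k_range u(2) by (simp add: x y[unfolded One_nat_def] sd_simps cong_def mod_simps)
  then have "cP (u * k ^ w) (u * k ^ 1)" by (rule cong_comb1[where ca = 1]) (simp add: algebra_simps)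
  then have "cP (k ^ w) (k ^ 1)" using cancel_left[OF u(1)] by simp
  then have "int p dvd k ^ w - k ^ 1" using cong_p by (simp add: cong_iff_dvd_diff)
  then have "w mod q = 1 mod q" using k_diff_unit by blast
  then have w1: "w = 1" using w q_ge_3 by simp
  have "\<not> int p dvd 1 - k" using k_minus_1_unit by (metis dvd_minus_iff minus_diff_eq)
  then obtain i where i: "cP ((1 - k) * i) 1" by (rule ex_inverse)
  have fy: "cP (fst (\<alpha> (ypow j))) (t * geom k j)" for j
  proof (induction j)
    case 0
    have "ypow 0 = xpow 0" by (simp only: xpow_0 ypow_0)
    then show ?case using x[of 0] by simp
  next
    case (Suc j)
    have "fst (\<alpha> (ypow (Suc j))) = (t + k * fst (\<alpha> (ypow j))) mod int P"
      unfolding ypow_Suc[of j k] \<alpha>'(5)[OF ypow_Cr ypow_Cr] by (simp add: sd_simps y[unfolded One_nat_def] w1)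
    then have "cP (fst (\<alpha> (ypow (Suc j)))) (t + k * fst (\<alpha> (ypow j)))" by simp
    also have "cP (t + k * fst (\<alpha> (ypow j))) (t + k * (t * geom k j))"
      by (intro cong_add cong_mult Suc cong_refl)
    finally show ?case by (simp add: geom_Suc algebra_simps)
  qed
  let ?r = "(t * i) mod int P"
  have "\<alpha> = aff k u ?r"
  proof (rule extensionalityI[OF \<alpha>'(3)])
    show "aff k u ?r \<in> extensional Cr" by (simp add: aff_def)
    fix s assume s: "s \<in> Cr"
    let ?a = "nat (fst s)" and ?b = "snd s"
    have ab: "?b < q" "int ?a = fst s" using s by auto
    have dec: "\<alpha> s = \<alpha> (xpow ?a) \<otimes>\<^bsub>M k\<^esub> \<alpha> (ypow ?b)"
      using arg_cong[OF decompose[OF s, of k], of \<alpha>] \<alpha>'(5)[OF xpow_Cr ypow_Cr] by simp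
    have "snd (\<alpha> s) = snd (aff k u ?r s)" unfolding dec using s ab by (simp add: sd_simps x sy w1 aff_def)
    moreover have "cP (fst (\<alpha> s)) (fst (aff k u ?r s))"
    proof -
      have c1: "cP (fst (\<alpha> s)) (u * fst s + fst (\<alpha> (ypow ?b)))" unfolding dec using ab by (simp add: sd_simps x cong_def mod_simps)
      have c2: "cP (u * fst s + fst (\<alpha> (ypow ?b))) (u * fst s + t * geom k ?b)" by (intro cong_add cong_refl fy)
      have "1 - k ^ ?b = (1 - k) * geom k ?b"
        using geom_telescope[of k ?b] by (simp add: algebra_simps)
      moreover have "cP (t * geom k ?b) (t * i * ((1 - k) * geom k ?b))"
        by (rule cong_comb1[OF cong_sym[OF i], where ca = "t * geom k ?b"]) (simp add: algebra_simps)
      ultimately have "cP (t * geom k ?b) (t * i * (1 - k ^ ?b))" by simp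
      then have c3: "cP (u * fst s + t * geom k ?b) (u * fst s + t * i * (1 - k ^ ?b))" by (intro cong_add cong_refl)
      have "cP (u * fst s + t * i * (1 - k ^ ?b)) (fst (aff k u ?r s))"
      proof -
        have "cP (t * i) ?r" by simp
        then have "cP (u * fst s + t * i * (1 - k ^ ?b)) (u * fst s + ?r * (1 - k ^ ?b))"
          by (intro cong_add cong_mult cong_refl)
        then show ?thesis using s by (simp add: aff_def)
      qed
      then show ?thesis using cong_trans[OF c1 cong_trans[OF c2 c3]] cong_trans by blast
    qed
    moreover have "fst (\<alpha> s) \<in> {0..<int P}" "fst (aff k u ?r s) \<in> {0..<int P}"
      using \<alpha>'(4)[OF s] aff_closed[OF s] by (simp_all only: mem_Times_iff)
    ultimately show "\<alpha> s = aff k u ?r s" by (intro prod_eqI cP_eqI)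
  qed
  then show thesis using u that[of u ?r] by simp
qed

definition dil :: "int \<Rightarrow> nat \<Rightarrow> int \<times> nat \<Rightarrow> int \<times> nat" where
  "dil u w = (\<lambda>s\<in>Cr. ((u * fst s) mod int P, (w * snd s) mod q))"

text \<open>The image of y is killed by q, so its component in Z_P satisfies q t = 0 and
  vanishes.\<close>

lemma auto_1_form:
  assumes \<alpha>: "\<alpha> \<in> auto (M 1)"
  obtains u w where "\<not> int p dvd u" "u \<in> {0..<int P}" "w \<in> {1..<q}" "\<alpha> = dil u w"
proof (rule auto_powers[OF _ \<alpha>])
  note \<alpha>' = autoD[OF \<alpha>, unfolded sd_simps(1)]
  fix u t w
  assume u: "\<not> int p dvd u" "u \<in> {0..<int P}" and t: "t \<in> {0..<int P}" and w: "w < q" and y: "\<alpha> (ypow 1) = (t, w)"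
    and x: "\<And>j. \<alpha> (xpow j) = ((u * int j) mod int P, 0)" and sy: "\<And>j. snd (\<alpha> (ypow j)) = (w * j) mod q"
  have e: "\<alpha> (ypow 0) = (0, 0)" using x[of 0] by (simp add: xpow_0 ypow_0)
  have fy: "fst (\<alpha> (ypow j)) = (t * int j) mod int P" for j
  proof (induction j)
    case (Suc j)
    then show ?case unfolding ypow_Suc[of j 1] \<alpha>'(5)[OF ypow_Cr ypow_Cr] by (simp add: sd_simps y[unfolded One_nat_def] mod_simps algebra_simps)
  qed (simp add: e)
  have "int P dvd int q * t" using fy[of q] e by (simp add: ypow_q ypow_0 mult.commute mod_0_imp_dvd)
  then have "int P dvd t" using coprime_q_P by (simp add: coprime_dvd_mult_right_iff coprime_commute)
  then have t0: "t = 0" using t by (auto dest: zdvd_imp_le)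
  have w0: "w \<noteq> 0"
  proof
    assume "w = 0"
    then have "\<alpha> (ypow 1) = \<alpha> (ypow 0)" using y e t0 by simp
    then have "ypow 1 = ypow 0" using \<alpha>'(6)[OF ypow_Cr ypow_Cr] by blast
    then show False using q_ge_3 by (simp add: ypow_def)
  qed
  have "\<alpha> = dil u w"
  proof (rule extensionalityI[OF \<alpha>'(3)])
    show "dil u w \<in> extensional Cr" by (simp add: dil_def)
    fix s assume s: "s \<in> Cr"
    let ?a = "nat (fst s)" and ?b = "snd s"
    have ab: "?b < q" "int ?a = fst s" using s by auto
    have dec: "\<alpha> s = \<alpha> (xpow ?a) \<otimes>\<^bsub>M 1\<^esub> \<alpha> (ypow ?b)"
      using arg_cong[OF decompose[OF s, of 1], of \<alpha>] \<alpha>'(5)[OF xpow_Cr ypow_Cr] by simp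
    show "\<alpha> s = dil u w s"
      unfolding dec using s ab by (intro prod_eqI) (simp_all add: sd_simps x sy fy t0 dil_def)
  qed
  then show thesis using u w w0 that[of u w] by simp
qed simp

lemma card_auto_k: "card (auto (M k)) = card {u \<in> {0..<int P}. \<not> int p dvd u} * P"
proof -
  let ?U = "{u \<in> {0..<int P}. \<not> int p dvd u}"
  have "bij_betw (\<lambda>(u, r). aff k u r) (?U \<times> {0..<int P}) (auto (M k))"
    unfolding bij_betw_def
  proof (intro conjI subset_antisym subsetI)
    show "inj_on (\<lambda>(u, r). aff k u r) (?U \<times> {0..<int P})"
    proof (rule inj_onI, clarify)
      fix u r u' r' assume ranges: "u \<in> {0..<int P}" "u' \<in> {0..<int P}" "r \<in> {0..<int P}" "r' \<in> {0..<int P}"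
        and eq: "aff k u r = aff k u' r'"
      have m: "(1, 0) \<in> Cr" "(0, 1) \<in> Cr" using P_ge_3 q_ge_3 by auto
      have "cP u u'" using fun_cong[OF eq, of "(1, 0)"] m by (simp add: aff_def cong_def)
      then have u: "u = u'" using ranges by (intro cP_eqI)
      have "cP (r * (1 - k)) (r' * (1 - k))" using fun_cong[OF eq, of "(0, 1)"] m by (simp add: aff_def cong_def)
      then have "cP ((k - 1) * r) ((k - 1) * r')" by (rule cong_comb1[where ca = "- 1"]) (simp add: algebra_simps)
      then have "cP r r'" using cancel_left[OF k_minus_1_unit] by simp
      then show "u = u' \<and> r = r'" using u ranges by (blast intro: cP_eqI)
    qed
    fix \<alpha> assume "\<alpha> \<in> auto (M k)"
    then show "\<alpha> \<in> (\<lambda>(u, r). aff k u r) ` (?U \<times> {0..<int P})" by (rule auto_k_form) force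
  qed (use aff_auto[OF k_q] in auto)
  from bij_betw_same_card[OF this] show ?thesis by (simp add: card_cartesian_product)
qed

lemma card_auto_1: "card (auto (M 1)) = card {u \<in> {0..<int P}. \<not> int p dvd u} * (q - 1)"
proof -
  let ?U = "{u \<in> {0..<int P}. \<not> int p dvd u}"
  have "bij_betw (\<lambda>(u, w). dil u w) (?U \<times> {1..<q}) (auto (M 1))"
    unfolding bij_betw_def
  proof (intro conjI subset_antisym subsetI)
    show "inj_on (\<lambda>(u, w). dil u w) (?U \<times> {1..<q})"
    proof (rule inj_onI, clarify)
      fix u u' and w w' :: nat assume ranges: "u \<in> {0..<int P}" "u' \<in> {0..<int P}" "w \<in> {1..<q}" "w' \<in> {1..<q}"
        and eq: "dil u w = dil u' w'"
      have m: "(1, 0) \<in> Cr" "(0, 1) \<in> Cr" using P_ge_3 q_ge_3 by auto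
      have "cP u u'" using fun_cong[OF eq, of "(1, 0)"] m by (simp add: dil_def cong_def)
      then have "u = u'" using ranges by (intro cP_eqI)
      moreover have "w = w'" using fun_cong[OF eq, of "(0, 1)"] m ranges by (simp add: dil_def)
      ultimately show "u = u' \<and> w = w'" by simp
    qed
    fix \<alpha> assume "\<alpha> \<in> auto (M 1)"
    then show "\<alpha> \<in> (\<lambda>(u, w). dil u w) ` (?U \<times> {1..<q})" by (rule auto_1_form) force
  next
    fix \<alpha> assume "\<alpha> \<in> (\<lambda>(u, w). dil u w) ` (?U \<times> {1..<q})"
    then obtain u w where uw: "\<not> int p dvd u" "w \<in> {1..<q}" "\<alpha> = dil u w" by auto
    have c: "dil u w s \<in> Cr" if "s \<in> Cr" for s using that P_pos q_ge_3 by (auto simp: dil_def)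
    show "\<alpha> \<in> auto (M 1)"
      unfolding uw(3)
    proof (rule autoI)
      have "inj_on (dil u w) Cr"
      proof (rule inj_onI)
        fix s t assume st: "s \<in> Cr" "t \<in> Cr" and eq: "dil u w s = dil u w t"
        have "cP (u * fst s) (u * fst t)" "(w * snd s) mod q = (w * snd t) mod q"
          using eq st by (auto simp: dil_def cong_def)
        then have "cP (fst s) (fst t)" "snd s = snd t"
          using cancel_left[OF uw(1)] mult_q_cancel[OF uw(2), of "snd s" "snd t"] st by auto
        then show "s = t" using st by (intro prod_eqI cP_eqI) auto
      qed
      moreover have "dil u w ` Cr \<subseteq> Cr" using c by blast
      ultimately show "bij_betw (dil u w) (carrier (M 1)) (carrier (M 1))"
        using endo_inj_surj[OF finite_Cr] unfolding sd_simps(1) bij_betw_def by blast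
      fix s t assume "s \<in> carrier (M 1)" "t \<in> carrier (M 1)"
      then have st: "s \<in> Cr" "t \<in> Cr" by (simp_all add: sd_simps(1))
      show "dil u w (s \<otimes>\<^bsub>M 1\<^esub> t) = dil u w s \<otimes>\<^bsub>M 1\<^esub> dil u w t"
        using st M_closed[OF st, of 1] by (simp add: dil_def sd_simps mod_simps distrib_left)
    qed (simp add: dil_def sd_simps(1))
  qed
  from bij_betw_same_card[OF this] show ?thesis by (simp add: card_cartesian_product)
qed

end

context pq_model
begin

lemma geom_cong: "cP U V \<Longrightarrow> cP (geom U j) (geom V j)"
  unfolding geom_def by (intro cong_sum cong_pow)

lemma fam_eqI:
  assumes "\<phi> \<in> extensional Cr" "\<And>t. t \<in> Cr \<Longrightarrow> \<phi> t \<in> Cr"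
    "\<And>t. t \<in> Cr \<Longrightarrow> cP (fst (\<phi> t)) (A * geom U (nat (fst t)) + B * (1 - m ^ snd t) + D * (l ^ (s * snd t) - m ^ snd t))"
    "\<And>t. t \<in> Cr \<Longrightarrow> snd (\<phi> t) = (s * snd t) mod q"
  shows "\<phi> = fam m l U A B D s"
proof (rule extensionalityI[OF assms(1)])
  fix t assume t: "t \<in> Cr"
  have "fst (\<phi> t) mod int P = fst (\<phi> t)" using assms(2)[OF t] by (auto simp: mem_Times_iff)
  then have "fst (\<phi> t) = fst (fam m l U A B D s t)" using assms(3)[OF t] t by (simp add: fam_def cong_def)
  then show "\<phi> t = fam m l U A B D s t" using assms(4)[OF t] fam_val(2)[OF t] by (simp add: prod_eq_iff)
qed (simp add: fam_def)

lemma fam_cong: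
  assumes "cP U U'" "cP A A'" "cP B B'" "cP D D'" shows "fam m l U A B D s = fam m l U' A' B' D' s"
proof (rule fam_eqI)
  fix t assume t: "t \<in> Cr"
  show "fam m l U A B D s t \<in> Cr" using P_pos q_ge_3 t by (simp add: fam_def)
  show "cP (fst (fam m l U A B D s t)) (A' * geom U' (nat (fst t)) + B' * (1 - m ^ snd t) + D' * (l ^ (s * snd t) - m ^ snd t))"
    by (rule cong_trans[OF fam_val(1)[OF t]]) (intro cong_add cong_mult cong_refl assms geom_cong)
qed (simp_all add: fam_val, simp add: fam_def)

end

section \<open>Brace maps between the groups of order \<open>p\<^sup>n q\<close>\<close>

text \<open>The cases of \<open>ml\<close> are: both groups nonabelian, nonabelian source with
  cyclic target, cyclic source with nonabelian target.\<close>

locale brace_analysis = pq_model p n P q k for p n P q :: nat and k :: int +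
  fixes m l :: int and \<phi> :: "int \<times> nat \<Rightarrow> int \<times> nat"
  assumes ml: "m = k \<and> l = k \<or> m = k \<and> l = 1 \<or> m = 1 \<and> l = k"
    and \<phi>: "\<phi> \<in> brace_maps (sd P q m) (sd P q l)"
begin

lemma m_q: "cP (m ^ q) 1" and l_q: "cP (l ^ q) 1" and m_nonneg: "m \<ge> 0"
  using ml k_q k_range by auto

sublocale B: brace_map "M m" "M l" \<phi>
  using group_M[OF m_q] group_M[OF l_q] \<phi> by (simp add: brace_map_def brace_map_axioms_def)

lemma \<phi>_Cr: "t \<in> Cr \<Longrightarrow> \<phi> t \<in> Cr"
  using B.closed[of t] by (simp add: sd_simps(1))

lemma \<phi>_1: "\<phi> (0, 0) = (0, 0)"
  using B.one by (simp add: sd_simps(3))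

lemma \<phi>_surj: assumes "z \<in> {0..<int P}" "b < q" obtains t where "t \<in> Cr" "\<phi> t = (z, b)"
  using B.\<phi>_\<psi>[of "(z, b)"] B.\<psi>_closed[of "(z, b)"] assms that[of "B.\<psi> (z, b)"] by (simp add: sd_simps(1))

lemma m_assoc: "s \<in> Cr \<Longrightarrow> t \<in> Cr \<Longrightarrow> u \<in> Cr \<Longrightarrow> s \<otimes>\<^bsub>M m\<^esub> t \<otimes>\<^bsub>M m\<^esub> u = s \<otimes>\<^bsub>M m\<^esub> (t \<otimes>\<^bsub>M m\<^esub> u)"
  using B.G.m_assoc by (simp add: sd_simps(1))

lemma one_left: "t \<in> Cr \<Longrightarrow> (0, 0) \<otimes>\<^bsub>M m\<^esub> t = t"
  using B.G.l_one[of t] by (simp add: sd_simps(1,3))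

text \<open>When \<open>N\<close> is cyclic, \<open>\<Gamma>\<close> acts trivially on \<open>N/\<int>\<^sub>P\<close>, since \<open>|\<Gamma>| = P q\<close> is prime to \<open>q - 1\<close>.\<close>

lemma twist_cyclic:
  assumes l1: "l = 1" and s: "s \<in> Cr"
  obtains u where "\<not> int p dvd u" "B.twist s = dil u 1"
proof -
  have s': "s \<in> carrier (M m)" using s by (simp add: sd_simps(1))
  have "B.twist s \<in> auto (M 1)" using B.twist_auto[OF s'] l1 by simp
  then obtain u w where uw: "\<not> int p dvd u" "w \<in> {1..<q}" "B.twist s = dil u w" by (rule auto_1_form)
  have pow: "B.twist (s [^]\<^bsub>M m\<^esub> j) (0, b) = (0, (w ^ j * b) mod q)" if "b < q" for j b
    using that
  proof (induction j arbitrary: b)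
    case 0
    then show ?case using P_pos B.twist_one[of "(0, b)"] by (simp add: sd_simps(1))
  next
    case (Suc j)
    have "(0, b) \<in> carrier (M l)" using Suc.prems P_pos by (simp add: sd_simps(1))
    then have "B.twist (s [^]\<^bsub>M m\<^esub> Suc j) (0, b) = B.twist (s [^]\<^bsub>M m\<^esub> j) (B.twist s (0, b))"
      using s' by (simp add: B.twist_comp)
    also have "B.twist s (0, b) = (0, (w * b) mod q)" using uw(3) Suc.prems P_pos by (simp add: dil_def)
    also have "B.twist (s [^]\<^bsub>M m\<^esub> j) \<dots> = (0, (w ^ j * ((w * b) mod q)) mod q)" using Suc.IH[of "(w * b) mod q"] by simp
    finally show ?case by (simp add: mod_simps mult_ac)
  qed
  have "order (M m) = P * q" using card_Cr by (simp add: order_def sd_simps(1))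
  then have "s [^]\<^bsub>M m\<^esub> (P * q) = \<one>\<^bsub>M m\<^esub>" using B.G.pow_order_eq_1[OF s'] by simp
  then have "(0, (w ^ (P * q) * 1) mod q) = (0 :: int, 1 :: nat)"
    using pow[of 1 "P * q"] q_ge_3 P_pos B.twist_one[of "(0, 1)"] by (simp add: sd_simps(1))
  then have "[w ^ (P * q) = 1] (mod q)" using q_ge_3 by (simp add: cong_def)
  then have w1: "[int w ^ (P * q) = 1] (mod int q)" using cong_int_iff[of "w ^ (P * q)" 1 q] by simp
  have "\<not> q dvd w" using uw(2) by (auto dest: dvd_imp_le)
  then have "[w ^ (q - 1) = 1] (mod q)" by (rule fermat_theorem[OF q])
  then have w2: "[int w ^ (q - 1) = 1] (mod int q)" using cong_int_iff[of "w ^ (q - 1)" 1 q] by simp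
  have "\<not> p dvd q - 1" using q_less_p q_ge_3 by (auto dest: dvd_imp_le)
  then have "coprime P (q - 1)" using prime_imp_coprime[OF p, of "q - 1"] by (simp add: P)
  moreover have "coprime q (q - 1)" using coprime_diff_one_right_nat[of q] q_ge_3 by simp
  ultimately have "coprime (P * q) (q - 1)" by simp
  then have "[int w = 1] (mod int q)" using power_coprime_1[OF w1 w2] P_pos q_ge_3 by simp
  then have "w = 1" using uw(2) q_ge_3 cong_int_iff[of w 1 q] by (simp add: cong_def)
  then show thesis using uw that by simp
qed

text \<open>Necessity of the shape demanded by \<open>brace_mapI\<close>. For nonabelian target the
  part r (1 - l^b) of an affine automorphism splits into a constant and the term R l^b; for cyclic
  target automorphisms are dilations and only A + U z is left.\<close>

lemma tdata:
  assumes s: "s \<in> Cr"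
  obtains A U R where "\<not> int p dvd U" "l = 1 \<Longrightarrow> R = 0"
    "\<And>t. t \<in> Cr \<Longrightarrow> cP (fst (\<phi> (s \<otimes>\<^bsub>M m\<^esub> t))) (A + U * fst (\<phi> t) + R * l ^ snd (\<phi> t))"
    "\<And>t. t \<in> Cr \<Longrightarrow> snd (\<phi> (s \<otimes>\<^bsub>M m\<^esub> t)) = (snd (\<phi> s) + snd (\<phi> t)) mod q"
proof -
  have s': "s \<in> carrier (M m)" using s by (simp add: sd_simps(1))
  have mult: "\<phi> (s \<otimes>\<^bsub>M m\<^esub> t) = \<phi> s \<otimes>\<^bsub>M l\<^esub> B.twist s (\<phi> t)" if "t \<in> Cr" for t
    using B.mult[OF s', of t] that by (simp add: sd_simps(1))
  let ?L = "l ^ snd (\<phi> s)"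
  have L: "\<not> int p dvd ?L" by (rule not_dvd_power[OF root_unit[OF l_q]])
  show thesis
  proof (cases "l = 1")
    case True
    obtain u where u: "\<not> int p dvd u" "B.twist s = dil u 1" using twist_cyclic[OF True s] .
    show thesis
    proof (rule that[OF u(1), of 0 "fst (\<phi> s)"])
      fix t assume t: "t \<in> Cr"
      have "B.twist s (\<phi> t) = ((u * fst (\<phi> t)) mod int P, snd (\<phi> t))"
        using \<phi>_Cr[OF t] unfolding u(2) by (auto simp: dil_def mem_Times_iff)
      then show "cP (fst (\<phi> (s \<otimes>\<^bsub>M m\<^esub> t))) (fst (\<phi> s) + u * fst (\<phi> t) + 0 * l ^ snd (\<phi> t))"
        "snd (\<phi> (s \<otimes>\<^bsub>M m\<^esub> t)) = (snd (\<phi> s) + snd (\<phi> t)) mod q"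
        unfolding mult[OF t] True by (simp_all add: sd_simps cong_def mod_simps)
    qed simp
  next
    case False
    then have lk: "l = k" using ml by blast
    have "B.twist s \<in> auto (M k)" using B.twist_auto[OF s'] lk by simp
    then obtain u r where u: "\<not> int p dvd u" "B.twist s = aff k u r" by (rule auto_k_form)
    show thesis
    proof (rule that[OF not_dvd_mult[OF L u(1)], of "- ?L * r" "fst (\<phi> s) + ?L * r"])
      fix t assume t: "t \<in> Cr"
      have tw: "B.twist s (\<phi> t) = ((u * fst (\<phi> t) + r * (1 - l ^ snd (\<phi> t))) mod int P, snd (\<phi> t))"
        using \<phi>_Cr[OF t] by (simp only: u(2)) (simp add: aff_def lk)
      show "snd (\<phi> (s \<otimes>\<^bsub>M m\<^esub> t)) = (snd (\<phi> s) + snd (\<phi> t)) mod q"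
        unfolding mult[OF t] tw by (simp add: sd_simps)
      have "cP (fst (\<phi> (s \<otimes>\<^bsub>M m\<^esub> t))) (fst (\<phi> s) + ?L * ((u * fst (\<phi> t) + r * (1 - l ^ snd (\<phi> t))) mod int P))"
        unfolding mult[OF t] tw by (simp add: sd_simps)
      also have "cP (fst (\<phi> s) + ?L * ((u * fst (\<phi> t) + r * (1 - l ^ snd (\<phi> t))) mod int P))
          (fst (\<phi> s) + ?L * (u * fst (\<phi> t) + r * (1 - l ^ snd (\<phi> t))))"
        by (intro cong_add cong_mult cong_refl) simp
      finally show "cP (fst (\<phi> (s \<otimes>\<^bsub>M m\<^esub> t))) (fst (\<phi> s) + ?L * r + ?L * u * fst (\<phi> t) + - ?L * r * l ^ snd (\<phi> t))"
        by (simp add: algebra_simps)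
    qed (use False in simp)
  qed
qed

end

section \<open>Recursions under translation by x (constants without primes) and by y (with
  primes)\<close>

locale brace_data = brace_analysis p n P q k m l \<phi> for p n P q :: nat and k m l :: int and \<phi> +
  fixes A U R A' U' R' :: int
  assumes U: "\<not> int p dvd U" and R1: "l = 1 \<Longrightarrow> R = 0"
    and Xf: "\<And>t. t \<in> Cr \<Longrightarrow> cP (fst (\<phi> (xpow 1 \<otimes>\<^bsub>M m\<^esub> t))) (A + U * fst (\<phi> t) + R * l ^ snd (\<phi> t))"
    and Xg: "\<And>t. t \<in> Cr \<Longrightarrow> snd (\<phi> (xpow 1 \<otimes>\<^bsub>M m\<^esub> t)) = (snd (\<phi> (xpow 1)) + snd (\<phi> t)) mod q"
    and U': "\<not> int p dvd U'" and R'1: "l = 1 \<Longrightarrow> R' = 0"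
    and Yf: "\<And>t. t \<in> Cr \<Longrightarrow> cP (fst (\<phi> (ypow 1 \<otimes>\<^bsub>M m\<^esub> t))) (A' + U' * fst (\<phi> t) + R' * l ^ snd (\<phi> t))"
    and Yg: "\<And>t. t \<in> Cr \<Longrightarrow> snd (\<phi> (ypow 1 \<otimes>\<^bsub>M m\<^esub> t)) = (snd (\<phi> (ypow 1)) + snd (\<phi> t)) mod q"
begin

abbreviation "f t \<equiv> fst (\<phi> t)"
abbreviation "g t \<equiv> snd (\<phi> t)"

definition s :: nat where "s = g (ypow 1)"

lemma g_less: "t \<in> Cr \<Longrightarrow> g t < q" and f_range: "t \<in> Cr \<Longrightarrow> f t \<in> {0..<int P}"
  using \<phi>_Cr by (auto simp: mem_Times_iff)

lemma xt_Cr: "t \<in> Cr \<Longrightarrow> xpow j \<otimes>\<^bsub>M m\<^esub> t \<in> Cr" and yt_Cr: "t \<in> Cr \<Longrightarrow> ypow j \<otimes>\<^bsub>M m\<^esub> t \<in> Cr"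
  using M_closed by simp_all

lemma xpow_Suc_mult: "t \<in> Cr \<Longrightarrow> xpow (Suc j) \<otimes>\<^bsub>M m\<^esub> t = xpow 1 \<otimes>\<^bsub>M m\<^esub> (xpow j \<otimes>\<^bsub>M m\<^esub> t)"
  unfolding xpow_Suc[of j m] by (rule m_assoc) simp_all

lemma ypow_Suc_mult: "t \<in> Cr \<Longrightarrow> ypow (Suc j) \<otimes>\<^bsub>M m\<^esub> t = ypow 1 \<otimes>\<^bsub>M m\<^esub> (ypow j \<otimes>\<^bsub>M m\<^esub> t)"
  unfolding ypow_Suc[of j m] by (rule m_assoc) simp_all

lemma xpow_one: "xpow j \<otimes>\<^bsub>M m\<^esub> (0, 0) = xpow j"
  by (auto simp: xpow_def sd_simps)

text \<open>x^P = 1 makes P times this exponent vanish modulo q, and P is prime to q.\<close>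

lemma gx1: "g (xpow 1) = 0"
proof -
  have "g (xpow j) = (g (xpow 1) * j) mod q" for j
  proof (induction j)
    case (Suc j)
    then show ?case using Xg[of "xpow j"] unfolding xpow_Suc[of j m] by (simp add: mod_simps)
  qed (simp add: xpow_0 \<phi>_1)
  from this[of P] have "(g (xpow 1) * P) mod q = 0" by (simp add: xpow_P \<phi>_1)
  then show ?thesis by (rule q_dvd_mult_P[OF _ g_less[OF xpow_Cr]])
qed

lemma gx: "t \<in> Cr \<Longrightarrow> g (xpow j \<otimes>\<^bsub>M m\<^esub> t) = g t"
proof (induction j)
  case 0
  then show ?case by (simp only: xpow_0 one_left)
next
  case (Suc j)
  then show ?case using Xg[OF xt_Cr[OF Suc.prems, of j]] gx1 g_less[OF Suc.prems] by (simp add: xpow_Suc_mult[simplified])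
qed

lemma gy: "g (ypow j) = (s * j) mod q"
proof (induction j)
  case (Suc j)
  then show ?case using Yg[of "ypow j"] unfolding ypow_Suc[of j m] by (simp add: s_def mod_simps)
qed (simp add: ypow_0 \<phi>_1)

lemma gyt: "t \<in> Cr \<Longrightarrow> g (ypow j \<otimes>\<^bsub>M m\<^esub> t) = (s * j + g t) mod q"
proof (induction j)
  case 0
  then show ?case using g_less by (simp only: ypow_0 one_left) simp
next
  case (Suc j)
  then show ?case using Yg[OF yt_Cr[OF Suc.prems, of j]] by (simp add: ypow_Suc_mult[simplified] s_def mod_simps algebra_simps)
qed

lemma g_eq: "t \<in> Cr \<Longrightarrow> g t = (s * snd t) mod q"
  using arg_cong[OF decompose[of t m], of g] by (simp add: gx gy)

lemma s_range: "s \<in> {1..<q}"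
proof -
  have "s < q" unfolding s_def by (rule g_less) simp
  moreover have "s \<noteq> 0"
  proof
    assume "s = 0"
    then have "g t = 0" if "t \<in> Cr" for t using g_eq[OF that] by simp
    moreover obtain t where "t \<in> Cr" "\<phi> t = (0, 1)" using \<phi>_surj[of 0 1] P_pos q_ge_3 by auto
    ultimately show False by force
  qed
  ultimately show ?thesis by simp
qed

lemma l_pow: "cP (l ^ (i mod q)) (l ^ i)" by (rule pow_mod[OF l_q])

lemma fx: "t \<in> Cr \<Longrightarrow> cP (f (xpow j \<otimes>\<^bsub>M m\<^esub> t)) ((A + R * l ^ g t) * geom U j + U ^ j * f t)"
proof (induction j)
  case 0
  then show ?case using one_left by (simp only: xpow_0) simp
next
  case (Suc j)
  have c1: "cP (f (xpow (Suc j) \<otimes>\<^bsub>M m\<^esub> t)) (A + U * f (xpow j \<otimes>\<^bsub>M m\<^esub> t) + R * l ^ g t)"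
    using Xf[OF xt_Cr[OF Suc.prems, of j]] unfolding xpow_Suc_mult[OF Suc.prems] gx[OF Suc.prems] .
  have c2: "cP (A + U * f (xpow j \<otimes>\<^bsub>M m\<^esub> t) + R * l ^ g t) (A + U * ((A + R * l ^ g t) * geom U j + U ^ j * f t) + R * l ^ g t)"
    by (intro cong_add cong_mult cong_refl Suc.IH Suc.prems)
  have e: "A + U * ((A + R * l ^ g t) * geom U j + U ^ j * f t) + R * l ^ g t = (A + R * l ^ g t) * geom U (Suc j) + U ^ Suc j * f t"
    by (simp add: geom_Suc algebra_simps)
  show ?case by (rule cong_trans[OF c1 c2[unfolded e]])
qed

text \<open>Translation by x^P is trivial. Comparing its effect on the values z = 0 and z = 1 gives
  U^P = 1, which modulo p reads U = 1.\<close>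

lemma U_p: "[U = 1] (mod int p)"
proof -
  obtain t1 where t1: "t1 \<in> Cr" "\<phi> t1 = (1, 0)" using \<phi>_surj[of 1 0] P_ge_3 q_ge_3 by auto
  note t = one_Cr \<phi>_1 t1
  have "cP 0 ((A + R) * geom U P)" using fx[OF t(1), of P] t one_left[OF t(1)] by (simp add: xpow_P)
  moreover have "cP 1 ((A + R) * geom U P + U ^ P)" using fx[OF t(3), of P] t one_left[OF t(3)] by (simp add: xpow_P)
  ultimately have "cP (U ^ P) 1" by (rule cong_comb2[where ca = 1 and cb = "- 1"]) simp
  then have "[U ^ P = 1] (mod int p)" by (rule cong_p)
  then show ?thesis using fermat_P[of U] cong_sym cong_trans by blast
qed

text \<open>A + R is the value at x. If p divided it, x^(p^(n-1)) would have the value (A + R) geom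
  U (p^(n-1)) = 0, against injectivity.\<close>

lemma AR_unit: "\<not> int p dvd A + R"
proof
  assume "int p dvd A + R"
  moreover have "int p ^ (n - 1) dvd geom U (p ^ (n - 1))" using dvd_geom_iff[OF U_p] by simp
  ultimately have "int p * int p ^ (n - 1) dvd (A + R) * geom U (p ^ (n - 1))" by (rule mult_dvd_mono)
  then have "cP ((A + R) * geom U (p ^ (n - 1))) 0" by (simp add: cong_0_iff P_eq)
  moreover have "cP (f (xpow (p ^ (n - 1)))) ((A + R) * geom U (p ^ (n - 1)))"
    using fx[OF one_Cr, of "p ^ (n - 1)"] by (simp add: xpow_one \<phi>_1)
  ultimately have "cP (f (xpow (p ^ (n - 1)))) 0" using cong_trans by blast
  then have "f (xpow (p ^ (n - 1))) = 0" using f_range[OF xpow_Cr, of "p ^ (n - 1)"] P_pos by (intro cP_eqI) auto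
  moreover have "g (xpow (p ^ (n - 1))) = 0" using gx[OF one_Cr, of "p ^ (n - 1)"] by (simp add: xpow_one \<phi>_1)
  ultimately have "\<phi> (xpow (p ^ (n - 1))) = \<phi> (0, 0)" by (simp add: prod_eq_iff \<phi>_1)
  moreover have "xpow (p ^ (n - 1)) \<in> carrier (M m)" "(0, 0) \<in> carrier (M m)"
    using xpow_Cr one_Cr by (simp_all only: sd_simps(1))
  ultimately have "xpow (p ^ (n - 1)) = (0, 0)" using B.inject by blast
  then show False by (rule xpow_eq_1)
qed

text \<open>y x and x^m y are the same element; its translation is expanded along both
  factorisations. Since \<phi> is surjective, the values z = f t and b = g t can be prescribed
  afterwards.\<close>

lemma braid:
  assumes t: "t \<in> Cr"
  shows "cP (A' + U' * (A + U * f t + R * l ^ g t) + R' * l ^ g t)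
    ((A + R * l ^ (s + g t)) * geom U (nat m) + U ^ nat m * (A' + U' * f t + R' * l ^ g t))"
proof -
  have yx: "ypow 1 \<otimes>\<^bsub>M m\<^esub> (xpow 1 \<otimes>\<^bsub>M m\<^esub> t) = xpow (nat m) \<otimes>\<^bsub>M m\<^esub> (ypow 1 \<otimes>\<^bsub>M m\<^esub> t)"
    using m_assoc[OF ypow_Cr xpow_Cr t, of 1 1] m_assoc[OF xpow_Cr ypow_Cr t, of "nat m" 1] relation[OF m_nonneg] by simp
  have "cP (f (ypow 1 \<otimes>\<^bsub>M m\<^esub> (xpow 1 \<otimes>\<^bsub>M m\<^esub> t))) (A' + U' * f (xpow 1 \<otimes>\<^bsub>M m\<^esub> t) + R' * l ^ g t)"
    using Yf[OF xt_Cr[OF t, of 1]] unfolding gx[OF t] .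
  moreover have "cP (A' + U' * f (xpow 1 \<otimes>\<^bsub>M m\<^esub> t) + R' * l ^ g t) (A' + U' * (A + U * f t + R * l ^ g t) + R' * l ^ g t)"
    by (intro cong_add cong_mult cong_refl Xf[OF t])
  ultimately have lhs: "cP (f (ypow 1 \<otimes>\<^bsub>M m\<^esub> (xpow 1 \<otimes>\<^bsub>M m\<^esub> t))) (A' + U' * (A + U * f t + R * l ^ g t) + R' * l ^ g t)"
    by (rule cong_trans)
  have "g (ypow 1 \<otimes>\<^bsub>M m\<^esub> t) = (s + g t) mod q" using Yg[OF t] by (simp add: s_def)
  then have "cP (f (xpow (nat m) \<otimes>\<^bsub>M m\<^esub> (ypow 1 \<otimes>\<^bsub>M m\<^esub> t)))
      ((A + R * l ^ ((s + g t) mod q)) * geom U (nat m) + U ^ nat m * f (ypow 1 \<otimes>\<^bsub>M m\<^esub> t))"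
    using fx[OF yt_Cr[OF t, of 1], of "nat m"] by simp
  moreover have "cP ((A + R * l ^ ((s + g t) mod q)) * geom U (nat m) + U ^ nat m * f (ypow 1 \<otimes>\<^bsub>M m\<^esub> t))
      ((A + R * l ^ (s + g t)) * geom U (nat m) + U ^ nat m * (A' + U' * f t + R' * l ^ g t))"
    by (intro cong_add cong_mult cong_refl Yf[OF t] l_pow)
  ultimately have rhs: "cP (f (xpow (nat m) \<otimes>\<^bsub>M m\<^esub> (ypow 1 \<otimes>\<^bsub>M m\<^esub> t)))
      ((A + R * l ^ (s + g t)) * geom U (nat m) + U ^ nat m * (A' + U' * f t + R' * l ^ g t))" by (rule cong_trans)
  show ?thesis using cong_trans[OF cong_sym[OF lhs] rhs[folded yx]] .
qed

lemma fy_Suc: "cP (f (ypow (Suc j))) (A' + U' * f (ypow j) + R' * l ^ (s * j))"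
proof -
  have "cP (f (ypow (Suc j))) (A' + U' * f (ypow j) + R' * l ^ g (ypow j))"
    using Yf[OF ypow_Cr, of j] unfolding ypow_Suc[of j m] .
  moreover have "cP (A' + U' * f (ypow j) + R' * l ^ g (ypow j)) (A' + U' * f (ypow j) + R' * l ^ (s * j))"
    unfolding gy by (intro cong_add cong_mult cong_refl l_pow)
  ultimately show ?thesis by (rule cong_trans)
qed

lemma f_decompose:
  assumes t: "t \<in> Cr"
  shows "cP (f t) ((A + R * l ^ (s * snd t)) * geom U (nat (fst t)) + U ^ nat (fst t) * f (ypow (snd t)))"
proof -
  have "cP (f t) ((A + R * l ^ g (ypow (snd t))) * geom U (nat (fst t)) + U ^ nat (fst t) * f (ypow (snd t)))"
    using fx[OF ypow_Cr, of "nat (fst t)" "snd t"] decompose[OF t, of m] by simp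
  moreover have "cP ((A + R * l ^ g (ypow (snd t))) * geom U (nat (fst t)) + U ^ nat (fst t) * f (ypow (snd t)))
      ((A + R * l ^ (s * snd t)) * geom U (nat (fst t)) + U ^ nat (fst t) * f (ypow (snd t)))"
    unfolding gy by (intro cong_add cong_mult cong_refl l_pow)
  ultimately show ?thesis by (rule cong_trans)
qed

lemma braid0: "cP (A' + U' * (A + R) + R') ((A + R * l ^ s) * geom U (nat m) + U ^ nat m * (A' + R'))"
proof -
  obtain t where "t \<in> Cr" "\<phi> t = (0, 0)" using \<phi>_surj[of 0 0] P_pos q_ge_3 by auto
  then show ?thesis using braid[of t] by simp
qed

lemma braid1: "cP (A' + U' * (A + R * l) + R' * l) ((A + R * l ^ Suc s) * geom U (nat m) + U ^ nat m * (A' + R' * l))"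
proof -
  obtain t where "t \<in> Cr" "\<phi> t = (0, 1)" using \<phi>_surj[of 0 1] P_pos q_ge_3 by auto
  then show ?thesis using braid[of t] by simp
qed

text \<open>Subtracting the relation at z = 0 from that at z = 1, with b = 0, leaves the coefficient
  of z.\<close>

lemma U_braid: "cP (U' * U) (U ^ nat m * U')"
proof -
  obtain t where "t \<in> Cr" "\<phi> t = (1, 0)" using \<phi>_surj[of 1 0] P_ge_3 q_ge_3 by auto
  then have "cP (A' + U' * (A + U + R) + R') ((A + R * l ^ s) * geom U (nat m) + U ^ nat m * (A' + U' + R'))"
    using braid[of t] by simp
  then show ?thesis by (rule cong_comb2[OF _ braid0, where ca = 1 and cb = "- 1"]) (simp add: algebra_simps)
qed

text \<open>Cancelling U' and U leaves U^(k - 1) = 1. As U has order dividing P and k - 1 is prime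
  to p, U = 1.\<close>

lemma m_k_U: assumes "m = k" shows "cP U 1"
proof -
  define j where "j = nat k - 1"
  have j: "nat k = Suc j" "j \<noteq> 0" using k_ge_2 by (auto simp: j_def)
  have "cP (U' * (U * 1)) (U' * (U * U ^ j))"
    using U_braid unfolding assms j(1) by (simp add: mult_ac)
  then have "cP (U * 1) (U * U ^ j)" using cancel_left[OF U', of "U * 1" "U * U ^ j"] by blast
  then have "cP 1 (U ^ j)" using cancel_left[OF U, of 1 "U ^ j"] by blast
  then have "cP (U ^ j) 1" by (rule cong_sym)
  moreover have "coprime j P"
  proof -
    have "int j = k - 1" using j k_ge_2 by linarith
    then have "\<not> p dvd j" using k_minus_1_unit by (metis int_dvd_int_iff)
    then have "coprime p j" using prime_imp_coprime[OF p] by blast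
    then show ?thesis by (simp add: P coprime_commute)
  qed
  ultimately show ?thesis using power_coprime_1[OF _ unipotent_P[OF U_p]] j(2) by blast
qed

text \<open>With U = 1 the braid relations at b = 0 and b = 1 are linear in A and R. If l = k they
  give U' = k and (k^(s+1) - k) R = 0, hence R = 0 because q does not divide s; if l = 1, R vanishes
  already and U' = k follows from the unit A. The recursion along y is then linear with multiplier
  k, constant term A' and forcing term R' l^(s j); it is solved by B (1 - k^j) + D (l^(s j) -
  k^j).\<close>

theorem nonabelian_form:
  assumes mk: "m = k" and A: "\<not> int p dvd A"
  obtains B D where "\<phi> = fam k l 1 A B D s" "l = k \<Longrightarrow> s = 1 \<Longrightarrow> D = 0" "l = 1 \<Longrightarrow> D = 0"
proof -
  note U1 = m_k_U[OF mk]
  have gk: "cP (geom U (nat k)) k" using geom_cong[OF U1, of "nat k"] k_range by simp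
  have Uk: "cP (U ^ j) 1" for j using cong_pow[OF U1, of j] by simp
  have F0: "cP (U' * (A + R)) (k * (A + R * l ^ s))"
    by (rule cong_comb3[OF braid0[unfolded mk] gk Uk[of "nat k"], where ca = 1 and cb = "A + R * l ^ s" and cc = "A' + R'"])
      (simp add: algebra_simps)
  have F1: "cP (U' * (A + R * l)) (k * (A + R * l ^ Suc s))"
    by (rule cong_comb3[OF braid1[unfolded mk] gk Uk[of "nat k"], where ca = 1 and cb = "A + R * l ^ Suc s" and cc = "A' + R' * l"])
      (simp add: algebra_simps)
  have AR: "cP U' k \<and> cP R 0"
  proof (cases "l = 1")
    case True
    have "cP (A * U') (A * k)" using F0 R1[OF True] by (simp add: mult.commute)
    then show ?thesis using cancel_left[OF A] R1[OF True] by simp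
  next
    case False
    then have lk: "l = k" using ml by blast
    have "cP ((k - 1) * (U' * R)) ((k - 1) * (k ^ Suc s * R))"
      by (rule cong_comb2[OF F1 F0, where ca = 1 and cb = "- 1"]) (simp add: lk algebra_simps)
    then have H2: "cP (U' * R) (k ^ Suc s * R)" using cancel_left[OF k_minus_1_unit] by simp
    have "cP (A * U') (A * k)" by (rule cong_comb2[OF F0 H2, where ca = 1 and cb = "- 1"]) (simp add: lk algebra_simps)
    then have U'k: "cP U' k" using cancel_left[OF A] by simp
    have "\<not> int p dvd k ^ Suc s - k ^ 1"
      using s_range by (intro k_diff_unit) (auto simp: mod_Suc)
    moreover have "cP ((k ^ Suc s - k ^ 1) * R) ((k ^ Suc s - k ^ 1) * 0)"
      by (rule cong_comb2[OF H2 U'k, where ca = "- 1" and cb = R]) (simp add: algebra_simps)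
    ultimately have "cP R 0" using cancel_left by blast
    then show ?thesis using U'k by blast
  qed
  then have U'k: "cP U' k" and R0: "cP R 0" by auto
  have rec: "cP (f (ypow (Suc j))) (A' + k * f (ypow j) + R' * l ^ (s * j))" for j
    by (rule cong_trans[OF fy_Suc]) (intro cong_add cong_mult cong_refl U'k)
  have "\<not> int p dvd 1 - k" using k_minus_1_unit by (metis dvd_minus_iff minus_diff_eq)
  then obtain i where i: "cP ((1 - k) * i) 1" by (rule ex_inverse)
  define B where "B = A' * i"
  have A'B: "cP A' ((1 - k) * B)"
    by (rule cong_comb1[OF i, where ca = "- A'"]) (simp add: B_def algebra_simps)
  have f0: "f (ypow 0) = 0" "f (ypow q) = 0" by (simp_all add: ypow_0 ypow_q \<phi>_1)
  obtain D where D: "cP R' ((l ^ s - k) * D)" "l = k \<Longrightarrow> s = 1 \<Longrightarrow> D = 0" "l = 1 \<Longrightarrow> D = 0"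
  proof (cases "l = 1")
    case True
    then show thesis using that[of 0] R'1 by simp
  next
    case False
    then have lk: "l = k" using ml by blast
    show thesis
    proof (cases "s = 1")
      case s1: True
      \<comment> \<open>For s = 1 and l = k the forcing term is in resonance with the multiplier,
        producing j k^(j-1) R'. The extra factor k avoids a negative exponent at j = 0. Closing the
        recursion at y^q = 1 gives q R' = 0, so R' = 0.\<close>
      have h: "cP (k * f (ypow j)) (k * (B * (1 - k ^ j)) + int j * k ^ j * R')" for j
      proof (induction j)
        case (Suc j)
        show ?case
          by (rule cong_comb3[OF rec[of j] Suc A'B, where ca = k and cb = k and cc = k]) (simp add: lk s1 algebra_simps)
      qed (simp add: f0)
      have "cP (int q * R') (int q * 0)"
      proof (rule cong_comb2[OF h[of q] k_q, where ca = "- 1" and cb = "k * B - int q * R'"])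
        show "int q * R' - int q * 0 = - 1 * (k * f (ypow q) - (k * (B * (1 - k ^ q)) + int q * k ^ q * R')) + (k * B - int q * R') * (k ^ q - 1)"
          by (simp add: f0 algebra_simps)
      qed
      moreover have "\<not> int p dvd int q"
        using q_less_p q_ge_3 by (auto dest: zdvd_imp_le)
      ultimately have "cP R' 0" using cancel_left by blast
      then show thesis using that[of 0] False by simp
    next
      case s1: False
      have "\<not> int p dvd k ^ s - k ^ 1" using s_range s1 by (intro k_diff_unit) auto
      then obtain i' where i': "cP ((k ^ s - k ^ 1) * i') 1" by (rule ex_inverse)
      have "cP R' ((l ^ s - k) * (R' * i'))"
        by (rule cong_comb1[OF i', where ca = "- R'"]) (simp add: lk algebra_simps)
      then show thesis using that[of "R' * i'"] s1 False by simp
    qed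
  qed
  have h: "cP (f (ypow j)) (B * (1 - k ^ j) + D * (l ^ (s * j) - k ^ j))" for j
  proof (induction j)
    case (Suc j)
    have "cP (f (ypow (Suc j))) ((1 - k) * B + k * (B * (1 - k ^ j) + D * (l ^ (s * j) - k ^ j)) + (l ^ s - k) * D * l ^ (s * j))"
      by (rule cong_trans[OF rec]) (intro cong_add cong_mult cong_refl A'B D Suc)
    then show ?case by (simp add: algebra_simps power_add)
  qed (simp add: f0)
  have "\<phi> = fam k l 1 A B D s"
  proof (rule fam_eqI)
    show "\<phi> \<in> extensional Cr" using B.extens by (simp add: sd_simps(1))
    fix t assume t: "t \<in> Cr"
    have "cP (f t) ((A + 0 * l ^ (s * snd t)) * geom 1 (nat (fst t)) + 1 * (B * (1 - k ^ snd t) + D * (l ^ (s * snd t) - k ^ snd t)))"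
      by (rule cong_trans[OF f_decompose[OF t]]) (intro cong_add cong_mult cong_refl geom_cong U1 R0 Uk h)
    then show "cP (f t) (A * geom 1 (nat (fst t)) + B * (1 - k ^ snd t) + D * (l ^ (s * snd t) - k ^ snd t))"
      by (simp add: add.assoc)
  qed (simp_all add: \<phi>_Cr[simplified] g_eq)
  then show thesis using D(2,3) that by blast
qed

text \<open>On elements with value in Z_P, translation by y^j acts by z \<mapsto> c + U'^j z; y^q =
  1 and the values z = 0 and z = 1 determine the coefficient.\<close>

lemma U'_q: "cP (U' ^ q) 1"
proof -
  have "\<exists>c. \<forall>t\<in>Cr. g t = 0 \<longrightarrow> cP (f (ypow j \<otimes>\<^bsub>M m\<^esub> t)) (c + U' ^ j * f t)" for j
  proof (induction j)
    case 0
    show ?case using one_left by (intro exI[of _ 0]) (simp only: ypow_0, simp)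
  next
    case (Suc j)
    then obtain c where c: "\<And>t. t \<in> Cr \<Longrightarrow> g t = 0 \<Longrightarrow> cP (f (ypow j \<otimes>\<^bsub>M m\<^esub> t)) (c + U' ^ j * f t)" by blast
    have "cP (f (ypow (Suc j) \<otimes>\<^bsub>M m\<^esub> t)) ((A' + U' * c + R' * l ^ ((s * j) mod q)) + U' ^ Suc j * f t)" if t: "t \<in> Cr" "g t = 0" for t
    proof -
      have "cP (f (ypow (Suc j) \<otimes>\<^bsub>M m\<^esub> t)) (A' + U' * f (ypow j \<otimes>\<^bsub>M m\<^esub> t) + R' * l ^ ((s * j) mod q))"
        using Yf[OF yt_Cr[OF t(1), of j]] gyt[OF t(1), of j] t(2) unfolding ypow_Suc_mult[OF t(1)] by simp
      then show ?thesis
        by (rule cong_comb2[OF _ c[OF t], where ca = 1 and cb = U']) (simp add: algebra_simps)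
    qed
    then show ?case by blast
  qed
  then obtain c where c: "\<And>t. t \<in> Cr \<Longrightarrow> g t = 0 \<Longrightarrow> cP (f (ypow q \<otimes>\<^bsub>M m\<^esub> t)) (c + U' ^ q * f t)" by blast
  obtain t1 where t1: "t1 \<in> Cr" "\<phi> t1 = (1, 0)" using \<phi>_surj[of 1 0] P_ge_3 q_ge_3 by auto
  note t = one_Cr \<phi>_1 t1
  have c0: "cP 0 c" using c[OF t(1)] t one_left[OF t(1)] by (simp add: ypow_q)
  have c1: "cP 1 (c + U' ^ q)" using c[OF t(3)] t one_left[OF t(3)] by (simp add: ypow_q)
  show ?thesis by (rule cong_comb2[OF c0 c1, where ca = 1 and cb = "- 1"]) simp
qed

text \<open>As x and y commute, the braid relations give (U' - 1) A = (U - 1) A', so U' = 1 modulo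
  p; being a q-th root of unity, U' = 1. Closing the recursion along y gives q A' = 0. Writing R' =
  (k^s - 1) D, the remaining relation becomes R = (1 - U) D, so U stays free and D absorbs both R
  and R'.\<close>

theorem cyclic_form:
  assumes m1: "m = 1" and A: "\<not> int p dvd A"
  obtains A1 D where "\<phi> = fam 1 k U A1 0 D s" "\<not> int p dvd A1"
proof -
  have lk: "l = k" using ml k_1 m1 by auto
  have nm: "nat m = Suc 0" using m1 by simp
  have G0: "cP (A' + U' * (A + R) + R') (A + R * k ^ s + U * (A' + R'))"
    using braid0 unfolding nm lk by simp
  have G1: "cP (A' + U' * (A + R * k) + R' * k) (A + R * k ^ Suc s + U * (A' + R' * k))"
    using braid1 unfolding nm lk by simp
  have "cP ((k - 1) * (U' * R + R')) ((k - 1) * (R * k ^ s + U * R'))"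
    by (rule cong_comb2[OF G1 G0, where ca = 1 and cb = "- 1"]) (simp add: algebra_simps)
  then have I2: "cP (U' * R + R') (R * k ^ s + U * R')" using cancel_left[OF k_minus_1_unit] by simp
  have I1: "cP (A' + U' * A) (A + U * A')"
    by (rule cong_comb2[OF G0 I2, where ca = 1 and cb = "- 1"]) (simp add: algebra_simps)
  have "[A * U' = A * 1] (mod int p)"
    by (rule cong_comb2[OF cong_p[OF I1] U_p, where ca = 1 and cb = A']) (simp add: algebra_simps)
  moreover have "coprime A (int p)" using A prime_imp_coprime[OF prime_int_p] by (simp add: coprime_commute)
  ultimately have "[U' = 1] (mod int p)" using cong_mult_lcancel by blast
  then have U'1: "cP U' 1" by (rule root_p[OF U'_q])
  have f0: "f (ypow 0) = 0" "f (ypow q) = 0" by (simp_all add: ypow_0 ypow_q \<phi>_1)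
  have rec: "cP (f (ypow (Suc j))) (A' + 1 * f (ypow j) + R' * k ^ (s * j))" for j
    by (rule cong_trans[OF fy_Suc[unfolded lk]]) (intro cong_add cong_mult cong_refl U'1)
  have ks: "\<not> int p dvd k ^ s - k ^ 0" using s_range by (intro k_diff_unit) auto
  have h0: "cP (f (ypow j)) (int j * A' + R' * geom (k ^ s) j)" for j
  proof (induction j)
    case (Suc j)
    show ?case
      by (rule cong_comb2[OF rec[of j, unfolded power_mult] Suc, where ca = 1 and cb = 1]) (simp add: geom_Suc' algebra_simps)
  qed (simp add: f0)
  have "cP ((k ^ s) ^ q) 1" using cong_pow[OF k_q, of s] by (simp add: power_mult[symmetric] mult.commute)
  then have "cP ((k ^ s - k ^ 0) * geom (k ^ s) q) ((k ^ s - k ^ 0) * 0)"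
    using geom_telescope[of "k ^ s" q] by (simp add: cong_iff_dvd_diff)
  then have gq: "cP (geom (k ^ s) q) 0" using cancel_left[OF ks, of "geom (k ^ s) q" 0] by blast
  have "cP (int q * A') (int q * 0)"
    by (rule cong_comb2[OF h0[of q] gq, where ca = "- 1" and cb = "- R'"]) (simp add: f0 algebra_simps)
  moreover have "\<not> int p dvd int q" using q_less_p q_ge_3 by (auto dest: zdvd_imp_le)
  ultimately have A'0: "cP A' 0" using cancel_left by blast
  obtain i where i: "cP ((k ^ s - k ^ 0) * i) 1" by (rule ex_inverse[OF ks])
  define D where "D = R' * i"
  have R'D: "cP R' ((k ^ s - k ^ 0) * D)"
    by (rule cong_comb1[OF i, where ca = "- R'"]) (simp add: D_def algebra_simps)
  have "cP ((k ^ s - k ^ 0) * R) ((k ^ s - k ^ 0) * ((1 - U) * D))"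
    by (rule cong_comb3[OF I2 U'1 R'D, where ca = "- 1" and cb = R and cc = "1 - U"]) (simp add: algebra_simps)
  then have RD: "cP R ((1 - U) * D)" using cancel_left[OF ks, of R "(1 - U) * D"] by blast
  have h: "cP (f (ypow j)) (D * (k ^ (s * j) - 1))" for j
  proof (induction j)
    case (Suc j)
    have "cP (f (ypow (Suc j))) (0 + 1 * (D * (k ^ (s * j) - 1)) + (k ^ s - k ^ 0) * D * k ^ (s * j))"
      by (rule cong_trans[OF rec]) (intro cong_add cong_mult cong_refl A'0 R'D Suc)
    then show ?case by (simp add: algebra_simps power_add)
  qed (simp add: f0)
  \<comment> \<open>Substituting U^a = 1 - (1 - U) geom U a cancels the products of geom U a with
    k^(s b) and leaves this coefficient of the geometric sum.\<close>
  let ?A1 = "A + (1 - U) * D"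
  have "\<phi> = fam 1 k U ?A1 0 D s"
  proof (rule fam_eqI)
    show "\<phi> \<in> extensional Cr" using B.extens by (simp add: sd_simps(1))
    fix t assume t: "t \<in> Cr"
    let ?a = "nat (fst t)" and ?b = "snd t"
    have "cP (f t) ((A + (1 - U) * D * k ^ (s * ?b)) * geom U ?a + U ^ ?a * (D * (k ^ (s * ?b) - 1)))"
      by (rule cong_trans[OF f_decompose[OF t, unfolded lk]]) (intro cong_add cong_mult cong_refl RD h)
    moreover have "(A + (1 - U) * D * k ^ (s * ?b)) * geom U ?a + U ^ ?a * (D * (k ^ (s * ?b) - 1)) =
        ?A1 * geom U ?a + 0 * (1 - 1 ^ ?b) + D * (k ^ (s * ?b) - 1 ^ ?b)"
    proof -
      have e: "U ^ ?a = 1 - (1 - U) * geom U ?a" using geom_telescope[of U ?a] by (simp add: algebra_simps)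
      show ?thesis unfolding e by (simp add: algebra_simps)
    qed
    ultimately show "cP (f t) (?A1 * geom U ?a + 0 * (1 - 1 ^ ?b) + D * (k ^ (s * ?b) - 1 ^ ?b))" by simp
  qed (simp_all add: \<phi>_Cr[simplified] g_eq)
  moreover have "\<not> int p dvd ?A1"
  proof -
    have "[?A1 = A] (mod int p)" by (rule cong_comb1[OF U_p, where ca = "- D"]) (simp add: algebra_simps)
    then show ?thesis using A cong_dvd_iff by blast
  qed
  ultimately show thesis by (rule that)
qed

end

section \<open>Inversion of values and the count of brace maps\<close>

context pq_model
begin

lemma xpow1_mult: "t \<in> Cr \<Longrightarrow> xpow 1 \<otimes>\<^bsub>M m\<^esub> t = ((1 + fst t) mod int P, snd t)"
  using P_ge_3 by (auto simp: xpow_def sd_simps)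

lemma inv_M: assumes m: "cP (m ^ q) 1" and s: "s \<in> Cr"
  shows "inv\<^bsub>M m\<^esub> s = ((- (m ^ (q - snd s) * fst s)) mod int P, (q - snd s) mod q)" (is "_ = ?i")
proof -
  interpret group "M m" by (rule group_M[OF m])
  have "cP (- (m ^ (q - snd s) * fst s) mod int P + m ^ ((q - snd s) mod q) * fst s)
      (- (m ^ (q - snd s) * fst s) + m ^ (q - snd s) * fst s)"
    by (intro cong_add cong_mult cong_refl pow_mod m) simp
  then have "fst (?i \<otimes>\<^bsub>M m\<^esub> s) = 0" by (simp add: sd_simps cong_def)
  moreover have "snd (?i \<otimes>\<^bsub>M m\<^esub> s) = 0" using s by (auto simp: sd_simps mod_simps)
  ultimately have "?i \<otimes>\<^bsub>M m\<^esub> s = \<one>\<^bsub>M m\<^esub>" by (simp add: prod_eq_iff sd_simps(3))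
  then show ?thesis using s P_pos by (intro inv_equality) (auto simp: sd_simps(1))
qed

definition flip :: "(int \<times> nat \<Rightarrow> int \<times> nat) \<Rightarrow> int \<times> nat \<Rightarrow> int \<times> nat" where
  "flip \<phi> = (\<lambda>t\<in>Cr. inv\<^bsub>M k\<^esub> \<phi> t)"

lemma flip_val:
  assumes "t \<in> Cr" "\<phi> t \<in> Cr"
  shows "cP (fst (flip \<phi> t)) (- (k ^ (q - snd (\<phi> t)) * fst (\<phi> t)))" "snd (flip \<phi> t) = (q - snd (\<phi> t)) mod q"
    "cP (k ^ snd (flip \<phi> t)) (k ^ (q - snd (\<phi> t)))"
  using assms pow_mod[OF k_q, of "q - snd (\<phi> t)"] by (simp_all add: flip_def inv_M[OF k_q])

lemma flip_brace: assumes m: "cP (m ^ q) 1" and \<phi>: "\<phi> \<in> brace_maps (M m) (M k)" shows "flip \<phi> \<in> brace_maps (M m) (M k)"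
proof -
  have "brace_map (M m) (M k) \<phi>"
    using group_M[OF m] group_M[OF k_q] \<phi> by (simp add: brace_map_def brace_map_axioms_def)
  from brace_map.inverse_brace_map[OF this] show ?thesis by (simp add: flip_def sd_simps(1))
qed

lemma brace_Cr: "\<phi> \<in> brace_maps (M m) (M l) \<Longrightarrow> t \<in> Cr \<Longrightarrow> \<phi> t \<in> Cr"
  by (auto simp: brace_maps_def bij_betw_def sd_simps(1))

lemma flip_flip: assumes \<phi>: "\<phi> \<in> brace_maps (M m) (M k)" shows "flip (flip \<phi>) = \<phi>"
proof -
  interpret group "M k" by (rule group_M[OF k_q])
  have "\<phi> \<in> extensional Cr" using \<phi> by (simp add: brace_maps_def sd_simps(1))
  then show ?thesis
    by (rule extensionalityI[rotated]) (use brace_Cr[OF \<phi>] in \<open>auto simp: flip_def sd_simps(1)\<close>)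
qed

lemma ex_brace_data:
  assumes "brace_analysis p n P q k m l \<phi>"
  obtains A U R A' U' R' where "brace_data p n P q k m l \<phi> A U R A' U' R'"
proof -
  interpret brace_analysis p n P q k m l \<phi> by fact
  show thesis
  proof (rule tdata[OF xpow_Cr[of 1]], rule tdata[OF ypow_Cr[of 1]])
    fix A U R A' U' R'
    assume "\<not> int p dvd U" "l = 1 \<Longrightarrow> R = 0"
      "\<And>t. t \<in> Cr \<Longrightarrow> cP (fst (\<phi> (xpow 1 \<otimes>\<^bsub>M m\<^esub> t))) (A + U * fst (\<phi> t) + R * l ^ snd (\<phi> t))"
      "\<And>t. t \<in> Cr \<Longrightarrow> snd (\<phi> (xpow 1 \<otimes>\<^bsub>M m\<^esub> t)) = (snd (\<phi> (xpow 1)) + snd (\<phi> t)) mod q"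
      "\<not> int p dvd U'" "l = 1 \<Longrightarrow> R' = 0"
      "\<And>t. t \<in> Cr \<Longrightarrow> cP (fst (\<phi> (ypow 1 \<otimes>\<^bsub>M m\<^esub> t))) (A' + U' * fst (\<phi> t) + R' * l ^ snd (\<phi> t))"
      "\<And>t. t \<in> Cr \<Longrightarrow> snd (\<phi> (ypow 1 \<otimes>\<^bsub>M m\<^esub> t)) = (snd (\<phi> (ypow 1)) + snd (\<phi> t)) mod q"
    then have "brace_data p n P q k m l \<phi> A U R A' U' R'" by unfold_locales
    then show thesis by (rule that)
  qed
qed

text \<open>Inverting the values of \<open>\<phi>\<close> exchanges \<open>A\<close> and \<open>R\<close> up to sign, so the case of a unit \<open>R\<close>
  reduces to that of a unit \<open>A\<close>.\<close>

lemma brace_dichotomy: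
  assumes an: "brace_analysis p n P q k m k \<phi>"
  obtains \<chi> A U R A' U' R' where "\<chi> = \<phi> \<or> \<chi> = flip \<phi>" "brace_data p n P q k m k \<chi> A U R A' U' R'" "\<not> int p dvd A"
proof (rule ex_brace_data[OF an])
  fix A U R A' U' R' assume d: "brace_data p n P q k m k \<phi> A U R A' U' R'"
  interpret brace_data p n P q k m k \<phi> A U R A' U' R' by (rule d)
  show thesis
  proof (cases "int p dvd A")
    case False
    then show thesis using that d by blast
  next
    case True
    then have R: "\<not> int p dvd - R" using AR_unit by (metis dvd_add dvd_minus_iff)
    have fb: "flip \<phi> \<in> brace_maps (M m) (M k)" by (rule flip_brace[OF m_q \<phi>])
    have an': "brace_analysis p n P q k m k (flip \<phi>)"
      using fb ml pq_model_axioms by (simp add: brace_analysis_def brace_analysis_axioms_def)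
    interpret f: brace_analysis p n P q k m k "flip \<phi>" by (rule an')
    show thesis
    proof (rule f.tdata[OF xpow_Cr[of 1]], rule f.tdata[OF ypow_Cr[of 1]])
      fix A2 U2 R2 A3 U3 R3
      assume Xg2: "\<And>t. t \<in> Cr \<Longrightarrow> snd (flip \<phi> (xpow 1 \<otimes>\<^bsub>M m\<^esub> t)) = (snd (flip \<phi> (xpow 1)) + snd (flip \<phi> t)) mod q"
        and Y: "\<not> int p dvd U3" "k = 1 \<Longrightarrow> R3 = 0"
        "\<And>t. t \<in> Cr \<Longrightarrow> cP (fst (flip \<phi> (ypow 1 \<otimes>\<^bsub>M m\<^esub> t))) (A3 + U3 * fst (flip \<phi> t) + R3 * k ^ snd (flip \<phi> t))"
        "\<And>t. t \<in> Cr \<Longrightarrow> snd (flip \<phi> (ypow 1 \<otimes>\<^bsub>M m\<^esub> t)) = (snd (flip \<phi> (ypow 1)) + snd (flip \<phi> t)) mod q"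
      \<comment> \<open>The inverse of x^z y^b has x-part - k^-b z. Multiplying A + U z + R k^b by -
        k^-b gives - R + U z' - A k^-b, where z' is the new x-part and k^-b is the power of k at the
        new y-exponent.\<close>
      have "cP (fst (flip \<phi> (xpow 1 \<otimes>\<^bsub>M m\<^esub> t))) (- R + U * fst (flip \<phi> t) + - A * k ^ snd (flip \<phi> t))" if t: "t \<in> Cr" for t
      proof -
        let ?K = "k ^ (q - g t)"
        have xt: "xpow 1 \<otimes>\<^bsub>M m\<^esub> t \<in> Cr" by (rule xt_Cr[OF t])
        have gq: "g t < q" by (rule g_less[OF t])
        have Kk: "cP (?K * k ^ g t) 1" using k_q gq by (simp add: power_add[symmetric])
        have 1: "cP (fst (flip \<phi> (xpow 1 \<otimes>\<^bsub>M m\<^esub> t))) (- (?K * f (xpow 1 \<otimes>\<^bsub>M m\<^esub> t)))"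
          using flip_val(1)[where \<phi> = \<phi>, OF xt \<phi>_Cr[OF xt]] unfolding gx[OF t] .
        have 2: "cP (- (?K * f (xpow 1 \<otimes>\<^bsub>M m\<^esub> t))) (- R - ?K * A - U * (?K * f t))"
          by (rule cong_comb2[OF Xf[OF t] Kk, where ca = "- ?K" and cb = "- R"]) (simp add: algebra_simps)
        have 3: "cP (- R - ?K * A - U * (?K * f t)) (- R + U * fst (flip \<phi> t) + - A * k ^ snd (flip \<phi> t))"
          by (rule cong_comb2[OF flip_val(1)[where \<phi> = \<phi>, OF t \<phi>_Cr[OF t]] flip_val(3)[where \<phi> = \<phi>, OF t \<phi>_Cr[OF t]], where ca = "- U" and cb = A])
            (simp add: algebra_simps)
        show ?thesis by (rule cong_trans[OF 1 cong_trans[OF 2 3]])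
      qed
      then have "brace_data p n P q k m k (flip \<phi>) (- R) U (- A) A3 U3 R3"
        using an' U k_1 Y Xg2 by (intro brace_data.intro brace_data_axioms.intro) auto
      then show thesis using that R by blast
    qed
  qed
qed

definition units :: "int set" where "units = {u \<in> {0..<int P}. \<not> int p dvd u}"
definition unipotents :: "int set" where "unipotents = {u \<in> {0..<int P}. [u = 1] (mod int p)}"

lemma units_mod: "\<not> int p dvd a \<Longrightarrow> a mod int P \<in> units"
  using p_dvd_cong[of "a mod int P" a] mod_range[of a] by (simp add: units_def)

lemma unipotents_mod: "[a = 1] (mod int p) \<Longrightarrow> a mod int P \<in> unipotents"
  using cong_trans[OF cong_p[of "a mod int P" a]] mod_range[of a] by (simp add: unipotents_def)

lemma finite_units: "finite units" and units_pos: "card units > 0"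
proof -
  show f: "finite units" by (rule finite_subset[of _ "{0..<int P}"]) (auto simp: units_def)
  have "1 \<in> units" using P_ge_3 prime_int_p not_prime_unit by (auto simp: units_def)
  then show "card units > 0" using f card_gt_0_iff by blast
qed

lemma card_unipotents: "card unipotents = p ^ (n - 1)"
proof -
  have "unipotents = (\<lambda>t. 1 + int p * t) ` {0..<int (p ^ (n - 1))}"
  proof (intro subset_antisym subsetI)
    fix u assume "u \<in> unipotents"
    then have u: "0 \<le> u" "u < int P" "int p dvd u - 1" by (auto simp: unipotents_def cong_iff_dvd_diff)
    then obtain t where t: "u = 1 + int p * t" by (auto simp: dvd_def algebra_simps)
    have "t \<ge> 0"
    proof (rule ccontr)
      assume "\<not> t \<ge> 0"
      then have "int p * t \<le> int p * (- 1)" using p_gt_2 by (intro mult_left_mono) auto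
      then show False using t u p_gt_2 by simp
    qed
    moreover have "int p * t < int p * int (p ^ (n - 1))" unfolding of_nat_mult[symmetric] P_eq[symmetric] using u t by simp
    then have "t < int (p ^ (n - 1))" using p_gt_2 by simp
    ultimately show "u \<in> (\<lambda>t. 1 + int p * t) ` {0..<int (p ^ (n - 1))}" using t by auto
  next
    fix u assume "u \<in> (\<lambda>t. 1 + int p * t) ` {0..<int (p ^ (n - 1))}"
    then obtain t where t: "0 \<le> t" "t + 1 \<le> int (p ^ (n - 1))" "u = 1 + int p * t" by auto
    have "int p * (t + 1) \<le> int p * int (p ^ (n - 1))" using t p_gt_2 by (intro mult_left_mono) auto
    also have "\<dots> = int P" using P_eq by (metis of_nat_mult)
    finally have "int p * t + int p \<le> int P" by (simp add: algebra_simps)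
    then show "u \<in> unipotents" using t p_gt_2 by (simp add: unipotents_def cong_iff_dvd_diff)
  qed
  moreover have "inj_on (\<lambda>t. 1 + int p * t) {0..<int (p ^ (n - 1))}" using p_gt_2 by (auto simp: inj_on_def)
  ultimately show ?thesis by (simp add: card_image nat_power_eq)
qed

text \<open>Redundant parameters are set to 0: for l = 1 the D term has the same shape as the B
  term, and for m = 1, as in \<open>F_CG\<close>, the B term vanishes.\<close>

definition F_GC where "F_GC = (\<lambda>(A, B, s). fam k 1 1 A B 0 s) ` (units \<times> {0..<int P} \<times> {1..<q})"
definition F_CG where "F_CG = (\<lambda>(A, U, D, s). fam 1 k U A 0 D s) ` (units \<times> unipotents \<times> {0..<int P} \<times> {1..<q})"
text \<open>When both groups are nonabelian and s = 1, the term D (k^(s b) - k^b) vanishes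
  identically; D = 0 is then the chosen representative. This accounts for the factor 1 + (q - 2)
  P.\<close>

definition pairs_sD :: "(nat \<times> int) set" where "pairs_sD = insert (1, 0) ({2..<q} \<times> {0..<int P})"
definition F_GG where "F_GG = (\<lambda>(A, B, s, D). fam k k 1 A B D s) ` (units \<times> {0..<int P} \<times> pairs_sD)"

lemma point_Cr: "(1, 0) \<in> Cr" "(2, 0) \<in> Cr" "(0, 1) \<in> Cr" "(0, 2) \<in> Cr"
  using P_ge_3 q_ge_3 by auto

text \<open>The values at x, x^2, y and y^2 are all that is needed to recover the
  parameters.\<close>

lemma fam_eqD:
  assumes eq: "fam m l U A B D s = fam m l U2 A2 B2 D2 s2"
  shows "cP A A2" "cP (A * (1 + U)) (A2 * (1 + U2))"
    "cP (B * (1 - m) + D * (l ^ s - m)) (B2 * (1 - m) + D2 * (l ^ s2 - m))"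
    "cP (B * (1 - m ^ 2) + D * (l ^ (s * 2) - m ^ 2)) (B2 * (1 - m ^ 2) + D2 * (l ^ (s2 * 2) - m ^ 2))"
    "s < q \<Longrightarrow> s2 < q \<Longrightarrow> s = s2"
proof -
  have e: "cP (fst (fam m l U A B D s t)) (fst (fam m l U2 A2 B2 D2 s2 t))" for t using eq by simp
  note v = cong_trans[OF cong_sym[OF fam_val(1)] cong_trans[OF e fam_val(1)]]
  have g2: "geom U (nat 2) = 1 + U" for U by (simp add: geom_def numeral_2_eq_2)
  show "cP A A2" using v[OF point_Cr(1) point_Cr(1)] by simp
  show "cP (A * (1 + U)) (A2 * (1 + U2))" using v[OF point_Cr(2) point_Cr(2)] by (simp add: g2[simplified])
  show "cP (B * (1 - m) + D * (l ^ s - m)) (B2 * (1 - m) + D2 * (l ^ s2 - m))" using v[OF point_Cr(3) point_Cr(3)] by simp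
  show "cP (B * (1 - m ^ 2) + D * (l ^ (s * 2) - m ^ 2)) (B2 * (1 - m ^ 2) + D2 * (l ^ (s2 * 2) - m ^ 2))"
    using v[OF point_Cr(4) point_Cr(4)] by simp
  show "s < q \<Longrightarrow> s2 < q \<Longrightarrow> s = s2"
    using fam_val(2)[OF point_Cr(3), of m l U A B D s] fam_val(2)[OF point_Cr(3), of m l U2 A2 B2 D2 s2] eq by simp
qed

lemma one_minus_k_unit: "\<not> int p dvd 1 - k"
  using k_minus_1_unit by (metis dvd_minus_iff minus_diff_eq)

lemma card_F_GC: "card F_GC = card units * P * (q - 1)"
proof -
  have "inj_on (\<lambda>(A, B, s). fam k 1 1 A B 0 s) (units \<times> {0..<int P} \<times> {1..<q})"
  proof (rule inj_onI)
    fix x y assume "x \<in> units \<times> {0..<int P} \<times> {1..<q}" "y \<in> units \<times> {0..<int P} \<times> {1..<q}"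
      and "(\<lambda>(A, B, s). fam k 1 1 A B 0 s) x = (\<lambda>(A, B, s). fam k 1 1 A B 0 s) y"
    then obtain A B s A2 B2 s2 where xy: "x = (A, B, s)" "y = (A2, B2, s2)"
      and r: "A \<in> units" "A2 \<in> units" "B \<in> {0..<int P}" "B2 \<in> {0..<int P}" "s \<in> {1..<q}" "s2 \<in> {1..<q}"
      and eq: "fam k 1 1 A B 0 s = fam k 1 1 A2 B2 0 s2"
      by (auto 0 0)
    note d = fam_eqD[OF eq]
    have "A = A2" using d(1) r by (intro cP_eqI) (auto simp: units_def)
    moreover have "cP ((1 - k) * B) ((1 - k) * B2)" using d(3) by (simp add: mult.commute)
    then have "B = B2" using cancel_left[OF one_minus_k_unit, of B B2] r by (intro cP_eqI) auto
    moreover have "s = s2" using d(5) r by simp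
    ultimately show "x = y" by (simp add: xy)
  qed
  then show ?thesis by (simp add: F_GC_def card_image card_cartesian_product)
qed

lemma card_F_CG: "card F_CG = card units * p ^ (n - 1) * P * (q - 1)"
proof -
  have "inj_on (\<lambda>(A, U, D, s). fam 1 k U A 0 D s) (units \<times> unipotents \<times> {0..<int P} \<times> {1..<q})"
  proof (rule inj_onI)
    fix x y assume "x \<in> units \<times> unipotents \<times> {0..<int P} \<times> {1..<q}" "y \<in> units \<times> unipotents \<times> {0..<int P} \<times> {1..<q}"
      and "(\<lambda>(A, U, D, s). fam 1 k U A 0 D s) x = (\<lambda>(A, U, D, s). fam 1 k U A 0 D s) y"
    then obtain A U D s A2 U2 D2 s2 where xy: "x = (A, U, D, s)" "y = (A2, U2, D2, s2)"
      and r: "A \<in> units" "A2 \<in> units" "U \<in> unipotents" "U2 \<in> unipotents" "D \<in> {0..<int P}" "D2 \<in> {0..<int P}" "s \<in> {1..<q}" "s2 \<in> {1..<q}"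
      and eq: "fam 1 k U A 0 D s = fam 1 k U2 A2 0 D2 s2"
      by (auto 0 0)
    note d = fam_eqD[OF eq]
    have A: "A = A2" using d(1) r by (intro cP_eqI) (auto simp: units_def)
    have Au: "\<not> int p dvd A" using r by (simp add: units_def)
    have "cP (A * U) (A * U2)" by (rule cong_comb1[OF d(2), where ca = 1]) (simp add: A algebra_simps)
    then have U: "U = U2" using cancel_left[OF Au, of U U2] r by (intro cP_eqI) (auto simp: unipotents_def)
    have s: "s = s2" using d(5) r by simp
    have ks: "\<not> int p dvd k ^ s - k ^ 0" using r by (intro k_diff_unit) auto
    have "cP ((k ^ s - k ^ 0) * D) ((k ^ s - k ^ 0) * D2)" by (rule cong_comb1[OF d(3), where ca = 1]) (simp add: s algebra_simps)
    then have "D = D2" using cancel_left[OF ks, of D D2] r by (intro cP_eqI) auto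
    then show "x = y" using A U s by (simp add: xy)
  qed
  then show ?thesis by (simp add: F_CG_def card_image card_cartesian_product card_unipotents)
qed

lemma card_pairs_sD: "card pairs_sD = 1 + (q - 2) * P"
  unfolding pairs_sD_def by (subst card_insert_disjoint) (auto simp: card_cartesian_product)

lemma pairs_sD_iff: "(s, D) \<in> pairs_sD \<longleftrightarrow> s \<in> {1..<q} \<and> D \<in> {0..<int P} \<and> (s = 1 \<longrightarrow> D = 0)"
  using q_ge_3 P_pos by (auto simp: pairs_sD_def)

lemma card_F_GG: "card F_GG = card units * P * (1 + (q - 2) * P)"
proof -
  have "inj_on (\<lambda>(A, B, s, D). fam k k 1 A B D s) (units \<times> {0..<int P} \<times> pairs_sD)"
  proof (rule inj_onI)
    fix x y assume "x \<in> units \<times> {0..<int P} \<times> pairs_sD" "y \<in> units \<times> {0..<int P} \<times> pairs_sD"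
      and "(\<lambda>(A, B, s, D). fam k k 1 A B D s) x = (\<lambda>(A, B, s, D). fam k k 1 A B D s) y"
    then obtain A B s D A2 B2 s2 D2 where xy: "x = (A, B, s, D)" "y = (A2, B2, s2, D2)"
      and "A \<in> units" "A2 \<in> units" "B \<in> {0..<int P}" "B2 \<in> {0..<int P}" "(s, D) \<in> pairs_sD" "(s2, D2) \<in> pairs_sD"
      and eq: "fam k k 1 A B D s = fam k k 1 A2 B2 D2 s2"
      by (auto 0 0)
    then have r: "A \<in> units" "A2 \<in> units" "B \<in> {0..<int P}" "B2 \<in> {0..<int P}" "s \<in> {1..<q}" "s2 \<in> {1..<q}"
      "D \<in> {0..<int P}" "D2 \<in> {0..<int P}" "s = 1 \<longrightarrow> D = 0" "s2 = 1 \<longrightarrow> D2 = 0" by (simp_all add: pairs_sD_iff)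
    note d = fam_eqD[OF eq]
    have A: "A = A2" using d(1) r by (intro cP_eqI) (auto simp: units_def)
    have s: "s = s2" using d(5) r by simp
    have D: "D = D2"
    proof (cases "s = 1")
      case True
      then show ?thesis using r s by simp
    next
      case False
      have u: "\<not> int p dvd (k ^ s - k ^ 1) * (k ^ s - k ^ 0)"
        using r False by (intro not_dvd_mult k_diff_unit) auto
      \<comment> \<open>Subtracting 1 + k times the equation at y from the one at y^2 eliminates B;
        the remaining coefficient of D factors as (k^s - k) (k^s - 1), a unit for s other than
        1.\<close>
      have "cP ((k ^ s - k ^ 1) * (k ^ s - k ^ 0) * D) ((k ^ s - k ^ 1) * (k ^ s - k ^ 0) * D2)"
        by (rule cong_comb2[OF d(4) d(3), where ca = 1 and cb = "- (1 + k)"])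
          (simp add: s algebra_simps power2_eq_square power_mult[of k s2 2])
      then show ?thesis using cancel_left[OF u, of D D2] r by (intro cP_eqI) auto
    qed
    have "cP ((1 - k) * B) ((1 - k) * B2)" by (rule cong_comb1[OF d(3), where ca = 1]) (simp add: s D algebra_simps)
    then have "B = B2" using cancel_left[OF one_minus_k_unit, of B B2] r by (intro cP_eqI) auto
    then show "x = y" using A s D by (simp add: xy)
  qed
  then show ?thesis by (simp add: F_GG_def card_image card_cartesian_product card_pairs_sD add_mult_distrib2)
qed

lemma one_q: "cP (1 ^ q) 1" by simp

lemma brace_GC: "brace_maps (M k) (M 1) = F_GC"
proof (intro subset_antisym subsetI)
  fix \<phi> assume "\<phi> \<in> brace_maps (M k) (M 1)"
  then have "brace_analysis p n P q k k 1 \<phi>"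
    using pq_model_axioms by (simp add: brace_analysis_def brace_analysis_axioms_def)
  then show "\<phi> \<in> F_GC"
  proof (rule ex_brace_data)
    fix A U R A' U' R' assume "brace_data p n P q k k 1 \<phi> A U R A' U' R'"
    then interpret brace_data p n P q k k 1 \<phi> A U R A' U' R' .
    have A: "\<not> int p dvd A" using AR_unit R1 by simp
    show ?thesis
    proof (rule nonabelian_form[OF refl A])
      fix B D assume "\<phi> = fam k 1 1 A B D s" "1 = (1 :: int) \<Longrightarrow> D = 0"
      then have "\<phi> = fam k 1 1 (A mod int P) (B mod int P) 0 s"
        by (simp add: fam_cong[of 1 1 A "A mod int P" B "B mod int P" 0 0])
      then show "\<phi> \<in> F_GC" unfolding F_GC_def using units_mod[OF A] s_range mod_range[of B]
        by (intro image_eqI[of _ _ "(A mod int P, B mod int P, s)"]) auto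
    qed
  qed
next
  fix \<phi> assume "\<phi> \<in> F_GC"
  then show "\<phi> \<in> brace_maps (M k) (M 1)"
    using k_q k_range by (auto simp: F_GC_def units_def intro!: fam_brace)
qed

lemma F_GG_brace: "F_GG \<subseteq> brace_maps (M k) (M k)"
  using k_q k_range by (auto simp: F_GG_def units_def pairs_sD_iff intro!: fam_brace)

lemma F_CG_brace: "F_CG \<subseteq> brace_maps (M 1) (M k)"
  using k_q k_range by (auto simp: F_CG_def units_def unipotents_def intro!: fam_brace)

lemma brace_GG: "brace_maps (M k) (M k) = F_GG \<union> flip ` F_GG"
proof (intro subset_antisym subsetI)
  fix \<phi> assume bm: "\<phi> \<in> brace_maps (M k) (M k)"
  then have "brace_analysis p n P q k k k \<phi>"
    using pq_model_axioms by (simp add: brace_analysis_def brace_analysis_axioms_def)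
  then show "\<phi> \<in> F_GG \<union> flip ` F_GG"
  proof (rule brace_dichotomy)
    fix \<chi> A U R A' U' R' assume \<chi>: "\<chi> = \<phi> \<or> \<chi> = flip \<phi>" and A: "\<not> int p dvd A"
      and "brace_data p n P q k k k \<chi> A U R A' U' R'"
    then interpret brace_data p n P q k k k \<chi> A U R A' U' R' by simp
    have "\<chi> \<in> F_GG"
    proof (rule nonabelian_form[OF refl A])
      fix B D assume D: "\<chi> = fam k k 1 A B D s" "k = k \<Longrightarrow> s = 1 \<Longrightarrow> D = 0"
      then have "\<chi> = fam k k 1 (A mod int P) (B mod int P) (D mod int P) s"
        by (simp add: fam_cong[of 1 1 A "A mod int P" B "B mod int P" D "D mod int P"])
      then show "\<chi> \<in> F_GG" unfolding F_GG_def using units_mod[OF A] s_range mod_range[of B] mod_range[of D] D(2)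
        by (intro image_eqI[of _ _ "(A mod int P, B mod int P, s, D mod int P)"]) (auto simp: pairs_sD_iff)
    qed
    then show ?thesis using \<chi> flip_flip[OF bm] by (metis UnI1 UnI2 imageI)
  qed
qed (use F_GG_brace flip_brace[OF k_q] in auto)

lemma brace_CG: "brace_maps (M 1) (M k) = F_CG \<union> flip ` F_CG"
proof (intro subset_antisym subsetI)
  fix \<phi> assume bm: "\<phi> \<in> brace_maps (M 1) (M k)"
  then have "brace_analysis p n P q k 1 k \<phi>"
    using pq_model_axioms by (simp add: brace_analysis_def brace_analysis_axioms_def)
  then show "\<phi> \<in> F_CG \<union> flip ` F_CG"
  proof (rule brace_dichotomy)
    fix \<chi> A U R A' U' R' assume \<chi>: "\<chi> = \<phi> \<or> \<chi> = flip \<phi>" and A: "\<not> int p dvd A"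
      and "brace_data p n P q k 1 k \<chi> A U R A' U' R'"
    then interpret brace_data p n P q k 1 k \<chi> A U R A' U' R' by simp
    have "\<chi> \<in> F_CG"
    proof (rule cyclic_form[OF refl A])
      fix A1 D assume D: "\<chi> = fam 1 k U A1 0 D s" "\<not> int p dvd A1"
      then have "\<chi> = fam 1 k (U mod int P) (A1 mod int P) 0 (D mod int P) s"
        by (simp add: fam_cong[of U "U mod int P" A1 "A1 mod int P" 0 0 D "D mod int P"])
      then show "\<chi> \<in> F_CG" unfolding F_CG_def using units_mod[OF D(2)] unipotents_mod[OF U_p] s_range mod_range[of D]
        by (intro image_eqI[of _ _ "(A1 mod int P, U mod int P, D mod int P, s)"]) auto
    qed
    then show ?thesis using \<chi> flip_flip[OF bm] by (metis UnI1 UnI2 imageI)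
  qed
qed (use F_CG_brace flip_brace[OF one_q] in auto)

text \<open>Modulo p the multiplier U is 1, so translation by x adds the constant A to the x-part of
  every value. This is the invariant that separates the family from its inverses.\<close>

lemma fam_X_mod_p:
  assumes U: "[U = 1] (mod int p)" and t: "t \<in> Cr"
  shows "[fst (fam m l U A B D s (xpow 1 \<otimes>\<^bsub>M m\<^esub> t)) = A + fst (fam m l U A B D s t)] (mod int p)"
proof -
  let ?r = "B * (1 - m ^ snd t) + D * (l ^ (s * snd t) - m ^ snd t)" and ?a = "nat (fst t)"
  have xt: "xpow 1 \<otimes>\<^bsub>M m\<^esub> t \<in> Cr" by (rule M_closed[OF xpow_Cr t])
  have n: "nat (fst (xpow 1 \<otimes>\<^bsub>M m\<^esub> t)) = Suc ?a mod P" "snd (xpow 1 \<otimes>\<^bsub>M m\<^esub> t) = snd t"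
    using t xpow1_mult[OF t] by (auto simp: nat_mod_distrib nat_add_distrib)
  have 1: "[fst (fam m l U A B D s (xpow 1 \<otimes>\<^bsub>M m\<^esub> t)) = A * geom U (Suc ?a mod P) + ?r] (mod int p)"
    using cong_p[OF fam_val(1)[OF xt, of m l U A B D s]] unfolding n by (simp add: add.assoc)
  have 2: "[fst (fam m l U A B D s t) = A * geom U ?a + ?r] (mod int p)"
    using cong_p[OF fam_val(1)[OF t, of m l U A B D s]] by (simp add: add.assoc)
  have 3: "[geom U (Suc ?a mod P) = 1 + U * geom U ?a] (mod int p)"
    using cong_p[OF geom_mod[OF U, of "Suc ?a"]] by (simp add: geom_Suc)
  have 4: "[A * geom U (Suc ?a mod P) + ?r = A + (A * geom U ?a + ?r)] (mod int p)"
    by (rule cong_comb2[OF 3 U, where ca = A and cb = "A * geom U ?a"]) (simp add: algebra_simps)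
  show ?thesis using cong_trans[OF 1 cong_trans[OF 4 cong_add[OF cong_refl cong_sym[OF 2]]]] .
qed

text \<open>In a member of the family, translation by x changes the x-part by a constant modulo p.
  In an inverted one the change is - k^b A with b the y-exponent of the value. Comparing b = 0 with
  b = s2 would make p divide A (k^s2 - 1), a product of two units.\<close>

lemma fam_flip_disjoint:
  assumes U: "[U = 1] (mod int p)" and A: "\<not> int p dvd A" and U2: "[U2 = 1] (mod int p)" and s2: "s2 \<in> {1..<q}"
    and b: "fam m k U A B D s \<in> brace_maps (M m) (M k)"
    and eq: "fam m k U2 A2 B2 D2 s2 = flip (fam m k U A B D s)"
  shows False
proof -
  let ?\<phi> = "fam m k U A B D s" and ?\<chi> = "fam m k U2 A2 B2 D2 s2"
  have key: "[A2 = - (k ^ snd (?\<chi> t) * A)] (mod int p)" if t: "t \<in> Cr" for t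
  proof -
    have xt: "xpow 1 \<otimes>\<^bsub>M m\<^esub> t \<in> Cr" by (rule M_closed[OF xpow_Cr t])
    let ?K = "k ^ (q - snd (?\<phi> t))"
    have sx: "snd (?\<phi> (xpow 1 \<otimes>\<^bsub>M m\<^esub> t)) = snd (?\<phi> t)"
      using fam_val(2)[OF xt, of m k U A B D s] fam_val(2)[OF t, of m k U A B D s] xpow1_mult[OF t, of m] by simp
    have 1: "[fst (?\<chi> (xpow 1 \<otimes>\<^bsub>M m\<^esub> t)) = - (?K * fst (?\<phi> (xpow 1 \<otimes>\<^bsub>M m\<^esub> t)))] (mod int p)"
      using cong_p[OF flip_val(1)[where \<phi> = ?\<phi>, OF xt brace_Cr[OF b xt]]] unfolding sx eq .
    have 2: "[fst (?\<chi> t) = - (?K * fst (?\<phi> t))] (mod int p)"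
      using cong_p[OF flip_val(1)[where \<phi> = ?\<phi>, OF t brace_Cr[OF b t]]] unfolding eq .
    have 3: "[k ^ snd (?\<chi> t) = ?K] (mod int p)"
      using cong_p[OF flip_val(3)[where \<phi> = ?\<phi>, OF t brace_Cr[OF b t]]] unfolding eq .
    have 4: "[A2 = - (?K * A)] (mod int p)"
    proof -
      have "[A2 + fst (?\<chi> t) = - (?K * fst (?\<phi> (xpow 1 \<otimes>\<^bsub>M m\<^esub> t)))] (mod int p)"
        using cong_trans[OF cong_sym[OF fam_X_mod_p[OF U2 t]] 1] .
      then show ?thesis
        by (rule cong_comb3[OF _ fam_X_mod_p[OF U t, of m k A B D s] 2, where ca = 1 and cb = "- ?K" and cc = "- 1"]) (simp add: algebra_simps)
    qed
    show ?thesis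
      by (rule cong_comb2[OF 4 3, where ca = 1 and cb = A]) (simp add: algebra_simps)
  qed
  have s0: "snd (?\<chi> (0, 0)) = 0" "snd (?\<chi> (0, 1)) = s2"
    using fam_val(2)[OF one_Cr, of m k U2 A2 B2 D2 s2] fam_val(2)[OF point_Cr(3), of m k U2 A2 B2 D2 s2] s2 by auto
  have "[A * (k ^ s2 - k ^ 0) = 0] (mod int p)"
    by (rule cong_comb2[OF key[OF one_Cr] key[OF point_Cr(3)], where ca = "- 1" and cb = 1]) (simp add: s0[unfolded One_nat_def] algebra_simps)
  then have "int p dvd A * (k ^ s2 - k ^ 0)" by (simp add: cong_0_iff)
  moreover have "\<not> int p dvd k ^ s2 - k ^ 0" using s2 by (intro k_diff_unit) auto
  ultimately show False using not_dvd_mult[OF A] by blast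
qed

lemma card_union_flip:
  assumes "F \<subseteq> brace_maps (M m) (M k)" "F \<inter> flip ` F = {}" "finite F"
  shows "card (F \<union> flip ` F) = 2 * card F"
proof -
  have "inj_on flip F" by (rule inj_on_inverseI[of F flip flip]) (rule flip_flip[OF subsetD[OF assms(1)]])
  then have "card (flip ` F) = card F" by (rule card_image)
  then show ?thesis using card_Un_disjoint[OF assms(3) finite_imageI[OF assms(3)] assms(2)] by simp
qed

lemma card_brace_GC: "card (brace_maps (M k) (M 1)) = card units * P * (q - 1)"
  by (simp add: brace_GC card_F_GC)

lemma card_brace_GG: "card (brace_maps (M k) (M k)) = 2 * (card units * P * (1 + (q - 2) * P))"
proof -
  have "F_GG \<inter> flip ` F_GG = {}"
  proof (rule ccontr)
    assume "F_GG \<inter> flip ` F_GG \<noteq> {}"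
    then obtain \<phi> \<chi> where fc: "\<phi> \<in> F_GG" "\<chi> \<in> F_GG" "\<chi> = flip \<phi>" by blast
    then obtain A B D s A2 B2 D2 s2 where "\<phi> = fam k k 1 A B D s" "A \<in> units" "\<chi> = fam k k 1 A2 B2 D2 s2" "s2 \<in> {1..<q}"
      by (auto simp: F_GG_def pairs_sD_iff)
    then show False using fam_flip_disjoint[of 1 A 1 s2 k B D s A2 B2 D2] fc F_GG_brace by (auto simp: units_def)
  qed
  moreover have "finite F_GG" by (simp add: F_GG_def finite_units pairs_sD_def)
  ultimately show ?thesis
    unfolding brace_GG using card_union_flip[OF F_GG_brace] by (simp add: card_F_GG)
qed

lemma card_brace_CG: "card (brace_maps (M 1) (M k)) = 2 * (card units * p ^ (n - 1) * P * (q - 1))"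
proof -
  have "F_CG \<inter> flip ` F_CG = {}"
  proof (rule ccontr)
    assume "F_CG \<inter> flip ` F_CG \<noteq> {}"
    then obtain \<phi> \<chi> where fc: "\<phi> \<in> F_CG" "\<chi> \<in> F_CG" "\<chi> = flip \<phi>" by blast
    then obtain A U D s A2 U2 D2 s2 where "\<phi> = fam 1 k U A 0 D s" "A \<in> units" "U \<in> unipotents"
      "\<chi> = fam 1 k U2 A2 0 D2 s2" "U2 \<in> unipotents" "s2 \<in> {1..<q}"
      by (auto simp: F_CG_def)
    then show False using fam_flip_disjoint[of U A U2 s2 1 0 D s A2 0 D2] fc F_CG_brace by (auto simp: units_def unipotents_def)
  qed
  moreover have "finite unipotents" by (rule finite_subset[of _ "{0..<int P}"]) (auto simp: unipotents_def)
  then have "finite F_CG" by (simp add: F_CG_def finite_units)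
  ultimately show ?thesis
    unfolding brace_CG using card_union_flip[OF F_CG_brace] by (simp add: card_F_CG)
qed

end

section \<open>Recognising G and C as model groups\<close>

lemma (in group) cyclic_group_ord:
  assumes "cyclic_group G" obtains c where "c \<in> carrier G" "ord c = order G"
proof -
  from assms obtain c where c: "c \<in> carrier G" "subgroup_generated G {c} = G" by (auto simp: cyclic_group_def)
  then have "generate G {c} = carrier G" using carrier_subgroup_generated[of G "{c}"] by auto
  then show thesis using that c generate_pow_card[of c] by (simp add: order_def)
qed

context pq_model
begin

lemma carrier_M: "carrier (M m) = Cr" by (rule sd_simps(1))

text \<open>Chinese remainders in multiplicative form: (a, b) is sent to c^(q a + P b). The images
  of the factors have coprime orders, which gives injectivity, and surjectivity follows by
  counting.\<close>

lemma cyclic_iso_M1: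
  assumes C: "group C" "cyclic_group C" "order C = P * q" shows "M 1 \<cong> C"
proof -
  interpret C: group C by (rule C(1))
  obtain c where c: "c \<in> carrier C" "C.ord c = P * q" using C.cyclic_group_ord[OF C(2)] C(3) by auto
  have eq: "c [^]\<^bsub>C\<^esub> i = c [^]\<^bsub>C\<^esub> j \<longleftrightarrow> [j = i] (mod int P * int q)" for i j :: int
    using C.int_pow_eq[OF c(1), of i j] by (simp add: c(2) cong_iff_dvd_diff)
  define h where "h s = c [^]\<^bsub>C\<^esub> (int q * fst s + int P * int (snd s))" for s :: "int \<times> nat"
  have h_Cr: "h s \<in> carrier C" for s using c by (simp add: h_def)
  have "h \<in> hom (M 1) C"
  proof (rule homI)
    fix s t assume "s \<in> carrier (M 1)" "t \<in> carrier (M 1)"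
    have 1: "[(fst s + fst t) mod int P = fst s + fst t] (mod int P)"
      and 2: "[int ((snd s + snd t) mod q) = int (snd s) + int (snd t)] (mod int q)"
      by (simp_all add: zmod_int)
    obtain d e where "(fst s + fst t) mod int P - (fst s + fst t) = int P * d"
      "int ((snd s + snd t) mod q) - (int (snd s) + int (snd t)) = int q * e"
      using 1 2 unfolding cong_iff_dvd_diff dvd_def by blast
    then have "(fst s + fst t) mod int P = fst s + fst t + int P * d"
      "int ((snd s + snd t) mod q) = int (snd s) + int (snd t) + int q * e" by linarith+
    then have "h (s \<otimes>\<^bsub>M 1\<^esub> t)
        = c [^]\<^bsub>C\<^esub> ((int q * fst s + int P * int (snd s)) + (int q * fst t + int P * int (snd t)))"
      unfolding h_def eq cong_iff_dvd_diff
      by (intro dvdI[of _ _ "- d - e"]) (simp add: sd_simps(2) algebra_simps)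
    then show "h (s \<otimes>\<^bsub>M 1\<^esub> t) = h s \<otimes>\<^bsub>C\<^esub> h t" using C.int_pow_mult[OF c(1)] by (simp add: h_def)
  qed (rule h_Cr)
  moreover have "bij_betw h Cr (carrier C)"
  proof -
    have inj: "inj_on h Cr"
    proof (rule inj_onI)
      fix s t assume st: "s \<in> Cr" "t \<in> Cr" and "h s = h t"
      then have d: "int P * int q dvd int q * (fst t - fst s) + int P * (int (snd t) - int (snd s))"
        by (simp add: h_def eq cong_iff_dvd_diff algebra_simps)
      have cop: "coprime (int P) (int q)" using coprime_q_P by (simp add: coprime_commute)
      have "int P dvd int q * (fst t - fst s)"
        using dvd_trans[OF dvd_triv_left d] by (simp add: dvd_add_left_iff)
      then have "int P dvd fst t - fst s" using coprime_dvd_mult_right_iff[OF cop] by simp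
      then have 1: "fst t = fst s" using st by (intro cP_eqI) (auto simp: cong_iff_dvd_diff)
      have "int q dvd int P * (int (snd t) - int (snd s))"
        using dvd_trans[OF dvd_triv_right d] by (simp add: dvd_add_right_iff)
      then have "int q dvd int (snd t) - int (snd s)"
        using coprime_dvd_mult_right_iff[of "int q" "int P"] cop by (simp add: coprime_commute)
      then have "[snd t = snd s] (mod q)" by (simp add: cong_int_iff[symmetric] cong_iff_dvd_diff)
      then have "snd t = snd s" using st by (auto simp: cong_def)
      with 1 show "s = t" by (simp add: prod_eq_iff)
    qed
    have "finite (carrier C)" using C.order_gt_0_iff_finite C(3) P_pos q_ge_3 by simp
    then have "h ` Cr = carrier C"
      using h_Cr C(3) card_Cr by (intro card_subset_eq) (auto simp: card_image[OF inj] order_def)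
    with inj show ?thesis by (simp add: bij_betw_def)
  qed
  ultimately have "h \<in> iso (M 1) C" by (simp add: iso_def carrier_M)
  then show ?thesis by (auto simp: is_iso_def)
qed

end

text \<open>An automorphism of Z_P is multiplication by its value at 1, and \<theta> turns addition
  modulo q into composition; so b acts as the b-th power of the multiplier of the generator
  1.\<close>

lemma semidirect_action:
  fixes P q :: nat
  assumes P: "P > 1" and \<theta>: "\<theta> \<in> hom (integer_mod_group q) (AutoGroup (integer_mod_group P))"
    and q: "q > 1" and x: "x \<in> {0..<int P}"
  shows "\<theta> (int b mod int q) x = (\<theta> 1 1 ^ b * x) mod int P"
proof -
  let ?Z = "integer_mod_group P"
  have cZ: "carrier ?Z = {0..<int P}" "carrier (integer_mod_group q) = {0..<int q}"
    using P q by (simp_all add: carrier_integer_mod_group)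
  have au: "\<theta> i \<in> auto ?Z" if "i \<in> {0..<int q}" for i
    using hom_in_carrier[OF \<theta>] that cZ(2) by (simp add: AutoGroup_simps(3))
  have lin: "\<theta> i (int a mod int P) = (\<theta> i 1 * int a) mod int P" if i: "i \<in> {0..<int q}" for i a
  proof (induction a)
    case 0
    have "\<theta> i (0 + 0) = (\<theta> i 0 + \<theta> i 0) mod int P" using autoD(5)[OF au[OF i], of 0 0] by simp
    moreover have "\<theta> i 0 \<in> {0..<int P}" using autoD(4)[OF au[OF i], of 0] cZ P by simp
    ultimately have "\<theta> i 0 mod int P = (\<theta> i 0 + \<theta> i 0) mod int P" by simp
    then have "[\<theta> i 0 + 0 = \<theta> i 0 + \<theta> i 0] (mod int P)" by (simp add: cong_def)
    then have "[0 = \<theta> i 0] (mod int P)" by (simp only: cong_add_lcancel)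
    then show ?case using \<open>\<theta> i 0 \<in> {0..<int P}\<close> by (simp add: cong_def)
  next
    case (Suc a)
    have "\<theta> i ((int a mod int P + 1) mod int P) = (\<theta> i (int a mod int P) + \<theta> i 1) mod int P"
      using autoD(5)[OF au[OF i], of "int a mod int P" 1] P by (simp add: cZ)
    then show ?case unfolding Suc.IH by (simp add: mod_simps algebra_simps)
  qed
  have lin': "\<theta> i y = (\<theta> i 1 * y) mod int P" if "i \<in> {0..<int q}" "y \<in> {0..<int P}" for i y
    using lin[OF that(1), of "nat y"] that(2) by simp
  have one: "\<one>\<^bsub>AutoGroup ?Z\<^esub> = \<theta> 0"
    using hom_one[OF \<theta>] group.AutoGroup[of ?Z] by simp
  have b: "\<forall>y\<in>{0..<int P}. \<theta> (int b mod int q) y = (\<theta> 1 1 ^ b * y) mod int P"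
  proof (induction b)
    case 0
    then show ?case by (simp add: one[symmetric] AutoGroup_simps(2) cZ)
  next
    case (Suc b)
    show ?case
    proof
      fix y assume y: "y \<in> {0..<int P}"
      have iq: "int b mod int q \<in> {0..<int q}" "1 \<in> {0..<int q}" using q by auto
      have "\<theta> ((1 + int b mod int q) mod int q) = \<theta> 1 \<otimes>\<^bsub>AutoGroup ?Z\<^esub> \<theta> (int b mod int q)"
        using hom_mult[OF \<theta>, of 1 "int b mod int q"] iq cZ by simp
      also have "\<dots> = compose (carrier ?Z) (\<theta> 1) (\<theta> (int b mod int q))"
        by (rule AutoGroup_simps(1)[OF au[OF iq(2)] au[OF iq(1)]])
      finally have "\<theta> (int (Suc b) mod int q) y = \<theta> 1 (\<theta> (int b mod int q) y)"
        using y by (simp add: compose_def cZ mod_simps)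
      also have "\<dots> = \<theta> 1 ((\<theta> 1 1 ^ b * y) mod int P)" using Suc.IH y by simp
      also have "\<dots> = (\<theta> 1 1 * ((\<theta> 1 1 ^ b * y) mod int P)) mod int P" using P iq by (intro lin') auto
      finally show "\<theta> (int (Suc b) mod int q) y = (\<theta> 1 1 ^ Suc b * y) mod int P"
        by (simp add: mod_simps mult.assoc)
    qed
  qed
  then show ?thesis using x by blast
qed

text \<open>k is the multiplier by which the generator of Z_q acts, so k^q = 1. Noncommutativity of
  G enters as k being different from 1.\<close>

lemma nonabelian_pq_model:
  assumes "n \<ge> 1" "Factorial_Ring.prime p" "Factorial_Ring.prime q" "odd p" "odd q" "p > q"
    and G: "nonabelian_cyclic_semidirect (p ^ n) q G"
  obtains k where "pq_model p n (p ^ n) q k" "sd (p ^ n) q k \<cong> G"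
proof -
  define P where "P = p ^ n"
  obtain \<theta> where \<theta>: "\<theta> \<in> hom (integer_mod_group q) (AutoGroup (integer_mod_group P))"
    and iso: "G \<cong> semidirect_product (integer_mod_group P) (integer_mod_group q) \<theta>" (is "G \<cong> ?S")
    and grp: "group G" and nc: "\<not> comm_group G"
    using G unfolding nonabelian_cyclic_semidirect_def P_def by blast
  have q: "q > 1" using assms(3) by (rule prime_gt_1_nat)
  have P: "P > 1" using one_less_power[OF prime_gt_1_nat[OF assms(2)], of n] assms(1) by (simp add: P_def)
  define k where "k = \<theta> 1 1"
  note act = semidirect_action[OF P \<theta> q, folded k_def]
  have cZ: "carrier (integer_mod_group P) = {0..<int P}" "carrier (integer_mod_group q) = {0..<int q}"
    using P q by (simp_all add: carrier_integer_mod_group)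
  have "\<theta> 1 \<in> auto (integer_mod_group P)"
    using hom_in_carrier[OF \<theta>, of 1] q by (simp add: AutoGroup_simps(3))
  from autoD(4)[OF this, of 1] have k: "0 \<le> k" "k < int P" using P by (simp_all add: cZ k_def)
  have "\<one>\<^bsub>AutoGroup (integer_mod_group P)\<^esub> = \<theta> 0"
    using hom_one[OF \<theta>] group.AutoGroup[of "integer_mod_group P"] by simp
  then have "\<theta> 0 1 = 1" using P by (metis AutoGroup_simps(2) restrict_apply' integer_mod_group_1 less_irrefl)
  then have kq: "[k ^ q = 1] (mod int P)" using act[of 1 q] P by (simp add: cong_def)
  define h where "h = (\<lambda>s :: int \<times> nat. (fst s, int (snd s)))"
  have cS: "carrier ?S = {0..<int P} \<times> {0..<int q}" by (simp add: semidirect_product_def cZ)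
  have h_car: "h s \<in> carrier ?S" if "s \<in> carrier (sd P q k)" for s
    using that by (auto simp: h_def cS sd_simps)
  have h_mult: "h (s \<otimes>\<^bsub>sd P q k\<^esub> t) = h s \<otimes>\<^bsub>?S\<^esub> h t" if "s \<in> carrier (sd P q k)" "t \<in> carrier (sd P q k)" for s t
    using that act[of "fst t" "snd s"] by (auto simp: h_def sd_simps semidirect_product_def zmod_int mod_simps)
  have "h \<in> iso (sd P q k) ?S"
  proof (rule isoI)
    show "h \<in> hom (sd P q k) ?S" by (rule homI) (use h_car h_mult in auto)
    show "bij_betw h (carrier (sd P q k)) (carrier ?S)"
      by (rule bij_betw_byWitness[of _ "\<lambda>s. (fst s, nat (snd s))"]) (auto simp: h_def sd_simps cS)
  qed
  then have "sd P q k \<cong> ?S" by (auto simp: is_iso_def)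
  moreover have "?S \<cong> G" using group.iso_sym[OF grp iso] .
  ultimately have isoG: "sd P q k \<cong> G" by (rule iso_trans)
  then obtain f where f: "f \<in> hom (sd P q k) G" "f ` carrier (sd P q k) = carrier G"
    by (auto simp: is_iso_def iso_def bij_betw_def)
  have "k \<noteq> 1"
  proof
    assume k: "k = 1"
    have "comm_group G"
    proof (rule group.group_comm_groupI[OF grp])
      fix x y assume "x \<in> carrier G" "y \<in> carrier G"
      then obtain s t where st: "s \<in> carrier (sd P q k)" "t \<in> carrier (sd P q k)" "x = f s" "y = f t"
        using f(2) by blast
      have "s \<otimes>\<^bsub>sd P q k\<^esub> t = t \<otimes>\<^bsub>sd P q k\<^esub> s" by (simp add: sd_simps k add.commute)
      then show "x \<otimes>\<^bsub>G\<^esub> y = y \<otimes>\<^bsub>G\<^esub> x" using hom_mult[OF f(1)] st by metis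
    qed
    with nc show False by blast
  qed
  then have "pq_model p n P q k"
    using assms k kq by unfold_locales (auto simp: P_def)
  then show thesis using that isoG by (simp add: P_def)
qed

section \<open>Counts for groups isomorphic to the models\<close>

context pq_model
begin

lemma iso_finite_card:
  assumes "M m \<cong> H" shows "finite (carrier H)"
proof -
  have "card Cr = card (carrier H)" using iso_same_card[OF assms] by (simp add: carrier_M)
  then show ?thesis using P_pos q_ge_3 by (metis card_Cr card.infinite mult_is_0 not_numeral_le_zero less_irrefl)
qed

lemma card_braces_auto:
  assumes "M l \<cong> A" "M m \<cong> B" "group A" "group B" "cP (l ^ q) 1" "cP (m ^ q) 1"
  shows "card (brace_maps A B) = card (brace_maps (M l) (M m))" "card (auto B) = card (auto (M m))"
    "finite (carrier A)" "finite (carrier B)"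
proof -
  note g = group_M[OF assms(5)] group_M[OF assms(6)]
  have f: "finite (carrier (M m'))" for m' by (simp add: carrier_M)
  show "card (brace_maps A B) = card (brace_maps (M l) (M m))"
    by (rule card_brace_maps_iso[OF assms(1,2) g(1) assms(3) g(2) assms(4) f f, symmetric])
  show "card (auto B) = card (auto (M m))" by (rule card_auto_iso[OF assms(2) g(2) assms(4) f, symmetric])
  show "finite (carrier A)" "finite (carrier B)" using assms(1,2) iso_finite_card by blast+
qed

lemma e_prime_eq:
  assumes "M l \<cong> A" "M m \<cong> B" "group A" "group B" "cP (l ^ q) 1" "cP (m ^ q) 1"
  shows "e_prime A B * card (auto (M l)) = card (brace_maps (M l) (M m))"
  using card_brace_maps_e_prime[OF assms(3,4)] card_braces_auto[OF assms]
    card_braces_auto(2)[OF assms(2,1) assms(4,3) assms(6,5)] by simp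

lemma hgs_number_eq:
  fixes K :: "'l :: field set"
  assumes "finite_galois K" "gal_group K \<cong> A" and AB: "M l \<cong> A" "M m \<cong> B" "group A" "group B" "cP (l ^ q) 1" "cP (m ^ q) 1"
  shows "hgs_number K B * card (auto (M m)) = card (brace_maps (M l) (M m))"
proof -
  \<comment> \<open>Finiteness of the Galois group, assumed in \<open>galois_extension\<close>, is
    obtained from its isomorphism with a group of order P q.\<close>
  have "card (carrier (gal_group K)) = card (carrier A)" by (rule iso_same_card[OF assms(2)])
  moreover have "card (carrier A) = P * q" using iso_same_card[OF AB(1)] by (simp add: carrier_M)
  ultimately have "card (carrier (gal_group K)) \<noteq> 0" using P_pos q_ge_3 by simp
  then have "finite (carrier (gal_group K))" by (meson card.infinite)
  then have gal: "galois_extension K" using assms(1) by (simp add: galois_extension_def)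
  have gG: "group (gal_group K)" by (rule galois_extension.group_Gal[OF gal])
  have "A \<cong> gal_group K" by (rule group.iso_sym[OF gG assms(2)])
  then have "M l \<cong> gal_group K" by (rule iso_trans[OF AB(1)])
  note c = card_braces_auto[OF this AB(2) gG AB(4,5,6)]
  show ?thesis using card_brace_maps_hgs_number[OF gal AB(4) c(4)] c by simp
qed

end

theorem theorem1p1:
  fixes n p q :: nat
    and G :: "('g, 'x) monoid_scheme" and C :: "('c, 'y) monoid_scheme"
  assumes "n \<ge> 1" and "Factorial_Ring.prime p" and "Factorial_Ring.prime q" and "odd p" and "odd q" and "p > q" and "q dvd p - 1"
    and G: "nonabelian_cyclic_semidirect (p ^ n) q G"
    and C: "group C" "cyclic_group C" "order C = p ^ n * q"
  shows
    "(e_prime G G = 2 + 2 * p ^ n * (q - 2) \<and>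
      (\<forall>K :: 'l :: field set. finite_galois K \<and> gal_group K \<cong> G \<longrightarrow>
         hgs_number K G = 2 + 2 * p ^ n * (q - 2))) \<and>
     (e_prime G C = q - 1 \<and>
      (\<forall>K :: 'l :: field set. finite_galois K \<and> gal_group K \<cong> G \<longrightarrow>
         hgs_number K C = p ^ n)) \<and>
     (e_prime C G = 2 * p ^ (2 * n - 1) \<and>
      (\<forall>K :: 'l :: field set. finite_galois K \<and> gal_group K \<cong> C \<longrightarrow>
         hgs_number K G = 2 * p ^ (n - 1) * (q - 1)))"
proof -
  obtain k where "pq_model p n (p ^ n) q k" and MG: "sd (p ^ n) q k \<cong> G"
    using nonabelian_pq_model[OF assms(1-6) G] .
  then interpret pq_model p n "p ^ n" q k by simp
  have MC: "M 1 \<cong> C" by (rule cyclic_iso_M1[OF C])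
  have gG: "group G" using G by (simp add: nonabelian_cyclic_semidirect_def)
  define u where "u = card units"
  have u: "u > 0" using units_pos by (simp add: u_def)
  have aut: "card (auto (M k)) = u * p ^ n" "card (auto (M 1)) = u * (q - 1)"
    using card_auto_k card_auto_1 by (simp_all add: u_def units_def)
  note br = card_brace_GG card_brace_GC card_brace_CG
  \<comment> \<open>These are |Aut G| and |Aut C|. A count of regular subgroups divides by the
    automorphisms of the source, a count of Hopf-Galois structures by those of the type.\<close>
  have pos: "u * p ^ n > 0" "u * (q - 1) > 0" using u P_pos q_ge_3 by simp_all
  have canc: "x = y" if "x * a = y * a" "a > 0" for x y a :: nat using that by simp
  note GG = MG MG gG gG k_q k_q and GC = MG MC gG C(1) k_q one_q and CG = MC MG C(1) gG one_q k_q
  have pp: "p ^ (n - 1) * p ^ n = p ^ (2 * n - 1)" using n by (simp add: power_add[symmetric] mult_2)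
  have "e_prime G G = 2 + 2 * p ^ n * (q - 2)"
    by (rule canc[OF _ pos(1)]) (use e_prime_eq[OF GG] aut br in \<open>simp add: u_def algebra_simps\<close>)
  moreover have "hgs_number K G = 2 + 2 * p ^ n * (q - 2)" if "finite_galois K" "gal_group K \<cong> G" for K :: "'l set"
    by (rule canc[OF _ pos(1)]) (use hgs_number_eq[OF that GG] aut br in \<open>simp add: u_def algebra_simps\<close>)
  moreover have "e_prime G C = q - 1"
    by (rule canc[OF _ pos(1)]) (use e_prime_eq[OF GC] aut br in \<open>simp add: u_def mult_ac\<close>)
  moreover have "hgs_number K C = p ^ n" if "finite_galois K" "gal_group K \<cong> G" for K :: "'l set"
    by (rule canc[OF _ pos(2)]) (use hgs_number_eq[OF that GC] aut br in \<open>simp add: u_def mult_ac\<close>)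
  moreover have "e_prime C G = 2 * p ^ (2 * n - 1)"
    unfolding pp[symmetric]
    by (rule canc[OF _ pos(2)]) (use e_prime_eq[OF CG] aut br in \<open>simp add: u_def mult_ac\<close>)
  moreover have "hgs_number K G = 2 * p ^ (n - 1) * (q - 1)" if "finite_galois K" "gal_group K \<cong> C" for K :: "'l set"
    by (rule canc[OF _ pos(1)]) (use hgs_number_eq[OF that CG] aut br in \<open>simp add: u_def mult_ac\<close>)
  ultimately show ?thesis by blast
qed

end
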